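(* Let $N\ge 1$, $T\in[0,\infty)$ and $x_0\in\mathbb{R}^N$. For all $i,j\in\{1,\dots,N\}$ let $p_{ij}:\mathbb{R}^N\to[0,1]$ be globally Lipschitz continuous. Let $\xi=(\xi^h)_{h>0}$ be a family of real random variables such that, with $m_k(\xi)=\lim_{h\to0}\mathbb{E}[(\xi^h)^k]/h$: (a) $m_1(\xi)=0$; (b) $m_2(\xi)$ exists; (c) if $m_2(\xi)>0$ then $m_3(\xi)=m_4(\xi)=0$. For $h>0$ let $X^h$ be the trajectory on $[0,T]$ of the agent-based model with external noise (described in the context), with timestep $h$, initial opinions $x_0$ and update distance $\mu^h=Nh$. Then, as $h\to0$, $X^h$ converges in distribution in $D([0,T],\mathbb{R}^N)$ to the (weak) solution $X$ of the SDE system $$dX_i=\frac1N\sum_{j=1}^N p_{ij}(X)\,(X_j-X_i)\,dt+\Bigl(\frac{m_2(\xi)}{N}\Bigr)^{1/2}d\beta_i,\quad i=1,\dots,N,\qquad X(0)=x_0,$$ where $\beta_1,\dots,\beta_N$ are independent standard Brownian motions. (In particular, for $m_2(\xi)=0$ the limit is the solution of the ODE $\frac{dX_i}{dt}=\frac1N\sum_{j=1}^N p_{ij}(X)(X_j-X_i)$, $X(0)=x_0$.)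
   Context: For a family $\zeta=(\zeta^h)_{h>0}$ of real random variables, $m_k(\zeta)=\lim_{h\to0}\mathbb{E}[(\zeta^h)^k]/h$, which is undefined (does not exist) if a finite limit does not exist. Agent-based model with external noise and timestep $h>0$: the opinions $x(t)\in\mathbb{R}^N$ evolve at times $t=0,h,2h,\dots$ as a discrete-time Markov chain with $x(0)=x_0$. At each timestep a pair $(i,j)\in\{1,\dots,N\}^2$ is chosen uniformly at random with replacement (each ordered pair, including $i=j$, has probability $N^{-2}$), and an independent copy of $\xi^h$ is drawn, independently of the past, of $(i,j)$ and of whether an interaction occurs. Then, given the current state $x=x(t)$, $$x_i(t+h)=\begin{cases}x_i(t)+\mu^h\,(x_j(t)-x_i(t))+\xi^h & \text{with probability } p_{ij}(x),\\ x_i(t)+\xi^h & \text{with probability } 1-p_{ij}(x),\end{cases}$$ and all other coordinates are unchanged. The trajectory $X^h=(X^h_t)_{t\in[0,T]}$ is the piecewise constant process $X^h_t=x(h\lfloor t/h\rfloor)$, viewed as a random element of the Skorokhod space $D([0,T],\mathbb{R}^N)$ of càdlàg functions. Convergence in distribution means $\mathbb{E}[f(X^h)]\to\mathbb{E}[f(X)]$ for every bounded continuous real-valued $f$ on $D([0,T],\mathbb{R}^N)$. *)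

theory Defs
  imports "HOL-Probability.Probability"
begin

section \<open>The Skorokhod space \<open>D([0,T], V)\<close>\<close>

text \<open>Paths on \<open>[0,T]\<close> are extensional functions, so that equality of paths is
  equality on \<open>[0,T]\<close>.\<close>

definition cadlag :: "real \<Rightarrow> (real \<Rightarrow> 'v::metric_space) set" where
  "cadlag T = {f \<in> extensional {0..T}.
     (\<forall>t\<in>{0..<T}. continuous (at_right t) f) \<and>
     (\<forall>t\<in>{0<..T}. \<exists>l. (f \<longlongrightarrow> l) (at_left t))}"

definition time_changes :: "real \<Rightarrow> (real \<Rightarrow> real) set" where
  "time_changes T = {l. strict_mono_on {0..T} l \<and> continuous_on {0..T} l \<and> l ` {0..T} = {0..T}}"

definition skorokhod_bounds ::
  "real \<Rightarrow> (real \<Rightarrow> 'v::metric_space) \<Rightarrow> (real \<Rightarrow> 'v) \<Rightarrow> real set" where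
  "skorokhod_bounds T f g =
     {e. 0 < e \<and> (\<exists>l\<in>time_changes T. \<forall>t\<in>{0..T}. \<bar>l t - t\<bar> \<le> e \<and> dist (f t) (g (l t)) \<le> e)}"

text \<open>The value \<open>0\<close> off the space is a dummy, needed because the library's
  \<^locale>\<open>Metric_space\<close> asks for symmetry and nonnegativity on the whole type.\<close>

definition skorokhod_dist ::
  "real \<Rightarrow> (real \<Rightarrow> 'v::metric_space) \<Rightarrow> (real \<Rightarrow> 'v) \<Rightarrow> real" where
  "skorokhod_dist T f g =
     (if f \<in> cadlag T \<and> g \<in> cadlag T then Inf (skorokhod_bounds T f g) else 0)"

lemma bounded_cadlag:
  fixes f :: "real \<Rightarrow> 'v::metric_space"
  assumes f: "f \<in> cadlag T"
  shows "bounded (f ` {0..T})"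
proof (cases "0 \<le> T")
  case True
  define P where "P = (\<lambda>a b. bounded (f ` ({a..b} \<inter> {0..T})))"
  have "P 0 T"
  proof (rule Bolzano[OF True])
    fix a b c :: real assume "P a b" "P b c" "a \<le> b" "b \<le> c"
    moreover have "f ` ({a..c} \<inter> {0..T}) \<subseteq> f ` ({a..b} \<inter> {0..T}) \<union> f ` ({b..c} \<inter> {0..T})"
    proof -
      have "{a..c} \<subseteq> {a..b} \<union> {b..c}" by auto
      then show ?thesis by blast
    qed
    ultimately show "P a c"
      unfolding P_def by (meson bounded_Un bounded_subset)
  next
    fix x :: real assume x: "0 \<le> x" "x \<le> T"
    have "\<exists>d>0. \<exists>c B. \<forall>y\<in>{0..T}. x < y \<longrightarrow> y < x + d \<longrightarrow> dist c (f y) \<le> B"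
    proof (cases "x < T")
      case True
      have "(f \<longlongrightarrow> f x) (at_right x)"
        using f x True by (auto simp: cadlag_def continuous_within)
      then have "eventually (\<lambda>y. dist (f y) (f x) < 1) (at_right x)"
        by (rule tendstoD) simp
      then obtain b where "b > x" "\<And>y. x < y \<Longrightarrow> y < b \<Longrightarrow> dist (f y) (f x) < 1"
        unfolding eventually_at_right_field by blast
      then show ?thesis
        by (intro exI[of _ "b - x"] conjI exI[of _ "f x"] exI[of _ 1])
           (auto simp: dist_commute intro: less_imp_le)
    qed (use x in \<open>auto intro!: exI[of _ 1]\<close>)
    then obtain d1 c1 B1 where 1: "d1 > 0"
      "\<And>y. y \<in> {0..T} \<Longrightarrow> x < y \<Longrightarrow> y < x + d1 \<Longrightarrow> dist c1 (f y) \<le> B1" by blast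
    have "\<exists>d>0. \<exists>c B. \<forall>y\<in>{0..T}. x - d < y \<longrightarrow> y < x \<longrightarrow> dist c (f y) \<le> B"
    proof (cases "0 < x")
      case True
      with x have "x \<in> {0<..T}" by simp
      with f obtain l where "(f \<longlongrightarrow> l) (at_left x)"
        unfolding cadlag_def by blast
      then have "eventually (\<lambda>y. dist (f y) l < 1) (at_left x)"
        by (rule tendstoD) simp
      then obtain b where "b < x" "\<And>y. b < y \<Longrightarrow> y < x \<Longrightarrow> dist (f y) l < 1"
        unfolding eventually_at_left_field by blast
      then show ?thesis
        by (intro exI[of _ "x - b"] conjI exI[of _ l] exI[of _ 1])
           (auto simp: dist_commute intro: less_imp_le)
    qed (use x in \<open>auto intro!: exI[of _ 1]\<close>)
    then obtain d2 c2 B2 where 2: "d2 > 0"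
      "\<And>y. y \<in> {0..T} \<Longrightarrow> x - d2 < y \<Longrightarrow> y < x \<Longrightarrow> dist c2 (f y) \<le> B2" by blast
    show "\<exists>d>0. \<forall>a b. a \<le> x \<and> x \<le> b \<and> b - a < d \<longrightarrow> P a b"
    proof (intro exI[of _ "min d1 d2"] conjI allI impI)
      fix a b assume ab: "a \<le> x \<and> x \<le> b \<and> b - a < min d1 d2"
      have "f ` ({a..b} \<inter> {0..T}) \<subseteq> cball c1 B1 \<union> {f x} \<union> cball c2 B2"
      proof safe
        fix y assume "y \<in> {a..b}" "y \<in> {0..T}" "f y \<notin> cball c2 B2" "f y \<notin> {}" "f y \<notin> cball c1 B1"
        then show "f y = f x"
          using 1(2)[of y] 2(2)[of y] ab by (cases "y < x"; cases "x < y") auto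
      qed
      then show "P a b"
        unfolding P_def by (rule bounded_subset[rotated]) simp
    qed (use 1 2 in auto)
  qed
  then show ?thesis by (simp add: P_def)
qed simp

lemma time_change_id: "(\<lambda>t. t) \<in> time_changes T"
  by (auto simp: time_changes_def strict_mono_on_def)

lemma time_change_compose:
  assumes "k \<in> time_changes T" "l \<in> time_changes T"
  shows "(\<lambda>t. k (l t)) \<in> time_changes T"
proof -
  have "continuous_on {0..T} (\<lambda>t. k (l t))"
    using assms unfolding time_changes_def
    by (intro continuous_on_compose2[of "{0..T}" k "{0..T}" l]) auto
  moreover have "(\<lambda>t. k (l t)) ` {0..T} = {0..T}"
  proof -
    have "(\<lambda>t. k (l t)) ` {0..T} = k ` (l ` {0..T})" by (simp only: image_image)
    with assms show ?thesis by (simp only: time_changes_def mem_Collect_eq)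
  qed
  moreover have "strict_mono_on {0..T} (\<lambda>t. k (l t))"
  proof (rule strict_mono_onI)
    fix r s assume rs: "r \<in> {0..T}" "s \<in> {0..T}" "r < s"
    have kl: "strict_mono_on {0..T} k" "strict_mono_on {0..T} l" "l ` {0..T} = {0..T}"
      using assms by (auto simp only: time_changes_def mem_Collect_eq)
    show "k (l r) < k (l s)"
      using strict_mono_onD[OF kl(1)] strict_mono_onD[OF kl(2) rs] kl(3) rs by blast
  qed
  ultimately show ?thesis by (simp add: time_changes_def)
qed

lemma time_change_inverse:
  assumes l: "l \<in> time_changes T"
  obtains k where "k \<in> time_changes T" "\<And>t. t \<in> {0..T} \<Longrightarrow> k (l t) = t"
    "\<And>t. t \<in> {0..T} \<Longrightarrow> l (k t) = t"
proof
  let ?k = "inv_into {0..T} l"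
  have mono: "strict_mono_on {0..T} l" and cont: "continuous_on {0..T} l"
    and im: "l ` {0..T} = {0..T}" using l by (auto simp: time_changes_def)
  have inj: "inj_on l {0..T}" using mono by (rule strict_mono_on_imp_inj_on)
  show kl: "?k (l t) = t" if "t \<in> {0..T}" for t using inj that by (rule inv_into_f_f)
  show lk: "l (?k t) = t" if "t \<in> {0..T}" for t using im that by (simp add: f_inv_into_f)
  have kin: "?k t \<in> {0..T}" if "t \<in> {0..T}" for t
    using inv_into_into[of t l "{0..T}"] that im by simp
  have "continuous_on (l ` {0..T}) ?k"
    using cont by (rule continuous_on_inv) (auto simp: kl)
  moreover have "?k ` {0..T} = {0..T}"
    using inj im by (metis inv_into_image_cancel subset_refl)
  moreover have "strict_mono_on {0..T} ?k"
  proof (rule strict_mono_onI)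
    fix r s assume rs: "r \<in> {0..T}" "s \<in> {0..T}" "r < s"
    show "?k r < ?k s"
    proof (rule ccontr)
      assume "\<not> ?k r < ?k s"
      then have "l (?k s) \<le> l (?k r)"
        using strict_mono_onD[OF mono kin[OF rs(2)] kin[OF rs(1)]]
        by (cases "?k s = ?k r") auto
      with rs lk show False by auto
    qed
  qed
  ultimately show "?k \<in> time_changes T" by (simp add: time_changes_def im)
qed

lemma time_change_in: "l \<in> time_changes T \<Longrightarrow> t \<in> {0..T} \<Longrightarrow> l t \<in> {0..T}"
  unfolding time_changes_def by blast

lemma time_change_end:
  assumes l: "l \<in> time_changes T" and T: "0 \<le> T"
  shows "l T = T"
proof -
  have "T \<in> l ` {0..T}" using l T by (simp add: time_changes_def)
  then obtain t where t: "t \<in> {0..T}" "l t = T" by force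
  have lT: "l T \<le> T" using time_change_in[OF l, of T] T by simp
  have mono: "strict_mono_on {0..T} l" using l by (simp add: time_changes_def)
  show ?thesis
  proof (cases "t = T")
    case False
    then have "l t < l T" using strict_mono_onD[OF mono, of t T] t(1) by simp
    with lT t(2) show ?thesis by simp
  qed (use t in simp)
qed

lemma skorokhod_bounds_nonempty:
  assumes "f \<in> cadlag T" "g \<in> cadlag T"
  shows "skorokhod_bounds T f g \<noteq> {}"
proof -
  have "bounded (f ` {0..T} \<union> g ` {0..T})"
    using assms by (simp add: bounded_cadlag)
  then obtain B where B: "\<And>x y. x \<in> f ` {0..T} \<union> g ` {0..T} \<Longrightarrow> y \<in> f ` {0..T} \<union> g ` {0..T} \<Longrightarrow> dist x y \<le> B"
    by (metis bounded_two_points)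
  have "max 1 B \<in> skorokhod_bounds T f g"
    unfolding skorokhod_bounds_def using B
    by (auto intro!: bexI[OF _ time_change_id] simp: le_max_iff_disj)
  then show ?thesis by blast
qed

lemma skorokhod_dist_lessE:
  assumes "f \<in> cadlag T" "g \<in> cadlag T" "skorokhod_dist T f g < e"
  obtains a where "a \<in> skorokhod_bounds T f g" "a < e"
  using cInf_lessD[OF skorokhod_bounds_nonempty[OF assms(1,2)]] assms
  by (auto simp: skorokhod_dist_def)

lemma skorokhod_dist_le:
  assumes "f \<in> cadlag T" "g \<in> cadlag T" "a \<in> skorokhod_bounds T f g"
  shows "skorokhod_dist T f g \<le> a"
  using assms by (auto simp: skorokhod_dist_def skorokhod_bounds_def
      intro!: cInf_lower bdd_belowI[of _ 0])

lemma skorokhod_bounds_sym: "skorokhod_bounds T f g \<subseteq> skorokhod_bounds T g f"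
proof
  fix e assume "e \<in> skorokhod_bounds T f g"
  then obtain l where e: "0 < e" and l: "l \<in> time_changes T"
    and le: "\<And>t. t \<in> {0..T} \<Longrightarrow> \<bar>l t - t\<bar> \<le> e \<and> dist (f t) (g (l t)) \<le> e"
    by (auto simp: skorokhod_bounds_def)
  obtain k where k: "k \<in> time_changes T" "\<And>t. t \<in> {0..T} \<Longrightarrow> l (k t) = t"
    using time_change_inverse[OF l] by metis
  have "\<bar>k t - t\<bar> \<le> e \<and> dist (g t) (f (k t)) \<le> e" if "t \<in> {0..T}" for t
  proof -
    have "k t \<in> {0..T}" using time_change_in[OF k(1) that] .
    from le[OF this] show ?thesis
      using k(2)[OF that] by (simp add: dist_commute abs_minus_commute)
  qed
  with e k(1) show "e \<in> skorokhod_bounds T g f"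
    unfolding skorokhod_bounds_def by blast
qed

lemma skorokhod_bounds_triangle:
  assumes "a \<in> skorokhod_bounds T f g" "b \<in> skorokhod_bounds T g h"
  shows "a + b \<in> skorokhod_bounds T f h"
proof -
  from assms obtain l k where ab: "0 < a" "0 < b"
    and l: "l \<in> time_changes T" "\<And>t. t \<in> {0..T} \<Longrightarrow> \<bar>l t - t\<bar> \<le> a \<and> dist (f t) (g (l t)) \<le> a"
    and k: "k \<in> time_changes T" "\<And>t. t \<in> {0..T} \<Longrightarrow> \<bar>k t - t\<bar> \<le> b \<and> dist (g t) (h (k t)) \<le> b"
    by (auto simp: skorokhod_bounds_def)
  have "\<bar>k (l t) - t\<bar> \<le> a + b \<and> dist (f t) (h (k (l t))) \<le> a + b" if t: "t \<in> {0..T}" for t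
  proof -
    have "l t \<in> {0..T}" using time_change_in[OF l(1) t] .
    from k(2)[OF this] l(2)[OF t] dist_triangle[of "f t" "h (k (l t))" "g (l t)"]
    show ?thesis by linarith
  qed
  moreover have "0 < a + b" using ab by simp
  ultimately show ?thesis
    unfolding skorokhod_bounds_def mem_Collect_eq
    by (intro conjI bexI[OF _ time_change_compose[OF k(1) l(1)]] ballI) auto
qed

lemma skorokhod_dist_zero_imp_eq:
  assumes f: "f \<in> cadlag T" and g: "g \<in> cadlag T" and z: "skorokhod_dist T f g = 0"
  shows "f = g"
proof (rule extensionalityI[of _ "{0..T}"])
  fix t assume t: "t \<in> {0..T}"
  have "dist (f t) (g t) \<le> 3 * e" if e: "0 < e" for e
  proof (cases "t < T")
    case False
    then have tT: "t = T" "0 \<le> T" using t by auto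
    obtain a where a: "a \<in> skorokhod_bounds T f g" "a < e"
      using skorokhod_dist_lessE[OF f g] z e by metis
    then obtain l where "l \<in> time_changes T" "dist (f t) (g (l t)) \<le> a"
      using t by (auto simp: skorokhod_bounds_def)
    with a e tT show ?thesis by (simp add: time_change_end)
  next
    case True
    have "eventually (\<lambda>u. dist (g u) (g t) < e) (at_right t)"
      using g t True e by (intro tendstoD) (auto simp: cadlag_def continuous_within)
    then obtain b1 where b1: "b1 > t" "\<And>u. t < u \<Longrightarrow> u < b1 \<Longrightarrow> dist (g u) (g t) < e"
      unfolding eventually_at_right_field by blast
    have "eventually (\<lambda>u. dist (f u) (f t) < e) (at_right t)"
      using f t True e by (intro tendstoD) (auto simp: cadlag_def continuous_within)
    then obtain b2 where b2: "b2 > t" "\<And>u. t < u \<Longrightarrow> u < b2 \<Longrightarrow> dist (f u) (f t) < e"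
      unfolding eventually_at_right_field by blast
    define s where "s = (t + min T (min b1 b2)) / 2"
    have s: "t < s" "s < T" "s < b1" "s < b2"
      using True b1(1) b2(1) by (auto simp: s_def min_def field_simps)
    have "0 < min e (min (s - t) (b1 - s))" using s e by auto
    then obtain a where a: "a \<in> skorokhod_bounds T f g" "a < min e (min (s - t) (b1 - s))"
      using skorokhod_dist_lessE[OF f g] z by metis
    moreover have "s \<in> {0..T}" using s t by simp
    ultimately obtain l where "\<bar>l s - s\<bar> \<le> a" "dist (f s) (g (l s)) \<le> a"
      unfolding skorokhod_bounds_def by blast
    then have ls: "t < l s" "l s < b1" "dist (f s) (g (l s)) < e" using a(2) by auto
    have "dist (f t) (g t) \<le> dist (f t) (f s) + dist (f s) (g (l s)) + dist (g (l s)) (g t)"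
      by (meson add_mono_thms_linordered_semiring(3) dist_triangle order_trans)
    with b1(2)[OF ls(1,2)] b2(2)[OF s(1,4)] ls(3) show ?thesis by (simp add: dist_commute)
  qed
  note le = this
  have "dist (f t) (g t) \<le> 0 + e" if "0 < e" for e using le[of "e/3"] that by simp
  then have "dist (f t) (g t) \<le> 0" by (rule field_le_epsilon)
  then show "f t = g t" by simp
qed (use f g in \<open>auto simp: cadlag_def\<close>)

lemma Metric_space_skorokhod:
  "Metric_space (cadlag T :: (real \<Rightarrow> 'v::metric_space) set) (skorokhod_dist T)"
proof
  show nonneg: "0 \<le> skorokhod_dist T f g" for f g :: "real \<Rightarrow> 'v"
  proof (cases "f \<in> cadlag T \<and> g \<in> cadlag T")
    case True
    then have "0 \<le> Inf (skorokhod_bounds T f g)"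
      using skorokhod_bounds_nonempty[of f T g]
      by (intro cInf_greatest) (auto simp: skorokhod_bounds_def)
    with True show ?thesis by (simp add: skorokhod_dist_def)
  qed (auto simp: skorokhod_dist_def)
  show "skorokhod_dist T f g = skorokhod_dist T g f" for f g :: "real \<Rightarrow> 'v"
  proof -
    have "skorokhod_bounds T f g = skorokhod_bounds T g f"
      by (intro subset_antisym skorokhod_bounds_sym)
    then show ?thesis by (simp add: skorokhod_dist_def conj_commute)
  qed
  show "skorokhod_dist T f g = 0 \<longleftrightarrow> f = g" if fg: "f \<in> cadlag T" "g \<in> cadlag T" for f g :: "real \<Rightarrow> 'v"
  proof
    assume "f = g"
    then have "e \<in> skorokhod_bounds T f g" if "0 < e" for e
      using that by (auto simp: skorokhod_bounds_def intro!: bexI[OF _ time_change_id])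
    then have "skorokhod_dist T f g \<le> 0 + e" if "0 < e" for e
      using skorokhod_dist_le[OF fg] that by simp
    then have "skorokhod_dist T f g \<le> 0" by (rule field_le_epsilon)
    with nonneg[of f g] show "skorokhod_dist T f g = 0" by simp
  qed (rule skorokhod_dist_zero_imp_eq[OF fg])
  show "skorokhod_dist T f h \<le> skorokhod_dist T f g + skorokhod_dist T g h"
    if fgh: "f \<in> cadlag T" "g \<in> cadlag T" "h \<in> cadlag T" for f g h :: "real \<Rightarrow> 'v"
  proof (rule field_le_epsilon)
    fix e :: real assume e: "0 < e"
    obtain a where a: "a \<in> skorokhod_bounds T f g" "a < skorokhod_dist T f g + e / 2"
      using skorokhod_dist_lessE[OF fgh(1,2), of "skorokhod_dist T f g + e / 2"] e by auto
    obtain b where b: "b \<in> skorokhod_bounds T g h" "b < skorokhod_dist T g h + e / 2"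
      using skorokhod_dist_lessE[OF fgh(2,3), of "skorokhod_dist T g h + e / 2"] e by auto
    have "skorokhod_dist T f h \<le> a + b"
      by (rule skorokhod_dist_le[OF fgh(1,3) skorokhod_bounds_triangle[OF a(1) b(1)]])
    with a b show "skorokhod_dist T f h \<le> skorokhod_dist T f g + skorokhod_dist T g h + e"
      by linarith
  qed
qed

definition skorokhod_topology :: "real \<Rightarrow> (real \<Rightarrow> 'v::metric_space) topology" where
  "skorokhod_topology T = Metric_space.mtopology (cadlag T) (skorokhod_dist T)"


section \<open>Convergence in distribution\<close>

definition borel_sets_of :: "'s topology \<Rightarrow> 's measure" where
  "borel_sets_of S = sigma (topspace S) {U. openin S U}"

text \<open>The measurability clauses say that \<open>Y h\<close> and \<open>Z\<close> are random elements of \<open>S\<close>; without them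
  the integrals below would not be genuine expectations.\<close>

definition converges_in_distribution ::
  "'s topology \<Rightarrow> (real \<Rightarrow> 'a measure) \<Rightarrow> (real \<Rightarrow> 'a \<Rightarrow> 's) \<Rightarrow> 'c measure \<Rightarrow> ('c \<Rightarrow> 's) \<Rightarrow> bool" where
  "converges_in_distribution S M Y Q Z \<longleftrightarrow>
     (\<forall>h>0. Y h \<in> M h \<rightarrow>\<^sub>M borel_sets_of S) \<and> Z \<in> Q \<rightarrow>\<^sub>M borel_sets_of S \<and>
     (\<forall>f. continuous_map S euclideanreal f \<and> bounded (f ` topspace S) \<longrightarrow>
        ((\<lambda>h. \<integral>\<omega>. f (Y h \<omega>) \<partial>M h) \<longlongrightarrow> (\<integral>\<omega>. f (Z \<omega>) \<partial>Q)) (at_right 0))"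


section \<open>The agent-based model with external noise\<close>

text \<open>\<open>has_moment_rate \<Xi> \<xi> k m\<close> says that \<open>m\<^sub>k(\<xi>)\<close> exists and equals \<open>m\<close>.  Integrability is required
  because the Bochner integral of a non-integrable function is \<open>0\<close>.\<close>

definition has_moment_rate ::
  "(real \<Rightarrow> 'b measure) \<Rightarrow> (real \<Rightarrow> 'b \<Rightarrow> real) \<Rightarrow> nat \<Rightarrow> real \<Rightarrow> bool" where
  "has_moment_rate \<Xi> \<xi> k m \<longleftrightarrow>
     (\<forall>\<^sub>F h in at_right 0. integrable (\<Xi> h) (\<lambda>\<omega>. \<xi> h \<omega> ^ k)) \<and>
     ((\<lambda>h. (\<integral>\<omega>. \<xi> h \<omega> ^ k \<partial>\<Xi> h) / h) \<longlongrightarrow> m) (at_right 0)"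

definition history :: "'a measure \<Rightarrow> (nat \<Rightarrow> 'a \<Rightarrow> 's::topological_space) \<Rightarrow> nat \<Rightarrow> 'a measure" where
  "history M x n = vimage_algebra (space M) (\<lambda>\<omega>. \<lambda>k\<in>{..n}. x k \<omega>) (\<Pi>\<^sub>M k\<in>{..n}. borel)"

definition markov_chain ::
  "'a measure \<Rightarrow> ('s::topological_space \<Rightarrow> 's measure) \<Rightarrow> 's \<Rightarrow> (nat \<Rightarrow> 'a \<Rightarrow> 's) \<Rightarrow> bool" where
  "markov_chain M K s x \<longleftrightarrow>
     prob_space M \<and> (\<forall>n. x n \<in> borel_measurable M) \<and> (AE \<omega> in M. x 0 \<omega> = s) \<and>
     (\<forall>n. \<forall>A\<in>sets borel. AE \<omega> in M.
        real_cond_exp M (history M x n) (\<lambda>\<omega>. indicator A (x (Suc n) \<omega>)) \<omega> = measure (K (x n \<omega>)) A)"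

text \<open>One timestep from state \<open>x\<close>, with update distance \<open>\<mu>\<close> and noise law \<open>\<nu>\<close>: draw the pair, decide
  whether to interact, and draw the noise independently of both.\<close>

definition abm_kernel ::
  "real \<Rightarrow> ('n::finite \<Rightarrow> 'n \<Rightarrow> real ^ 'n \<Rightarrow> real) \<Rightarrow> real measure \<Rightarrow> real ^ 'n \<Rightarrow> (real ^ 'n) measure" where
  "abm_kernel \<mu> p \<nu> x = do {
     (i, j) \<leftarrow> measure_pmf (pmf_of_set UNIV);
     interact \<leftarrow> measure_pmf (bernoulli_pmf (p i j x));
     z \<leftarrow> \<nu>;
     return borel (\<chi> k. if k = i then x $ i + (if interact then \<mu> * (x $ j - x $ i) else 0) + z
                        else x $ k)
   }"

definition trajectory :: "real \<Rightarrow> real \<Rightarrow> (nat \<Rightarrow> 'a \<Rightarrow> 's) \<Rightarrow> 'a \<Rightarrow> real \<Rightarrow> 's" where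
  "trajectory T h x \<omega> = (\<lambda>t\<in>{0..T}. x (nat \<lfloor>t / h\<rfloor>) \<omega>)"


section \<open>The limiting equation\<close>

definition brownian_motion ::
  "'c measure \<Rightarrow> (real \<Rightarrow> 'c measure) \<Rightarrow> real \<Rightarrow> (real \<Rightarrow> 'c \<Rightarrow> real) \<Rightarrow> bool" where
  "brownian_motion Q F T B \<longleftrightarrow>
     (\<forall>t\<in>{0..T}. B t \<in> borel_measurable (F t)) \<and>
     (AE \<omega> in Q. B 0 \<omega> = 0) \<and>
     (\<forall>\<omega>\<in>space Q. continuous_on {0..T} (\<lambda>t. B t \<omega>)) \<and>
     (\<forall>s\<in>{0..T}. \<forall>t\<in>{s<..T}.
        distributed Q lborel (\<lambda>\<omega>. B t \<omega> - B s \<omega>) (normal_density 0 (sqrt (t - s))) \<and>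
        prob_space.indep_set Q (sets (F s))
          (sets (vimage_algebra (space Q) (\<lambda>\<omega>. B t \<omega> - B s \<omega>) borel)))"

text \<open>Weak solutions on \<open>[0,T]\<close> of \<open>dX = b(X) dt + \<sigma> d\<beta>\<close>, \<open>X(0) = x0\<close>, in integral form.  The diffusion
  coefficient \<open>\<sigma>\<close> is constant, so the Ito integral of \<open>\<sigma>\<close> over \<open>[0,t]\<close> is \<open>\<sigma> (\<beta> t - \<beta> 0)\<close>.\<close>

definition weak_solution ::
  "'c measure \<Rightarrow> (real \<Rightarrow> 'c measure) \<Rightarrow> real \<Rightarrow> (real \<Rightarrow> 'c \<Rightarrow> real ^ 'n::finite) \<Rightarrow>
   (real ^ 'n \<Rightarrow> real ^ 'n) \<Rightarrow> real \<Rightarrow> real ^ 'n \<Rightarrow> (real \<Rightarrow> 'c \<Rightarrow> real ^ 'n) \<Rightarrow> bool" where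
  "weak_solution Q F T \<beta> b \<sigma> x0 X \<longleftrightarrow>
     prob_space Q \<and> filtration (space Q) F \<and> (\<forall>t. subalgebra Q (F t)) \<and>
     (\<forall>i. brownian_motion Q F T (\<lambda>t \<omega>. \<beta> t \<omega> $ i)) \<and>
     prob_space.indep_vars Q (\<lambda>_. \<Pi>\<^sub>M t\<in>{0..T}. borel) (\<lambda>i \<omega>. \<lambda>t\<in>{0..T}. \<beta> t \<omega> $ i) UNIV \<and>
     (\<forall>t\<in>{0..T}. X t \<in> borel_measurable (F t)) \<and>
     (\<forall>\<omega>\<in>space Q. continuous_on {0..T} (\<lambda>t. X t \<omega>)) \<and>
     (AE \<omega> in Q. X 0 \<omega> = x0 \<and>
        (\<forall>t\<in>{0..T}. (\<lambda>s. b (X s \<omega>)) integrable_on {0..t} \<and>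
          X t \<omega> = X 0 \<omega> + integral {0..t} (\<lambda>s. b (X s \<omega>)) + \<sigma> *\<^sub>R (\<beta> t \<omega> - \<beta> 0 \<omega>)))"

definition ode_solution ::
  "real \<Rightarrow> (real ^ 'n::finite \<Rightarrow> real ^ 'n) \<Rightarrow> real ^ 'n \<Rightarrow> (real \<Rightarrow> real ^ 'n) \<Rightarrow> bool" where
  "ode_solution T b x0 y \<longleftrightarrow>
     y 0 = x0 \<and> (\<forall>t\<in>{0..T}. (y has_vector_derivative b (y t)) (at t within {0..T}))"

definition abm_drift :: "('n::finite \<Rightarrow> 'n \<Rightarrow> real ^ 'n \<Rightarrow> real) \<Rightarrow> real ^ 'n \<Rightarrow> real ^ 'n" where
  "abm_drift p x = (\<chi> i. (1 / real CARD('n)) * (\<Sum>j\<in>UNIV. p i j x * (x $ j - x $ i)))"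

end

theory Submission
  imports Defs
begin

text \<open>Let \<open>W\<^sub>n = x\<^sub>n - h \<Sum>\<^sub>l\<^sub><\<^sub>n b(x\<^sub>l)\<close>.  The chain is the Euler scheme, of step \<open>h\<close>, for
  \<open>z(t) = w(t) + \<integral> b(z)\<close> driven by \<open>W\<close>, and the solution map \<open>w \<mapsto> z\<close> is locally Lipschitz in the uniform
  norm.  It therefore suffices to control \<open>W\<close>: Ottaviani's inequality makes its oscillation over blocks of
  length \<open>d\<close> small, uniformly in \<open>h\<close>, and its characteristic functions show that the block increments
  converge jointly to those of \<open>(m\<^sub>2/N)\<^sup>1\<^sup>/\<^sup>2 \<beta>\<close>.  So for a bounded Lipschitz functional on the Skorokhod space one may
  replace the path of the chain by an Euler path of fixed step \<open>d\<close>, let \<open>h \<rightarrow> 0\<close>, and then \<open>d \<rightarrow> 0\<close>.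

  The Ottaviani argument needs \<open>P(|W\<^sub>t\<^sub>+\<^sub>d - W\<^sub>t| \<ge> \<epsilon>) = O(d\<^sup>2)\<close>, although the noise has no uniform fourth
  moments when \<open>m\<^sub>2 = 0\<close>; the bounded function \<open>(1 - cos(d W))\<^sup>2\<close> replaces them.\<close>

section \<open>Approximate solutions of a perturbed equation\<close>

text \<open>Compactness in the Skorokhod space and a martingale problem are both avoided: chain and
  SDE are each compared pathwise with the same function of finitely many block increments, so only
  the joint law of those increments has to converge. Two features shape the estimates. The drift is
  a bounded Lipschitz factor times an unbounded linear one, hence only locally Lipschitz but of
  linear growth, so every comparison first confines the paths to a ball. And \<open>W\<close> is not
  a martingale, nor are its increments independent: the noise mean is merely o(h), and the law of a
  step depends on the state. In the characteristic functions both defects enter as errors o(h) (1 +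
  |x|^2) per step, summed against a uniform second moment of the chain. The order d^2 in the tail is
  forced by a union bound over about T/d blocks, where the order d of Chebyshev's inequality would
  not vanish. The constant diffusion coefficient makes the SDE solvable path by path; existence,
  adaptedness and uniqueness then come from the same deterministic lemmas.\<close>

text \<open>The weight exp(-2 L s) is Bielecki's: against it the integral of L u is at most half of
  the weighted supremum v, so v <= a + v/2. A bounded \<open>u\<close> makes v finite, which is what
  allows v/2 to be subtracted. Only \<open>D\<close> is integrated, so the argument suits a
  \<open>u\<close> of which no regularity is known.\<close>

lemma gronwall_weighted_sup:
  fixes u :: "real \<Rightarrow> real" and D :: "real \<Rightarrow> 'v::euclidean_space"
  assumes L: "0 \<le> L" and t: "t \<in> {0..T}"
    and bdd: "\<And>s. s \<in> {0..T} \<Longrightarrow> 0 \<le> u s \<and> u s \<le> U"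
    and D: "\<And>s. s \<in> {0..T} \<Longrightarrow> norm (D s) \<le> L * u s"
    and int: "\<And>s. s \<in> {0..T} \<Longrightarrow> D integrable_on {0..s}"
    and le: "\<And>s. s \<in> {0..T} \<Longrightarrow> u s \<le> a + norm (integral {0..s} D)"
  shows "u t \<le> 2 * a * exp (2 * L * T)"
proof (cases "L = 0")
  case True
  then have "integral {0..t} D = 0"
    using D t by (intro integral_unique has_integral_is_0) auto
  with le[OF t] bdd[OF t] True show ?thesis by simp
next
  case False
  with L have L: "0 < L" by simp
  define v where "v = (SUP s\<in>{0..T}. exp (- 2 * L * s) * u s)"
  have bdda: "bdd_above ((\<lambda>s. exp (- 2 * L * s) * u s) ` {0..T})"
  proof (rule bdd_aboveI2)
    fix s assume s: "s \<in> {0..T}"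
    then have "exp (- 2 * L * s) * u s \<le> 1 * U" using bdd[OF s] L
      by (intro mult_mono) auto
    then show "exp (- 2 * L * s) * u s \<le> U" by simp
  qed
  have le_v: "u s \<le> v * exp (2 * L * s)" if s: "s \<in> {0..T}" for s
  proof -
    have "exp (- 2 * L * s) * u s \<le> v" unfolding v_def by (rule cSUP_upper[OF s bdda])
    then show ?thesis by (simp add: exp_minus field_simps)
  qed
  have v0: "0 \<le> v"
    using le_v[OF t] bdd[OF t] by (meson exp_gt_zero order_trans zero_le_mult_iff not_le)
  have "exp (- 2 * L * s) * u s \<le> a + v / 2" if s: "s \<in> {0..T}" for s
  proof -
    \<comment> \<open>The bound L v exp(2 L r) has the primitive v/2 exp(2 L r); the factor 1/2 is
      the gain from the doubled exponent.\<close>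
    have hi: "((\<lambda>r. L * (v * exp (2 * L * r))) has_integral (v / 2 * exp (2 * L * s) - v / 2 * exp (2 * L * 0))) {0..s}"
      using s L by (intro fundamental_theorem_of_calculus)
        (auto intro!: derivative_eq_intros simp flip: has_real_derivative_iff_has_vector_derivative)
    have "norm (integral {0..s} D) \<le> integral {0..s} (\<lambda>r. L * (v * exp (2 * L * r)))"
    proof (rule integral_norm_bound_integral)
      show "D integrable_on {0..s}" by (rule int[OF s])
      show "(\<lambda>r. L * (v * exp (2 * L * r))) integrable_on {0..s}" using hi by blast
      fix r assume "r \<in> {0..s}"
      with s have r: "r \<in> {0..T}" by auto
      show "norm (D r) \<le> L * (v * exp (2 * L * r))"
        using D[OF r] mult_left_mono[OF le_v[OF r], of L] L by linarith
    qed
    also have "\<dots> = v / 2 * (exp (2 * L * s) - 1)"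
      using integral_unique[OF hi] by (simp add: algebra_simps)
    finally have "u s \<le> a + v / 2 * (exp (2 * L * s) - 1)" using le[OF s] by simp
    then have "exp (- 2 * L * s) * u s \<le> exp (- 2 * L * s) * (a + v / 2 * (exp (2 * L * s) - 1))"
      by simp
    also have "\<dots> = exp (- 2 * L * s) * (a - v / 2) + v / 2"
      by (simp add: algebra_simps flip: exp_add)
    also have "\<dots> \<le> a + v / 2"
    proof -
      have a0: "0 \<le> a"
        using le[of 0] bdd[of 0] t by auto
      have "exp (- 2 * L * s) \<le> 1" using s L by simp
      then have "exp (- 2 * L * s) * a \<le> 1 * a" using a0 by (rule mult_right_mono)
      moreover have "0 \<le> exp (- 2 * L * s) * (v/2)" using v0 by simp
      ultimately show ?thesis by (simp add: algebra_simps)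
    qed
    finally show ?thesis .
  qed
  then have "v \<le> a + v / 2" unfolding v_def[symmetric]
    by (subst v_def, intro cSUP_least) (use t in auto)
  then have v: "v \<le> 2 * a" by simp
  have "u t \<le> v * exp (2 * L * t)" by (rule le_v[OF t])
  also have "\<dots> \<le> (2 * a) * exp (2 * L * T)"
    using v v0 t L by (intro mult_mono) auto
  finally show ?thesis .
qed

section \<open>Step paths and Euler schemes\<close>

definition step_path :: "real \<Rightarrow> (nat \<Rightarrow> 'v) \<Rightarrow> real \<Rightarrow> 'v" where
  "step_path d v t = v (nat \<lfloor>t / d\<rfloor>)"

lemma nat_floor_divide_bounds:
  assumes "0 < d" "0 \<le> (t::real)"
  shows "real (nat \<lfloor>t / d\<rfloor>) * d \<le> t" "t < (real (nat \<lfloor>t / d\<rfloor>) + 1) * d"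
proof -
  have n: "real (nat \<lfloor>t / d\<rfloor>) = of_int \<lfloor>t / d\<rfloor>" using assms by simp
  show "real (nat \<lfloor>t / d\<rfloor>) * d \<le> t"
    unfolding n using of_int_floor_le[of "t / d"] by (simp only: pos_le_divide_eq[OF assms(1)])
  have "t / d < real_of_int \<lfloor>t / d\<rfloor> + 1" by linarith
  then show "t < (real (nat \<lfloor>t / d\<rfloor>) + 1) * d"
    unfolding n by (simp only: pos_divide_less_eq[OF assms(1)])
qed

lemma nat_floor_divide_eqI:
  assumes "0 < d" "real n * d \<le> t" "t < (real n + 1) * d"
  shows "nat \<lfloor>t / d\<rfloor> = n"
proof -
  have "\<lfloor>t / d\<rfloor> = int n" using assms by (intro floor_unique) (auto simp: field_simps)
  then show ?thesis by simp
qed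

lemma step_path_has_integral_piece:
  fixes v :: "nat \<Rightarrow> 'v::euclidean_space"
  assumes d: "0 < d" and t: "real n * d \<le> t" "t \<le> (real n + 1) * d"
  shows "(step_path d v has_integral (t - real n * d) *\<^sub>R v n) {real n * d..t}"
\<comment> \<open>The right end point already belongs to the next step; a single point does not
  affect the integral.\<close>
proof (rule has_integral_spike_finite[of "{(real n + 1) * d}"])
  show "((\<lambda>_. v n) has_integral (t - real n * d) *\<^sub>R v n) {real n * d..t}"
    using has_integral_const_real[of "v n" "real n * d" t] t by simp
  fix s assume "s \<in> {real n * d..t} - {(real n + 1) * d}"
  with t have "real n * d \<le> s" "s < (real n + 1) * d" by auto
  then show "step_path d v s = v n" by (simp add: step_path_def nat_floor_divide_eqI[OF d])
qed simp

lemma step_path_has_integral: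
  fixes v :: "nat \<Rightarrow> 'v::euclidean_space"
  assumes d: "0 < d" and t: "0 \<le> t"
  defines "n \<equiv> nat \<lfloor>t / d\<rfloor>"
  shows "(step_path d v has_integral (d *\<^sub>R (\<Sum>l<n. v l) + (t - real n * d) *\<^sub>R v n)) {0..t}"
proof -
  have *: "(step_path d v has_integral (d *\<^sub>R (\<Sum>l<k. v l))) {0..real k * d}" for k
  proof (induction k)
    case (Suc k)
    have "(step_path d v has_integral (d *\<^sub>R (\<Sum>l<k. v l) + (real (Suc k) * d - real k * d) *\<^sub>R v k)) {0..real (Suc k) * d}"
      using d by (intro has_integral_combine[OF _ _ Suc step_path_has_integral_piece[OF d]])
        (auto simp: algebra_simps)
    moreover have "real (Suc k) * d - real k * d = d" by (simp add: algebra_simps)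
    ultimately show ?case by (simp add: scaleR_add_right)
  qed (simp add: has_integral_refl)
  have n: "real n * d \<le> t" "t \<le> (real n + 1) * d"
    using nat_floor_divide_bounds[OF d t] by (auto simp: n_def)
  show ?thesis
    using d by (intro has_integral_combine[OF _ n(1) * step_path_has_integral_piece[OF d n]]) simp
qed

text \<open>The driver enters through its initial value and its increments, so that the chain
  itself, with step h and driver \<open>W\<close>, is an instance.\<close>

fun euler :: "('v::real_normed_vector \<Rightarrow> 'v) \<Rightarrow> real \<Rightarrow> (nat \<Rightarrow> 'v) \<Rightarrow> nat \<Rightarrow> 'v" where
  "euler b d v 0 = v 0"
| "euler b d v (Suc k) = euler b d v k + d *\<^sub>R b (euler b d v k) + (v (Suc k) - v k)"

lemma euler_eq_sum: "euler b d v k = v k + d *\<^sub>R (\<Sum>l<k. b (euler b d v l))"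
  by (induction k) (auto simp: algebra_simps)

text \<open>A (1 + c)^k satisfies the recursion with equality, so strong induction closes at
  once.\<close>

lemma discrete_gronwall:
  fixes a :: "nat \<Rightarrow> real"
  assumes "0 \<le> c" and "\<And>k. k \<le> K \<Longrightarrow> a k \<le> A + c * (\<Sum>l<k. a l)"
  shows "k \<le> K \<Longrightarrow> a k \<le> A * (1 + c) ^ k"
proof (induction k rule: less_induct)
  case (less k)
  have "a k \<le> A + c * (\<Sum>l<k. a l)" using assms(2) less.prems by simp
  also have "\<dots> \<le> A + c * (\<Sum>l<k. A * (1 + c) ^ l)"
    using less assms(1) by (intro add_left_mono mult_left_mono sum_mono) auto
  also have "\<dots> = A * (1 + c) ^ k"
    by (induction k) (auto simp: algebra_simps)
  finally show ?case .
qed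

text \<open>A common format for exact solutions (\<open>\<eta> = 0\<close>), Euler paths and the
  chain: \<open>\<eta>\<close> is the defect in the integral equation with driver \<open>w\<close>,
  which may jump. Boundedness is included because the Gronwall argument needs a finite
  supremum.\<close>

definition approx_solution ::
  "('v::euclidean_space \<Rightarrow> 'v) \<Rightarrow> real \<Rightarrow> (real \<Rightarrow> 'v) \<Rightarrow> real \<Rightarrow> (real \<Rightarrow> 'v) \<Rightarrow> bool" where
  "approx_solution b T w \<eta> z \<longleftrightarrow> bounded (z ` {0..T}) \<and>
     (\<forall>t\<in>{0..T}. (\<lambda>s. b (z s)) integrable_on {0..t} \<and>
        norm (z t - w t - integral {0..t} (\<lambda>s. b (z s))) \<le> \<eta>)"

text \<open>Linear growth without additive constant fits the opinion drift, which vanishes at 0.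
  Growth confines solutions to a ball, and inside the ball the Lipschitz bound applies.\<close>

locale drift =
  fixes b :: "'v::euclidean_space \<Rightarrow> 'v" and C :: real
  assumes C_nonneg: "0 \<le> C"
    and growth: "\<And>x. norm (b x) \<le> C * norm x"
    and locally_lipschitz: "\<And>R. \<exists>L\<ge>0. \<forall>x\<in>cball 0 R. \<forall>y\<in>cball 0 R. norm (b x - b y) \<le> L * norm (x - y)"
begin

definition lip :: "real \<Rightarrow> real" where
  "lip R = (SOME L. 0 \<le> L \<and> (\<forall>x\<in>cball 0 R. \<forall>y\<in>cball 0 R. norm (b x - b y) \<le> L * norm (x - y)))"

lemma lip: "0 \<le> lip R" "norm x \<le> R \<Longrightarrow> norm y \<le> R \<Longrightarrow> norm (b x - b y) \<le> lip R * norm (x - y)"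
proof -
  have "0 \<le> lip R \<and> (\<forall>x\<in>cball 0 R. \<forall>y\<in>cball 0 R. norm (b x - b y) \<le> lip R * norm (x - y))"
    unfolding lip_def by (rule someI_ex[OF locally_lipschitz])
  then show "0 \<le> lip R" "norm x \<le> R \<Longrightarrow> norm y \<le> R \<Longrightarrow> norm (b x - b y) \<le> lip R * norm (x - y)"
    by auto
qed

lemma continuous_b: "continuous_on UNIV b"
proof (rule continuous_at_imp_continuous_on, rule ballI)
  fix x :: 'v
  have "continuous_on (cball 0 (norm x + 1)) b"
    using lip by (intro lipschitz_on_continuous_on[of "lip (norm x + 1)"] lipschitz_onI) (auto simp: dist_norm)
  then have "continuous_on (ball 0 (norm x + 1)) b"
    by (rule continuous_on_subset) auto
  then show "isCont b x" by (simp add: continuous_on_eq_continuous_at)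
qed

text \<open>The constant of \<open>gronwall_weighted_sup\<close> with L = C and a = A + 1, where A
  bounds the driver and 1 the defect.\<close>

definition radius :: "real \<Rightarrow> real \<Rightarrow> real" where
  "radius T A = 2 * (A + 1) * exp (2 * C * T)"

lemma approx_solution_bounded:
  assumes z: "approx_solution b T w \<eta> z" and \<eta>: "\<eta> \<le> 1" and t: "t \<in> {0..T}"
    and w: "\<And>s. s \<in> {0..T} \<Longrightarrow> norm (w s) \<le> A"
  shows "norm (z t) \<le> radius T A"
proof -
  obtain U where U: "\<And>s. s \<in> {0..T} \<Longrightarrow> norm (z s) \<le> U"
    using z unfolding approx_solution_def bounded_iff by blast
  show ?thesis unfolding radius_def
  proof (rule gronwall_weighted_sup[where u = "\<lambda>s. norm (z s)" and D = "\<lambda>s. b (z s)" and U = U])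
    fix s assume s: "s \<in> {0..T}"
    have "norm (z s - w s - integral {0..s} (\<lambda>s. b (z s))) \<le> 1"
      using z s \<eta> unfolding approx_solution_def by force
    moreover have "norm (z s) \<le> norm (z s - w s - integral {0..s} (\<lambda>s. b (z s))) + norm (w s) + norm (integral {0..s} (\<lambda>s. b (z s)))"
      using norm_triangle_ineq[of "z s - w s - integral {0..s} (\<lambda>s. b (z s)) + w s" "integral {0..s} (\<lambda>s. b (z s))"]
        norm_triangle_ineq[of "z s - w s - integral {0..s} (\<lambda>s. b (z s))" "w s"] by simp
    ultimately show "norm (z s) \<le> A + 1 + norm (integral {0..s} (\<lambda>s. b (z s)))"
      using w[OF s] by linarith
  qed (use C_nonneg t U growth z in \<open>auto simp: approx_solution_def\<close>)
qed

text \<open>Both paths lie in the ball of radius \<open>radius T A\<close>, so a single Lipschitz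
  constant serves; the driver cancels in the difference and only the two defects remain.\<close>

lemma approx_solution_close:
  assumes z: "approx_solution b T w \<eta> z" "\<eta> \<le> 1" and y: "approx_solution b T w \<eta>' y" "\<eta>' \<le> 1"
    and t: "t \<in> {0..T}" and w: "\<And>s. s \<in> {0..T} \<Longrightarrow> norm (w s) \<le> A"
  shows "norm (z t - y t) \<le> 2 * (\<eta> + \<eta>') * exp (2 * lip (radius T A) * T)"
proof (rule gronwall_weighted_sup[where u = "\<lambda>s. norm (z s - y s)"
      and D = "\<lambda>s. b (z s) - b (y s)" and U = "2 * radius T A"])
  note bz = approx_solution_bounded[OF z _ w] and yb = approx_solution_bounded[OF y _ w]
  fix s assume s: "s \<in> {0..T}"
  show "0 \<le> norm (z s - y s) \<and> norm (z s - y s) \<le> 2 * radius T A"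
    using bz[OF s] yb[OF s] norm_triangle_ineq4[of "z s" "y s"] by simp
  show "norm (b (z s) - b (y s)) \<le> lip (radius T A) * norm (z s - y s)"
    using lip(2)[OF bz[OF s] yb[OF s]] .
  have iz: "(\<lambda>s. b (z s)) integrable_on {0..s}" and iy: "(\<lambda>s. b (y s)) integrable_on {0..s}"
    using z y s by (auto simp: approx_solution_def)
  then show "(\<lambda>s. b (z s) - b (y s)) integrable_on {0..s}" by (rule integrable_diff)
  define Iz Iy where "Iz = integral {0..s} (\<lambda>s. b (z s))" and "Iy = integral {0..s} (\<lambda>s. b (y s))"
  have "integral {0..s} (\<lambda>s. b (z s) - b (y s)) = Iz - Iy"
    using iz iy unfolding Iz_def Iy_def by (rule integral_diff)
  moreover have "norm (z s - w s - Iz) \<le> \<eta>" "norm (y s - w s - Iy) \<le> \<eta>'"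
    using z y s by (auto simp: approx_solution_def Iz_def Iy_def)
  moreover have "norm (z s - y s) \<le> norm (z s - w s - Iz) + norm (y s - w s - Iy) + norm (Iz - Iy)"
    using norm_triangle_ineq[of "(z s - w s - Iz) - (y s - w s - Iy)" "Iz - Iy"]
      norm_triangle_ineq4[of "z s - w s - Iz" "y s - w s - Iy"] by simp
  ultimately show "norm (z s - y s) \<le> \<eta> + \<eta>' + norm (integral {0..s} (\<lambda>s. b (z s) - b (y s)))"
    by simp
qed (use lip t in auto)

text \<open>Linear growth makes the summed drift a discrete Gronwall term with c = C d, and (1 + C
  d)^k <= exp(C T) as long as k d <= T. The bound does not depend on the step.\<close>

lemma euler_bounded:
  assumes d: "0 < d" and A: "\<And>k. real k * d \<le> T \<Longrightarrow> norm (v k) \<le> A" and k: "real k * d \<le> T"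
  shows "norm (euler b d v k) \<le> A * exp (C * T)"
proof -
  have A0: "0 \<le> A" using A[of 0] k d norm_ge_zero[of "v 0"]
    by (metis mult_nonneg_nonneg mult_zero_left of_nat_0 of_nat_0_le_iff order_trans less_imp_le)
  have "norm (euler b d v l) \<le> A + (C * d) * (\<Sum>j<l. norm (euler b d v j))" if "l \<le> k" for l
  proof -
    have ld: "real l * d \<le> T"
      using that k d by (meson of_nat_mono mult_right_mono order_trans less_imp_le)
    have "norm (euler b d v l) \<le> norm (v l) + norm (d *\<^sub>R (\<Sum>j<l. b (euler b d v j)))"
      by (subst euler_eq_sum) (rule norm_triangle_ineq)
    also have "norm (d *\<^sub>R (\<Sum>j<l. b (euler b d v j))) \<le> d * (\<Sum>j<l. C * norm (euler b d v j))"
      using d by (auto intro!: mult_left_mono order_trans[OF norm_sum] sum_mono growth)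
    also have "\<dots> = (C * d) * (\<Sum>j<l. norm (euler b d v j))"
      by (simp add: sum_distrib_left mult_ac)
    finally show ?thesis using A[OF ld] by simp
  qed
  then have "norm (euler b d v k) \<le> A * (1 + C * d) ^ k"
    by (rule discrete_gronwall[rotated, where K = k]) (use C_nonneg d in auto)
  also have "(1 + C * d) ^ k \<le> exp (C * d) ^ k"
    using C_nonneg d by (intro power_mono exp_ge_add_one_self) auto
  also have "exp (C * d) ^ k = exp (C * (real k * d))"
    by (simp add: mult_ac flip: exp_of_nat_mult)
  also have "\<dots> \<le> exp (C * T)" using C_nonneg k by (simp add: mult_left_mono)
  finally show ?thesis using A0 by (simp add: mult_left_mono)
qed

text \<open>The defect has two sources: \<open>\<rho>\<close> from replacing the driver by its
  sampled version, and d times a bound for the drift, because at time t the integral has entered a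
  step whose increment the scheme has not yet added.\<close>

lemma euler_approx_solution:
  assumes d: "0 < d" and A: "\<And>k. real k * d \<le> T \<Longrightarrow> norm (v k) \<le> A"
    and w: "\<And>t. t \<in> {0..T} \<Longrightarrow> norm (w t - step_path d v t) \<le> \<rho>"
  shows "approx_solution b T w (\<rho> + d * (C * (A * exp (C * T)))) (step_path d (euler b d v))"
  unfolding approx_solution_def
proof (intro conjI ballI)
  have kd: "real (nat \<lfloor>t / d\<rfloor>) * d \<le> T" if "t \<in> {0..T}" for t
    using nat_floor_divide_bounds(1)[OF d, of t] that by auto
  have eb: "norm (euler b d v k) \<le> A * exp (C * T)" if "real k * d \<le> T" for k
    by (rule euler_bounded[OF d _ that]) (rule A)
  show "bounded (step_path d (euler b d v) ` {0..T})"
    unfolding bounded_iff step_path_def using eb[OF kd] by blast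
  fix t assume t: "t \<in> {0..T}"
  then have t0: "0 \<le> t" by simp
  let ?n = "nat \<lfloor>t / d\<rfloor>"
  have eq: "(\<lambda>s. b (step_path d (euler b d v) s)) = step_path d (\<lambda>k. b (euler b d v k))"
    by (simp add: step_path_def fun_eq_iff)
  note hi = step_path_has_integral[OF d t0, of "\<lambda>k. b (euler b d v k)"]
  show "(\<lambda>s. b (step_path d (euler b d v) s)) integrable_on {0..t}"
    unfolding eq using hi by blast
  have "step_path d (euler b d v) t - w t - integral {0..t} (\<lambda>s. b (step_path d (euler b d v) s))
    = (step_path d v t - w t) - (t - real ?n * d) *\<^sub>R b (euler b d v ?n)"
    unfolding eq integral_unique[OF hi] by (simp add: step_path_def euler_eq_sum[of b d v ?n])
  also have "norm \<dots> \<le> norm (w t - step_path d v t) + norm ((t - real ?n * d) *\<^sub>R b (euler b d v ?n))"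
    by (metis norm_minus_commute norm_triangle_ineq4)
  also have "norm ((t - real ?n * d) *\<^sub>R b (euler b d v ?n)) \<le> d * (C * (A * exp (C * T)))"
  proof -
    have "\<bar>t - real ?n * d\<bar> \<le> d"
      using nat_floor_divide_bounds[OF d t0] by (simp add: algebra_simps)
    moreover have "norm (b (euler b d v ?n)) \<le> C * (A * exp (C * T))"
      using growth[of "euler b d v ?n"] mult_left_mono[OF eb[OF kd[OF t]] C_nonneg] by linarith
    ultimately show ?thesis by (simp add: mult_mono)
  qed
  finally show "norm (step_path d (euler b d v) t - w t - integral {0..t} (\<lambda>s. b (step_path d (euler b d v) s)))
      \<le> \<rho> + d * (C * (A * exp (C * T)))" using w[OF t] by linarith
qed

end

section \<open>The solution map for continuous drivers\<close>

context drift begin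

definition euler_path :: "(real \<Rightarrow> 'v) \<Rightarrow> nat \<Rightarrow> real \<Rightarrow> 'v" where
  "euler_path w q = step_path (inverse (real (Suc q))) (euler b (inverse (real (Suc q))) (\<lambda>k. w (real k * inverse (real (Suc q)))))"

text \<open>A limit of Euler paths along one fixed sequence of steps, instead of a fixed point: the
  value at t is then a limit of functions of finitely many driver values up to time t, from which
  measurability and adaptedness follow.\<close>

definition solution :: "(real \<Rightarrow> 'v) \<Rightarrow> real \<Rightarrow> 'v" where
  "solution w t = lim (\<lambda>q. euler_path w q t)"

lemma approx_solution_mono: "approx_solution b T w \<eta> z \<Longrightarrow> \<eta> \<le> \<eta>' \<Longrightarrow> approx_solution b T w \<eta>' z"
  unfolding approx_solution_def by (meson order_trans)

lemma euler_path_approx_solution: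
  assumes w: "continuous_on {0..T} w" and \<eta>: "0 < \<eta>"
  shows "\<forall>\<^sub>F q in sequentially. approx_solution b T w \<eta> (euler_path w q)"
proof -
  have "bounded (w ` {0..T})"
    using w by (intro compact_imp_bounded compact_continuous_image) auto
  then obtain A where A: "\<And>s. s \<in> {0..T} \<Longrightarrow> norm (w s) \<le> A"
    unfolding bounded_iff by blast
  have "uniformly_continuous_on {0..T} w"
    using w by (intro compact_uniformly_continuous) auto
  then obtain \<delta> where \<delta>: "0 < \<delta>"
    "\<And>s t. s \<in> {0..T} \<Longrightarrow> t \<in> {0..T} \<Longrightarrow> dist s t < \<delta> \<Longrightarrow> dist (w s) (w t) < \<eta> / 2"
    using \<eta> unfolding uniformly_continuous_on_def by (metis half_gt_zero)
  have lim: "(\<lambda>q. inverse (real (Suc q)) * K) \<longlonglongrightarrow> 0 * K" for K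
    by (intro tendsto_intros LIMSEQ_inverse_real_of_nat)
  have "\<forall>\<^sub>F q in sequentially. inverse (real (Suc q)) * 1 < \<delta>"
    using order_tendstoD(2)[OF lim[of 1]] \<delta> by simp
  moreover have "\<forall>\<^sub>F q in sequentially. inverse (real (Suc q)) * (C * (A * exp (C * T))) < \<eta> / 2"
    using \<eta> by (intro order_tendstoD(2)[OF lim]) simp
  ultimately show ?thesis
  proof eventually_elim
    case (elim q)
    define d where "d = inverse (real (Suc q))"
    have d: "0 < d" "d < \<delta>" using elim by (auto simp: d_def)
    have "approx_solution b T w (\<eta> / 2 + d * (C * (A * exp (C * T))))
       (step_path d (euler b d (\<lambda>k. w (real k * d))))"
    proof (rule euler_approx_solution[OF d(1)])
      fix k assume "real k * d \<le> T"
      then show "norm (w (real k * d)) \<le> A" using A d by simp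
    next
      fix t assume t: "t \<in> {0..T}"
      then have "0 \<le> t" by simp
      note n = nat_floor_divide_bounds[OF d(1) this]
      have "dist t (real (nat \<lfloor>t / d\<rfloor>) * d) < \<delta>"
        using n d(2) by (simp add: dist_real_def algebra_simps)
      then show "norm (w t - step_path d (\<lambda>k. w (real k * d)) t) \<le> \<eta> / 2"
        using \<delta>(2)[OF t, of "real (nat \<lfloor>t / d\<rfloor>) * d"] n(1) t d(1)
        by (simp add: step_path_def dist_norm less_imp_le)
    qed
    then show ?case
      unfolding euler_path_def d_def[symmetric]
      by (rule approx_solution_mono) (use elim(2) in \<open>simp add: d_def\<close>)
  qed
qed

text \<open>Euler paths of small defect are close to each other by
  \<open>approx_solution_close\<close>, so the sequence is uniformly Cauchy and the solution comes
  from completeness; the defect then passes to the limit.\<close>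

lemma
  assumes w: "continuous_on {0..T} w"
  shows solution_uniform_limit: "uniform_limit {0..T} (euler_path w) (solution w) sequentially"
    and solution_is_solution: "approx_solution b T w 0 (solution w)"
proof -
  have "bounded (w ` {0..T})"
    using w by (intro compact_imp_bounded compact_continuous_image) auto
  then obtain A where A: "\<And>s. s \<in> {0..T} \<Longrightarrow> norm (w s) \<le> A"
    unfolding bounded_iff by blast
  define E where "E = exp (2 * lip (radius T A) * T)"
  have E: "0 < E" by (simp add: E_def)
  have "uniformly_Cauchy_on {0..T} (euler_path w)"
    unfolding uniformly_Cauchy_on_def
  proof (intro allI impI)
    fix e :: real assume e: "0 < e"
    \<comment> \<open>Two defects \<open>\<eta>\<close> give a distance of at most 4
      \<open>\<eta>\<close> E; the 5 makes the final inequality strict, and the 1 is required by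
      \<open>approx_solution_close\<close>.\<close>
    define \<eta> where "\<eta> = min 1 (e / (5 * E))"
    have \<eta>: "0 < \<eta>" "\<eta> \<le> 1" using e E by (auto simp: \<eta>_def)
    have "4 * \<eta> * E \<le> 4 * (e / (5 * E)) * E"
      using E unfolding \<eta>_def by (intro mult_right_mono mult_left_mono) auto
    also have "\<dots> < e" using E e by simp
    finally have le: "2 * (\<eta> + \<eta>) * E < e" by simp
    obtain Q where Q: "\<And>q. q \<ge> Q \<Longrightarrow> approx_solution b T w \<eta> (euler_path w q)"
      using euler_path_approx_solution[OF w \<eta>(1)] unfolding eventually_sequentially by blast
    show "\<exists>M. \<forall>x\<in>{0..T}. \<forall>m\<ge>M. \<forall>n\<ge>M. dist (euler_path w m x) (euler_path w n x) < e"
    proof (intro exI[of _ Q] ballI allI impI)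
      fix x m n assume x: "x \<in> {0..T}" and mn: "Q \<le> m" "Q \<le> n"
      have "norm (euler_path w m x - euler_path w n x) \<le> 2 * (\<eta> + \<eta>) * E"
        unfolding E_def by (rule approx_solution_close[OF Q[OF mn(1)] \<eta>(2) Q[OF mn(2)] \<eta>(2) x A])
      with le show "dist (euler_path w m x) (euler_path w n x) < e" by (simp add: dist_norm)
    qed
  qed
  then have "uniformly_convergent_on {0..T} (euler_path w)"
    by (rule Cauchy_uniformly_convergent)
  then show ul: "uniform_limit {0..T} (euler_path w) (solution w) sequentially"
    unfolding uniformly_convergent_uniform_limit_iff solution_def .
  have pt: "(\<lambda>q. euler_path w q t) \<longlonglongrightarrow> solution w t" if "t \<in> {0..T}" for t
    using ul that by (rule tendsto_uniform_limitI)
  have bd: "\<forall>\<^sub>F q in sequentially. \<forall>t\<in>{0..T}. norm (euler_path w q t) \<le> radius T A"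
    using euler_path_approx_solution[OF w, of 1]
    by simp (auto elim!: eventually_mono intro!: approx_solution_bounded[where w = w] A)
  have bs: "norm (solution w t) \<le> radius T A" if "t \<in> {0..T}" for t
    using bd by (intro tendsto_upperbound[OF tendsto_norm[OF pt[OF that]]])
      (use that in \<open>auto elim: eventually_mono\<close>)
  show "approx_solution b T w 0 (solution w)"
    unfolding approx_solution_def
  proof (intro conjI ballI)
    show "bounded (solution w ` {0..T})"
      using bs unfolding bounded_iff by blast
    fix t assume t: "t \<in> {0..T}"
    have close: "\<exists>q. (\<forall>s\<in>{0..T}. norm (euler_path w q s - solution w s) \<le> e \<and>
        norm (b (euler_path w q s) - b (solution w s)) \<le> e) \<and> approx_solution b T w e (euler_path w q)"
      if e: "0 < e" for e
    proof -
      \<comment> \<open>Paths within e' of each other also have drifts within e, since the Lipschitz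
        constant times e' is at most e.\<close>
      define e' where "e' = min e (e / (lip (radius T A) + 1))"
      have l0: "0 \<le> lip (radius T A)" by (rule lip)
      have e': "0 < e'" "e' \<le> e" using e l0 by (auto simp: e'_def)
      have "lip (radius T A) * e' \<le> lip (radius T A) * (e / (lip (radius T A) + 1))"
        using l0 by (intro mult_left_mono) (auto simp: e'_def)
      also have "\<dots> \<le> e" using l0 e by (simp add: field_simps)
      finally have le: "lip (radius T A) * e' \<le> e" .
      have "\<forall>\<^sub>F q in sequentially. (\<forall>s\<in>{0..T}. norm (euler_path w q s - solution w s) \<le> e \<and>
        norm (b (euler_path w q s) - b (solution w s)) \<le> e) \<and> approx_solution b T w e (euler_path w q)"
        using uniform_limitD[OF ul e'(1)] bd euler_path_approx_solution[OF w e]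
      proof eventually_elim
        case (elim q)
        have "norm (b (euler_path w q s) - b (solution w s)) \<le> e" if s: "s \<in> {0..T}" for s
        proof -
          have "norm (b (euler_path w q s) - b (solution w s)) \<le> lip (radius T A) * norm (euler_path w q s - solution w s)"
            using elim(2) bs s by (intro lip) auto
          also have "\<dots> \<le> lip (radius T A) * e'"
            using elim(1) s l0 by (intro mult_left_mono) (auto simp: dist_norm less_imp_le)
          finally show ?thesis using le by linarith
        qed
        moreover have "norm (euler_path w q s - solution w s) \<le> e" if s: "s \<in> {0..T}" for s
          using elim(1) s e'(2) by (force simp: dist_norm)
        ultimately show ?case using elim(3) by blast
      qed
      from eventually_happens'[OF sequentially_bot this] show ?thesis by blast
    qed
    have "(\<lambda>s. b (solution w s)) integrable_on cbox 0 t"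
    proof (rule integrable_uniform_limit)
      fix e :: real assume "0 < e"
      from close[OF this] obtain q where q: "\<forall>s\<in>{0..T}. norm (b (euler_path w q s) - b (solution w s)) \<le> e"
        "approx_solution b T w e (euler_path w q)" by blast
      show "\<exists>g. (\<forall>x\<in>cbox 0 t. norm (b (solution w x) - g x) \<le> e) \<and> g integrable_on cbox 0 t"
        using q t by (intro exI[of _ "\<lambda>s. b (euler_path w q s)"]) (auto simp: norm_minus_commute approx_solution_def)
    qed
    then show int: "(\<lambda>s. b (solution w s)) integrable_on {0..t}" by simp
    have "norm (solution w t - w t - integral {0..t} (\<lambda>s. b (solution w s))) \<le> 0 + e" if e: "0 < e" for e
    proof -
      \<comment> \<open>Three errors are added: e' for the defect, e' for the path at time t, and at
        most T e' for the integral of the drift.\<close>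
      define e' where "e' = e / (T + 2)"
      have e': "0 < e'" "e' * (T + 2) = e" using e t by (auto simp: e'_def)
      from close[OF e'(1)] obtain q where q: "\<And>s. s\<in>{0..T} \<Longrightarrow> norm (euler_path w q s - solution w s) \<le> e'"
        "\<And>s. s\<in>{0..T} \<Longrightarrow> norm (b (euler_path w q s) - b (solution w s)) \<le> e'"
        "approx_solution b T w e' (euler_path w q)" by blast
      define I J where "I = integral {0..t} (\<lambda>s. b (euler_path w q s))" and "J = integral {0..t} (\<lambda>s. b (solution w s))"
      have intq: "(\<lambda>s. b (euler_path w q s)) integrable_on {0..t}"
        using q(3) t by (auto simp: approx_solution_def)
      have "norm (I - J) = norm (integral {0..t} (\<lambda>s. b (euler_path w q s) - b (solution w s)))"
        unfolding I_def J_def using integral_diff[OF intq int] by simp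
      also have "\<dots> \<le> integral {0..t} (\<lambda>s. e')"
        using q(2) t by (intro integral_norm_bound_integral integrable_diff intq int) auto
      also have "\<dots> = t * e'" using t by simp
      also have "\<dots> \<le> T * e'" using t e' by (intro mult_right_mono) auto
      finally have 1: "norm (I - J) \<le> T * e'" .
      have 2: "norm (euler_path w q t - w t - I) \<le> e'"
        using q(3) t by (auto simp: approx_solution_def I_def)
      have "solution w t - w t - J = (euler_path w q t - w t - I) - (euler_path w q t - solution w t) + (I - J)"
        by simp
      then have "norm (solution w t - w t - J) \<le> norm (euler_path w q t - w t - I) + norm (euler_path w q t - solution w t) + norm (I - J)"
        by (metis norm_triangle_mono norm_triangle_ineq4 order_refl)
      also have "\<dots> \<le> e' + e' + T * e'" using 1 2 q(1)[OF t] by linarith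
      also have "\<dots> = e" using e'(2) by (simp add: algebra_simps)
      finally show ?thesis by (simp add: J_def)
    qed
    then show "norm (solution w t - w t - integral {0..t} (\<lambda>s. b (solution w s))) \<le> 0"
      by (rule field_le_epsilon)
  qed
qed

lemma solution_unique:
  assumes w: "continuous_on {0..T} w" and y: "approx_solution b T w 0 y" and t: "t \<in> {0..T}"
  shows "y t = solution w t"
proof -
  have "bounded (w ` {0..T})"
    using w by (intro compact_imp_bounded compact_continuous_image) auto
  then obtain A where A: "\<And>s. s \<in> {0..T} \<Longrightarrow> norm (w s) \<le> A"
    unfolding bounded_iff by blast
  show ?thesis
    using approx_solution_close[OF y _ solution_is_solution[OF w] _ t A] by simp
qed

lemma solution_eq:
  assumes w: "continuous_on {0..T} w" and t: "t \<in> {0..T}"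
  shows "(\<lambda>s. b (solution w s)) integrable_on {0..t}"
    "solution w t = w t + integral {0..t} (\<lambda>s. b (solution w s))"
  using solution_is_solution[OF w] t by (auto simp: approx_solution_def algebra_simps)

lemma continuous_on_solution:
  assumes w: "continuous_on {0..T} w"
  shows "continuous_on {0..T} (solution w)"
proof (cases "0 \<le> T")
  case True
  have "continuous_on {0..T} (\<lambda>t. w t + integral {0..t} (\<lambda>s. b (solution w s)))"
    using solution_eq(1)[OF w, of T] True by (intro continuous_on_add w indefinite_integral_continuous_1) auto
  then show ?thesis by (rule continuous_on_eq) (simp add: solution_eq(2)[OF w])
qed simp

end

text \<open>The growth constant comes from |x_j - x_i| <= 2 |x| in each of the N coordinates and the
  l1 norm. The local Lipschitz constant has to grow with R, because the Lipschitz factor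
  \<open>p i j\<close> multiplies an opinion difference.\<close>

lemma drift_abm_drift:
  fixes p :: "'n::finite \<Rightarrow> 'n \<Rightarrow> real ^ 'n \<Rightarrow> real"
  assumes p: "\<And>i j y. p i j y \<in> {0..1}" and lip: "\<And>i j. \<exists>L. L-lipschitz_on UNIV (p i j)"
  shows "drift (abm_drift p) (2 * real CARD('n))"
proof
  let ?N = "real CARD('n)"
  have N: "0 < ?N" by simp
  show "0 \<le> 2 * ?N" by simp
  have coord: "\<bar>x $ j - x $ i\<bar> \<le> 2 * norm x" for x :: "real ^ 'n" and i j
    using component_le_norm_cart[of x i] component_le_norm_cart[of x j] by linarith
  fix x :: "real ^ 'n"
  have "\<bar>abm_drift p x $ i\<bar> \<le> 2 * norm x" for i
  proof -
    have "\<bar>p i j x * (x $ j - x $ i)\<bar> \<le> 1 * (2 * norm x)" for j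
      unfolding abs_mult using p[of i j x] by (intro mult_mono coord) auto
    then have "\<bar>\<Sum>j\<in>UNIV. p i j x * (x $ j - x $ i)\<bar> \<le> (\<Sum>j\<in>(UNIV::'n set). 1 * (2 * norm x))"
      by (intro order_trans[OF sum_abs] sum_mono)
    then show ?thesis using N by (simp add: abm_drift_def abs_mult field_simps)
  qed
  then have "(\<Sum>i\<in>UNIV. \<bar>abm_drift p x $ i\<bar>) \<le> (\<Sum>i\<in>(UNIV::'n set). 2 * norm x)"
    by (intro sum_mono)
  then show "norm (abm_drift p x) \<le> 2 * ?N * norm x"
    using norm_le_l1_cart[of "abm_drift p x"] by simp
next
  fix R :: real
  from lip obtain L where L: "\<And>i j. (L i j)-lipschitz_on UNIV (p i j)" by metis
  have L0: "0 \<le> L i j" for i j using L by (rule lipschitz_on_nonneg)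
  define K where "K = (\<Sum>i\<in>UNIV. \<Sum>j\<in>UNIV. 2 + L i j * (2 * \<bar>R\<bar>))"
  have K: "0 \<le> K" unfolding K_def using L0 by (intro sum_nonneg add_nonneg_nonneg mult_nonneg_nonneg) auto
  have coord: "\<bar>x $ j - x $ i\<bar> \<le> 2 * norm x" for x :: "real ^ 'n" and i j
    using component_le_norm_cart[of x i] component_le_norm_cart[of x j] by linarith
  have "norm (abm_drift p x - abm_drift p y) \<le> K * norm (x - y)" if "norm x \<le> R" "norm y \<le> R" for x y
  proof -
    have t: "\<bar>p i j x * (x $ j - x $ i) - p i j y * (y $ j - y $ i)\<bar> \<le> (2 + L i j * (2 * \<bar>R\<bar>)) * norm (x - y)" for i j
    proof -
      have "p i j x * (x $ j - x $ i) - p i j y * (y $ j - y $ i)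
        = p i j x * ((x - y) $ j - (x - y) $ i) + (p i j x - p i j y) * (y $ j - y $ i)"
        by (simp add: algebra_simps)
      also have "\<bar>\<dots>\<bar> \<le> \<bar>p i j x\<bar> * \<bar>(x - y) $ j - (x - y) $ i\<bar> + \<bar>p i j x - p i j y\<bar> * \<bar>y $ j - y $ i\<bar>"
        by (metis abs_mult abs_triangle_ineq)
      also have "\<dots> \<le> 1 * (2 * norm (x - y)) + (L i j * norm (x - y)) * (2 * \<bar>R\<bar>)"
      proof (intro add_mono mult_mono)
        show "\<bar>p i j x - p i j y\<bar> \<le> L i j * norm (x - y)"
          using lipschitz_onD[OF L, of x y i j] by (simp add: dist_norm)
        show "\<bar>y $ j - y $ i\<bar> \<le> 2 * \<bar>R\<bar>" using coord[where x=y, of j i] that by linarith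
      qed (use p coord[of "x - y"] L0 in auto)
      finally show ?thesis by (simp add: algebra_simps)
    qed
    have i: "\<bar>(abm_drift p x - abm_drift p y) $ i\<bar> \<le> (\<Sum>j\<in>UNIV. (2 + L i j * (2 * \<bar>R\<bar>)) * norm (x - y))" for i
    proof -
      have "(abm_drift p x - abm_drift p y) $ i = (1 / real CARD('n)) * (\<Sum>j\<in>UNIV. p i j x * (x $ j - x $ i) - p i j y * (y $ j - y $ i))"
        by (simp add: abm_drift_def sum_subtractf diff_divide_distrib)
      also have "\<bar>\<dots>\<bar> \<le> 1 * (\<Sum>j\<in>UNIV. (2 + L i j * (2 * \<bar>R\<bar>)) * norm (x - y))"
        unfolding abs_mult
        by (intro mult_mono order_trans[OF sum_abs] sum_mono t) (auto simp: Suc_leI)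
      finally show ?thesis by simp
    qed
    have "norm (abm_drift p x - abm_drift p y) \<le> (\<Sum>i\<in>UNIV. \<bar>(abm_drift p x - abm_drift p y) $ i\<bar>)"
      by (rule norm_le_l1_cart)
    also have "\<dots> \<le> K * norm (x - y)"
      unfolding K_def sum_distrib_right by (rule sum_mono) (rule i)
    finally show ?thesis .
  qed
  then show "\<exists>L\<ge>0. \<forall>x\<in>cball 0 R. \<forall>y\<in>cball 0 R. norm (abm_drift p x - abm_drift p y) \<le> L * norm (x - y)"
    using K by (intro exI[of _ K]) auto
qed

section \<open>Transitions of the chain\<close>

definition next_state :: "real \<Rightarrow> real ^ 'n \<Rightarrow> 'n::finite \<Rightarrow> 'n \<Rightarrow> bool \<Rightarrow> real \<Rightarrow> real ^ 'n" where
  "next_state \<mu> x i j b z = x + ((if b then \<mu> * (x $ j - x $ i) else 0) + z) *\<^sub>R axis i 1"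

definition step_average ::
  "real \<Rightarrow> ('n::finite \<Rightarrow> 'n \<Rightarrow> real ^ 'n \<Rightarrow> real) \<Rightarrow> real measure \<Rightarrow> real ^ 'n \<Rightarrow>
   (real ^ 'n \<Rightarrow> 'v::{banach, second_countable_topology}) \<Rightarrow> 'v" where
  "step_average \<mu> p \<nu> x f = (1 / (real CARD('n))\<^sup>2) *\<^sub>R (\<Sum>(i, j)\<in>UNIV.
     p i j x *\<^sub>R (\<integral>z. f (next_state \<mu> x i j True z) \<partial>\<nu>) + (1 - p i j x) *\<^sub>R (\<integral>z. f (next_state \<mu> x i j False z) \<partial>\<nu>))"

lemma measurable_next_state [measurable (raw)]:
  assumes [measurable]: "f \<in> borel_measurable M" "g \<in> borel_measurable M"
  shows "(\<lambda>w. next_state \<mu> (f w) i j b (g w)) \<in> borel_measurable M"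
proof -
  have "(\<lambda>w. f w $ k) \<in> borel_measurable M" for k
    by (rule measurable_compose[OF assms(1) borel_measurable_continuous_onI[OF linear_continuous_on[OF bounded_linear_vec_nth]]])
  then show ?thesis unfolding next_state_def by (cases b) auto
qed

locale abm_kernel_setup =
  fixes \<mu> :: real and p :: "'n::finite \<Rightarrow> 'n \<Rightarrow> real ^ 'n \<Rightarrow> real" and \<nu> :: "real measure"
  assumes p: "\<And>i j y. p i j y \<in> {0..1}" and p_meas [measurable]: "\<And>i j. p i j \<in> borel_measurable borel"
    and \<nu>: "prob_space \<nu>" and sets_\<nu> [measurable_cong, simp]: "sets \<nu> = sets borel"
begin

sublocale \<nu>: prob_space \<nu> by (rule \<nu>)

lemma kernel_component:
  "distr \<nu> borel (next_state \<mu> x i j b) \<in> space (subprob_algebra borel)"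
  using \<nu>.prob_space_distr[of "next_state \<mu> x i j b" borel]
  by (auto simp: space_subprob_algebra intro!: prob_space_imp_subprob_space measurable_next_state)

text \<open>With the innermost draw written as a push-forward of the noise law, the
  \<open>do\<close> block becomes a nest of binds to which the integral formula for binds
  applies.\<close>

lemma abm_kernel_eq:
  "abm_kernel \<mu> p \<nu> x = measure_pmf (pmf_of_set UNIV) \<bind> (\<lambda>(i, j). measure_pmf (bernoulli_pmf (p i j x)) \<bind>
     (\<lambda>b. distr \<nu> borel (next_state \<mu> x i j b)))"
proof -
  have "\<nu> \<bind> (\<lambda>z. return borel (\<chi> k. if k = i then x $ i + (if b then \<mu> * (x $ j - x $ i) else 0) + z else x $ k))
     = distr \<nu> borel (next_state \<mu> x i j b)" for i j b
  proof -
    have "(\<chi> k. if k = i then x $ i + (if b then \<mu> * (x $ j - x $ i) else 0) + z else x $ k) = next_state \<mu> x i j b z" for z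
      by (simp add: next_state_def vec_eq_iff axis_def)
    then show ?thesis
      by (simp add: bind_return_distr' \<nu>.not_empty measurable_next_state)
  qed
  then show ?thesis unfolding abm_kernel_def by simp
qed

lemma bernoulli_component:
  "measure_pmf (bernoulli_pmf (p i j x)) \<bind> (\<lambda>b. distr \<nu> borel (next_state \<mu> x i j b)) \<in> space (subprob_algebra borel)"
proof -
  have m: "(\<lambda>b. distr \<nu> borel (next_state \<mu> x i j b)) \<in> measure_pmf (bernoulli_pmf (p i j x)) \<rightarrow>\<^sub>M subprob_algebra borel"
    using kernel_component by (auto simp: measurable_def)
  then show ?thesis
    using subprob_space_bind[OF prob_space_imp_subprob_space[OF prob_space_measure_pmf] m]
    by (simp add: space_subprob_algebra sets_bind[OF sets_kernel[OF m]])
qed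

lemma nn_integral_abm_kernel:
  assumes f[measurable]: "f \<in> borel_measurable borel"
  shows "(\<integral>\<^sup>+y. f y \<partial>abm_kernel \<mu> p \<nu> x) = ennreal (1 / (real CARD('n))\<^sup>2) * (\<Sum>(i, j)\<in>UNIV.
     ennreal (p i j x) * (\<integral>\<^sup>+z. f (next_state \<mu> x i j True z) \<partial>\<nu>)
      + ennreal (1 - p i j x) * (\<integral>\<^sup>+z. f (next_state \<mu> x i j False z) \<partial>\<nu>))"
proof -
  have m1: "(\<lambda>b. distr \<nu> borel (next_state \<mu> x i j b)) \<in> measure_pmf (bernoulli_pmf (p i j x)) \<rightarrow>\<^sub>M subprob_algebra borel" for i j
    using kernel_component by (auto simp: measurable_def)
  have m2: "(\<lambda>(i, j). measure_pmf (bernoulli_pmf (p i j x)) \<bind> (\<lambda>b. distr \<nu> borel (next_state \<mu> x i j b)))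
     \<in> measure_pmf (pmf_of_set UNIV) \<rightarrow>\<^sub>M subprob_algebra borel"
    using bernoulli_component by (auto simp: measurable_def)
  have inner: "(\<integral>\<^sup>+y. f y \<partial>(measure_pmf (bernoulli_pmf (p i j x)) \<bind> (\<lambda>b. distr \<nu> borel (next_state \<mu> x i j b))))
    = ennreal (p i j x) * (\<integral>\<^sup>+z. f (next_state \<mu> x i j True z) \<partial>\<nu>)
      + ennreal (1 - p i j x) * (\<integral>\<^sup>+z. f (next_state \<mu> x i j False z) \<partial>\<nu>)" for i j
    using p[of i j x]
    by (subst nn_integral_bind[OF f m1]) (simp add: nn_integral_distr mult.commute measurable_next_state)
  have "(\<integral>\<^sup>+y. f y \<partial>abm_kernel \<mu> p \<nu> x)
    = (\<integral>\<^sup>+ij. (case ij of (i, j) \<Rightarrow> ennreal (p i j x) * (\<integral>\<^sup>+z. f (next_state \<mu> x i j True z) \<partial>\<nu>)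
      + ennreal (1 - p i j x) * (\<integral>\<^sup>+z. f (next_state \<mu> x i j False z) \<partial>\<nu>)) \<partial>measure_pmf (pmf_of_set UNIV))"
    unfolding abm_kernel_eq by (subst nn_integral_bind[OF f m2]) (simp add: case_prod_unfold inner)
  also have "\<dots> = (\<Sum>ij\<in>UNIV. (case ij of (i, j) \<Rightarrow> ennreal (p i j x) * (\<integral>\<^sup>+z. f (next_state \<mu> x i j True z) \<partial>\<nu>)
      + ennreal (1 - p i j x) * (\<integral>\<^sup>+z. f (next_state \<mu> x i j False z) \<partial>\<nu>)) * ennreal (1 / (real CARD('n))\<^sup>2))"
    by (subst nn_integral_measure_pmf_finite) (simp_all add: power2_eq_square)
  finally show ?thesis by (simp add: sum_distrib_left mult.commute case_prod_unfold)
qed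

lemma nn_integral_abm_kernel_real:
  assumes f: "f \<in> borel_measurable borel" "\<And>y. 0 \<le> f y"
    and int: "\<And>i j b. integrable \<nu> (\<lambda>z. f (next_state \<mu> x i j b z))"
  shows "(\<integral>\<^sup>+y. ennreal (f y) \<partial>abm_kernel \<mu> p \<nu> x) = ennreal (step_average \<mu> p \<nu> x f)"
proof -
  have e: "(\<integral>\<^sup>+z. ennreal (f (next_state \<mu> x i j b z)) \<partial>\<nu>) = ennreal (\<integral>z. f (next_state \<mu> x i j b z) \<partial>\<nu>)" for i j b
    using f by (intro nn_integral_eq_integral int) auto
  have pos: "0 \<le> (\<integral>z. f (next_state \<mu> x i j b z) \<partial>\<nu>)" for i j b
    using f by (intro integral_nonneg_AE) auto
  have p': "0 \<le> p i j x" "0 \<le> 1 - p i j x" for i j using p[of i j x] by auto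
  have "(\<integral>\<^sup>+y. ennreal (f y) \<partial>abm_kernel \<mu> p \<nu> x) = ennreal (1 / (real CARD('n))\<^sup>2) * (\<Sum>(i, j)\<in>UNIV.
     ennreal (p i j x * (\<integral>z. f (next_state \<mu> x i j True z) \<partial>\<nu>) + (1 - p i j x) * (\<integral>z. f (next_state \<mu> x i j False z) \<partial>\<nu>)))"
    using f p' pos by (subst nn_integral_abm_kernel) (auto simp: e ennreal_mult ennreal_plus)
  also have "\<dots> = ennreal (step_average \<mu> p \<nu> x f)"
    unfolding step_average_def split_beta using p' pos
    by (subst sum_ennreal) (auto simp: ennreal_mult[symmetric] sum_nonneg)
  finally show ?thesis .
qed

lemma prob_space_abm_kernel: "prob_space (abm_kernel \<mu> p \<nu> x)" "sets (abm_kernel \<mu> p \<nu> x) = sets borel"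
proof -
  have m2: "(\<lambda>(i, j). measure_pmf (bernoulli_pmf (p i j x)) \<bind> (\<lambda>b. distr \<nu> borel (next_state \<mu> x i j b)))
     \<in> measure_pmf (pmf_of_set UNIV) \<rightarrow>\<^sub>M subprob_algebra borel"
    using bernoulli_component by (auto simp: measurable_def)
  show s: "sets (abm_kernel \<mu> p \<nu> x) = sets borel"
    unfolding abm_kernel_eq by (rule sets_bind[OF sets_kernel[OF m2]]) auto
  have "(\<integral>\<^sup>+y. ennreal 1 \<partial>abm_kernel \<mu> p \<nu> x) = ennreal (step_average \<mu> p \<nu> x (\<lambda>_. 1))"
    by (rule nn_integral_abm_kernel_real) auto
  also have "step_average \<mu> p \<nu> x (\<lambda>_. 1::real) = 1"
    by (simp add: step_average_def split_beta \<nu>.prob_space power2_eq_square)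
  finally show "prob_space (abm_kernel \<mu> p \<nu> x)" by (intro prob_spaceI) simp
qed

lemma measurable_abm_kernel: "abm_kernel \<mu> p \<nu> \<in> borel \<rightarrow>\<^sub>M subprob_algebra borel"
proof (rule measurable_subprob_algebra)
  fix A :: "(real ^ 'n) set" assume A[measurable]: "A \<in> sets borel"
  have "emeasure (abm_kernel \<mu> p \<nu> x) A = (\<integral>\<^sup>+y. indicator A y \<partial>abm_kernel \<mu> p \<nu> x)" for x
    by (simp add: prob_space_abm_kernel(2))
  also have "(\<integral>\<^sup>+y. indicator A y \<partial>abm_kernel \<mu> p \<nu> x) = ennreal (1 / (real CARD('n))\<^sup>2) * (\<Sum>(i, j)\<in>UNIV.
     ennreal (p i j x) * (\<integral>\<^sup>+z. indicator A (next_state \<mu> x i j True z) \<partial>\<nu>)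
      + ennreal (1 - p i j x) * (\<integral>\<^sup>+z. indicator A (next_state \<mu> x i j False z) \<partial>\<nu>))" for x
    by (rule nn_integral_abm_kernel) simp
  finally have eq: "emeasure (abm_kernel \<mu> p \<nu> x) A = ennreal (1 / (real CARD('n))\<^sup>2) * (\<Sum>(i, j)\<in>UNIV.
     ennreal (p i j x) * (\<integral>\<^sup>+z. indicator A (next_state \<mu> x i j True z) \<partial>\<nu>)
      + ennreal (1 - p i j x) * (\<integral>\<^sup>+z. indicator A (next_state \<mu> x i j False z) \<partial>\<nu>))" for x .
  show "(\<lambda>x. emeasure (abm_kernel \<mu> p \<nu> x) A) \<in> borel_measurable borel"
    unfolding eq split_beta by measurable
qed (auto simp: prob_space_abm_kernel intro: prob_space_imp_subprob_space)

end

locale abm_markov = abm_kernel_setup \<mu> p \<nu>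
  for \<mu> :: real and p :: "'n::finite \<Rightarrow> 'n \<Rightarrow> real ^ 'n \<Rightarrow> real" and \<nu> :: "real measure" +
  fixes M :: "'a measure" and x0 :: "real ^ 'n" and x :: "nat \<Rightarrow> 'a \<Rightarrow> real ^ 'n"
  assumes chain: "markov_chain M (abm_kernel \<mu> p \<nu>) x0 x"
begin

sublocale prob_space M using chain by (simp add: markov_chain_def)

lemma x_measurable [measurable]: "x n \<in> borel_measurable M"
  using chain by (simp add: markov_chain_def)

lemma x_initial: "AE w in M. x 0 w = x0"
  using chain by (simp add: markov_chain_def)

lemma history_restrict_measurable: "(\<lambda>w. \<lambda>k\<in>{..n}. x k w) \<in> M \<rightarrow>\<^sub>M (\<Pi>\<^sub>M k\<in>{..n}. borel)"
  by (rule measurable_restrict) simp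

lemma space_history [simp]: "space (history M x n) = space M"
  by (simp add: history_def)

lemma subalgebra_history: "subalgebra M (history M x n)"
  unfolding subalgebra_def history_def
  using history_restrict_measurable[of n]
  by (auto simp: sets_vimage_algebra2[OF measurable_space[OF history_restrict_measurable, THEN funcsetI]] intro: measurable_sets)

lemma x_history_measurable: "k \<le> n \<Longrightarrow> x k \<in> borel_measurable (history M x n)"
proof -
  assume k: "k \<le> n"
  have "(\<lambda>w. \<lambda>k\<in>{..n}. x k w) \<in> history M x n \<rightarrow>\<^sub>M (\<Pi>\<^sub>M k\<in>{..n}. borel)"
    unfolding history_def by (rule measurable_vimage_algebra1) (use measurable_space[OF history_restrict_measurable] in auto)
  from measurable_compose[OF this measurable_component_singleton[of k]] k
  show ?thesis by simp
qed

lemma history_le_M: "f \<in> borel_measurable (history M x n) \<Longrightarrow> f \<in> borel_measurable M"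
  by (rule measurable_from_subalg[OF subalgebra_history])

text \<open>\<open>markov_chain\<close> prescribes the conditional law of the next state on single
  Borel sets only. Two measures on pairs (past, next state) are compared on measurable rectangles,
  an intersection-stable generator; integrating H against both covers functions of past and next
  state together.\<close>

lemma nn_integral_next:
  assumes H[measurable]: "case_prod H \<in> borel_measurable (history M x n \<Otimes>\<^sub>M borel)"
  shows "(\<integral>\<^sup>+w. H w (x (Suc n) w) \<partial>M) = (\<integral>\<^sup>+w. (\<integral>\<^sup>+y. H w y \<partial>abm_kernel \<mu> p \<nu> (x n w)) \<partial>M)"
proof -
  let ?G = "history M x n" and ?K = "abm_kernel \<mu> p \<nu>"
  interpret sub: sigma_finite_subalgebra M ?G
    by (intro finite_measure_subalgebra_is_sigma_finite finite_measure_subalgebra.intro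
        finite_measure_axioms finite_measure_subalgebra_axioms.intro subalgebra_history)
  have id[measurable]: "(\<lambda>w. w) \<in> M \<rightarrow>\<^sub>M ?G"
    using subalgebra_history[of n] by (auto simp: measurable_def subalgebra_def)
  have xn[measurable]: "x n \<in> borel_measurable ?G" by (rule x_history_measurable) simp
  let ?R = "restr_to_subalg M ?G"
  have R: "sets ?R = sets ?G" "space ?R = space M"
    using subalgebra_history[of n] by (auto simp: sets_restr_to_subalg space_restr_to_subalg)
  have Km: "(\<lambda>w. ?K (x n w)) \<in> ?R \<rightarrow>\<^sub>M subprob_algebra borel"
    using measurable_compose[OF xn measurable_abm_kernel] by (simp add: R cong: measurable_cong_sets)
  have Dm: "(\<lambda>w. distr (?K (x n w)) (?G \<Otimes>\<^sub>M borel) (\<lambda>y. (w, y))) \<in> ?R \<rightarrow>\<^sub>M subprob_algebra (?G \<Otimes>\<^sub>M borel)"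
  proof (rule measurable_distr2[OF _ Km])
    show "(\<lambda>(w, y :: real ^ 'n). (w, y)) \<in> ?R \<Otimes>\<^sub>M borel \<rightarrow>\<^sub>M ?G \<Otimes>\<^sub>M borel"
    proof -
      have "sets (?R \<Otimes>\<^sub>M (borel :: (real ^ 'n) measure)) = sets (?G \<Otimes>\<^sub>M borel)"
        by (rule sets_pair_measure_cong) (auto simp: R)
      from measurable_ident_sets[OF this] show ?thesis by (simp add: case_prod_unfold id_def)
    qed
  qed
  \<comment> \<open>\<open>\<mu>1\<close> is the actual joint law of past and next state,
    \<open>\<mu>2\<close> the one composed from the law of the past and the kernel.\<close>
  define \<mu>1 where "\<mu>1 = distr M (?G \<Otimes>\<^sub>M borel) (\<lambda>w. (w, x (Suc n) w))"
  define \<mu>2 where "\<mu>2 = ?R \<bind> (\<lambda>w. distr (?K (x n w)) (?G \<Otimes>\<^sub>M borel) (\<lambda>y. (w, y)))"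
  have Pm: "(\<lambda>y. (w, y)) \<in> ?K (x n w) \<rightarrow>\<^sub>M ?G \<Otimes>\<^sub>M borel" if "w \<in> space M" for w
    using that by (simp add: prob_space_abm_kernel(2) cong: measurable_cong_sets)
  have "\<mu>1 = \<mu>2"
  proof (rule measure_eqI_generator_eq[where E = "{A \<times> B | A B. A \<in> sets ?G \<and> B \<in> sets borel}" and \<Omega> = "space M \<times> UNIV" and A = "\<lambda>_. space M \<times> UNIV"])
    show "Int_stable {A \<times> B | A B. A \<in> sets ?G \<and> B \<in> sets (borel :: (real ^ 'n) measure)}"
      by (rule Int_stable_pair_measure_generator)
    show "{A \<times> B | A B. A \<in> sets ?G \<and> B \<in> sets (borel :: (real ^ 'n) measure)} \<subseteq> Pow (space M \<times> UNIV)"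
      using sets.sets_into_space[of _ ?G] by auto
    show "sets \<mu>1 = sigma_sets (space M \<times> UNIV) {A \<times> B | A B. A \<in> sets ?G \<and> B \<in> sets (borel :: (real ^ 'n) measure)}"
      by (simp add: \<mu>1_def sets_pair_measure)
    have "sets \<mu>2 = sets (?G \<Otimes>\<^sub>M borel)" unfolding \<mu>2_def
      by (rule sets_bind[OF sets_kernel[OF Dm]]) (auto simp: R not_empty)
    then show "sets \<mu>2 = sigma_sets (space M \<times> UNIV) {A \<times> B | A B. A \<in> sets ?G \<and> B \<in> sets (borel :: (real ^ 'n) measure)}"
      by (simp add: sets_pair_measure)
    show "range (\<lambda>_. space M \<times> UNIV) \<subseteq> {A \<times> B | A B. A \<in> sets ?G \<and> B \<in> sets (borel :: (real ^ 'n) measure)}"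
    proof -
      have "space M \<in> sets ?G" "UNIV \<in> sets (borel :: (real ^ 'n) measure)" using sets.top[of ?G] by auto
      then show ?thesis by blast
    qed
    show "emeasure \<mu>1 (space M \<times> UNIV) \<noteq> \<infinity>"
    proof -
      interpret m1: prob_space \<mu>1 unfolding \<mu>1_def by (rule prob_space_distr) measurable
      show ?thesis by simp
    qed
    fix X assume "X \<in> {A \<times> B | A B. A \<in> sets ?G \<and> B \<in> sets (borel :: (real ^ 'n) measure)}"
    then obtain A B where X: "X = A \<times> B" and A[measurable]: "A \<in> sets ?G" and B[measurable]: "B \<in> sets (borel :: (real ^ 'n) measure)" by auto
    have AM[measurable]: "A \<in> sets M" using A subalgebra_history[of n] by (auto simp: subalgebra_def)
    have Xm: "X \<in> sets (?G \<Otimes>\<^sub>M borel)" unfolding X by simp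
    have ce: "AE w in M. real_cond_exp M ?G (\<lambda>w. indicator B (x (Suc n) w)) w = measure (?K (x n w)) B"
      using chain B by (simp add: markov_chain_def)
    have ind: "integrable M (\<lambda>w. indicator B (x (Suc n) w) :: real)"
      by (rule integrable_const_bound[of _ 1]) auto
    have Kmeas[measurable]: "(\<lambda>w. measure (?K (x n w)) B) \<in> borel_measurable M"
    proof -
      have "(\<lambda>w. measure (?K (x n w)) B) \<in> borel_measurable ?G"
        using measurable_compose[OF measurable_compose[OF xn measurable_abm_kernel] measurable_measure_subprob_algebra[OF B]] .
      then show ?thesis by (rule history_le_M)
    qed
    \<comment> \<open>The conditional expectation may be exchanged for the kernel because A belongs
      to the history.\<close>
    have "(\<integral>w\<in>A. indicator B (x (Suc n) w) \<partial>M) = (\<integral>w\<in>A. real_cond_exp M ?G (\<lambda>w. indicator B (x (Suc n) w)) w \<partial>M)"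
      by (rule sub.real_cond_exp_intA[OF ind A])
    also have "\<dots> = (\<integral>w\<in>A. measure (?K (x n w)) B \<partial>M)"
      unfolding set_lebesgue_integral_def using ce
      by (intro integral_cong_AE) (auto intro: measurable_from_subalg[OF subalgebra_history] borel_measurable_cond_exp)
    finally have eq: "(\<integral>w\<in>A. indicator B (x (Suc n) w) \<partial>M) = (\<integral>w\<in>A. measure (?K (x n w)) B \<partial>M)" .
    have "emeasure \<mu>1 X = emeasure M (A \<inter> (x (Suc n) -` B \<inter> space M))"
    proof -
      have "(\<lambda>w. (w, x (Suc n) w)) -` X \<inter> space M = A \<inter> (x (Suc n) -` B \<inter> space M)"
        using sets.sets_into_space[OF AM] by (auto simp: X)
      then show ?thesis unfolding \<mu>1_def using Xm by (simp add: emeasure_distr)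
    qed
    also have "\<dots> = ennreal (\<integral>w\<in>A. indicator B (x (Suc n) w) \<partial>M)"
    proof -
      have "(\<integral>w\<in>A. indicator B (x (Suc n) w) \<partial>M) = (\<integral>w. indicator (A \<inter> (x (Suc n) -` B \<inter> space M)) w \<partial>M)"
        unfolding set_lebesgue_integral_def by (intro Bochner_Integration.integral_cong) (auto simp: indicator_def)
      also have "\<dots> = prob (A \<inter> (x (Suc n) -` B \<inter> space M))"
        by (simp add: Int_absorb2 sets.sets_into_space)
      finally show ?thesis by (simp add: emeasure_eq_measure)
    qed
    also have "\<dots> = ennreal (\<integral>w. indicator A w * measure (?K (x n w)) B \<partial>M)"
      unfolding eq by (simp add: set_lebesgue_integral_def)
    also have "\<dots> = (\<integral>\<^sup>+w. ennreal (indicator A w * measure (?K (x n w)) B) \<partial>M)"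
    proof (rule nn_integral_eq_integral[symmetric])
      show "integrable M (\<lambda>w. indicator A w * measure (?K (x n w)) B)"
        using prob_space.prob_le_1[OF prob_space_abm_kernel(1)]
        by (intro integrable_const_bound[of _ 1]) (auto simp: indicator_def)
    qed auto
    also have "\<dots> = (\<integral>\<^sup>+w. emeasure (distr (?K (x n w)) (?G \<Otimes>\<^sub>M borel) (\<lambda>y. (w, y))) X \<partial>M)"
    proof (rule nn_integral_cong)
      fix w assume w: "w \<in> space M"
      interpret K: prob_space "?K (x n w)" by (rule prob_space_abm_kernel)
      have "(\<lambda>y. (w, y)) -` X \<inter> space (?K (x n w)) = (if w \<in> A then B else {})"
        using sets_eq_imp_space_eq[OF prob_space_abm_kernel(2)] by (auto simp: X)
      then show "ennreal (indicator A w * measure (?K (x n w)) B) = emeasure (distr (?K (x n w)) (?G \<Otimes>\<^sub>M borel) (\<lambda>y. (w, y))) X"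
        by (subst emeasure_distr[OF Pm[OF w] Xm]) (simp add: K.emeasure_eq_measure indicator_def)
    qed
    also have "\<dots> = (\<integral>\<^sup>+w. emeasure (distr (?K (x n w)) (?G \<Otimes>\<^sub>M borel) (\<lambda>y. (w, y))) X \<partial>?R)"
      using measurable_compose[OF Dm measurable_emeasure_subprob_algebra[OF Xm]]
      by (intro nn_integral_subalgebra2[symmetric] subalgebra_history) (simp add: R cong: measurable_cong_sets)
    also have "\<dots> = emeasure \<mu>2 X"
      unfolding \<mu>2_def by (rule emeasure_bind[OF _ Dm Xm, symmetric]) (simp add: R not_empty)
    finally show "emeasure \<mu>1 X = emeasure \<mu>2 X" .
  qed auto
  have "(\<integral>\<^sup>+w. H w (x (Suc n) w) \<partial>M) = (\<integral>\<^sup>+w. case_prod H w \<partial>\<mu>1)"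
    unfolding \<mu>1_def by (subst nn_integral_distr) auto
  also have "\<dots> = (\<integral>\<^sup>+w. (\<integral>\<^sup>+w. case_prod H w \<partial>distr (?K (x n w)) (?G \<Otimes>\<^sub>M borel) (\<lambda>y. (w, y))) \<partial>?R)"
    unfolding \<open>\<mu>1 = \<mu>2\<close> \<mu>2_def by (rule nn_integral_bind[OF H Dm])
  also have "\<dots> = (\<integral>\<^sup>+w. (\<integral>\<^sup>+w. case_prod H w \<partial>distr (?K (x n w)) (?G \<Otimes>\<^sub>M borel) (\<lambda>y. (w, y))) \<partial>M)"
    using measurable_compose[OF Dm nn_integral_measurable_subprob_algebra[OF H]]
    by (intro nn_integral_subalgebra2 subalgebra_history) (simp add: R cong: measurable_cong_sets)
  also have "\<dots> = (\<integral>\<^sup>+w. (\<integral>\<^sup>+y. H w y \<partial>?K (x n w)) \<partial>M)"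
    by (intro nn_integral_cong) (simp add: nn_integral_distr[OF Pm])
  finally show ?thesis .
qed

text \<open>Integrability at the next step is a conclusion: the nonnegative integral is bounded by
  that of G first, and finiteness follows. This lets second moments be propagated by induction along
  the chain.\<close>

lemma integral_next_le:
  fixes H :: "'a \<Rightarrow> real ^ 'n \<Rightarrow> real"
  assumes H: "case_prod H \<in> borel_measurable (history M x n \<Otimes>\<^sub>M borel)" and H0: "\<And>w y. 0 \<le> H w y"
    and int: "\<And>w i j b. w \<in> space M \<Longrightarrow> integrable \<nu> (\<lambda>z. H w (next_state \<mu> (x n w) i j b z))"
    and le: "\<And>w. w \<in> space M \<Longrightarrow> step_average \<mu> p \<nu> (x n w) (H w) \<le> G w" and G: "integrable M G"
  shows "integrable M (\<lambda>w. H w (x (Suc n) w))" "expectation (\<lambda>w. H w (x (Suc n) w)) \<le> expectation G"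
proof -
  have Hm[measurable]: "H w \<in> borel_measurable borel" if "w \<in> space M" for w
    using measurable_compose_Pair1[OF _ H, of w] that by simp
  have id[measurable]: "(\<lambda>w. w) \<in> M \<rightarrow>\<^sub>M history M x n"
    using subalgebra_history[of n] by (auto simp: measurable_def subalgebra_def)
  have HM: "(\<lambda>w. H w (x (Suc n) w)) \<in> borel_measurable M"
    using measurable_compose[OF measurable_Pair[OF id x_measurable[of "Suc n"]] H] by simp
  have "(\<integral>\<^sup>+w. ennreal (H w (x (Suc n) w)) \<partial>M) = (\<integral>\<^sup>+w. (\<integral>\<^sup>+y. ennreal (H w y) \<partial>abm_kernel \<mu> p \<nu> (x n w)) \<partial>M)"
    using H by (intro nn_integral_next) (simp add: split_beta)
  also have "\<dots> = (\<integral>\<^sup>+w. ennreal (step_average \<mu> p \<nu> (x n w) (H w)) \<partial>M)"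
    by (intro nn_integral_cong nn_integral_abm_kernel_real Hm H0 int)
  also have "\<dots> \<le> (\<integral>\<^sup>+w. ennreal (G w) \<partial>M)"
    by (intro nn_integral_mono ennreal_leI le)
  also have "\<dots> = ennreal (expectation G)"
  proof (rule nn_integral_eq_integral[OF G])
    have "0 \<le> step_average \<mu> p \<nu> (x n w) (H w)" for w
      unfolding step_average_def split_beta using p H0
      by (intro scaleR_nonneg_nonneg sum_nonneg add_nonneg_nonneg integral_nonneg_AE) auto
    then show "AE w in M. 0 \<le> G w" using le by (auto intro: order_trans)
  qed
  finally have le': "(\<integral>\<^sup>+w. ennreal (H w (x (Suc n) w)) \<partial>M) \<le> ennreal (expectation G)" .
  show i: "integrable M (\<lambda>w. H w (x (Suc n) w))"
    using le' H0 by (intro integrableI_bounded HM) (auto simp: less_top[symmetric] top_unique)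
  have "0 \<le> step_average \<mu> p \<nu> (x n w) (H w)" for w
    unfolding step_average_def split_beta using p H0
    by (intro scaleR_nonneg_nonneg sum_nonneg add_nonneg_nonneg integral_nonneg_AE) auto
  then have "0 \<le> expectation G" using le by (intro integral_nonneg_AE) (auto intro: order_trans)
  moreover have "ennreal (expectation (\<lambda>w. H w (x (Suc n) w))) \<le> ennreal (expectation G)"
    using le' nn_integral_eq_integral[OF i] H0 by simp
  ultimately show "expectation (\<lambda>w. H w (x (Suc n) w)) \<le> expectation G" by simp
qed

lemma measurable_step_average:
  fixes H :: "'a \<Rightarrow> real ^ 'n \<Rightarrow> 'v::{banach, second_countable_topology}"
  assumes H: "case_prod H \<in> borel_measurable (history M x n \<Otimes>\<^sub>M borel)"
  shows "(\<lambda>w. step_average \<mu> p \<nu> (x n w) (H w)) \<in> borel_measurable (history M x n)"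
proof -
  have xn[measurable]: "x n \<in> borel_measurable (history M x n)" by (rule x_history_measurable) simp
  have "(\<lambda>(w, z). (w, next_state \<mu> (x n w) i j b z)) \<in> history M x n \<Otimes>\<^sub>M \<nu> \<rightarrow>\<^sub>M history M x n \<Otimes>\<^sub>M borel" for i j b
    by measurable
  from measurable_compose[OF this H]
  have "(\<lambda>(w, z). H w (next_state \<mu> (x n w) i j b z)) \<in> borel_measurable (history M x n \<Otimes>\<^sub>M \<nu>)" for i j b
    by (simp add: split_beta)
  then have [measurable]: "(\<lambda>w. \<integral>z. H w (next_state \<mu> (x n w) i j b z) \<partial>\<nu>) \<in> borel_measurable (history M x n)" for i j b
    by (rule \<nu>.borel_measurable_lebesgue_integral)
  show ?thesis unfolding step_average_def split_beta by measurable
qed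

text \<open>A signed function bounded by 1 becomes nonnegative after adding 1, and the shift passes
  through the average because the weights sum to one.\<close>

lemma integral_next_real:
  fixes H :: "'a \<Rightarrow> real ^ 'n \<Rightarrow> real"
  assumes H: "case_prod H \<in> borel_measurable (history M x n \<Otimes>\<^sub>M borel)" and H1: "\<And>w y. \<bar>H w y\<bar> \<le> 1"
  shows "expectation (\<lambda>w. H w (x (Suc n) w)) = expectation (\<lambda>w. step_average \<mu> p \<nu> (x n w) (H w))"
    "\<bar>step_average \<mu> p \<nu> (x n w) (H w)\<bar> \<le> 1"
proof -
  have avg: "step_average \<mu> p \<nu> y (\<lambda>y. g y + 1) = step_average \<mu> p \<nu> y g + 1"
    if "g \<in> borel_measurable borel" "\<And>y. \<bar>g y\<bar> \<le> 1" for g :: "real ^ 'n \<Rightarrow> real" and y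
  proof -
    have "integrable \<nu> (\<lambda>z. g (next_state \<mu> y i j b z))" for i j b
      using that by (intro \<nu>.integrable_const_bound[of _ 1] AE_I2) auto
    then have 1: "(\<integral>z. g (next_state \<mu> y i j b z) + 1 \<partial>\<nu>) = (\<integral>z. g (next_state \<mu> y i j b z) \<partial>\<nu>) + 1" for i j b
      by (simp add: \<nu>.prob_space)
    have 2: "P *\<^sub>R (a + 1) + (1 - P) *\<^sub>R (c + 1) = (P *\<^sub>R a + (1 - P) *\<^sub>R c) + 1" for P a c :: real
      by (simp add: algebra_simps)
    show ?thesis
      unfolding step_average_def case_prod_unfold 1 2 sum.distrib by (simp add: distrib_left power2_eq_square)
  qed
  have bound: "\<bar>step_average \<mu> p \<nu> y g\<bar> \<le> 1" if "\<And>y. \<bar>g y\<bar> \<le> 1" for g :: "real ^ 'n \<Rightarrow> real" and y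
  proof -
    have i: "\<bar>\<integral>z. g (next_state \<mu> y i j b z) \<partial>\<nu>\<bar> \<le> 1" for i j b
    proof (cases "integrable \<nu> (\<lambda>z. g (next_state \<mu> y i j b z))")
      case True
      have "\<bar>\<integral>z. g (next_state \<mu> y i j b z) \<partial>\<nu>\<bar> \<le> (\<integral>z. \<bar>g (next_state \<mu> y i j b z)\<bar> \<partial>\<nu>)" by (rule integral_abs_bound)
      also have "\<dots> \<le> (\<integral>z. 1 \<partial>\<nu>)" using True that by (intro integral_mono) auto
      finally show ?thesis by (simp add: \<nu>.prob_space)
    qed (simp add: not_integrable_integral_eq)
    have "\<bar>p i j y * (\<integral>z. g (next_state \<mu> y i j True z) \<partial>\<nu>) + (1 - p i j y) * (\<integral>z. g (next_state \<mu> y i j False z) \<partial>\<nu>)\<bar> \<le> 1" for i j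
    proof -
      have "\<bar>p i j y * (\<integral>z. g (next_state \<mu> y i j True z) \<partial>\<nu>) + (1 - p i j y) * (\<integral>z. g (next_state \<mu> y i j False z) \<partial>\<nu>)\<bar>
        \<le> p i j y * 1 + (1 - p i j y) * 1"
        using p[of i j y] by (intro order_trans[OF abs_triangle_ineq] add_mono) (auto simp: abs_mult intro!: mult_left_le i)
      then show ?thesis by simp
    qed
    then have "(\<Sum>ij\<in>(UNIV :: ('n \<times> 'n) set). \<bar>case ij of (i, j) \<Rightarrow> p i j y * (\<integral>z. g (next_state \<mu> y i j True z) \<partial>\<nu>) + (1 - p i j y) * (\<integral>z. g (next_state \<mu> y i j False z) \<partial>\<nu>)\<bar>)
      \<le> (\<Sum>ij\<in>(UNIV :: ('n \<times> 'n) set). 1)" by (intro sum_mono) (auto simp: split_beta)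
    then have "\<bar>\<Sum>ij\<in>(UNIV :: ('n \<times> 'n) set). case ij of (i, j) \<Rightarrow> p i j y * (\<integral>z. g (next_state \<mu> y i j True z) \<partial>\<nu>) + (1 - p i j y) * (\<integral>z. g (next_state \<mu> y i j False z) \<partial>\<nu>)\<bar>
      \<le> (real CARD('n))\<^sup>2" using order_trans[OF sum_abs] by (fastforce simp: power2_eq_square)
    then show ?thesis by (simp add: step_average_def abs_mult divide_simps)
  qed
  show "\<bar>step_average \<mu> p \<nu> (x n w) (H w)\<bar> \<le> 1" by (rule bound[OF H1])
  have Hm[measurable]: "H w \<in> borel_measurable borel" if "w \<in> space M" for w
    using measurable_compose_Pair1[OF _ H, of w] that by simp
  have id[measurable]: "(\<lambda>w. w) \<in> M \<rightarrow>\<^sub>M history M x n"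
    using subalgebra_history[of n] by (auto simp: measurable_def subalgebra_def)
  have HM: "(\<lambda>w. H w (x (Suc n) w)) \<in> borel_measurable M"
    using measurable_compose[OF measurable_Pair[OF id x_measurable[of "Suc n"]] H] by simp
  have i1: "integrable M (\<lambda>w. H w (x (Suc n) w))"
    using HM H1 by (intro integrable_const_bound[of _ 1]) auto
  have i2: "integrable M (\<lambda>w. step_average \<mu> p \<nu> (x n w) (H w))"
    using history_le_M[OF measurable_step_average[OF H]] bound[OF H1] by (intro integrable_const_bound[of _ 1]) auto
  have n1: "0 \<le> H w y + 1" for w y using H1[of w y] by linarith
  have n2: "0 \<le> step_average \<mu> p \<nu> (x n w) (H w) + 1" for w using bound[of "H w" "x n w", OF H1] by linarith
  have "(\<integral>\<^sup>+w. ennreal (H w (x (Suc n) w) + 1) \<partial>M) = (\<integral>\<^sup>+w. (\<integral>\<^sup>+y. ennreal (H w y + 1) \<partial>abm_kernel \<mu> p \<nu> (x n w)) \<partial>M)"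
    using H by (intro nn_integral_next) (simp add: split_beta)
  also have "\<dots> = (\<integral>\<^sup>+w. ennreal (step_average \<mu> p \<nu> (x n w) (H w) + 1) \<partial>M)"
  proof (rule nn_integral_cong)
    fix w assume w: "w \<in> space M"
    have "(\<integral>\<^sup>+y. ennreal (H w y + 1) \<partial>abm_kernel \<mu> p \<nu> (x n w)) = ennreal (step_average \<mu> p \<nu> (x n w) (\<lambda>y. H w y + 1))"
    proof (rule nn_integral_abm_kernel_real)
      show "integrable \<nu> (\<lambda>z. H w (next_state \<mu> (x n w) i j b z) + 1)" for i j b
      proof (rule \<nu>.integrable_const_bound[of _ 2])
        have "\<bar>H w y + 1\<bar> \<le> 2" for y using H1[of w y] by linarith
        then show "AE z in \<nu>. norm (H w (next_state \<mu> (x n w) i j b z) + 1) \<le> 2" by simp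
      qed (use Hm[OF w] in simp)
    qed (use Hm[OF w] n1 in auto)
    then show "(\<integral>\<^sup>+y. ennreal (H w y + 1) \<partial>abm_kernel \<mu> p \<nu> (x n w)) = ennreal (step_average \<mu> p \<nu> (x n w) (H w) + 1)"
      by (simp add: avg[OF Hm[OF w] H1])
  qed
  finally have "ennreal (expectation (\<lambda>w. H w (x (Suc n) w) + 1)) = ennreal (expectation (\<lambda>w. step_average \<mu> p \<nu> (x n w) (H w) + 1))"
    using i1 i2 n1 n2 by (simp add: nn_integral_eq_integral)
  then have "expectation (\<lambda>w. H w (x (Suc n) w) + 1) = expectation (\<lambda>w. step_average \<mu> p \<nu> (x n w) (H w) + 1)"
    using n1 n2 by (simp add: integral_nonneg_AE)
  then show "expectation (\<lambda>w. H w (x (Suc n) w)) = expectation (\<lambda>w. step_average \<mu> p \<nu> (x n w) (H w))"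
    using i1 i2 by (simp add: prob_space)
qed

end

section \<open>One-step estimates for second moments and characteristic functions\<close>

lemma cis_approx: "norm (cis t - 1) \<le> \<bar>t\<bar>" "norm (cis t - 1 - \<i> * t) \<le> t\<^sup>2 / 2"
  using iexp_approx1[of t 0] iexp_approx1[of t 1] by (simp_all add: cis_conv_exp power2_eq_square diff_diff_eq)

lemma exp_minus_approx:
  fixes y :: real
  assumes "0 \<le> y"
  shows "\<bar>exp (- y) - (1 - y)\<bar> \<le> y\<^sup>2 / 2"
proof -
  have "1 - y \<le> exp (- y)" using exp_ge_add_one_self[of "-y"] by simp
  moreover have "exp (- y) \<le> 1 - y + y\<^sup>2 / 2"
  proof -
    have "(\<lambda>x. exp (- x) - (1 - x + x\<^sup>2 / 2)) y \<le> (\<lambda>x. exp (- x) - (1 - x + x\<^sup>2 / 2)) 0"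
    proof (rule DERIV_nonpos_imp_nonincreasing[OF assms], intro exI conjI)
      fix x :: real assume "0 \<le> x" "x \<le> y"
      show "((\<lambda>x. exp (- x) - (1 - x + x\<^sup>2 / 2)) has_real_derivative (- exp (- x) - (- 1 + x))) (at x)"
        by (auto intro!: derivative_eq_intros)
      show "- exp (- x) - (- 1 + x) \<le> 0" using exp_ge_add_one_self[of "-x"] by simp
    qed
    then show ?thesis by simp
  qed
  ultimately show ?thesis by (simp add: abs_le_iff)
qed

lemma abs_le_imp_power2_le: "\<bar>a\<bar> \<le> s \<Longrightarrow> a\<^sup>2 \<le> s\<^sup>2" for a s :: real
  using power_mono[of "\<bar>a\<bar>" s 2] by simp

lemma mult_le_of_abs_le:
  fixes a b s t :: real
  assumes "\<bar>a\<bar> \<le> s" "\<bar>b\<bar> \<le> t"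
  shows "a * b \<le> s * t"
proof -
  have "a * b \<le> \<bar>a\<bar> * \<bar>b\<bar>" using abs_ge_self[of "a * b"] by (simp only: abs_mult)
  also have "\<dots> \<le> s * t" using assms abs_ge_zero[of a] by (intro mult_mono) linarith+
  finally show ?thesis .
qed

lemma sum_pair_UNIV: "(\<Sum>(i, j)\<in>(UNIV :: ('n::finite \<times> 'm::finite) set). f i j) = (\<Sum>i\<in>UNIV. \<Sum>j\<in>UNIV. f i j)"
  unfolding UNIV_Times_UNIV[symmetric] by (rule sum.cartesian_product[symmetric])

text \<open>The moment conditions in the quantitative form in which they hold for each small fixed
  h: mean at most h and second moment at most \<open>\<kappa>\<close> h. Later
  \<open>\<kappa>\<close> is m2 + 1.\<close>

locale abm_chain = abm_markov "N * h" p \<nu> M x0 x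
  for N h :: real and p :: "'n::finite \<Rightarrow> 'n \<Rightarrow> real ^ 'n \<Rightarrow> real" and \<nu> :: "real measure"
    and M :: "'a measure" and x0 :: "real ^ 'n" and x :: "nat \<Rightarrow> 'a \<Rightarrow> real ^ 'n" +
  fixes \<kappa> :: real
  assumes N [simp]: "N = real CARD('n)"
    and lipschitz: "\<And>i j. \<exists>L. L-lipschitz_on UNIV (p i j)"
    and h: "0 < h" "h \<le> 1"
    and noise_square: "integrable \<nu> (\<lambda>z. z\<^sup>2)"
    and noise_mean: "\<bar>\<integral>z. z \<partial>\<nu>\<bar> \<le> h" and noise_variance: "(\<integral>z. z\<^sup>2 \<partial>\<nu>) \<le> \<kappa> * h"
begin

abbreviation b :: "real ^ 'n \<Rightarrow> real ^ 'n" where "b \<equiv> abm_drift p"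
abbreviation avg :: "real ^ 'n \<Rightarrow> (real ^ 'n \<Rightarrow> 'v::{banach, second_countable_topology}) \<Rightarrow> 'v" where
  "avg \<equiv> step_average (N * h) p \<nu>"

sublocale drift b "2 * N" using drift_abm_drift[OF p lipschitz] by simp

lemma avg_eq: "avg y f = (1 / N\<^sup>2) *\<^sub>R (\<Sum>i\<in>UNIV. \<Sum>j\<in>UNIV.
     p i j y *\<^sub>R (\<integral>z. f (next_state (N * h) y i j True z) \<partial>\<nu>) + (1 - p i j y) *\<^sub>R (\<integral>z. f (next_state (N * h) y i j False z) \<partial>\<nu>))"
  unfolding step_average_def sum_pair_UNIV by simp

lemma b_measurable [measurable]: "b \<in> borel_measurable borel"
  by (rule borel_measurable_continuous_onI[OF continuous_b])

lemma noise_integrable: "integrable \<nu> (\<lambda>z. z)"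
  by (rule \<nu>.square_integrable_imp_integrable[OF _ noise_square]) simp

lemma kappa_nonneg: "0 \<le> \<kappa>"
proof -
  have "0 \<le> (\<integral>z. z\<^sup>2 \<partial>\<nu>)" by simp
  then have "0 \<le> \<kappa> * h" using noise_variance by linarith
  then show ?thesis using h by (simp add: zero_le_mult_iff)
qed

lemma kick_bound: "\<bar>N * h * (y $ j - y $ i)\<bar> \<le> 2 * N * h * norm y"
proof -
  have "\<bar>y $ j - y $ i\<bar> \<le> 2 * norm y"
    using component_le_norm_cart[of y i] component_le_norm_cart[of y j] by linarith
  then have "N * h * \<bar>y $ j - y $ i\<bar> \<le> N * h * (2 * norm y)" using h by (intro mult_left_mono) auto
  then show ?thesis using h by (simp add: abs_mult mult_ac)
qed

text \<open>This is where the update distance N h matters: a pair has weight 1/N^2, the kick carries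
  N h and the drift 1/N, so the mean displacement of a step without noise is exactly h b(y).\<close>

lemma sum_kicks: "(\<Sum>i\<in>UNIV. \<Sum>j\<in>UNIV. d $ i * (p i j y * (N * h * (y $ j - y $ i)))) = N\<^sup>2 * (h * (d \<bullet> b y))"
proof -
  have "(\<Sum>j\<in>UNIV. d $ i * (p i j y * (N * h * (y $ j - y $ i)))) = N\<^sup>2 * (h * (d $ i * b y $ i))" for i
    by (simp add: abm_drift_def sum_distrib_left power2_eq_square mult_ac)
  then show ?thesis by (simp add: inner_vec_def sum_distrib_left)
qed

text \<open>Coefficients of h and of h^2 |y|^2 in \<open>square_average\<close>. In
  \<open>c2\<close> the 1 stems from the noise mean acting on c, \<open>\<kappa>\<close> from the
  noise variance, and 4N from the products of the noise mean with kick and drift; these also give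
  the 4N of \<open>c3\<close>, whose 4N^2 is the squared kick.\<close>

definition c2 :: real where "c2 = 1 + \<kappa> + 4 * N"
definition c3 :: real where "c3 = 4 * N\<^sup>2 + 4 * N"

lemma c2_nonneg: "0 \<le> c2" and c3_nonneg: "0 \<le> c3"
  unfolding c2_def c3_def using kappa_nonneg by auto

text \<open>As a quadratic polynomial in z the square involves only the first two moments of the
  noise.\<close>

lemma square_expand:
  "(norm (next_state (N * h) y i j B z - y - h *\<^sub>R b y + c))\<^sup>2
    = (let a = (if B then N * h * (y $ j - y $ i) else 0); d = c - h *\<^sub>R b y
       in z\<^sup>2 + 2 * (a + d $ i) * z + (a\<^sup>2 + 2 * a * d $ i + (norm d)\<^sup>2))"
proof -
  have *: "(norm (s *\<^sub>R axis i 1 + d))\<^sup>2 = s\<^sup>2 + 2 * s * d $ i + (norm d)\<^sup>2" for s and d :: "real ^ 'n"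
    unfolding power2_norm_eq_inner
    by (simp add: inner_add_left inner_add_right inner_axis_axis inner_axis' inner_axis power2_eq_square algebra_simps)
  have "next_state (N * h) y i j B z - y - h *\<^sub>R b y + c = ((if B then N * h * (y $ j - y $ i) else 0) + z) *\<^sub>R axis i 1 + (c - h *\<^sub>R b y)"
    by (simp add: next_state_def)
  then show ?thesis unfolding Let_def by (simp only: *) (simp add: power2_eq_square algebra_simps)
qed

lemma square_integrable: "integrable \<nu> (\<lambda>z. (norm (next_state (N * h) y i j B z - y - h *\<^sub>R b y + c))\<^sup>2)"
  unfolding square_expand Let_def
  by (intro Bochner_Integration.integrable_add integrable_mult_right noise_square noise_integrable \<nu>.integrable_const)

text \<open>Subtracting h b(y) removes the mean kick, so the product of the fixed vector c with the
  increment survives only through the noise mean; that costs the factor 1 + h. All other terms are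
  of order h, or of order h^2 with |y|^2.\<close>

lemma square_average:
  "avg y (\<lambda>y'. (norm (y' - y - h *\<^sub>R b y + c))\<^sup>2) \<le> (1 + h) * (norm c)\<^sup>2 + h * c2 + h\<^sup>2 * c3 * (norm y)\<^sup>2"
proof -
  define a where "a i j = N * h * (y $ j - y $ i)" for i j
  define d where "d = c - h *\<^sub>R b y"
  define a1 a2 where "a1 = (\<integral>z. z \<partial>\<nu>)" and "a2 = (\<integral>z. z\<^sup>2 \<partial>\<nu>)"
  define s where "s = 2 * N * h * norm y"
  have s0: "0 \<le> s" using h by (simp add: s_def)
  have int: "(\<integral>z. z\<^sup>2 + 2 * (a + d $ i) * z + (a\<^sup>2 + 2 * a * d $ i + (norm d)\<^sup>2) \<partial>\<nu>)
    = a2 + 2 * (a + d $ i) * a1 + (a\<^sup>2 + 2 * a * d $ i + (norm d)\<^sup>2)" for a i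
    using noise_square noise_integrable by (simp add: a1_def a2_def \<nu>.prob_space)
  have term_le: "p i j y * (\<integral>z. (norm (next_state (N * h) y i j True z - y - h *\<^sub>R b y + c))\<^sup>2 \<partial>\<nu>)
      + (1 - p i j y) * (\<integral>z. (norm (next_state (N * h) y i j False z - y - h *\<^sub>R b y + c))\<^sup>2 \<partial>\<nu>)
    \<le> (s\<^sup>2 + 2 * s * h + a2 + (norm d)\<^sup>2) + 2 * a1 * d $ i + 2 * (d $ i * (p i j y * a i j))" for i j
  proof -
    have "p i j y * (\<integral>z. (norm (next_state (N * h) y i j True z - y - h *\<^sub>R b y + c))\<^sup>2 \<partial>\<nu>)
      + (1 - p i j y) * (\<integral>z. (norm (next_state (N * h) y i j False z - y - h *\<^sub>R b y + c))\<^sup>2 \<partial>\<nu>)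
      = p i j y * ((a i j)\<^sup>2 + 2 * a i j * a1) + a2 + (norm d)\<^sup>2 + 2 * a1 * d $ i + 2 * (d $ i * (p i j y * a i j))"
      unfolding square_expand Let_def d_def[symmetric] int a_def[symmetric] if_True if_False
      by (simp add: int algebra_simps)
    moreover have "p i j y * ((a i j)\<^sup>2 + 2 * a i j * a1) \<le> 1 * (s\<^sup>2 + 2 * s * h)"
    proof (rule order_trans[OF mult_left_mono mult_right_mono])
      have as: "\<bar>a i j\<bar> \<le> s" unfolding a_def s_def by (rule kick_bound)
      then have "(a i j)\<^sup>2 \<le> s\<^sup>2" by (rule abs_le_imp_power2_le)
      moreover have "a i j * a1 \<le> s * h"
        using as noise_mean[folded a1_def] by (rule mult_le_of_abs_le)
      ultimately show "(a i j)\<^sup>2 + 2 * a i j * a1 \<le> s\<^sup>2 + 2 * s * h" by simp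
      show "0 \<le> s\<^sup>2 + 2 * s * h" using s0 h by simp
    qed (use p[of i j y] in auto)
    ultimately show ?thesis by simp
  qed
  have sumd: "\<bar>\<Sum>i\<in>UNIV. d $ i\<bar> \<le> N * norm d"
  proof -
    have "\<bar>\<Sum>i\<in>UNIV. d $ i\<bar> \<le> (\<Sum>i\<in>(UNIV :: 'n set). norm d)"
      by (intro order_trans[OF sum_abs] sum_mono component_le_norm_cart)
    then show ?thesis by simp
  qed
  have "(\<Sum>i\<in>UNIV. \<Sum>j\<in>UNIV. p i j y * (\<integral>z. (norm (next_state (N * h) y i j True z - y - h *\<^sub>R b y + c))\<^sup>2 \<partial>\<nu>)
      + (1 - p i j y) * (\<integral>z. (norm (next_state (N * h) y i j False z - y - h *\<^sub>R b y + c))\<^sup>2 \<partial>\<nu>))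
    \<le> (\<Sum>i\<in>UNIV. \<Sum>j\<in>UNIV. (s\<^sup>2 + 2 * s * h + a2 + (norm d)\<^sup>2) + 2 * a1 * d $ i + 2 * (d $ i * (p i j y * a i j)))"
    by (intro sum_mono term_le)
  also have "\<dots> = N\<^sup>2 * (s\<^sup>2 + 2 * s * h + a2 + (norm d)\<^sup>2) + N * (2 * a1 * (\<Sum>i\<in>UNIV. d $ i)) + 2 * (N\<^sup>2 * (h * (d \<bullet> b y)))"
    unfolding sum_kicks[symmetric] a_def by (simp add: sum.distrib sum_distrib_left power2_eq_square mult_ac distrib_left)
  also have "N * (2 * a1 * (\<Sum>i\<in>UNIV. d $ i)) \<le> N\<^sup>2 * (2 * h * norm d)"
  proof -
    have "a1 * (\<Sum>i\<in>UNIV. d $ i) \<le> h * (N * norm d)"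
      using noise_mean[folded a1_def] sumd by (rule mult_le_of_abs_le)
    then have "N * (2 * (a1 * (\<Sum>i\<in>UNIV. d $ i))) \<le> N * (2 * (h * (N * norm d)))" by (intro mult_left_mono) auto
    then show ?thesis by (simp add: power2_eq_square mult_ac)
  qed
  finally have "(\<Sum>i\<in>UNIV. \<Sum>j\<in>UNIV. p i j y * (\<integral>z. (norm (next_state (N * h) y i j True z - y - h *\<^sub>R b y + c))\<^sup>2 \<partial>\<nu>)
      + (1 - p i j y) * (\<integral>z. (norm (next_state (N * h) y i j False z - y - h *\<^sub>R b y + c))\<^sup>2 \<partial>\<nu>))
    \<le> N\<^sup>2 * (s\<^sup>2 + 2 * s * h + a2 + (norm d)\<^sup>2 + 2 * h * norm d + 2 * h * (d \<bullet> b y))"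
    by (simp add: algebra_simps)
  then have L1: "avg y (\<lambda>y'. (norm (y' - y - h *\<^sub>R b y + c))\<^sup>2) \<le> s\<^sup>2 + 2 * s * h + a2 + (norm d)\<^sup>2 + 2 * h * norm d + 2 * h * (d \<bullet> b y)"
    unfolding avg_eq real_scaleR_def by (simp add: divide_le_eq mult.commute)
  \<comment> \<open>Since c = d + h b(y), completing the square absorbs the product of d with the
    drift.\<close>
  have L2: "(norm d)\<^sup>2 + 2 * h * norm d + 2 * h * (d \<bullet> b y) \<le> (norm c)\<^sup>2 + 2 * h * norm c + 2 * h * (h * (2 * N * norm y))"
  proof -
    have "(norm d)\<^sup>2 + 2 * h * (d \<bullet> b y) \<le> (norm c)\<^sup>2"
    proof -
      have "(norm c)\<^sup>2 = (norm (d + h *\<^sub>R b y))\<^sup>2" by (simp add: d_def)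
      also have "\<dots> = (norm d)\<^sup>2 + 2 * h * (d \<bullet> b y) + (h * norm (b y))\<^sup>2"
        unfolding power_mult_distrib power2_norm_eq_inner
        by (simp add: inner_add_left inner_add_right inner_commute power2_eq_square algebra_simps)
      finally show ?thesis by simp
    qed
    moreover have "norm d \<le> norm c + h * (2 * N * norm y)"
    proof -
      have "norm d \<le> norm c + norm (h *\<^sub>R b y)" unfolding d_def by (rule norm_triangle_ineq4)
      also have "norm (h *\<^sub>R b y) \<le> h * (2 * N * norm y)" using growth[of y] h by (simp add: mult_left_mono)
      finally show ?thesis by simp
    qed
    then have "2 * h * norm d \<le> 2 * h * (norm c + h * (2 * N * norm y))" using h by (intro mult_left_mono) auto
    ultimately show ?thesis by (simp add: algebra_simps)
  qed
  have L3: "s\<^sup>2 + 2 * s * h + a2 + ((norm c)\<^sup>2 + 2 * h * norm c + 2 * h * (h * (2 * N * norm y)))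
     \<le> (1 + h) * (norm c)\<^sup>2 + h * c2 + h\<^sup>2 * c3 * (norm y)\<^sup>2"
  proof -
    \<comment> \<open>Trades terms linear in a norm for a constant plus the square, the only shape
      allowed in the conclusion.\<close>
    have am: "2 * t \<le> 1 + t\<^sup>2" for t :: real using zero_le_power2[of "t - 1"] by (simp add: power2_eq_square algebra_simps)
    define Y n where "Y = (norm y)\<^sup>2" and "n = (norm c)\<^sup>2"
    have "h * (2 * norm c) \<le> h * (1 + n)" unfolding n_def using h am by (intro mult_left_mono) auto
    moreover have "(4 * N * h\<^sup>2) * (2 * norm y) \<le> (4 * N * h\<^sup>2) * (1 + Y)"
      unfolding Y_def using am by (intro mult_left_mono) auto
    moreover have "4 * N * h\<^sup>2 \<le> 4 * N * h"
      using h by (intro mult_left_mono) (auto simp: power2_eq_square)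
    moreover have "a2 \<le> \<kappa> * h" unfolding a2_def by (rule noise_variance)
    moreover have "s\<^sup>2 = 4 * N\<^sup>2 * h\<^sup>2 * Y" by (simp add: s_def Y_def power_mult_distrib)
    moreover have "2 * s * h + 2 * h * (h * (2 * N * norm y)) = (4 * N * h\<^sup>2) * (2 * norm y)"
      by (simp add: s_def power2_eq_square)
    moreover have "(1 + h) * n + h * (1 + \<kappa> + 4 * N) + h\<^sup>2 * (4 * N\<^sup>2 + 4 * N) * Y
      = n + h * (1 + n) + \<kappa> * h + 4 * N * h + 4 * N\<^sup>2 * h\<^sup>2 * Y + (4 * N * h\<^sup>2) * (1 + Y) - 4 * N * h\<^sup>2"
      by (simp add: algebra_simps)
    ultimately show ?thesis unfolding c2_def c3_def Y_def[symmetric] n_def[symmetric] by linarith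
  qed
  from L1 L2 L3 show ?thesis by linarith
qed

text \<open>The phases of kick and drift cancel to first order, since their means agree by
  \<open>sum_kicks\<close>; what remains is quadratic in h |y|. Only the coordinate i of the drawn
  pair receives noise, which turns the variance m into m/N. The Gaussian factor is free of y, and
  this is the source of independence of the increments in the limit.\<close>

lemma char_average:
  assumes \<Theta>: "norm \<theta> \<le> \<Theta>" and m: "0 \<le> m" and \<delta>: "0 \<le> \<delta>"
    and char: "\<And>u. \<bar>u\<bar> \<le> \<Theta> \<Longrightarrow> norm (char \<nu> u - complex_of_real (1 - u\<^sup>2 * m * h / 2)) \<le> h * \<delta>"
  shows "norm (avg y (\<lambda>y'. cis (\<theta> \<bullet> (y' - y - h *\<^sub>R b y))) - complex_of_real (exp (- (m / (2 * N) * h * (norm \<theta>)\<^sup>2))))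
    \<le> h * (\<delta> + h * (8 * \<Theta>\<^sup>2 * N\<^sup>2 + (\<delta> + \<Theta>\<^sup>2 * m / 2) * \<Theta> * 2 * N + (m * \<Theta>\<^sup>2)\<^sup>2 / 2)) * (1 + (norm y)\<^sup>2)"
proof -
  have \<Theta>0: "0 \<le> \<Theta>" using \<Theta> norm_ge_zero order_trans by blast
  \<comment> \<open>\<open>\<tau>\<close> is the phase of the drift; t bounds it and every kick
    phase; r and q are the deviations from 1 of the noise factor and of the averaged kick
    factor.\<close>
  define \<tau> where "\<tau> = h * (\<theta> \<bullet> b y)"
  define t where "t = h * \<Theta> * (2 * N * norm y)"
  define r where "r i = char \<nu> (\<theta> $ i) - 1" for i
  define \<rho> where "\<rho> = h * (\<delta> + \<Theta>\<^sup>2 * m / 2)"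
  define q where "q i j = p i j y *\<^sub>R (cis (\<theta> $ i * (N * h * (y $ j - y $ i))) - 1)" for i j
  have t0: "0 \<le> t" and \<rho>0: "0 \<le> \<rho>" using h \<Theta>0 m \<delta> by (auto simp: t_def \<rho>_def)
  have \<theta>i: "\<bar>\<theta> $ i\<bar> \<le> \<Theta>" for i using component_le_norm_cart[of \<theta> i] \<Theta> by linarith
  have \<tau>t: "\<bar>\<tau>\<bar> \<le> t"
  proof -
    have "\<bar>\<theta> \<bullet> b y\<bar> \<le> norm \<theta> * norm (b y)" by (rule Cauchy_Schwarz_ineq2)
    also have "\<dots> \<le> \<Theta> * (2 * N * norm y)" using \<Theta> \<Theta>0 growth[of y] by (intro mult_mono) auto
    finally show ?thesis using h by (simp add: \<tau>_def t_def abs_mult mult_left_mono mult.assoc)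
  qed
  have r\<rho>: "norm (r i) \<le> \<rho>" for i
  proof -
    define v where "v = (\<theta> $ i)\<^sup>2 * m * h / 2"
    have "(\<theta> $ i)\<^sup>2 \<le> \<Theta>\<^sup>2" using \<theta>i[of i] by (rule abs_le_imp_power2_le)
    then have "v \<le> \<Theta>\<^sup>2 * m * h / 2"
      unfolding v_def using m h by (intro divide_right_mono mult_right_mono) auto
    moreover have "0 \<le> v" unfolding v_def using m h by simp
    ultimately have 1: "norm (complex_of_real v) \<le> \<Theta>\<^sup>2 * m * h / 2" by simp
    have 2: "norm (char \<nu> (\<theta> $ i) - complex_of_real (1 - v)) \<le> h * \<delta>"
      using char[OF \<theta>i[of i]] by (simp add: v_def)
    have "r i = (char \<nu> (\<theta> $ i) - complex_of_real (1 - v)) - complex_of_real v" by (simp add: r_def)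
    then have "norm (r i) \<le> norm (char \<nu> (\<theta> $ i) - complex_of_real (1 - v)) + norm (complex_of_real v)"
      by (metis norm_triangle_ineq4)
    also have "\<dots> \<le> h * \<delta> + \<Theta>\<^sup>2 * m * h / 2" using 1 2 by (rule add_mono[rotated])
    finally show ?thesis by (simp add: \<rho>_def algebra_simps)
  qed
  have val: "(\<integral>z. cis (\<theta> \<bullet> (next_state (N * h) y i j B z - y - h *\<^sub>R b y)) \<partial>\<nu>)
    = cis (- \<tau>) * cis (\<theta> $ i * (if B then N * h * (y $ j - y $ i) else 0)) * (1 + r i)" for i j B
  proof -
    have "\<theta> \<bullet> (next_state (N * h) y i j B z - y - h *\<^sub>R b y)
      = - \<tau> + \<theta> $ i * (if B then N * h * (y $ j - y $ i) else 0) + \<theta> $ i * z" for z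
    proof -
      have "next_state (N * h) y i j B z - y - h *\<^sub>R b y = ((if B then N * h * (y $ j - y $ i) else 0) + z) *\<^sub>R axis i 1 - h *\<^sub>R b y"
        by (simp add: next_state_def)
      then show ?thesis by (simp only:) (simp add: inner_diff_right inner_axis \<tau>_def algebra_simps)
    qed
    then have "(\<integral>z. cis (\<theta> \<bullet> (next_state (N * h) y i j B z - y - h *\<^sub>R b y)) \<partial>\<nu>)
      = (\<integral>z. cis (- \<tau>) * cis (\<theta> $ i * (if B then N * h * (y $ j - y $ i) else 0)) * iexp (\<theta> $ i * z) \<partial>\<nu>)"
      by (simp only: cis_conv_exp[symmetric] cis_mult)
    also have "\<dots> = cis (- \<tau>) * cis (\<theta> $ i * (if B then N * h * (y $ j - y $ i) else 0)) * char \<nu> (\<theta> $ i)"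
      unfolding char_def by simp
    finally show ?thesis by (simp add: r_def)
  qed
  have "avg y (\<lambda>y'. cis (\<theta> \<bullet> (y' - y - h *\<^sub>R b y)))
    = (1 / N\<^sup>2) *\<^sub>R (\<Sum>i\<in>UNIV. \<Sum>j\<in>UNIV. cis (- \<tau>) * ((1 + r i) * (1 + q i j)))"
    unfolding avg_eq val q_def
    by (intro arg_cong[where f = "\<lambda>u. (1 / N\<^sup>2) *\<^sub>R u"] sum.cong refl) (simp add: scaleR_conv_of_real algebra_simps)
  \<comment> \<open>\<open>rb\<close> keeps the noise of first order; \<open>e\<close> collects the
    second order: kick phases beyond the linear term, and products of noise and kick.\<close>
  define rb where "rb = (1 / N) *\<^sub>R (\<Sum>i\<in>UNIV. r i)"
  define e where "e = (1 / N\<^sup>2) *\<^sub>R (\<Sum>i\<in>UNIV. \<Sum>j\<in>UNIV. (q i j - \<i> * complex_of_real (\<theta> $ i * (p i j y * (N * h * (y $ j - y $ i))))) + r i * q i j)"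
  have sumq: "(1 / N\<^sup>2) *\<^sub>R (\<Sum>i\<in>UNIV. \<Sum>j\<in>UNIV. \<i> * complex_of_real (\<theta> $ i * (p i j y * (N * h * (y $ j - y $ i))))) = \<i> * complex_of_real \<tau>"
  proof -
    have "(\<Sum>i\<in>UNIV. \<Sum>j\<in>UNIV. \<i> * complex_of_real (\<theta> $ i * (p i j y * (N * h * (y $ j - y $ i))))) = \<i> * complex_of_real (N\<^sup>2 * \<tau>)"
      unfolding \<tau>_def sum_kicks[symmetric] of_real_sum sum_distrib_left ..
    then show ?thesis by (simp add: scaleR_conv_of_real)
  qed
  have "(1 / N\<^sup>2) *\<^sub>R (\<Sum>i\<in>UNIV. \<Sum>j\<in>UNIV. (1 + r i) * (1 + q i j)) = 1 + rb + \<i> * complex_of_real \<tau> + e"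
  proof -
    have "(\<Sum>i\<in>UNIV. \<Sum>j\<in>(UNIV :: 'n set). 1 + r i) = complex_of_real (N\<^sup>2) + complex_of_real N * (\<Sum>i\<in>UNIV. r i)"
      by (simp add: sum.distrib sum_distrib_left power2_eq_square distrib_left)
    then have "(1 / N\<^sup>2) *\<^sub>R (\<Sum>i\<in>UNIV. \<Sum>j\<in>(UNIV :: 'n set). 1 + r i) = 1 + rb"
      by (simp add: rb_def scaleR_conv_of_real power2_eq_square distrib_left)
    moreover have "(1 + r i) * (1 + q i j) = (1 + r i) + \<i> * complex_of_real (\<theta> $ i * (p i j y * (N * h * (y $ j - y $ i))))
      + ((q i j - \<i> * complex_of_real (\<theta> $ i * (p i j y * (N * h * (y $ j - y $ i))))) + r i * q i j)" for i j
      by (simp add: algebra_simps)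
    ultimately show ?thesis
      unfolding e_def sumq[symmetric] by (simp only: sum.distrib scaleR_add_right)
  qed
  moreover have "avg y (\<lambda>y'. cis (\<theta> \<bullet> (y' - y - h *\<^sub>R b y))) = cis (- \<tau>) * ((1 / N\<^sup>2) *\<^sub>R (\<Sum>i\<in>UNIV. \<Sum>j\<in>UNIV. (1 + r i) * (1 + q i j)))"
    unfolding \<open>avg y (\<lambda>y'. cis (\<theta> \<bullet> (y' - y - h *\<^sub>R b y))) = _\<close> sum_distrib_left[symmetric] by (simp only: mult_scaleR_right)
  ultimately have avg_val: "avg y (\<lambda>y'. cis (\<theta> \<bullet> (y' - y - h *\<^sub>R b y))) = cis (- \<tau>) * (1 + rb + \<i> * complex_of_real \<tau> + e)" by simp
  have qb: "norm (q i j) \<le> t" "norm (q i j - \<i> * complex_of_real (\<theta> $ i * (p i j y * (N * h * (y $ j - y $ i))))) \<le> t\<^sup>2 / 2" for i j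
  proof -
    define s where "s = \<theta> $ i * (N * h * (y $ j - y $ i))"
    have s: "\<bar>s\<bar> \<le> t"
    proof -
      have "\<bar>s\<bar> \<le> \<Theta> * (2 * N * h * norm y)" unfolding s_def abs_mult[of "\<theta> $ i"] using \<theta>i \<Theta>0 kick_bound by (intro mult_mono) auto
      then show ?thesis by (simp add: t_def mult_ac)
    qed
    have p1: "0 \<le> p i j y" "p i j y \<le> 1" using p[of i j y] by auto
    have "norm (q i j) = p i j y * norm (cis s - 1)" using p1 by (simp add: q_def s_def)
    also have "\<dots> \<le> 1 * t" using p1 cis_approx(1)[of s] s by (intro mult_mono) auto
    finally show "norm (q i j) \<le> t" by simp
    have "q i j - \<i> * complex_of_real (\<theta> $ i * (p i j y * (N * h * (y $ j - y $ i)))) = p i j y *\<^sub>R (cis s - 1 - \<i> * s)"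
      by (simp add: q_def s_def scaleR_conv_of_real algebra_simps)
    then have "norm (q i j - \<i> * complex_of_real (\<theta> $ i * (p i j y * (N * h * (y $ j - y $ i))))) = p i j y * norm (cis s - 1 - \<i> * s)"
      using p1 by simp
    also have "\<dots> \<le> 1 * (t\<^sup>2 / 2)"
    proof (intro mult_mono)
      have "s\<^sup>2 \<le> t\<^sup>2" using s by (rule abs_le_imp_power2_le)
      then show "norm (cis s - 1 - \<i> * s) \<le> t\<^sup>2 / 2" using cis_approx(2)[of s] by simp
    qed (use p1 in auto)
    finally show "norm (q i j - \<i> * complex_of_real (\<theta> $ i * (p i j y * (N * h * (y $ j - y $ i))))) \<le> t\<^sup>2 / 2" by simp
  qed
  have avg_bound: "norm ((1 / N\<^sup>2) *\<^sub>R (\<Sum>i\<in>UNIV. \<Sum>j\<in>UNIV. f i j)) \<le> K" if "\<And>i j. norm (f i j) \<le> K" for f :: "'n \<Rightarrow> 'n \<Rightarrow> complex" and K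
  proof -
    have "norm (\<Sum>i\<in>UNIV. \<Sum>j\<in>UNIV. f i j) \<le> (\<Sum>i\<in>(UNIV::'n set). \<Sum>j\<in>(UNIV::'n set). K)"
      by (intro order_trans[OF norm_sum] sum_mono that)
    then show ?thesis by (simp add: divide_le_eq power2_eq_square mult_ac)
  qed
  have eb: "norm e \<le> t\<^sup>2 / 2 + \<rho> * t"
    unfolding e_def
  proof (rule avg_bound)
    fix i j
    have "norm (r i * q i j) \<le> \<rho> * t" unfolding norm_mult using r\<rho> qb(1) \<rho>0 by (intro mult_mono) auto
    then show "norm ((q i j - \<i> * complex_of_real (\<theta> $ i * (p i j y * (N * h * (y $ j - y $ i))))) + r i * q i j) \<le> t\<^sup>2 / 2 + \<rho> * t"
      using qb(2)[of i j] norm_triangle_le add_mono by blast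
  qed
  have rb\<rho>: "norm rb \<le> \<rho>"
  proof -
    have "norm (\<Sum>i\<in>UNIV. r i) \<le> (\<Sum>i\<in>(UNIV::'n set). \<rho>)" by (intro order_trans[OF norm_sum] sum_mono r\<rho>)
    then show ?thesis by (simp add: rb_def divide_le_eq mult.commute)
  qed
  have A: "norm (cis (- \<tau>) * (1 + rb + \<i> * complex_of_real \<tau> + e) - (1 + rb)) \<le> 2 * t\<^sup>2 + 2 * \<rho> * t"
  proof -
    have "cis (- \<tau>) * (1 + rb + \<i> * complex_of_real \<tau> + e) - (1 + rb)
      = (cis (- \<tau>) - 1 - \<i> * complex_of_real (- \<tau>)) + rb * (cis (- \<tau>) - 1) + \<i> * complex_of_real \<tau> * (cis (- \<tau>) - 1) + e * cis (- \<tau>)"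
      by (simp add: algebra_simps)
    also have "norm \<dots> \<le> norm (cis (- \<tau>) - 1 - \<i> * complex_of_real (- \<tau>)) + norm (rb * (cis (- \<tau>) - 1)) + norm (\<i> * complex_of_real \<tau> * (cis (- \<tau>) - 1)) + norm (e * cis (- \<tau>))"
      by (intro norm_triangle_mono order_refl)
    also have "\<dots> \<le> t\<^sup>2 / 2 + \<rho> * t + t * t + (t\<^sup>2 / 2 + \<rho> * t)"
    proof (intro add_mono)
      have "\<tau>\<^sup>2 \<le> t\<^sup>2" using \<tau>t by (rule abs_le_imp_power2_le)
      then show "norm (cis (- \<tau>) - 1 - \<i> * complex_of_real (- \<tau>)) \<le> t\<^sup>2 / 2" using cis_approx(2)[of "-\<tau>"] by simp
      have c: "norm (cis (- \<tau>) - 1) \<le> t" using cis_approx(1)[of "-\<tau>"] \<tau>t by simp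
      show "norm (rb * (cis (- \<tau>) - 1)) \<le> \<rho> * t" unfolding norm_mult using rb\<rho> c \<rho>0 by (intro mult_mono) auto
      show "norm (\<i> * complex_of_real \<tau> * (cis (- \<tau>) - 1)) \<le> t * t" unfolding norm_mult using \<tau>t c t0 by (intro mult_mono) auto
      show "norm (e * cis (- \<tau>)) \<le> t\<^sup>2 / 2 + \<rho> * t" using eb by (simp add: norm_mult)
    qed
    finally show ?thesis by (simp add: power2_eq_square algebra_simps)
  qed
  \<comment> \<open>The mean over the coordinates of the single exponents
    \<open>(\<theta> $ i)\<^sup>2 * m * h / 2\<close>.\<close>
  define k where "k = m / (2 * N) * h * (norm \<theta>)\<^sup>2"
  have B: "norm (1 + rb - complex_of_real (1 - k)) \<le> h * \<delta>"
  proof -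
    have "(norm \<theta>)\<^sup>2 = (\<Sum>i\<in>UNIV. (\<theta> $ i)\<^sup>2)" unfolding power2_norm_eq_inner inner_vec_def by (simp add: power2_eq_square)
    then have k: "k = (1 / N) * (\<Sum>i\<in>UNIV. (\<theta> $ i)\<^sup>2 * m * h / 2)"
      unfolding k_def by (simp add: sum_distrib_left sum_distrib_right field_simps)
    have "1 + rb - complex_of_real (1 - k) = (1 / N) *\<^sub>R (\<Sum>i\<in>UNIV. r i + complex_of_real ((\<theta> $ i)\<^sup>2 * m * h / 2))"
      unfolding k rb_def by (simp add: sum.distrib scaleR_conv_of_real distrib_left)
    also have "norm \<dots> \<le> (1 / N) * (\<Sum>i\<in>(UNIV::'n set). h * \<delta>)"
    proof -
      have "norm (r i + complex_of_real ((\<theta> $ i)\<^sup>2 * m * h / 2)) \<le> h * \<delta>" for i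
        using char[OF \<theta>i[of i]] by (simp add: r_def algebra_simps)
      then have "norm (\<Sum>i\<in>UNIV. r i + complex_of_real ((\<theta> $ i)\<^sup>2 * m * h / 2)) \<le> (\<Sum>i\<in>(UNIV::'n set). h * \<delta>)"
        by (intro order_trans[OF norm_sum] sum_mono)
      then show ?thesis by (simp add: pos_divide_le_eq mult_ac)
    qed
    finally show ?thesis by simp
  qed
  have k0: "0 \<le> k" using m h by (simp add: k_def)
  have k1: "k \<le> h * (m * \<Theta>\<^sup>2)"
  proof -
    have "(norm \<theta>)\<^sup>2 \<le> \<Theta>\<^sup>2" using \<Theta> by (intro power_mono) auto
    moreover have "m / (2 * N) \<le> m"
    proof -
      have "1 \<le> card (UNIV :: 'n set)" by (simp add: Suc_leI)
      then have "1 \<le> N" by simp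
      then have "1 \<le> 2 * N" by linarith
      then have "m * 1 \<le> m * (2 * N)" using m by (rule mult_left_mono)
      then show ?thesis using \<open>1 \<le> N\<close> by (simp add: divide_le_eq)
    qed
    ultimately have "m / (2 * N) * h * (norm \<theta>)\<^sup>2 \<le> m * h * \<Theta>\<^sup>2" using m h by (intro mult_mono) auto
    then show ?thesis by (simp add: k_def mult_ac)
  qed
  have Cc: "norm (complex_of_real (1 - k) - complex_of_real (exp (- k))) \<le> h\<^sup>2 * ((m * \<Theta>\<^sup>2)\<^sup>2 / 2)"
  proof -
    have "norm (complex_of_real (1 - k) - complex_of_real (exp (- k))) = \<bar>exp (- k) - (1 - k)\<bar>"
      by (simp only: of_real_diff[symmetric] norm_of_real abs_minus_commute)
    also have "\<dots> \<le> k\<^sup>2 / 2" by (rule exp_minus_approx[OF k0])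
    also have "\<dots> \<le> (h * (m * \<Theta>\<^sup>2))\<^sup>2 / 2" using k0 k1 by (intro divide_right_mono power_mono) auto
    finally show ?thesis by (simp add: power_mult_distrib)
  qed
  have "norm (avg y (\<lambda>y'. cis (\<theta> \<bullet> (y' - y - h *\<^sub>R b y))) - complex_of_real (exp (- k)))
     \<le> (2 * t\<^sup>2 + 2 * \<rho> * t) + h * \<delta> + h\<^sup>2 * ((m * \<Theta>\<^sup>2)\<^sup>2 / 2)"
  proof -
    have tri: "norm (u - w) \<le> K + L + L'" if "norm (u - v) \<le> K" "norm (v - v') \<le> L" "norm (v' - w) \<le> L'"
      for u v v' w :: complex and K L L'
      using norm_triangle_ineq[of "u - v" "v - v'"] norm_triangle_ineq[of "u - v'" "v' - w"] that by simp
    show ?thesis unfolding avg_val by (rule tri[OF A B Cc])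
  qed
  also have "\<dots> \<le> h * (\<delta> + h * (8 * \<Theta>\<^sup>2 * N\<^sup>2 + (\<delta> + \<Theta>\<^sup>2 * m / 2) * \<Theta> * 2 * N + (m * \<Theta>\<^sup>2)\<^sup>2 / 2)) * (1 + (norm y)\<^sup>2)"
  proof -
    define Y where "Y = (norm y)\<^sup>2"
    have Y0: "0 \<le> Y" by (simp add: Y_def)
    have am: "2 * norm y \<le> 1 + Y" using zero_le_power2[of "norm y - 1"] by (simp add: Y_def power2_eq_square algebra_simps)
    have 1: "2 * t\<^sup>2 = h\<^sup>2 * (8 * \<Theta>\<^sup>2 * N\<^sup>2) * Y" by (simp add: t_def Y_def power_mult_distrib)
    define g where "g = (\<delta> + \<Theta>\<^sup>2 * m / 2) * \<Theta> * 2 * N"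
    have g0: "0 \<le> g" unfolding g_def using \<delta> m \<Theta>0 by simp
    have 2: "2 * \<rho> * t \<le> h\<^sup>2 * g * (1 + Y)"
    proof -
      have "2 * \<rho> * t = h\<^sup>2 * g * (2 * norm y)" by (simp add: t_def \<rho>_def g_def power2_eq_square algebra_simps)
      also have "\<dots> \<le> h\<^sup>2 * g * (1 + Y)" using am g0 by (intro mult_left_mono) auto
      finally show ?thesis .
    qed
    have "h * \<delta> * 1 \<le> h * \<delta> * (1 + Y)" using h \<delta> Y0 by (intro mult_left_mono) auto
    moreover have "h\<^sup>2 * ((m * \<Theta>\<^sup>2)\<^sup>2 / 2) * 1 \<le> h\<^sup>2 * ((m * \<Theta>\<^sup>2)\<^sup>2 / 2) * (1 + Y)" using Y0 by (intro mult_left_mono) auto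
    moreover have "h\<^sup>2 * (8 * \<Theta>\<^sup>2 * N\<^sup>2) * Y \<le> h\<^sup>2 * (8 * \<Theta>\<^sup>2 * N\<^sup>2) * (1 + Y)" by (intro mult_left_mono) auto
    ultimately have "(2 * t\<^sup>2 + 2 * \<rho> * t) + h * \<delta> + h\<^sup>2 * ((m * \<Theta>\<^sup>2)\<^sup>2 / 2)
      \<le> h\<^sup>2 * (8 * \<Theta>\<^sup>2 * N\<^sup>2) * (1 + Y) + h\<^sup>2 * g * (1 + Y) + h * \<delta> * (1 + Y) + h\<^sup>2 * ((m * \<Theta>\<^sup>2)\<^sup>2 / 2) * (1 + Y)"
      using 1 2 by linarith
    also have "\<dots> = h * (\<delta> + h * (8 * \<Theta>\<^sup>2 * N\<^sup>2 + g + (m * \<Theta>\<^sup>2)\<^sup>2 / 2)) * (1 + Y)"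
      by (simp only: power2_eq_square distrib_left distrib_right mult_ac add_ac)
    finally show ?thesis unfolding g_def Y_def .
  qed
  finally show ?thesis by (simp add: k_def)
qed

end

section \<open>The driving noise of the chain\<close>

context abm_chain begin

definition W :: "nat \<Rightarrow> 'a \<Rightarrow> real ^ 'n" where
  "W n w = x n w - h *\<^sub>R (\<Sum>l<n. b (x l w))"

lemma W_Suc: "W (Suc n) w - W n w = x (Suc n) w - x n w - h *\<^sub>R b (x n w)"
  by (simp add: W_def scaleR_add_right)

lemma W_history_measurable:
  assumes "k \<le> n"
  shows "W k \<in> borel_measurable (history M x n)"
proof -
  have [measurable]: "x l \<in> borel_measurable (history M x n)" if "l \<le> n" for l by (rule x_history_measurable[OF that])
  have "(\<lambda>w. b (x l w)) \<in> borel_measurable (history M x n)" if "l \<in> {..<k}" for l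
    using that assms measurable_compose[OF x_history_measurable[of l n] b_measurable] by simp
  then show ?thesis unfolding W_def using x_history_measurable[OF assms]
    by (intro borel_measurable_diff borel_measurable_scaleR borel_measurable_sum borel_measurable_const) auto
qed

lemma W_measurable [measurable]: "W k \<in> borel_measurable M"
  by (rule history_le_M[OF W_history_measurable[OF order_refl]])

text \<open>The event A of the past turns \<open>square_average\<close> into a statement about
  conditional second moments, the form in which it is applied to the first-passage events of the
  maximal inequality.\<close>

lemma square_step:
  assumes A: "A \<in> sets (history M x n)" and c: "c \<in> borel_measurable (history M x n)"
    and int: "integrable M (\<lambda>w. indicator A w * (norm (c w))\<^sup>2)" "integrable M (\<lambda>w. indicator A w * (norm (x n w))\<^sup>2)"
  shows "integrable M (\<lambda>w. indicator A w * (norm (x (Suc n) w - x n w - h *\<^sub>R b (x n w) + c w))\<^sup>2)"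
    "expectation (\<lambda>w. indicator A w * (norm (x (Suc n) w - x n w - h *\<^sub>R b (x n w) + c w))\<^sup>2)
      \<le> (1 + h) * expectation (\<lambda>w. indicator A w * (norm (c w))\<^sup>2) + h * c2 * prob A
        + h\<^sup>2 * c3 * expectation (\<lambda>w. indicator A w * (norm (x n w))\<^sup>2)"
proof -
  have AM[measurable]: "A \<in> events" using A subalgebra_history[of n] by (auto simp: subalgebra_def)
  have [measurable]: "A \<in> sets (history M x n)" by fact
  have [measurable]: "c \<in> borel_measurable (history M x n)" by fact
  have [measurable]: "x n \<in> borel_measurable (history M x n)" by (rule x_history_measurable) simp
  define H where "H w y = indicator A w * (norm (y - x n w - h *\<^sub>R b (x n w) + c w))\<^sup>2" for w y
  define G where "G w = (1 + h) * (indicator A w * (norm (c w))\<^sup>2) + h * c2 * indicator A w + h\<^sup>2 * c3 * (indicator A w * (norm (x n w))\<^sup>2)" for w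
  have iA: "integrable M (indicator A :: 'a \<Rightarrow> real)"
    by (rule integrable_real_indicator) (auto simp: less_top[symmetric])
  have "case_prod H \<in> borel_measurable (history M x n \<Otimes>\<^sub>M borel)"
    unfolding H_def by measurable
  moreover have "0 \<le> H w y" for w y by (simp add: H_def)
  moreover have "integrable \<nu> (\<lambda>z. H w (next_state (N * h) (x n w) i j B z))" for w i j B
    unfolding H_def by (rule integrable_mult_right[OF square_integrable])
  moreover have "avg (x n w) (H w) \<le> G w" for w
  proof (cases "w \<in> A")
    case True
    then have "H w = (\<lambda>y. (norm (y - x n w - h *\<^sub>R b (x n w) + c w))\<^sup>2)"
      by (intro ext) (simp add: H_def)
    then show ?thesis using square_average[of "x n w" "c w"] True by (simp add: G_def)
  next
    case False
    then have "H w = (\<lambda>y. 0)" by (intro ext) (simp add: H_def)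
    then show ?thesis using False by (simp add: G_def step_average_def split_beta)
  qed
  moreover have G: "integrable M G"
    unfolding G_def using int iA by (intro Bochner_Integration.integrable_add integrable_mult_right)
  ultimately have "integrable M (\<lambda>w. H w (x (Suc n) w))" "expectation (\<lambda>w. H w (x (Suc n) w)) \<le> expectation G"
    by (rule integral_next_le)+
  moreover have "expectation G = (1 + h) * expectation (\<lambda>w. indicator A w * (norm (c w))\<^sup>2) + h * c2 * prob A
        + h\<^sup>2 * c3 * expectation (\<lambda>w. indicator A w * (norm (x n w))\<^sup>2)"
    unfolding G_def using int iA by simp
  ultimately show "integrable M (\<lambda>w. indicator A w * (norm (x (Suc n) w - x n w - h *\<^sub>R b (x n w) + c w))\<^sup>2)"
    "expectation (\<lambda>w. indicator A w * (norm (x (Suc n) w - x n w - h *\<^sub>R b (x n w) + c w))\<^sup>2)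
      \<le> (1 + h) * expectation (\<lambda>w. indicator A w * (norm (c w))\<^sup>2) + h * c2 * prob A
        + h\<^sup>2 * c3 * expectation (\<lambda>w. indicator A w * (norm (x n w))\<^sup>2)"
    by (simp_all only: H_def)
qed

text \<open>A rate for which one step multiplies E|x|^2 + 1 by at most 1 + h c5; the added 1 absorbs
  the constant term h c2.\<close>

definition c5 :: real where "c5 = 1 + 2 * (4 * N + 4 * N\<^sup>2) + c3 + c2"

lemma c5_nonneg: "0 \<le> c5" unfolding c5_def using c2_nonneg c3_nonneg by simp

lemma moment_bound_power:
  "integrable M (\<lambda>w. (norm (x n w))\<^sup>2) \<and> expectation (\<lambda>w. (norm (x n w))\<^sup>2) + 1 \<le> ((norm x0)\<^sup>2 + 1) * (1 + h * c5) ^ n"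
proof (induction n)
  case 0
  have "AE w in M. (norm (x 0 w))\<^sup>2 = (norm x0)\<^sup>2" using x_initial by eventually_elim simp
  moreover have "integrable M (\<lambda>w. (norm x0)\<^sup>2)" by simp
  ultimately show ?case
    using integrable_cong_AE[of "\<lambda>w. (norm (x 0 w))\<^sup>2" M "\<lambda>w. (norm x0)\<^sup>2"]
      integral_cong_AE[of "\<lambda>w. (norm (x 0 w))\<^sup>2" M "\<lambda>w. (norm x0)\<^sup>2"] by (simp add: prob_space)
next
  case (Suc n)
  \<comment> \<open>With this c the increment of \<open>W\<close> plus c is the next state itself,
    so \<open>square_step\<close> bounds its second moment.\<close>
  define c where "c w = x n w + h *\<^sub>R b (x n w)" for w
  have [measurable]: "x n \<in> borel_measurable (history M x n)" by (rule x_history_measurable) simp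
  have cm[measurable]: "c \<in> borel_measurable (history M x n)" unfolding c_def by measurable
  have cb: "(norm (c w))\<^sup>2 \<le> (1 + h * (4 * N + 4 * N\<^sup>2)) * (norm (x n w))\<^sup>2" for w
  proof -
    have "norm (c w) \<le> norm (x n w) + norm (h *\<^sub>R b (x n w))" unfolding c_def by (rule norm_triangle_ineq)
    also have "norm (h *\<^sub>R b (x n w)) \<le> h * (2 * N * norm (x n w))" using growth[of "x n w"] h by (simp add: mult_left_mono)
    finally have "norm (c w) \<le> (1 + h * (2 * N)) * norm (x n w)" by (simp add: algebra_simps)
    then have "(norm (c w))\<^sup>2 \<le> ((1 + h * (2 * N)) * norm (x n w))\<^sup>2" by (rule power_mono) simp
    also have "\<dots> = (1 + h * (4 * N) + (h * h) * (4 * N\<^sup>2)) * (norm (x n w))\<^sup>2"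
      by (simp add: power2_eq_square algebra_simps)
    also have "\<dots> \<le> (1 + h * (4 * N) + h * (4 * N\<^sup>2)) * (norm (x n w))\<^sup>2"
      using h by (intro mult_right_mono add_left_mono mult_right_mono) (auto simp: mult_left_le)
    finally show ?thesis by (simp add: algebra_simps)
  qed
  have xi: "integrable M (\<lambda>w. (norm (x n w))\<^sup>2)" using Suc by simp
  have ci: "integrable M (\<lambda>w. (norm (c w))\<^sup>2)"
    by (rule Bochner_Integration.integrable_bound[OF integrable_mult_right[OF xi, of "1 + h * (4 * N + 4 * N\<^sup>2)"]])
      (use cb history_le_M[OF cm] h in \<open>auto simp: abs_mult\<close>)
  have sp: "space M \<in> sets (history M x n)" using sets.top[of "history M x n"] by simp
  have ind: "indicator (space M) w * r = r" if "w \<in> space M" for w and r :: real using that by simp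
  note st = square_step[OF sp cm]
  have i1: "integrable M (\<lambda>w. indicator (space M) w * (norm (c w))\<^sup>2)" "integrable M (\<lambda>w. indicator (space M) w * (norm (x n w))\<^sup>2)"
    using ci xi by (simp_all cong: Bochner_Integration.integrable_cong)
  have eqx: "x (Suc n) w - x n w - h *\<^sub>R b (x n w) + c w = x (Suc n) w" for w by (simp add: c_def)
  have int: "integrable M (\<lambda>w. (norm (x (Suc n) w))\<^sup>2)"
    using st(1)[OF i1] unfolding eqx by (simp cong: Bochner_Integration.integrable_cong)
  have "expectation (\<lambda>w. (norm (x (Suc n) w))\<^sup>2)
    \<le> (1 + h) * expectation (\<lambda>w. (norm (c w))\<^sup>2) + h * c2 + h\<^sup>2 * c3 * expectation (\<lambda>w. (norm (x n w))\<^sup>2)"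
    using st(2)[OF i1] unfolding eqx by (simp add: prob_space cong: Bochner_Integration.integral_cong)
  also have "\<dots> \<le> (1 + h * c5) * (expectation (\<lambda>w. (norm (x n w))\<^sup>2) + 1) - 1"
  proof -
    define e where "e = expectation (\<lambda>w. (norm (x n w))\<^sup>2)"
    have e0: "0 \<le> e" unfolding e_def by simp
    define g where "g = 4 * N + 4 * N\<^sup>2"
    have g0: "0 \<le> g" unfolding g_def by simp
    have "expectation (\<lambda>w. (norm (c w))\<^sup>2) \<le> expectation (\<lambda>w. (1 + h * g) * (norm (x n w))\<^sup>2)"
      by (rule integral_mono[OF ci integrable_mult_right[OF xi]]) (use cb in \<open>simp add: g_def\<close>)
    then have "expectation (\<lambda>w. (norm (c w))\<^sup>2) \<le> (1 + h * g) * e" by (simp add: e_def)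
    then have 1: "(1 + h) * expectation (\<lambda>w. (norm (c w))\<^sup>2) \<le> (1 + h) * ((1 + h * g) * e)" using h by (intro mult_left_mono) auto
    have hh: "h * h \<le> h" using h by (simp add: mult_left_le)
    have "(h * h) * (g * e) \<le> h * (g * e)" using hh g0 e0 by (intro mult_right_mono) auto
    moreover have "(h * h) * (c3 * e) \<le> h * (c3 * e)" using hh c3_nonneg e0 by (intro mult_right_mono) auto
    moreover have "0 \<le> h * (c2 * e)" "0 \<le> h * (g * e)" "0 \<le> h * g" "0 \<le> h * c3" using h c2_nonneg c3_nonneg g0 e0 by auto
    moreover have "(1 + h) * ((1 + h * g) * e) + h * c2 + h\<^sup>2 * c3 * e = e + h * e + h * (g * e) + (h * h) * (g * e) + h * c2 + (h * h) * (c3 * e)"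
      by (simp add: power2_eq_square algebra_simps)
    moreover have "(1 + h * c5) * (e + 1) - 1 = e + h * e + 2 * (h * (g * e)) + h * (c3 * e) + h * (c2 * e) + h + 2 * (h * g) + h * c3 + h * c2"
      unfolding c5_def g_def by (simp add: algebra_simps)
    ultimately show ?thesis using 1 h unfolding e_def[symmetric] by linarith
  qed
  finally have "expectation (\<lambda>w. (norm (x (Suc n) w))\<^sup>2) + 1 \<le> (1 + h * c5) * (expectation (\<lambda>w. (norm (x n w))\<^sup>2) + 1)" by simp
  also have "\<dots> \<le> (1 + h * c5) * (((norm x0)\<^sup>2 + 1) * (1 + h * c5) ^ n)"
    using Suc h c5_nonneg by (intro mult_left_mono) auto
  finally show ?case using int by (simp add: mult_ac)
qed

lemma x_square_integrable: "integrable M (\<lambda>w. (norm (x n w))\<^sup>2)"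
  using moment_bound_power by blast

lemma moment_bound:
  assumes "real n * h \<le> t"
  shows "expectation (\<lambda>w. (norm (x n w))\<^sup>2) + 1 \<le> ((norm x0)\<^sup>2 + 1) * exp (c5 * t)"
proof -
  have "expectation (\<lambda>w. (norm (x n w))\<^sup>2) + 1 \<le> ((norm x0)\<^sup>2 + 1) * (1 + h * c5) ^ n" using moment_bound_power by blast
  also have "(1 + h * c5) ^ n \<le> exp (h * c5) ^ n" using h c5_nonneg by (intro power_mono exp_ge_add_one_self) auto
  also have "exp (h * c5) ^ n = exp (c5 * (real n * h))" by (simp add: mult_ac flip: exp_of_nat_mult)
  also have "\<dots> \<le> exp (c5 * t)" using assms c5_nonneg by (simp add: mult_left_mono)
  finally show ?thesis by (simp add: mult_left_mono add_nonneg_nonneg)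
qed

text \<open>Iterates \<open>square_step\<close> with c the increment accumulated since n0. The event
  A lies in the history at n0, hence in all later ones; the power of 1 + h is the price of the
  nonzero noise mean.\<close>

lemma window_second_moment:
  assumes A: "A \<in> sets (history M x n0)"
  shows "integrable M (\<lambda>w. indicator A w * (norm (W (n0 + k) w - W n0 w))\<^sup>2)
    \<and> expectation (\<lambda>w. indicator A w * (norm (W (n0 + k) w - W n0 w))\<^sup>2)
      \<le> (1 + h) ^ k * (real k * h * c2 * prob A + h\<^sup>2 * c3 * (\<Sum>l<k. expectation (\<lambda>w. indicator A w * (norm (x (n0 + l) w))\<^sup>2)))"
proof (induction k)
  case (Suc k)
  let ?e = "\<lambda>l. expectation (\<lambda>w. indicator A w * (norm (x (n0 + l) w))\<^sup>2)"
  have AM[measurable]: "A \<in> events" using A subalgebra_history[of n0] by (auto simp: subalgebra_def)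
  have sub: "sets (history M x n0) \<subseteq> sets (history M x (n0 + k))"
  proof -
    have "(\<lambda>w. \<lambda>j\<in>{..n0}. x j w) \<in> history M x (n0 + k) \<rightarrow>\<^sub>M (\<Pi>\<^sub>M j\<in>{..n0}. borel)"
      by (intro measurable_restrict x_history_measurable) auto
    then show ?thesis
      unfolding history_def[of M x n0]
      by (auto simp: sets_vimage_algebra2[OF measurable_space[OF history_restrict_measurable, THEN funcsetI]] dest: measurable_sets)
  qed
  have A': "A \<in> sets (history M x (n0 + k))" using A sub by blast
  have cm: "(\<lambda>w. W (n0 + k) w - W n0 w) \<in> borel_measurable (history M x (n0 + k))"
    by (intro borel_measurable_diff W_history_measurable) auto
  have xi: "integrable M (\<lambda>w. indicator A w * (norm (x (n0 + l) w))\<^sup>2)" for l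
    using integrable_mult_indicator[OF AM x_square_integrable] by simp
  have eqW: "x (Suc (n0 + k)) w - x (n0 + k) w - h *\<^sub>R b (x (n0 + k) w) + (W (n0 + k) w - W n0 w) = W (n0 + Suc k) w - W n0 w" for w
    using W_Suc[of "n0 + k" w] by (simp add: algebra_simps)
  note st = square_step[OF A' cm conjunct1[OF Suc] xi, unfolded eqW]
  have S0: "0 \<le> ?e l" for l by (intro integral_nonneg_AE) auto
  have "expectation (\<lambda>w. indicator A w * (norm (W (n0 + Suc k) w - W n0 w))\<^sup>2)
    \<le> (1 + h) * expectation (\<lambda>w. indicator A w * (norm (W (n0 + k) w - W n0 w))\<^sup>2) + h * c2 * prob A + h\<^sup>2 * c3 * ?e k"
    by (rule st(2))
  also have "\<dots> \<le> (1 + h) * ((1 + h) ^ k * (real k * h * c2 * prob A + h\<^sup>2 * c3 * (\<Sum>l<k. ?e l))) + 1 * (h * c2 * prob A + h\<^sup>2 * c3 * ?e k)"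
  proof -
    have "(1 + h) * expectation (\<lambda>w. indicator A w * (norm (W (n0 + k) w - W n0 w))\<^sup>2)
      \<le> (1 + h) * ((1 + h) ^ k * (real k * h * c2 * prob A + h\<^sup>2 * c3 * (\<Sum>l<k. ?e l)))"
      using Suc h by (intro mult_left_mono) auto
    then show ?thesis by simp
  qed
  also have "\<dots> \<le> (1 + h) * ((1 + h) ^ k * (real k * h * c2 * prob A + h\<^sup>2 * c3 * (\<Sum>l<k. ?e l))) + (1 + h) ^ Suc k * (h * c2 * prob A + h\<^sup>2 * c3 * ?e k)"
    using h c2_nonneg c3_nonneg S0[of k] by (intro add_left_mono mult_right_mono one_le_power add_nonneg_nonneg mult_nonneg_nonneg) auto
  also have "\<dots> = (1 + h) ^ Suc k * (real (Suc k) * h * c2 * prob A + h\<^sup>2 * c3 * (\<Sum>l<Suc k. ?e l))"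
    by (simp add: algebra_simps)
  finally show ?case using st(1) by blast
qed simp

text \<open>Ottaviani's inequality: the conditional second moment of the remaining increment, bounded by
  \<open>window_second_moment\<close>, plays the role of independence.\<close>

lemma window_maximal:
  assumes \<epsilon>: "0 < \<epsilon>" and le: "n0 \<le> n1" and t: "real n1 * h \<le> t"
  shows "prob {w \<in> space M. \<exists>n\<in>{n0..n1}. 2 * \<epsilon> \<le> norm (W n w - W n0 w)}
    \<le> prob {w \<in> space M. \<epsilon> \<le> norm (W n1 w - W n0 w)}
      + exp t / \<epsilon>\<^sup>2 * (real (n1 - n0) * h * c2 * prob {w \<in> space M. \<exists>n\<in>{n0..n1}. 2 * \<epsilon> \<le> norm (W n w - W n0 w)}
          + h * t * c3 * (((norm x0)\<^sup>2 + 1) * exp (c5 * t)))"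
proof -
  \<comment> \<open>First-passage events: n is the first index at which the deviation from
    \<open>W n0\<close> reaches 2 \<open>\<epsilon>\<close>.\<close>
  define A where "A n = {w \<in> space M. 2 * \<epsilon> \<le> norm (W n w - W n0 w) \<and> (\<forall>k\<in>{n0..<n}. norm (W k w - W n0 w) < 2 * \<epsilon>)}" for n
  define E where "E = {w \<in> space M. \<exists>n\<in>{n0..n1}. 2 * \<epsilon> \<le> norm (W n w - W n0 w)}"
  define D where "D = {w \<in> space M. \<epsilon> \<le> norm (W n1 w - W n0 w)}"
  define Km where "Km = ((norm x0)\<^sup>2 + 1) * exp (c5 * t)"
  have Ah: "A n \<in> sets (history M x n)" if "n0 \<le> n" for n
  proof -
    have [measurable]: "W k \<in> borel_measurable (history M x n)" if "k \<le> n" for k by (rule W_history_measurable[OF that])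
    have [measurable]: "W n0 \<in> borel_measurable (history M x n)" "W n \<in> borel_measurable (history M x n)"
      using \<open>n0 \<le> n\<close> by auto
    have "A n = {w \<in> space (history M x n). 2 * \<epsilon> \<le> norm (W n w - W n0 w)} \<inter> {w \<in> space (history M x n). \<forall>k\<in>{n0..<n}. norm (W k w - W n0 w) < 2 * \<epsilon>}"
      by (auto simp: A_def)
    also have "\<dots> \<in> sets (history M x n)"
      by (intro sets.Int sets.sets_Collect_finite_All borel_measurable_le borel_measurable_less borel_measurable_norm borel_measurable_diff borel_measurable_const W_history_measurable)
        (use that in auto)
    finally show ?thesis .
  qed
  have AM[measurable]: "A n \<in> events" if "n0 \<le> n" for n
    using Ah[OF that] subalgebra_history[of n] by (auto simp: subalgebra_def)
  have D[measurable]: "D \<in> events" unfolding D_def by measurable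
  have disj: "disjoint_family_on A {n0..n1}"
  proof -
    have "A m \<inter> A n = {}" if "m < n" "n0 \<le> m" for m n
    proof (rule equals0I)
      fix w assume "w \<in> A m \<inter> A n"
      then have "2 * \<epsilon> \<le> norm (W m w - W n0 w)" "\<forall>k\<in>{n0..<n}. norm (W k w - W n0 w) < 2 * \<epsilon>"
        by (auto simp: A_def)
      moreover have "m \<in> {n0..<n}" using that by simp
      ultimately show False by force
    qed
    then show ?thesis unfolding disjoint_family_on_def by (metis Int_commute atLeastAtMost_iff linorder_neqE_nat)
  qed
  have EA: "E = (\<Union>n\<in>{n0..n1}. A n)"
  proof safe
    fix w assume "w \<in> E"
    then obtain n where n: "n \<in> {n0..n1}" "2 * \<epsilon> \<le> norm (W n w - W n0 w)" and w: "w \<in> space M" by (auto simp: E_def)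
    define m where "m = (LEAST m. n0 \<le> m \<and> 2 * \<epsilon> \<le> norm (W m w - W n0 w))"
    have m: "n0 \<le> m \<and> 2 * \<epsilon> \<le> norm (W m w - W n0 w)" unfolding m_def by (rule LeastI[of _ n]) (use n in auto)
    have "m \<le> n" unfolding m_def by (rule Least_le) (use n in auto)
    moreover have "norm (W k w - W n0 w) < 2 * \<epsilon>" if "k \<in> {n0..<m}" for k
    proof (rule ccontr)
      assume "\<not> norm (W k w - W n0 w) < 2 * \<epsilon>"
      then have "m \<le> k" unfolding m_def by (intro Least_le) (use that in auto)
      with that show False by simp
    qed
    ultimately show "w \<in> (\<Union>n\<in>{n0..n1}. A n)" using m n w by (auto simp: A_def intro!: bexI[of _ m])
  qed (auto simp: A_def E_def)
  have EM[measurable]: "E \<in> events" unfolding EA by (intro sets.finite_UN) auto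
  have probE: "prob E = (\<Sum>n\<in>{n0..n1}. prob (A n))"
    unfolding EA using disj by (intro finite_measure_finite_Union) auto
  \<comment> \<open>After the first passage a path that ends within \<open>\<epsilon>\<close> of its
    start has to move back by at least \<open>\<epsilon>\<close>; this is the remaining alternative
    to D.\<close>
  define B where "B n = {w \<in> A n. \<epsilon> \<le> norm (W n1 w - W n w)}" for n
  have B[measurable]: "B n \<in> events" if "n0 \<le> n" for n
  proof -
    have "B n = A n \<inter> {w \<in> space M. \<epsilon> \<le> norm (W n1 w - W n w)}" by (auto simp: B_def A_def)
    also have "\<dots> \<in> events" using AM[OF that] by (intro sets.Int) auto
    finally show ?thesis .
  qed
  have 1: "prob (A n) \<le> prob (A n \<inter> D) + prob (B n)" if n: "n \<in> {n0..n1}" for n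
  proof -
    have "A n \<subseteq> (A n \<inter> D) \<union> B n"
    proof
      fix w assume w: "w \<in> A n"
      have "norm (W n w - W n0 w) \<le> norm (W n1 w - W n0 w) + norm (W n1 w - W n w)"
        using norm_triangle_ineq4[of "W n1 w - W n0 w" "W n1 w - W n w"] by simp
      with w show "w \<in> (A n \<inter> D) \<union> B n" by (auto simp: A_def B_def D_def)
    qed
    then have "prob (A n) \<le> prob ((A n \<inter> D) \<union> B n)" using n by (intro finite_measure_mono) auto
    also have "\<dots> \<le> prob (A n \<inter> D) + prob (B n)" using n by (intro measure_Un_le) auto
    finally show ?thesis .
  qed
  have 2: "(\<Sum>n\<in>{n0..n1}. prob (A n \<inter> D)) \<le> prob D"
  proof -
    have "(\<Sum>n\<in>{n0..n1}. prob (A n \<inter> D)) = prob (\<Union>n\<in>{n0..n1}. A n \<inter> D)"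
      using disj by (intro finite_measure_finite_Union[symmetric]) (auto simp: disjoint_family_on_def)
    also have "\<dots> \<le> prob D" by (intro finite_measure_mono) auto
    finally show ?thesis .
  qed
  let ?e = "\<lambda>n l. expectation (\<lambda>w. indicator (A n) w * (norm (x l w))\<^sup>2)"
  have e0: "0 \<le> ?e n l" for n l by (intro integral_nonneg_AE) auto
  have pw: "(1 + h) ^ k \<le> exp t" if "k \<le> n1" for k
  proof -
    have "(1 + h) ^ k \<le> exp h ^ k" using h by (intro power_mono exp_ge_add_one_self) auto
    also have "\<dots> = exp (real k * h)" by (simp flip: exp_of_nat_mult)
    also have "\<dots> \<le> exp t"
    proof -
      have "real k * h \<le> real n1 * h" using that h by (intro mult_right_mono) auto
      then have "real k * h \<le> t" using t by linarith
      then show ?thesis by simp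
    qed
    finally show ?thesis .
  qed
  have 3: "prob (B n) \<le> exp t / \<epsilon>\<^sup>2 * (real (n1 - n0) * h * c2 * prob (A n) + h\<^sup>2 * c3 * (\<Sum>l<n1. ?e n l))" if n: "n \<in> {n0..n1}" for n
  proof -
    define k where "k = n1 - n"
    have nk: "n + k = n1" "k \<le> n1" "k \<le> n1 - n0" using n by (auto simp: k_def)
    note win = window_second_moment[OF Ah, of n k, unfolded nk(1)]
    have i: "integrable M (\<lambda>w. indicator (A n) w * (norm (W n1 w - W n w))\<^sup>2)" using win n by simp
    have "\<epsilon>\<^sup>2 * prob (B n) = expectation (\<lambda>w. \<epsilon>\<^sup>2 * indicator (B n) w)" using n by simp
    also have "\<dots> \<le> expectation (\<lambda>w. indicator (A n) w * (norm (W n1 w - W n w))\<^sup>2)"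
    proof (rule integral_mono[OF _ i])
      show "integrable M (\<lambda>w. \<epsilon>\<^sup>2 * indicator (B n) w)"
        using n by (intro integrable_mult_right integrable_real_indicator) (auto simp: less_top[symmetric])
      fix w show "\<epsilon>\<^sup>2 * indicator (B n) w \<le> indicator (A n) w * (norm (W n1 w - W n w))\<^sup>2"
        using \<epsilon> by (auto simp: B_def indicator_def intro: power_mono)
    qed
    also have "\<dots> \<le> (1 + h) ^ k * (real k * h * c2 * prob (A n) + h\<^sup>2 * c3 * (\<Sum>l<k. ?e n (n + l)))"
      using win n by simp
    also have "\<dots> \<le> exp t * (real (n1 - n0) * h * c2 * prob (A n) + h\<^sup>2 * c3 * (\<Sum>l<n1. ?e n l))"
    proof (rule mult_mono[OF pw[OF nk(2)]])
      have "(\<Sum>l<k. ?e n (n + l)) = (\<Sum>l\<in>(\<lambda>l. n + l) ` {..<k}. ?e n l)" by (subst sum.reindex) auto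
      also have "\<dots> \<le> (\<Sum>l<n1. ?e n l)" using nk(1) by (intro sum_mono2) (auto intro: e0)
      finally have "h\<^sup>2 * c3 * (\<Sum>l<k. ?e n (n + l)) \<le> h\<^sup>2 * c3 * (\<Sum>l<n1. ?e n l)"
        using c3_nonneg by (intro mult_left_mono) auto
      moreover have "real k * h * c2 * prob (A n) \<le> real (n1 - n0) * h * c2 * prob (A n)"
        using nk(3) h c2_nonneg by (intro mult_right_mono) auto
      ultimately show "real k * h * c2 * prob (A n) + h\<^sup>2 * c3 * (\<Sum>l<k. ?e n (n + l))
          \<le> real (n1 - n0) * h * c2 * prob (A n) + h\<^sup>2 * c3 * (\<Sum>l<n1. ?e n l)" by (rule add_mono[rotated])
    qed (use h c2_nonneg c3_nonneg e0 in \<open>auto intro!: add_nonneg_nonneg mult_nonneg_nonneg sum_nonneg\<close>)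
    finally show ?thesis using \<epsilon> by (simp add: pos_le_divide_eq mult.commute)
  qed
  \<comment> \<open>After swapping the sums, disjointness of the \<open>A n\<close> leaves one full
    second moment for each l, so the double sum is of order n1 and its contribution, weighted by
    h^2, of order h.\<close>
  have 4: "(\<Sum>n\<in>{n0..n1}. \<Sum>l<n1. ?e n l) \<le> real n1 * Km"
  proof -
    have "(\<Sum>n\<in>{n0..n1}. \<Sum>l<n1. ?e n l) = (\<Sum>l<n1. \<Sum>n\<in>{n0..n1}. ?e n l)" by (rule sum.swap)
    also have "\<dots> \<le> (\<Sum>l<n1. Km)"
    proof (rule sum_mono)
      fix l assume "l \<in> {..<n1}"
      then have "real l * h \<le> real n1 * h" using h by (intro mult_right_mono) auto
      then have lt: "real l * h \<le> t" using t by linarith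
      have i: "integrable M (\<lambda>w. indicator (A n) w * (norm (x l w))\<^sup>2)" if "n \<in> {n0..n1}" for n
        using integrable_mult_indicator[OF AM x_square_integrable] that by simp
      have "(\<Sum>n\<in>{n0..n1}. ?e n l) = expectation (\<lambda>w. \<Sum>n\<in>{n0..n1}. indicator (A n) w * (norm (x l w))\<^sup>2)"
        using i by (intro Bochner_Integration.integral_sum[symmetric]) auto
      also have "\<dots> \<le> expectation (\<lambda>w. (norm (x l w))\<^sup>2)"
      proof (rule integral_mono[OF _ x_square_integrable])
        show "integrable M (\<lambda>w. \<Sum>n\<in>{n0..n1}. indicator (A n) w * (norm (x l w))\<^sup>2)" using i by (intro Bochner_Integration.integrable_sum) auto
        fix w
        have "(\<Sum>n\<in>{n0..n1}. indicator (A n) w) = (indicator (\<Union>n\<in>{n0..n1}. A n) w :: real)"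
          using disj by (intro indicator_UN_disjoint[symmetric]) auto
        then have "(\<Sum>n\<in>{n0..n1}. indicator (A n) w :: real) \<le> 1" by (simp add: indicator_def)
        then show "(\<Sum>n\<in>{n0..n1}. indicator (A n) w * (norm (x l w))\<^sup>2) \<le> (norm (x l w))\<^sup>2"
          unfolding sum_distrib_right[symmetric] by (intro mult_left_le_one_le) (auto intro: sum_nonneg)
      qed
      also have "\<dots> \<le> Km" using moment_bound[OF lt] by (simp add: Km_def)
      finally show "(\<Sum>n\<in>{n0..n1}. ?e n l) \<le> Km" .
    qed
    finally show ?thesis by simp
  qed
  have Km0: "0 \<le> Km" unfolding Km_def by (intro mult_nonneg_nonneg add_nonneg_nonneg) auto
  have "prob E \<le> (\<Sum>n\<in>{n0..n1}. prob (A n \<inter> D) + exp t / \<epsilon>\<^sup>2 * (real (n1 - n0) * h * c2 * prob (A n) + h\<^sup>2 * c3 * (\<Sum>l<n1. ?e n l)))"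
    unfolding probE using 1 3 by (intro sum_mono) fastforce
  also have "\<dots> = (\<Sum>n\<in>{n0..n1}. prob (A n \<inter> D)) + exp t / \<epsilon>\<^sup>2 * (real (n1 - n0) * h * c2 * prob E + h\<^sup>2 * c3 * (\<Sum>n\<in>{n0..n1}. \<Sum>l<n1. ?e n l))"
    unfolding probE by (simp only: sum.distrib sum_distrib_left[symmetric])
  also have "\<dots> \<le> prob D + exp t / \<epsilon>\<^sup>2 * (real (n1 - n0) * h * c2 * prob E + h * t * c3 * Km)"
  proof (rule add_mono[OF 2 mult_left_mono[OF add_left_mono]])
    have "h\<^sup>2 * c3 * (\<Sum>n\<in>{n0..n1}. \<Sum>l<n1. ?e n l) \<le> h\<^sup>2 * c3 * (real n1 * Km)"
      using 4 c3_nonneg by (intro mult_left_mono) auto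
    also have "\<dots> = h * c3 * Km * (real n1 * h)" by (simp add: power2_eq_square)
    also have "\<dots> \<le> h * c3 * Km * t" using t h c3_nonneg Km0 by (intro mult_left_mono) auto
    finally show "h\<^sup>2 * c3 * (\<Sum>n\<in>{n0..n1}. \<Sum>l<n1. ?e n l) \<le> h * t * c3 * Km" by (simp add: mult_ac)
  qed (use \<epsilon> in auto)
  finally show ?thesis unfolding E_def D_def Km_def .
qed

lemma integral_next_complex:
  fixes H :: "'a \<Rightarrow> real ^ 'n \<Rightarrow> complex"
  assumes H: "case_prod H \<in> borel_measurable (history M x n \<Otimes>\<^sub>M borel)" and H1: "\<And>w y. norm (H w y) \<le> 1"
  shows "expectation (\<lambda>w. H w (x (Suc n) w)) = expectation (\<lambda>w. avg (x n w) (H w))"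
    "integrable M (\<lambda>w. avg (x n w) (H w))"
proof -
  have Hm[measurable]: "H w \<in> borel_measurable borel" if "w \<in> space M" for w
    using measurable_compose_Pair1[OF _ H, of w] that by simp
  have i\<nu>: "integrable \<nu> (\<lambda>z. H w (next_state (N * h) (x n w) i j B z))" if "w \<in> space M" for w i j B
    using Hm[OF that] H1 by (intro \<nu>.integrable_const_bound[of _ 1] AE_I2) auto
  have id[measurable]: "(\<lambda>w. w) \<in> M \<rightarrow>\<^sub>M history M x n"
    using subalgebra_history[of n] by (auto simp: measurable_def subalgebra_def)
  have HM: "(\<lambda>w. H w (x (Suc n) w)) \<in> borel_measurable M"
    using measurable_compose[OF measurable_Pair[OF id x_measurable[of "Suc n"]] H] by simp
  have re: "avg (x n w) (\<lambda>y. Re (H w y)) = Re (avg (x n w) (H w))"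
    and im: "avg (x n w) (\<lambda>y. Im (H w y)) = Im (avg (x n w) (H w))" if "w \<in> space M" for w
    unfolding avg_eq using i\<nu>[OF that] by simp_all
  have reb: "\<bar>Re (H w y)\<bar> \<le> 1" and imb: "\<bar>Im (H w y)\<bar> \<le> 1" for w y
    using H1[of w y] abs_Re_le_cmod[of "H w y"] abs_Im_le_cmod[of "H w y"] by linarith+
  have rem: "case_prod (\<lambda>w y. Re (H w y)) \<in> borel_measurable (history M x n \<Otimes>\<^sub>M borel)"
    "case_prod (\<lambda>w y. Im (H w y)) \<in> borel_measurable (history M x n \<Otimes>\<^sub>M borel)"
    using H by (simp_all add: split_beta)
  note R = integral_next_real[OF rem(1) reb] and I = integral_next_real[OF rem(2) imb]
  have am: "(\<lambda>w. avg (x n w) (H w)) \<in> borel_measurable M"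
    by (rule history_le_M[OF measurable_step_average[OF H]])
  show ai: "integrable M (\<lambda>w. avg (x n w) (H w))"
  proof (rule integrable_const_bound[of _ 2, OF AE_I2 am])
    fix w assume "w \<in> space M"
    then show "norm (avg (x n w) (H w)) \<le> 2"
      using cmod_le[of "avg (x n w) (H w)"] R(2)[of w] I(2)[of w] re im by (simp add: )
  qed
  have Hi: "integrable M (\<lambda>w. H w (x (Suc n) w))"
    using HM H1 by (intro integrable_const_bound[of _ 1] AE_I2) auto
  show "expectation (\<lambda>w. H w (x (Suc n) w)) = expectation (\<lambda>w. avg (x n w) (H w))"
  proof (rule complex_eqI)
    have "Re (expectation (\<lambda>w. H w (x (Suc n) w))) = expectation (\<lambda>w. Re (H w (x (Suc n) w)))" using Hi by simp
    also have "\<dots> = expectation (\<lambda>w. Re (avg (x n w) (H w)))"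
      unfolding R(1) by (intro Bochner_Integration.integral_cong refl re)
    finally show "Re (expectation (\<lambda>w. H w (x (Suc n) w))) = Re (expectation (\<lambda>w. avg (x n w) (H w)))" using ai by simp
    have "Im (expectation (\<lambda>w. H w (x (Suc n) w))) = expectation (\<lambda>w. Im (H w (x (Suc n) w)))" using Hi by simp
    also have "\<dots> = expectation (\<lambda>w. Im (avg (x n w) (H w)))"
      unfolding I(1) by (intro Bochner_Integration.integral_cong refl im)
    finally show "Im (expectation (\<lambda>w. H w (x (Suc n) w))) = Im (expectation (\<lambda>w. avg (x n w) (H w)))" using ai by simp
  qed
qed

text \<open>One conditional expectation at a time: the last factor is replaced by a deterministic
  Gaussian one, at the cost given by \<open>char_average\<close> and averaged by
  \<open>moment_bound\<close>. All factors have modulus at most one, so the errors simply add.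
  Frequencies may change from step to step, which gives access to the joint law of block
  increments.\<close>

lemma char_of_increments:
  assumes \<Theta>: "\<And>l. norm (\<theta> l) \<le> \<Theta>" and m: "0 \<le> m" and \<delta>: "0 \<le> \<delta>"
    and char: "\<And>u. \<bar>u\<bar> \<le> \<Theta> \<Longrightarrow> norm (char \<nu> u - complex_of_real (1 - u\<^sup>2 * m * h / 2)) \<le> h * \<delta>"
    and t: "real n * h \<le> t"
  shows "norm (expectation (\<lambda>w. cis (\<Sum>l<n. \<theta> l \<bullet> (W (Suc l) w - W l w)))
      - complex_of_real (exp (- (m / (2 * N) * h * (\<Sum>l<n. (norm (\<theta> l))\<^sup>2)))))
    \<le> real n * h * (\<delta> + h * (8 * \<Theta>\<^sup>2 * N\<^sup>2 + (\<delta> + \<Theta>\<^sup>2 * m / 2) * \<Theta> * 2 * N + (m * \<Theta>\<^sup>2)\<^sup>2 / 2)) * (((norm x0)\<^sup>2 + 1) * exp (c5 * t))"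
  using t
proof (induction n)
  case (Suc n)
  have \<Theta>0: "0 \<le> \<Theta>" using \<Theta>[of 0] norm_ge_zero order_trans by blast
  define Z where "Z w = cis (\<Sum>l<n. \<theta> l \<bullet> (W (Suc l) w - W l w))" for w
  define \<eta> where "\<eta> = \<delta> + h * (8 * \<Theta>\<^sup>2 * N\<^sup>2 + (\<delta> + \<Theta>\<^sup>2 * m / 2) * \<Theta> * 2 * N + (m * \<Theta>\<^sup>2)\<^sup>2 / 2)"
  define Km where "Km = ((norm x0)\<^sup>2 + 1) * exp (c5 * t)"
  have \<eta>0: "0 \<le> \<eta>" unfolding \<eta>_def using \<delta> h m \<Theta>0 by (intro add_nonneg_nonneg mult_nonneg_nonneg) auto
  define k where "k l = m / (2 * N) * h * (norm (\<theta> l))\<^sup>2" for l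
  have k0: "0 \<le> k l" for l unfolding k_def using m h by simp
  have nt: "real n * h \<le> t"
  proof -
    have "real n * h \<le> real (Suc n) * h" using h by (intro mult_right_mono) auto
    with Suc.prems show ?thesis by linarith
  qed
  have cism[measurable]: "cis \<in> borel_measurable borel"
    by (intro borel_measurable_continuous_onI continuous_intros)
  have Zm[measurable]: "Z \<in> borel_measurable (history M x n)"
    unfolding Z_def
    by (intro measurable_compose[OF _ cism] borel_measurable_sum borel_measurable_inner borel_measurable_diff W_history_measurable borel_measurable_const) auto
  have [measurable]: "x n \<in> borel_measurable (history M x n)" by (rule x_history_measurable) simp
  define H where "H w y = Z w * cis (\<theta> n \<bullet> (y - x n w - h *\<^sub>R b (x n w)))" for w y
  have Hm: "case_prod H \<in> borel_measurable (history M x n \<Otimes>\<^sub>M borel)" unfolding H_def by measurable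
  have H1: "norm (H w y) \<le> 1" for w y by (simp add: H_def Z_def norm_mult)
  define \<phi> where "\<phi> w = avg (x n w) (\<lambda>y. cis (\<theta> n \<bullet> (y - x n w - h *\<^sub>R b (x n w))))" for w
  have avgH: "avg (x n w) (H w) = Z w * \<phi> w" for w
  proof -
    have "avg (x n w) (H w) = (1 / N\<^sup>2) *\<^sub>R (\<Sum>i\<in>UNIV. \<Sum>j\<in>UNIV. Z w * (
      p i j (x n w) *\<^sub>R (\<integral>z. cis (\<theta> n \<bullet> (next_state (N * h) (x n w) i j True z - x n w - h *\<^sub>R b (x n w))) \<partial>\<nu>)
      + (1 - p i j (x n w)) *\<^sub>R (\<integral>z. cis (\<theta> n \<bullet> (next_state (N * h) (x n w) i j False z - x n w - h *\<^sub>R b (x n w))) \<partial>\<nu>)))"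
      unfolding avg_eq H_def by (simp only: integral_mult_right_zero distrib_left mult_scaleR_right)
    also have "\<dots> = Z w * \<phi> w"
      unfolding \<phi>_def avg_eq by (simp only: sum_distrib_left[symmetric] mult_scaleR_right)
    finally show ?thesis .
  qed
  have step: "(\<lambda>w. cis (\<Sum>l<Suc n. \<theta> l \<bullet> (W (Suc l) w - W l w))) = (\<lambda>w. H w (x (Suc n) w))"
    by (simp add: H_def Z_def cis_mult W_Suc fun_eq_iff)
  have next_eq: "expectation (\<lambda>w. cis (\<Sum>l<Suc n. \<theta> l \<bullet> (W (Suc l) w - W l w))) = expectation (\<lambda>w. Z w * \<phi> w)"
    unfolding step integral_next_complex(1)[OF Hm H1] avgH ..
  have Zi: "integrable M Z"
    using history_le_M[OF Zm] by (intro integrable_const_bound[of _ 1] AE_I2) (auto simp: Z_def)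
  have Z\<phi>i: "integrable M (\<lambda>w. Z w * \<phi> w)"
    using integral_next_complex(2)[OF Hm H1] unfolding avgH .
  have 1: "norm (expectation (\<lambda>w. Z w * \<phi> w) - expectation Z * complex_of_real (exp (- k n))) \<le> h * \<eta> * Km"
  proof -
    have "norm (expectation (\<lambda>w. Z w * \<phi> w) - expectation Z * complex_of_real (exp (- k n)))
      = norm (expectation (\<lambda>w. Z w * \<phi> w - Z w * complex_of_real (exp (- k n))))"
      using Zi Z\<phi>i by simp
    also have "\<dots> \<le> expectation (\<lambda>w. norm (Z w * \<phi> w - Z w * complex_of_real (exp (- k n))))"
      by (rule integral_norm_bound)
    also have "\<dots> \<le> expectation (\<lambda>w. h * \<eta> * (1 + (norm (x n w))\<^sup>2))"
    proof (rule integral_mono)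
      show "integrable M (\<lambda>w. norm (Z w * \<phi> w - Z w * complex_of_real (exp (- k n))))"
        using Zi Z\<phi>i by (intro integrable_norm Bochner_Integration.integrable_diff integrable_mult_left)
      show "integrable M (\<lambda>w. h * \<eta> * (1 + (norm (x n w))\<^sup>2))"
        by (intro integrable_mult_right Bochner_Integration.integrable_add x_square_integrable) simp
      fix w
      have "norm (Z w * \<phi> w - Z w * complex_of_real (exp (- k n))) = norm (\<phi> w - complex_of_real (exp (- k n)))"
        by (simp only: right_diff_distrib[symmetric] norm_mult) (simp add: Z_def)
      also have "\<dots> \<le> h * \<eta> * (1 + (norm (x n w))\<^sup>2)"
        unfolding \<phi>_def k_def \<eta>_def by (rule char_average[OF \<Theta> m \<delta> char])
      finally show "norm (Z w * \<phi> w - Z w * complex_of_real (exp (- k n))) \<le> h * \<eta> * (1 + (norm (x n w))\<^sup>2)" .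
    qed
    also have "\<dots> = h * \<eta> * (expectation (\<lambda>w. (norm (x n w))\<^sup>2) + 1)"
      using x_square_integrable[of n] by (simp add: prob_space add.commute)
    also have "\<dots> \<le> h * \<eta> * Km"
      using moment_bound[OF nt] h \<eta>0 unfolding Km_def by (intro mult_left_mono) auto
    finally show ?thesis .
  qed
  have 2: "norm (expectation Z * complex_of_real (exp (- k n)) - complex_of_real (exp (- (\<Sum>l<n. k l))) * complex_of_real (exp (- k n)))
    \<le> real n * h * \<eta> * Km"
  proof -
    have "norm (expectation Z - complex_of_real (exp (- (\<Sum>l<n. k l)))) \<le> real n * h * \<eta> * Km"
      using Suc.IH[OF nt] unfolding Z_def \<eta>_def Km_def k_def by (simp only: sum_distrib_left)
    moreover have "norm (expectation Z * complex_of_real (exp (- k n)) - complex_of_real (exp (- (\<Sum>l<n. k l))) * complex_of_real (exp (- k n)))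
      = norm (expectation Z - complex_of_real (exp (- (\<Sum>l<n. k l)))) * exp (- k n)"
      by (simp only: left_diff_distrib[symmetric] norm_mult norm_of_real abs_exp_cancel)
    moreover have "\<dots> \<le> norm (expectation Z - complex_of_real (exp (- (\<Sum>l<n. k l)))) * 1"
      using k0[of n] by (intro mult_left_mono) auto
    ultimately show ?thesis by linarith
  qed
  have e: "complex_of_real (exp (- (\<Sum>l<n. k l))) * complex_of_real (exp (- k n)) = complex_of_real (exp (- (m / (2 * N) * h * (\<Sum>l<Suc n. (norm (\<theta> l))\<^sup>2))))"
    unfolding of_real_mult[symmetric] exp_add[symmetric] k_def by (simp add: sum_distrib_left sum_divide_distrib algebra_simps)
  have "norm (expectation (\<lambda>w. cis (\<Sum>l<Suc n. \<theta> l \<bullet> (W (Suc l) w - W l w)))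
      - complex_of_real (exp (- (m / (2 * N) * h * (\<Sum>l<Suc n. (norm (\<theta> l))\<^sup>2))))) \<le> h * \<eta> * Km + real n * h * \<eta> * Km"
    unfolding next_eq e[symmetric]
    by (rule norm_diff_triangle_le[OF 1 2])
  also have "\<dots> = real (Suc n) * h * \<eta> * Km" by (simp add: algebra_simps)
  finally show ?case unfolding \<eta>_def Km_def .
qed (simp add: prob_space)

end

section \<open>Random elements of the Skorokhod space\<close>

lemma measurable_continuous_map_comp:
  assumes Y: "Y \<in> N \<rightarrow>\<^sub>M borel_sets_of S" and g: "continuous_map S euclideanreal g"
  shows "(\<lambda>w. g (Y w)) \<in> borel_measurable N"
proof (rule borel_measurableI)
  fix U :: "real set" assume U: "open U"
  have sp: "Y w \<in> topspace S" if "w \<in> space N" for w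
    using measurable_space[OF Y that] by (simp add: borel_sets_of_def space_measure_of_conv)
  have "openin S {x \<in> topspace S. g x \<in> U}"
    using g U by (simp add: continuous_map_def)
  then have "{x \<in> topspace S. g x \<in> U} \<in> sets (borel_sets_of S)"
    unfolding borel_sets_of_def by (intro in_measure_of) (auto dest: openin_subset)
  then have "Y -` {x \<in> topspace S. g x \<in> U} \<inter> space N \<in> sets N"
    by (rule measurable_sets[OF Y])
  also have "Y -` {x \<in> topspace S. g x \<in> U} \<inter> space N = (\<lambda>w. g (Y w)) -` U \<inter> space N"
    using sp by auto
  finally show "(\<lambda>w. g (Y w)) -` U \<inter> space N \<in> sets N" .
qed

lemma measurable_borel_sets_ofI:
  assumes "\<And>w. w \<in> space N \<Longrightarrow> Y w \<in> topspace S"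
    and "\<And>U. openin S U \<Longrightarrow> Y -` U \<inter> space N \<in> sets N"
  shows "Y \<in> N \<rightarrow>\<^sub>M borel_sets_of S"
  unfolding borel_sets_of_def
  by (rule measurable_measure_of) (use assms in \<open>auto dest: openin_subset\<close>)

section \<open>Lipschitz test functions and measurability of limits\<close>

context Metric_space begin

lemma lipschitz_continuous_map:
  assumes "0 \<le> k" and lip: "\<And>x y. x \<in> M \<Longrightarrow> y \<in> M \<Longrightarrow> \<bar>g x - g y\<bar> \<le> k * d x y"
  shows "continuous_map mtopology euclideanreal g"
  unfolding continuous_map_def
proof (intro conjI allI impI)
  fix U :: "real set" assume "openin euclideanreal U"
  then have U: "open U" by simp
  show "openin mtopology {x \<in> topspace mtopology. g x \<in> U}"
    unfolding openin_mtopology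
  proof (intro conjI allI impI)
    fix x assume "x \<in> {x \<in> topspace mtopology. g x \<in> U}"
    then have x: "x \<in> M" "g x \<in> U" by auto
    obtain e where e: "0 < e" "ball (g x) e \<subseteq> U" using U x open_contains_ball by blast
    have "mball x (e / (k + 1)) \<subseteq> {x \<in> topspace mtopology. g x \<in> U}"
    proof
      fix y assume "y \<in> mball x (e / (k + 1))"
      then have y: "y \<in> M" "d x y < e / (k + 1)" by auto
      have "\<bar>g x - g y\<bar> \<le> (k + 1) * d x y" using lip[OF x(1) y(1)] nonneg[of x y] unfolding distrib_right by linarith
      also have "\<dots> < e" using y(2) assms(1) by (simp add: field_simps)
      finally show "y \<in> {x \<in> topspace mtopology. g x \<in> U}"
        using y e by (auto simp: dist_real_def subset_iff)
    qed
    then show "\<exists>r>0. mball x r \<subseteq> {x \<in> topspace mtopology. g x \<in> U}"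
      using e assms(1) by (intro exI[of _ "e / (k + 1)"]) auto
  qed auto
qed auto

text \<open>The Pasch-Hausdorff envelope: \<open>g k\<close> is the largest k-Lipschitz minorant of
  f, and it increases to f wherever f is continuous.\<close>

lemma inf_convolution:
  fixes f :: "'a \<Rightarrow> real" and k :: nat
  assumes B: "\<And>x. x \<in> M \<Longrightarrow> \<bar>f x\<bar> \<le> B"
  defines "g \<equiv> \<lambda>k x. INF y\<in>M. f y + real k * d x y"
  shows "\<And>x y. x \<in> M \<Longrightarrow> y \<in> M \<Longrightarrow> \<bar>g k x - g k y\<bar> \<le> real k * d x y"
    and "\<And>x. x \<in> M \<Longrightarrow> \<bar>g k x\<bar> \<le> B" and "\<And>x. x \<in> M \<Longrightarrow> g k x \<le> f x"
    and "\<And>x. x \<in> M \<Longrightarrow> continuous_map mtopology euclideanreal f \<Longrightarrow> (\<lambda>k. g k x) \<longlonglongrightarrow> f x"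
proof -
  have bdd: "bdd_below ((\<lambda>y. f y + real k * d x y) ` M)" if "x \<in> M" for x k
    by (rule bdd_belowI2[of _ "-B"]) (use B in \<open>force intro!: add_increasing2\<close>)
  have le: "g k x \<le> f y + real k * d x y" if "x \<in> M" "y \<in> M" for x y k
    unfolding g_def by (rule cINF_lower[OF bdd]) (use that in auto)
  have ge: "c \<le> g k x" if "x \<in> M" "\<And>y. y \<in> M \<Longrightarrow> c \<le> f y + real k * d x y" for x c k
    unfolding g_def by (rule cINF_greatest) (use that in auto)
  have 1: "g k x \<le> g k y + real k * d x y" if xy: "x \<in> M" "y \<in> M" for x y k
  proof -
    have "g k x - real k * d x y \<le> g k y"
    proof (rule ge[OF xy(2)])
      fix z assume z: "z \<in> M"
      have "real k * d x z \<le> real k * (d x y + d y z)"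
        using triangle[OF xy z] by (intro mult_left_mono) auto
      then show "g k x - real k * d x y \<le> f z + real k * d y z"
        using le[OF xy(1) z, of k] by (simp add: algebra_simps)
    qed
    then show ?thesis by simp
  qed
  show "\<bar>g k x - g k y\<bar> \<le> real k * d x y" if "x \<in> M" "y \<in> M" for x y
    using 1[OF that, of k] 1[OF that(2,1), of k] commute[of x y] by (simp add: abs_le_iff)
  show fle: "g k x \<le> f x" if "x \<in> M" for x k using le[OF that that] that by simp
  have "-B \<le> g k x" if "x \<in> M" for x
  proof (rule ge[OF that])
    fix y assume "y \<in> M"
    then show "-B \<le> f y + real k * d x y" using B[of y] nonneg[of x y] by (simp add: abs_le_iff add_increasing2)
  qed
  moreover have "g k x \<le> B" if "x \<in> M" for x using fle[OF that, of k] B[OF that] by (simp add: abs_le_iff)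
  ultimately show "\<bar>g k x\<bar> \<le> B" if "x \<in> M" for x using that by (simp add: abs_le_iff minus_le_iff)
  show "(\<lambda>k. g k x) \<longlonglongrightarrow> f x" if x: "x \<in> M" and f: "continuous_map mtopology euclideanreal f" for x
  proof (rule LIMSEQ_I)
    fix e :: real assume e: "0 < e"
    have "\<And>U. openin euclideanreal U \<Longrightarrow> openin mtopology {y \<in> topspace mtopology. f y \<in> U}"
      using f unfolding continuous_map_def by blast
    then have "openin mtopology {y \<in> topspace mtopology. f y \<in> ball (f x) (e/2)}"
      by (metis open_ball open_openin)
    then obtain r where r: "0 < r" "mball x r \<subseteq> {y \<in> topspace mtopology. f y \<in> ball (f x) (e/2)}"
      using x e unfolding openin_mtopology by (metis (no_types, lifting) centre_in_ball half_gt_zero mem_Collect_eq topspace_mtopology)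
    show "\<exists>no. \<forall>n\<ge>no. norm (g n x - f x) < e"
    proof (intro exI allI impI)
      \<comment> \<open>Beyond distance r the penalty n d(x, y) exceeds the oscillation 2B of f, so
        only points near x can lower the infimum.\<close>
      fix n assume n: "nat \<lceil>2 * B / r\<rceil> \<le> n"
      have n': "2 * B / r \<le> real n" using n by linarith
      have "f x - e/2 \<le> g n x"
      proof (rule ge[OF x])
        fix y assume y: "y \<in> M"
        show "f x - e/2 \<le> f y + real n * d x y"
        proof (cases "d x y < r")
          case True
          then have "\<bar>f x - f y\<bar> < e/2" using r(2) x y by (auto simp: dist_real_def)
          moreover have "0 \<le> real n * d x y" by simp
          ultimately show ?thesis by linarith
        next
          case False
          have "2 * B \<le> real n * r" using n' r(1) by (simp add: field_simps)
          also have "\<dots> \<le> real n * d x y" using False by (intro mult_left_mono) auto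
          finally show ?thesis using B[OF x] B[OF y] e by (simp add: abs_le_iff)
        qed
      qed
      then show "norm (g n x - f x) < e" using fle[OF x, of n] e by simp
    qed
  qed
qed

text \<open>Lipschitz minorants give the lower bound for the limit inferior, and the same argument
  for -f gives the upper bound. The minorants have to converge only under the fixed law Q, so no
  uniformity in h enters.\<close>

lemma lipschitz_tests_suffice:
  assumes Y: "\<And>h. 0 < h \<Longrightarrow> Y h \<in> P h \<rightarrow>\<^sub>M borel_sets_of mtopology" and P: "\<And>h. 0 < h \<Longrightarrow> prob_space (P h)"
    and Z: "Z \<in> Q \<rightarrow>\<^sub>M borel_sets_of mtopology" and Q: "prob_space Q"
    and lim: "\<And>g k B. 0 \<le> k \<Longrightarrow> (\<And>x y. x \<in> M \<Longrightarrow> y \<in> M \<Longrightarrow> \<bar>g x - g y\<bar> \<le> k * d x y) \<Longrightarrow>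
       (\<And>x. x \<in> M \<Longrightarrow> \<bar>g x\<bar> \<le> B) \<Longrightarrow>
       ((\<lambda>h. \<integral>w. g (Y h w) \<partial>P h) \<longlongrightarrow> (\<integral>w. g (Z w) \<partial>Q)) (at_right (0::real))"
    and f: "continuous_map mtopology euclideanreal f" "bounded (f ` topspace mtopology)"
  shows "((\<lambda>h. \<integral>w. f (Y h w) \<partial>P h) \<longlongrightarrow> (\<integral>w. f (Z w) \<partial>Q)) (at_right (0::real))"
proof -
  interpret Q: prob_space Q by fact
  have YM: "Y h w \<in> M" if "0 < h" "w \<in> space (P h)" for h w
    using measurable_space[OF Y[OF that(1)] that(2)] by (simp add: borel_sets_of_def space_measure_of_conv)
  have ZM: "Z w \<in> M" if "w \<in> space Q" for w
    using measurable_space[OF Z that] by (simp add: borel_sets_of_def space_measure_of_conv)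
  have lower: "\<forall>\<^sub>F h in at_right 0. (\<integral>w. f (Z w) \<partial>Q) - e < (\<integral>w. f (Y h w) \<partial>P h)"
    if f: "continuous_map mtopology euclideanreal f" and B: "\<And>x. x \<in> M \<Longrightarrow> \<bar>f x\<bar> \<le> B" and e: "0 < e" for f B e
  proof -
    define g where "g k x = (INF y\<in>M. f y + real k * d x y)" for k x
    note g = inf_convolution[of f B, OF B, folded g_def]
    have gc: "continuous_map mtopology euclideanreal (g k)" for k
      by (rule lipschitz_continuous_map[of "real k"]) (use g(1) in auto)
    have "(\<lambda>k. \<integral>w. g k (Z w) \<partial>Q) \<longlonglongrightarrow> (\<integral>w. f (Z w) \<partial>Q)"
      by (rule integral_dominated_convergence[where w = "\<lambda>_. B"])
        (use g ZM f in \<open>auto intro!: measurable_continuous_map_comp[OF Z] gc\<close>)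
    then have "\<forall>\<^sub>F k in sequentially. (\<integral>w. f (Z w) \<partial>Q) - e < (\<integral>w. g k (Z w) \<partial>Q)"
      by (rule order_tendstoD) (use e in auto)
    from eventually_happens'[OF sequentially_bot this]
    obtain k where k: "(\<integral>w. f (Z w) \<partial>Q) - e < (\<integral>w. g k (Z w) \<partial>Q)"
      by blast
    have "((\<lambda>h. \<integral>w. g k (Y h w) \<partial>P h) \<longlongrightarrow> (\<integral>w. g k (Z w) \<partial>Q)) (at_right 0)"
      by (rule lim[OF _ g(1) g(2)]) auto
    then have "\<forall>\<^sub>F h in at_right 0. (\<integral>w. f (Z w) \<partial>Q) - e < (\<integral>w. g k (Y h w) \<partial>P h)"
      using k by (rule order_tendstoD)
    then show ?thesis using eventually_at_right_less[of "0::real"]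
    proof eventually_elim
      case (elim h)
      interpret P: prob_space "P h" by (rule P[OF elim(2)])
      note comp = measurable_continuous_map_comp[OF Y[OF elim(2)]]
      have "(\<integral>w. g k (Y h w) \<partial>P h) \<le> (\<integral>w. f (Y h w) \<partial>P h)"
        by (intro integral_mono P.integrable_const_bound[where B = B] comp gc f)
          (use g YM[OF elim(2)] B in auto)
      with elim(1) show ?case by linarith
    qed
  qed
  obtain B where B: "\<And>x. x \<in> M \<Longrightarrow> \<bar>f x\<bar> \<le> B"
    using f(2) unfolding bounded_iff by auto
  show ?thesis
  proof (rule order_tendstoI)
    fix a assume "a < (\<integral>w. f (Z w) \<partial>Q)"
    then show "\<forall>\<^sub>F h in at_right 0. a < (\<integral>w. f (Y h w) \<partial>P h)"
      using lower[OF f(1) B, of "(\<integral>w. f (Z w) \<partial>Q) - a"] by simp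
  next
    fix a assume a: "(\<integral>w. f (Z w) \<partial>Q) < a"
    have "continuous_map mtopology euclideanreal (\<lambda>x. - f x)"
      using f(1) by (rule continuous_map_minus)
    from lower[OF this, of B "a - (\<integral>w. f (Z w) \<partial>Q)"] B a
    show "\<forall>\<^sub>F h in at_right 0. (\<integral>w. f (Y h w) \<partial>P h) < a" by simp
  qed
qed

text \<open>The limit lies in an open U exactly if, for some margin 1/(j+1), all late approximants
  lie in the part \<open>V j\<close> of U that keeps this margin. This describes the preimage of U
  by countably many operations.\<close>

lemma measurable_borel_sets_of_limit:
  assumes Y: "\<And>q::nat. Y q \<in> N \<rightarrow>\<^sub>M borel_sets_of mtopology"
    and Z: "\<And>w. w \<in> space N \<Longrightarrow> Z w \<in> M"
    and lim: "\<And>w. w \<in> space N \<Longrightarrow> (\<lambda>q. d (Y q w) (Z w)) \<longlonglongrightarrow> 0"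
  shows "Z \<in> N \<rightarrow>\<^sub>M borel_sets_of mtopology"
proof (rule measurable_borel_sets_ofI)
  fix U assume U: "openin mtopology U"
  \<comment> \<open>The strict inequality for r is what makes \<open>V j\<close> open.\<close>
  define V where "V j = {x \<in> M. \<exists>r>inverse (real (Suc j)). mball x r \<subseteq> U}" for j
  have V: "openin mtopology (V j)" for j
    unfolding openin_mtopology
  proof (intro conjI allI impI)
    fix x assume "x \<in> V j"
    then obtain r where r: "x \<in> M" "inverse (real (Suc j)) < r" "mball x r \<subseteq> U" by (auto simp: V_def)
    define s where "s = (r - inverse (real (Suc j))) / 2"
    have "0 < (a - c) / 2 \<and> c < a - (a - c) / 2" if "c < a" for a c :: real using that by (simp add: field_simps)
    from this[OF r(2)] have s: "0 < s" "inverse (real (Suc j)) < r - s" unfolding s_def by blast+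
    have "y \<in> V j" if y: "y \<in> mball x s" for y
    proof -
      have "mball y (r - s) \<subseteq> mball x r" by (rule mball_subset) (use y r commute in auto)
      then show ?thesis unfolding V_def using y s r by auto
    qed
    then show "\<exists>r>0. mball x r \<subseteq> V j" using s by blast
  qed (auto simp: V_def)
  have eq: "Z -` U \<inter> space N = (\<Union>j. \<Union>q0. \<Inter>q\<in>{q0..}. Y q -` V j \<inter> space N)"
  proof (intro set_eqI iffI)
    fix w assume w: "w \<in> Z -` U \<inter> space N"
    then obtain r where r: "0 < r" "mball (Z w) r \<subseteq> U" using U unfolding openin_mtopology by auto
    obtain j where j: "inverse (real (Suc j)) < r / 2" using r(1) reals_Archimedean[of "r/2"] by auto
    have "\<forall>\<^sub>F q in sequentially. d (Y q w) (Z w) < r / 2"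
      using order_tendstoD(2)[OF lim, of w "r/2"] w r by simp
    then obtain q0 where q0: "\<And>q. q \<ge> q0 \<Longrightarrow> d (Y q w) (Z w) < r / 2"
      unfolding eventually_sequentially by blast
    have "Y q w \<in> V j" if "q \<ge> q0" for q
    proof -
      have ym: "Y q w \<in> M"
        using measurable_space[OF Y, of w q] w by (simp add: borel_sets_of_def space_measure_of_conv)
      have "mball (Y q w) (r / 2) \<subseteq> mball (Z w) r"
        by (rule mball_subset) (use q0[OF that] Z w in \<open>auto simp: commute\<close>)
      then show ?thesis unfolding V_def using ym j r(2) by blast
    qed
    then show "w \<in> (\<Union>j. \<Union>q0. \<Inter>q\<in>{q0..}. Y q -` V j \<inter> space N)" using w by auto
  next
    fix w assume "w \<in> (\<Union>j. \<Union>q0. \<Inter>q\<in>{q0..}. Y q -` V j \<inter> space N)"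
    then obtain j q0 where q0: "\<And>q. q \<ge> q0 \<Longrightarrow> Y q w \<in> V j" and w: "w \<in> space N" by auto
    have "\<forall>\<^sub>F q in sequentially. d (Y q w) (Z w) < inverse (real (Suc j))"
      using order_tendstoD(2)[OF lim, of w "inverse (real (Suc j))"] w by simp
    then have "\<forall>\<^sub>F q in sequentially. d (Y q w) (Z w) < inverse (real (Suc j)) \<and> q \<ge> q0"
      using eventually_ge_at_top[of q0] by (rule eventually_conj)
    from eventually_happens'[OF sequentially_bot this]
    obtain q where q: "d (Y q w) (Z w) < inverse (real (Suc j))" "q \<ge> q0"
      by blast
    from q0[OF q(2)] obtain r where r: "inverse (real (Suc j)) < r" "mball (Y q w) r \<subseteq> U" "Y q w \<in> M"
      unfolding V_def by auto
    have "Z w \<in> mball (Y q w) r" using q(1) r Z[OF w] by auto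
    then show "w \<in> Z -` U \<inter> space N" using r w by auto
  qed
  have "Y q -` V j \<inter> space N \<in> sets N" for q j
  proof -
    have "V j \<in> sets (borel_sets_of mtopology)"
      unfolding borel_sets_of_def
    proof (rule in_measure_of)
      show "{U. openin mtopology U} \<subseteq> Pow (topspace mtopology)" using openin_subset by blast
    qed (use V in simp)
    then show ?thesis by (rule measurable_sets[OF Y])
  qed
  then show "Z -` U \<inter> space N \<in> sets N"
    unfolding eq by (intro sets.countable_UN sets.countable_INT image_subsetI) auto
qed (use Z in auto)

end

section \<open>Step paths and continuous paths as random elements\<close>

lemma step_path_cadlag:
  assumes d: "0 < d"
  shows "(\<lambda>t\<in>{0..T}. step_path d v t) \<in> cadlag T"
  unfolding cadlag_def
proof (intro CollectI conjI ballI)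
  fix t assume t: "t \<in> {0..<T}"
  let ?n = "nat \<lfloor>t / d\<rfloor>"
  have n: "real ?n * d \<le> t" "t < (real ?n + 1) * d"
    using nat_floor_divide_bounds[OF d, of t] t by auto
  have "\<forall>\<^sub>F u in at_right t. u < min T ((real ?n + 1) * d) \<and> t < u"
    using t n by (intro eventually_conj eventually_at_right_less)
      (auto simp: eventually_at_right_field intro!: exI[of _ "min T ((real ?n + 1) * d)"])
  then have "\<forall>\<^sub>F u in at_right t. (\<lambda>t\<in>{0..T}. step_path d v t) u = (\<lambda>t\<in>{0..T}. step_path d v t) t"
  proof eventually_elim
    case (elim u)
    then have "nat \<lfloor>u / d\<rfloor> = ?n" using n by (intro nat_floor_divide_eqI[OF d]) auto
    then show ?case using elim t by (simp add: step_path_def)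
  qed
  then show "continuous (at_right t) (\<lambda>t\<in>{0..T}. step_path d v t)"
    unfolding continuous_within by (rule tendsto_eventually)
next
  fix t assume t: "t \<in> {0<..T}"
  \<comment> \<open>At a grid point the left limit is the value of the preceding step; hence ceiling
    minus one instead of floor.\<close>
  define n where "n = nat (\<lceil>t / d\<rceil> - 1)"
  have td: "0 < t / d" using t d by simp
  then have "real n = real_of_int \<lceil>t / d\<rceil> - 1" by (simp add: n_def)
  then have "real n < t / d" "t / d \<le> real n + 1" by linarith+
  then have n: "real n * d < t" "t \<le> (real n + 1) * d" using d by (simp_all add: pos_less_divide_eq pos_divide_le_eq)
  have "\<forall>\<^sub>F u in at_left t. real n * d < u \<and> u < t"
    using n by (auto simp: eventually_at_left_field intro!: exI[of _ "real n * d"])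
  then have "\<forall>\<^sub>F u in at_left t. (\<lambda>t\<in>{0..T}. step_path d v t) u = v n"
  proof eventually_elim
    case (elim u)
    then have "nat \<lfloor>u / d\<rfloor> = n" using n by (intro nat_floor_divide_eqI[OF d]) auto
    moreover have "0 \<le> u" using elim d by (meson less_imp_le mult_nonneg_nonneg of_nat_0_le_iff order_trans)
    ultimately show ?case using elim t by (simp add: step_path_def)
  qed
  then show "\<exists>l. ((\<lambda>t\<in>{0..T}. step_path d v t) \<longlongrightarrow> l) (at_left t)"
    by (intro exI[of _ "v n"] tendsto_eventually)
qed auto

lemma continuous_path_cadlag:
  assumes f: "continuous_on {0..T} f"
  shows "(\<lambda>t\<in>{0..T}. f t) \<in> cadlag T"
  unfolding cadlag_def
proof (intro CollectI conjI ballI)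
  fix t assume t: "t \<in> {0..<T}"
  have "(f \<longlongrightarrow> f t) (at t within {0..T})" using f t by (auto simp: continuous_on_def)
  then have "(f \<longlongrightarrow> f t) (at t within {t<..<T})" by (rule tendsto_within_subset) (use t in auto)
  moreover have "at t within {t<..<T} = at_right t" using t by (intro at_within_nhd[of _ "{..<T}"]) auto
  ultimately have "(f \<longlongrightarrow> f t) (at_right t)" by simp
  moreover have "\<forall>\<^sub>F u in at_right t. f u = (\<lambda>t\<in>{0..T}. f t) u"
    using t by (auto simp: eventually_at_right_field intro!: exI[of _ T])
  ultimately have "((\<lambda>t\<in>{0..T}. f t) \<longlongrightarrow> f t) (at_right t)"
    by (rule Lim_transform_eventually)
  then show "continuous (at_right t) (\<lambda>t\<in>{0..T}. f t)"
    using t by (simp add: continuous_within)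
next
  fix t assume t: "t \<in> {0<..T}"
  have "(f \<longlongrightarrow> f t) (at t within {0..T})" using f t by (auto simp: continuous_on_def)
  then have "(f \<longlongrightarrow> f t) (at t within {0<..<t})" by (rule tendsto_within_subset) (use t in auto)
  moreover have "at t within {0<..<t} = at_left t" using t by (intro at_within_nhd[of _ "{0<..}"]) auto
  ultimately have "(f \<longlongrightarrow> f t) (at_left t)" by simp
  moreover have "\<forall>\<^sub>F u in at_left t. f u = (\<lambda>t\<in>{0..T}. f t) u"
    using t by (auto simp: eventually_at_left_field intro!: exI[of _ 0])
  ultimately have "((\<lambda>t\<in>{0..T}. f t) \<longlongrightarrow> f t) (at_left t)"
    by (rule Lim_transform_eventually)
  then show "\<exists>l. ((\<lambda>t\<in>{0..T}. f t) \<longlongrightarrow> l) (at_left t)" by blast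
qed auto

text \<open>The identity serves as time change. All comparisons of paths in the proof are uniform in
  time and reach the Skorokhod distance through this bound.\<close>

lemma skorokhod_dist_le_uniform:
  assumes "f \<in> cadlag T" "g \<in> cadlag T" "0 < e" "\<And>t. t \<in> {0..T} \<Longrightarrow> dist (f t) (g t) \<le> e"
  shows "skorokhod_dist T f g \<le> e"
  using assms(3,4)
  by (intro skorokhod_dist_le[OF assms(1,2)])
    (auto simp: skorokhod_bounds_def intro!: bexI[OF _ time_change_id])

lemma topspace_skorokhod: "topspace (skorokhod_topology T :: (real \<Rightarrow> 'v::metric_space) topology) = cadlag T"
  unfolding skorokhod_topology_def
  by (rule Metric_space.topspace_mtopology[OF Metric_space_skorokhod])

text \<open>Only the values up to index floor(T/d) enter, so the map from sequences to step paths is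
  continuous for the product topology, and preimages of Skorokhod-open sets are open sets of
  sequences.\<close>

lemma measurable_step_path:
  fixes V :: "nat \<Rightarrow> 'a \<Rightarrow> 'v::{metric_space, second_countable_topology}"
  assumes d: "0 < d" and V: "\<And>k. V k \<in> borel_measurable N"
  shows "(\<lambda>w. \<lambda>t\<in>{0..T}. step_path d (\<lambda>k. V k w) t) \<in> N \<rightarrow>\<^sub>M borel_sets_of (skorokhod_topology T)"
proof (rule measurable_borel_sets_ofI)
  show "(\<lambda>t\<in>{0..T}. step_path d (\<lambda>k. V k w) t) \<in> topspace (skorokhod_topology T)" for w
    using step_path_cadlag[OF d] by (simp add: topspace_skorokhod)
  interpret D: Metric_space "cadlag T :: (real \<Rightarrow> 'v) set" "skorokhod_dist T"
    by (rule Metric_space_skorokhod)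
  fix U :: "(real \<Rightarrow> 'v) set" assume "openin (skorokhod_topology T) U"
  then have U: "openin D.mtopology U" by (simp add: skorokhod_topology_def)
  let ?\<Theta> = "\<lambda>v::nat \<Rightarrow> 'v. \<lambda>t\<in>{0..T}. step_path d v t"
  have "open {v. ?\<Theta> v \<in> U}"
    unfolding open_subopen[of "{v. ?\<Theta> v \<in> U}"]
  proof (intro ballI)
    fix v assume "v \<in> {v. ?\<Theta> v \<in> U}"
    then obtain r where r: "0 < r" "D.mball (?\<Theta> v) r \<subseteq> U" using U unfolding D.openin_mtopology by auto
    let ?W = "\<Inter>k\<in>{..nat \<lfloor>T / d\<rfloor>}. (\<lambda>u::nat \<Rightarrow> 'v. u k) -` ball (v k) (r / 2)"
    have "open ?W"
      by (intro open_INT ballI open_vimage) (auto intro: continuous_on_product_coordinates)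
    moreover have "v \<in> ?W" using r by simp
    moreover have "?W \<subseteq> {v. ?\<Theta> v \<in> U}"
    proof
      fix u assume u: "u \<in> ?W"
      have "dist (v (nat \<lfloor>t / d\<rfloor>)) (u (nat \<lfloor>t / d\<rfloor>)) \<le> r / 2" if "t \<in> {0..T}" for t
      proof -
        have "nat \<lfloor>t / d\<rfloor> \<le> nat \<lfloor>T / d\<rfloor>" using that d by (intro nat_mono floor_mono divide_right_mono) auto
        then show ?thesis using u by (auto intro: less_imp_le)
      qed
      then have "skorokhod_dist T (?\<Theta> v) (?\<Theta> u) \<le> r / 2"
        using r by (intro skorokhod_dist_le_uniform step_path_cadlag[OF d]) (auto simp: step_path_def)
      then have "?\<Theta> u \<in> D.mball (?\<Theta> v) r" using r step_path_cadlag[OF d] by auto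
      then show "u \<in> {v. ?\<Theta> v \<in> U}" using r by auto
    qed
    ultimately show "\<exists>T. open T \<and> v \<in> T \<and> T \<subseteq> {v. ?\<Theta> v \<in> U}" by blast
  qed
  moreover have "(\<lambda>w k. V k w) \<in> borel_measurable N"
    by (rule measurable_coordinatewise_then_product) (rule V)
  ultimately have "(\<lambda>w k. V k w) -` {v. ?\<Theta> v \<in> U} \<inter> space N \<in> sets N"
    by (intro measurable_sets[of _ _ borel]) auto
  then show "(\<lambda>w. \<lambda>t\<in>{0..T}. step_path d (\<lambda>k. V k w) t) -` U \<inter> space N \<in> sets N"
    by (simp add: vimage_def)
qed

lemma measurable_continuous_path:
  fixes X :: "real \<Rightarrow> 'a \<Rightarrow> 'v::{metric_space, second_countable_topology}"
  assumes X: "\<And>t. t \<in> {0..T} \<Longrightarrow> X t \<in> borel_measurable N" and T: "0 \<le> T"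
    and cont: "\<And>w. w \<in> space N \<Longrightarrow> continuous_on {0..T} (\<lambda>t. X t w)"
  shows "(\<lambda>w. \<lambda>t\<in>{0..T}. X t w) \<in> N \<rightarrow>\<^sub>M borel_sets_of (skorokhod_topology T)"
proof -
  interpret D: Metric_space "cadlag T :: (real \<Rightarrow> 'v) set" "skorokhod_dist T"
    by (rule Metric_space_skorokhod)
  define d where "d q = inverse (real (Suc q))" for q
  have d: "0 < d q" for q by (simp add: d_def)
  \<comment> \<open>Sampled step paths converge uniformly to the continuous path. The minimum keeps
    the sampling times in [0, T], where X is measurable; at the steps that the path on [0, T] uses
    it changes nothing.\<close>
  define Y where "Y q w = (\<lambda>t\<in>{0..T}. step_path (d q) (\<lambda>k. X (min T (real k * d q)) w) t)" for q w
  show ?thesis unfolding skorokhod_topology_def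
  proof (rule D.measurable_borel_sets_of_limit[where Y = Y])
    show "Y q \<in> N \<rightarrow>\<^sub>M borel_sets_of D.mtopology" for q
      unfolding Y_def[abs_def] skorokhod_topology_def[symmetric]
      using d[of q] T by (intro measurable_step_path d X) (auto simp: less_imp_le)
    fix w assume w: "w \<in> space N"
    show c: "(\<lambda>t\<in>{0..T}. X t w) \<in> cadlag T" by (rule continuous_path_cadlag[OF cont[OF w]])
    have uc: "uniformly_continuous_on {0..T} (\<lambda>t. X t w)"
      using cont[OF w] by (intro compact_uniformly_continuous) auto
    show "(\<lambda>q. skorokhod_dist T (Y q w) (\<lambda>t\<in>{0..T}. X t w)) \<longlonglongrightarrow> 0"
    proof (rule LIMSEQ_I)
      fix e :: real assume e: "0 < e"
      then obtain \<delta> where \<delta>: "0 < \<delta>" "\<And>s t. s \<in> {0..T} \<Longrightarrow> t \<in> {0..T} \<Longrightarrow> dist s t < \<delta> \<Longrightarrow> dist (X s w) (X t w) < e / 2"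
        using uc unfolding uniformly_continuous_on_def by (metis half_gt_zero)
      obtain q0 where q0: "d q0 < \<delta>" using reals_Archimedean[OF \<delta>(1)] by (auto simp: d_def)
      show "\<exists>no. \<forall>n\<ge>no. norm (skorokhod_dist T (Y n w) (\<lambda>t\<in>{0..T}. X t w) - 0) < e"
      proof (intro exI[of _ q0] allI impI)
        fix q assume "q0 \<le> q"
        then have "d q \<le> d q0" by (simp add: d_def field_simps)
        then have dq: "d q < \<delta>" using q0 by simp
        have "skorokhod_dist T (Y q w) (\<lambda>t\<in>{0..T}. X t w) \<le> e / 2"
          unfolding Y_def
        proof (rule skorokhod_dist_le_uniform[OF step_path_cadlag[OF d] c])
          fix t assume t: "t \<in> {0..T}"
          then have n: "real (nat \<lfloor>t / d q\<rfloor>) * d q \<le> t" "t < (real (nat \<lfloor>t / d q\<rfloor>) + 1) * d q"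
            using nat_floor_divide_bounds[OF d, of t q] by auto
          have "dist (real (nat \<lfloor>t / d q\<rfloor>) * d q) t < \<delta>"
            using n dq by (simp add: dist_real_def algebra_simps)
          then have "dist (X (real (nat \<lfloor>t / d q\<rfloor>) * d q) w) (X t w) < e / 2"
            using t n(1) d[of q] by (intro \<delta>) auto
          moreover have "min T (real (nat \<lfloor>t / d q\<rfloor>) * d q) = real (nat \<lfloor>t / d q\<rfloor>) * d q" using n t by auto
          ultimately show "dist ((\<lambda>t\<in>{0..T}. step_path (d q) (\<lambda>k. X (min T (real k * d q)) w) t) t) ((\<lambda>t\<in>{0..T}. X t w) t) \<le> e / 2"
            using t by (simp add: step_path_def)
        qed (use e in simp)
        then show "norm (skorokhod_dist T (Y q w) (\<lambda>t\<in>{0..T}. X t w) - 0) < e"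
          using D.nonneg[of "Y q w" "\<lambda>t\<in>{0..T}. X t w"] e by simp
      qed
    qed
  qed
qed

section \<open>Convergence of characteristic functions\<close>

text \<open>Trigonometric polynomials in the coordinates from I. As linear combinations of
  exponentials they turn convergence of characteristic functions into convergence of expectations;
  being closed under products they are accessible to Stone-Weierstrass.\<close>

inductive_set trig_polys :: "'i set \<Rightarrow> (('i \<Rightarrow> real) \<Rightarrow> complex) set" for I where
  exponential: "(\<lambda>y. cis (\<Sum>j\<in>I. \<theta> j * y j)) \<in> trig_polys I"
| scale: "f \<in> trig_polys I \<Longrightarrow> (\<lambda>y. c * f y) \<in> trig_polys I"
| add: "f \<in> trig_polys I \<Longrightarrow> g \<in> trig_polys I \<Longrightarrow> (\<lambda>y. f y + g y) \<in> trig_polys I"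

lemma trig_polys_const: "(\<lambda>y. c) \<in> trig_polys I"
  using trig_polys.scale[OF trig_polys.exponential[of "\<lambda>_. 0" I], of c] by simp

lemma trig_polys_mult:
  assumes "f \<in> trig_polys I" "g \<in> trig_polys I"
  shows "(\<lambda>y. f y * g y) \<in> trig_polys I"
  using assms(1)
proof induction
  case (exponential \<theta>)
  show ?case using assms(2)
  proof induction
    case (exponential \<eta>)
    have "(\<lambda>y. cis (\<Sum>j\<in>I. (\<theta> j + \<eta> j) * y j)) \<in> trig_polys I" by (rule trig_polys.exponential)
    then show ?case by (simp add: cis_mult sum.distrib algebra_simps)
  next
    case (scale g c)
    from trig_polys.scale[OF scale.IH, of c] show ?case by (simp add: mult_ac)
  next
    case (add g g')
    from trig_polys.add[OF add.IH] show ?case by (simp add: algebra_simps)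
  qed
next
  case (scale f c)
  from trig_polys.scale[OF scale.IH, of c] show ?case by (simp add: mult_ac)
next
  case (add f f')
  from trig_polys.add[OF add.IH] show ?case by (simp add: algebra_simps)
qed

lemma trig_polys_sin:
  assumes "finite I" "j \<in> I"
  shows "(\<lambda>y. complex_of_real (sin (a * y j))) \<in> trig_polys I"
proof -
  have e: "(\<lambda>y. cis (c * y j)) \<in> trig_polys I" for c
  proof -
    have "(\<Sum>k\<in>I. (if k = j then c else 0) * y k) = c * y j" for y
      using assms by (simp add: if_distrib[of "\<lambda>x. x * _"] cong: if_cong)
    then show ?thesis using trig_polys.exponential[of "\<lambda>k. if k = j then c else 0" I] by simp
  qed
  have "(\<lambda>y. (1 / (2 * \<i>)) * cis (a * y j) + (- (1 / (2 * \<i>))) * cis (- a * y j)) \<in> trig_polys I"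
    by (intro trig_polys.add trig_polys.scale e)
  moreover have "(1 / (2 * \<i>)) * cis (a * y j) + (- (1 / (2 * \<i>))) * cis (- a * y j) = complex_of_real (sin (a * y j))" for y
    by (simp add: complex_eq_iff)
  ultimately show ?thesis by simp
qed

lemma trig_polys_bounded: "f \<in> trig_polys I \<Longrightarrow> \<exists>K. \<forall>y. norm (f y) \<le> K"
proof (induction rule: trig_polys.induct)
  case (scale f c)
  then obtain K where "\<forall>y. norm (f y) \<le> K" by blast
  then show ?case by (intro exI[of _ "norm c * K"]) (simp add: norm_mult mult_left_mono)
next
  case (add f g)
  then obtain K L where "\<forall>y. norm (f y) \<le> K" "\<forall>y. norm (g y) \<le> L" by blast
  then show ?case by (intro exI[of _ "K + L"]) (meson add_mono norm_triangle_ineq order_trans)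
qed (auto intro: exI[of _ 1])

lemma trig_polys_measurable:
  assumes "f \<in> trig_polys I" and [measurable]: "\<And>j. j \<in> I \<Longrightarrow> (\<lambda>w. Y w j) \<in> borel_measurable M"
  shows "(\<lambda>w. f (Y w)) \<in> borel_measurable M"
  using assms(1)
proof induction
  case (exponential \<theta>)
  have "cis \<in> borel_measurable borel"
    by (intro borel_measurable_continuous_onI continuous_intros)
  then show ?case by measurable
qed auto

lemma (in prob_space) trig_polys_integrable:
  assumes "f \<in> trig_polys I" "\<And>j. j \<in> I \<Longrightarrow> (\<lambda>w. Y w j) \<in> borel_measurable M"
  shows "integrable M (\<lambda>w. f (Y w))"
proof -
  obtain K where "\<And>y. norm (f y) \<le> K" using trig_polys_bounded[OF assms(1)] by blast
  then show ?thesis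
    using trig_polys_measurable[where Y = Y, OF assms] by (intro integrable_const_bound[of _ K]) auto
qed

text \<open>Folding the line by \<open>arcsin \<circ> sin\<close> makes the approximant bounded off the box as well.\<close>

lemma trig_polys_approx:
  fixes g :: "('i::countable \<Rightarrow> real) \<Rightarrow> real"
  assumes I: "finite I" and g: "continuous_on UNIV g" and B: "\<And>y. \<bar>g y\<bar> \<le> B"
    and \<rho>: "0 < \<rho>" and \<epsilon>: "0 < \<epsilon>"
  obtains q where "(\<lambda>y. complex_of_real (q y)) \<in> trig_polys I" "\<And>y. \<bar>q y\<bar> \<le> B + \<epsilon>"
    "\<forall>y. (\<forall>j\<in>I. \<bar>y j\<bar> \<le> \<rho>) \<and> (\<forall>j. j \<notin> I \<longrightarrow> y j = 0) \<longrightarrow> \<bar>g y - q y\<bar> \<le> \<epsilon>"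
proof -
  \<comment> \<open>Scaled so that a y stays in [-pi/2, pi/2] for |y| <= \<open>\<rho>\<close>,
    where arcsin inverts sin.\<close>
  define a where "a = pi / (2 * \<rho>)"
  have a: "0 < a" using \<rho> by (simp add: a_def)
  define K where "K = {u. \<forall>j. u j \<in> (if j \<in> I then {-1..1::real} else {0})}"
  define emb where "emb y = (\<lambda>j. if j \<in> I then sin (a * y j) else 0)" for y :: "'i \<Rightarrow> real"
  \<comment> \<open>Continuous functions of the sine variables whose pull-back is a trigonometric
    polynomial. The coordinates in I belong to R and separate the points of the compact cube K, so
    Stone-Weierstrass applies.\<close>
  define R where "R = {P. continuous_on UNIV P \<and> (\<lambda>y. complex_of_real (P (emb y))) \<in> trig_polys I}"
  have "compactin (product_topology (\<lambda>j::'i. euclidean) UNIV) (PiE UNIV (\<lambda>j. if j \<in> I then {-1..1::real} else {0}))"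
    by (subst compactin_PiE) auto
  moreover have "PiE UNIV (\<lambda>j. if j \<in> I then {-1..1::real} else {0}) = K"
    by (auto simp: K_def PiE_def Pi_def)
  ultimately have "compact K"
    by (simp only: euclidean_product_topology compactin_euclidean_iff)
  interpret F: function_ring_on R K
  proof
    fix f h assume f: "f \<in> R" and h: "h \<in> R"
    show "(\<lambda>x. f x + h x) \<in> R" using f h by (auto simp: R_def intro!: continuous_intros trig_polys.add)
    show "(\<lambda>x. f x * h x) \<in> R" using f h by (auto simp: R_def intro!: continuous_intros trig_polys_mult)
  next
    fix u v assume u: "u \<in> K" and v: "v \<in> K" and "u \<noteq> v"
    then obtain j where j: "u j \<noteq> v j" by blast
    have "u k = 0 \<and> v k = 0" if "k \<notin> I" for k
      using u v that unfolding K_def by (metis (mono_tags, lifting) mem_Collect_eq singletonD)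
    with j have jI: "j \<in> I" by metis
    have "(\<lambda>u. u j) \<in> R"
      using trig_polys_sin[OF I jI, of a] jI
      by (auto simp: R_def emb_def intro: continuous_on_product_coordinates)
    then show "\<exists>f\<in>R. f u \<noteq> f v" using j by (intro bexI[of _ "\<lambda>u. u j"])
  qed (use \<open>compact K\<close> in \<open>auto simp: R_def intro: continuous_on_subset trig_polys_const\<close>)
  define \<tau> where "\<tau> u = (\<lambda>j. if j \<in> I then arcsin (u j) / a else 0)" for u :: "'i \<Rightarrow> real"
  have "continuous_on K \<tau>"
    unfolding \<tau>_def
  proof (rule continuous_on_coordinatewise_then_product)
    fix j
    have "continuous_on K (\<lambda>u. u j)" by (rule continuous_on_subset[OF continuous_on_product_coordinates]) simp
    then have "continuous_on K (\<lambda>u. arcsin (u j) / a)" if "j \<in> I"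
      using that a by (intro continuous_intros) (auto simp: K_def)
    then show "continuous_on K (\<lambda>u. if j \<in> I then arcsin (u j) / a else 0)" by (cases "j \<in> I") auto
  qed
  then have "continuous_on K (\<lambda>u. g (\<tau> u))"
    by (rule continuous_on_compose2[OF g]) simp
  from F.Stone_Weierstrass_basic[OF this \<epsilon>] obtain P where P: "P \<in> R" "\<And>u. u \<in> K \<Longrightarrow> \<bar>g (\<tau> u) - P u\<bar> < \<epsilon>" by blast
  have embK: "emb y \<in> K" for y by (auto simp: K_def emb_def)
  show ?thesis
  proof (rule that[of "\<lambda>y. P (emb y)"])
    show "(\<lambda>y. complex_of_real (P (emb y))) \<in> trig_polys I" using P by (simp add: R_def)
    show "\<bar>P (emb y)\<bar> \<le> B + \<epsilon>" for y
      using P(2)[OF embK[of y]] B[of "\<tau> (emb y)"] by linarith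
    show "\<forall>y. (\<forall>j\<in>I. \<bar>y j\<bar> \<le> \<rho>) \<and> (\<forall>j. j \<notin> I \<longrightarrow> y j = 0) \<longrightarrow> \<bar>g y - P (emb y)\<bar> \<le> \<epsilon>"
    proof (intro allI impI)
    fix y assume "(\<forall>j\<in>I. \<bar>y j\<bar> \<le> \<rho>) \<and> (\<forall>j. j \<notin> I \<longrightarrow> y j = 0)"
    then have y: "\<And>j. j \<in> I \<Longrightarrow> \<bar>y j\<bar> \<le> \<rho>" "\<And>j. j \<notin> I \<Longrightarrow> y j = 0" by blast+
    have "arcsin (sin (a * y j)) / a = y j" if "j \<in> I" for j
    proof -
      have "\<bar>a * y j\<bar> \<le> a * \<rho>" using y(1)[OF that] a by (simp add: abs_mult)
      also have "\<dots> = pi / 2" using \<rho> by (simp add: a_def)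
      finally show ?thesis using a by (subst arcsin_sin) auto
    qed
    then have "\<tau> (emb y) = y" using y(2) by (auto simp: \<tau>_def emb_def)
    then show "\<bar>g y - P (emb y)\<bar> \<le> \<epsilon>" using P(2)[OF embK[of y]] by simp
    qed
  qed
qed

lemma borel_measurable_continuous_product:
  fixes g :: "('i::countable \<Rightarrow> real) \<Rightarrow> real"
  assumes g: "continuous_on UNIV g"
    and Y: "\<And>j. j \<in> I \<Longrightarrow> (\<lambda>w. Y w j) \<in> borel_measurable M" "\<And>w j. j \<notin> I \<Longrightarrow> Y w j = 0"
  shows "(\<lambda>w. g (Y w)) \<in> borel_measurable M"
proof -
  have "(\<lambda>w. Y w j) \<in> borel_measurable M" for j using Y by (cases "j \<in> I") auto
  then have "(\<lambda>w. Y w) \<in> borel_measurable M"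
    by (rule measurable_coordinatewise_then_product)
  then show ?thesis
    by (rule measurable_compose) (rule borel_measurable_continuous_onI[OF g])
qed

text \<open>Inside the box q is within \<open>\<epsilon>\<close> of g; outside, the difference is at
  most 2B + \<open>\<epsilon>\<close> <= 2B + 1, and this happens with probability at most
  \<open>\<delta>\<close>.\<close>

lemma (in prob_space) trig_polys_L1_close:
  fixes g q :: "('i::countable \<Rightarrow> real) \<Rightarrow> real"
  assumes g: "continuous_on UNIV g" and B: "\<And>y. \<bar>g y\<bar> \<le> B"
    and q: "(\<lambda>y. complex_of_real (q y)) \<in> trig_polys I" "\<And>y. \<bar>q y\<bar> \<le> B + \<epsilon>"
      "\<forall>y. (\<forall>j\<in>I. \<bar>y j\<bar> \<le> \<rho>) \<and> (\<forall>j. j \<notin> I \<longrightarrow> y j = 0) \<longrightarrow> \<bar>g y - q y\<bar> \<le> \<epsilon>"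
    and I: "finite I" and \<epsilon>: "0 \<le> \<epsilon>" "\<epsilon> \<le> 1"
    and Y: "\<forall>j\<in>I. (\<lambda>w. Y w j) \<in> borel_measurable M" "\<forall>w j. j \<notin> I \<longrightarrow> Y w j = 0"
    and out: "prob {w \<in> space M. \<exists>j\<in>I. \<rho> < \<bar>Y w j\<bar>} \<le> \<delta>"
  shows "integrable M (\<lambda>w. g (Y w))" "integrable M (\<lambda>w. q (Y w))"
    "expectation (\<lambda>w. \<bar>g (Y w) - q (Y w)\<bar>) \<le> \<epsilon> + (2 * B + 1) * \<delta>"
proof -
  show ig: "integrable M (\<lambda>w. g (Y w))"
    using B borel_measurable_continuous_product[of g I Y M] g Y by (intro integrable_const_bound[of _ B]) auto
  have "integrable M (\<lambda>w. Re (complex_of_real (q (Y w))))"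
    using Y(1) by (intro integrable_Re trig_polys_integrable[OF q(1)]) auto
  then show iq: "integrable M (\<lambda>w. q (Y w))" by simp
  let ?A = "{w \<in> space M. \<exists>j\<in>I. \<rho> < \<bar>Y w j\<bar>}"
  have [measurable]: "?A \<in> sets M"
  proof -
    have "?A = (\<Union>j\<in>I. {w \<in> space M. \<rho> < \<bar>Y w j\<bar>})" by auto
    also have "\<dots> \<in> sets M"
      using I Y(1) by (intro sets.finite_UN) (auto intro!: borel_measurable_less borel_measurable_abs)
    finally show ?thesis .
  qed
  have B0: "0 \<le> B" using B[of undefined] by linarith
  have "expectation (\<lambda>w. \<bar>g (Y w) - q (Y w)\<bar>) \<le> expectation (\<lambda>w. \<epsilon> + (2 * B + 1) * indicator ?A w)"
  proof (rule integral_mono)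
    fix w assume w: "w \<in> space M"
    show "\<bar>g (Y w) - q (Y w)\<bar> \<le> \<epsilon> + (2 * B + 1) * indicator ?A w"
    proof (cases "w \<in> ?A")
      case True
      then show ?thesis using B[of "Y w"] q(2)[of "Y w"] \<epsilon> by auto
    next
      case False
      with w have "\<bar>g (Y w) - q (Y w)\<bar> \<le> \<epsilon>" using Y(2) by (intro q(3)[rule_format]) (auto simp: not_less)
      then show ?thesis using False by simp
    qed
  next
    show "integrable M (\<lambda>w. \<epsilon> + (2 * B + 1) * indicator ?A w)"
      by (intro Bochner_Integration.integrable_add integrable_mult_right integrable_real_indicator integrable_const)
        (auto simp: less_top[symmetric])
  qed (use ig iq in auto)
  also have "\<dots> = \<epsilon> + (2 * B + 1) * prob ?A"
    by (subst Bochner_Integration.integral_add) (auto simp: prob_space less_top[symmetric])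
  also have "\<dots> \<le> \<epsilon> + (2 * B + 1) * \<delta>" using out B0 by (intro add_left_mono mult_left_mono) auto
  finally show "expectation (\<lambda>w. \<bar>g (Y w) - q (Y w)\<bar>) \<le> \<epsilon> + (2 * B + 1) * \<delta>" .
qed

lemma (in prob_space) finite_family_tight:
  fixes Y :: "'a \<Rightarrow> 'i \<Rightarrow> real"
  assumes I: "finite I" and Y: "\<And>j. j \<in> I \<Longrightarrow> (\<lambda>w. Y w j) \<in> borel_measurable M" and e: "0 < e"
  shows "\<exists>\<rho>0. \<forall>\<rho>\<ge>\<rho>0. prob {w \<in> space M. \<exists>j\<in>I. \<rho> < \<bar>Y w j\<bar>} \<le> e"
proof -
  define S where "S w = (\<Sum>j\<in>I. \<bar>Y w j\<bar>)" for w
  have S[measurable]: "S \<in> borel_measurable M" unfolding S_def using Y by (intro borel_measurable_sum) auto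
  define A where "A n = {w \<in> space M. real n < S w}" for n
  have [measurable]: "A n \<in> sets M" for n unfolding A_def by measurable
  have "(\<lambda>n. prob (A n)) \<longlonglongrightarrow> prob (\<Inter>n. A n)"
    by (rule finite_Lim_measure_decseq) (auto simp: A_def decseq_def)
  moreover have "(\<Inter>n. A n) = {}"
  proof -
    have "\<exists>n. \<not> real n < S w" for w by (metis not_less_iff_gr_or_eq reals_Archimedean2)
    then show ?thesis by (auto simp: A_def)
  qed
  ultimately have "(\<lambda>n. prob (A n)) \<longlonglongrightarrow> 0" by simp
  from eventually_happens'[OF sequentially_bot order_tendstoD(2)[OF this e]]
  obtain n where n: "prob (A n) < e" by blast
  have "prob {w \<in> space M. \<exists>j\<in>I. \<rho> < \<bar>Y w j\<bar>} \<le> e" if "real n \<le> \<rho>" for \<rho>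
  proof -
    have "prob {w \<in> space M. \<exists>j\<in>I. \<rho> < \<bar>Y w j\<bar>} \<le> prob (A n)"
    proof (rule finite_measure_mono)
      show "{w \<in> space M. \<exists>j\<in>I. \<rho> < \<bar>Y w j\<bar>} \<subseteq> A n"
      proof safe
        fix w j assume w: "w \<in> space M" and j: "j \<in> I" "\<rho> < \<bar>Y w j\<bar>"
        have "\<bar>Y w j\<bar> \<le> S w" unfolding S_def using I j by (intro member_le_sum) auto
        then show "w \<in> A n" using w j that by (auto simp: A_def)
      qed
    qed simp
    with n show ?thesis by simp
  qed
  then show ?thesis by blast
qed

lemma (in prob_space) trig_polys_dense:
  fixes g :: "('i::countable \<Rightarrow> real) \<Rightarrow> real"
  assumes I: "finite I" and g: "continuous_on UNIV g" and B: "\<And>y. \<bar>g y\<bar> \<le> B"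
    and Y: "\<And>j. j \<in> I \<Longrightarrow> (\<lambda>w. Y w j) \<in> borel_measurable M" "\<And>w j. j \<notin> I \<Longrightarrow> Y w j = 0"
    and e: "0 < e"
  obtains q where "(\<lambda>y. complex_of_real (q y)) \<in> trig_polys I"
    "integrable M (\<lambda>w. g (Y w))" "integrable M (\<lambda>w. q (Y w))"
    "expectation (\<lambda>w. \<bar>g (Y w) - q (Y w)\<bar>) \<le> e"
proof -
  have B0: "0 \<le> B" using B[of undefined] by linarith
  define \<epsilon> where "\<epsilon> = min 1 (e / 2)"
  define \<delta> where "\<delta> = e / 2 / (2 * B + 1)"
  have pos: "0 < \<epsilon>" "\<epsilon> \<le> 1" "0 < \<delta>" using e B0 by (auto simp: \<epsilon>_def \<delta>_def)
  from finite_family_tight[of I Y, OF I Y(1) pos(3)] obtain \<rho>0 where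
    \<rho>0: "\<And>\<rho>. \<rho> \<ge> \<rho>0 \<Longrightarrow> prob {w \<in> space M. \<exists>j\<in>I. \<rho> < \<bar>Y w j\<bar>} \<le> \<delta>" by blast
  have "0 < max 1 \<rho>0" by simp
  from trig_polys_approx[OF I g B this pos(1)] obtain q where q: "(\<lambda>y. complex_of_real (q y)) \<in> trig_polys I"
     "\<And>y. \<bar>q y\<bar> \<le> B + \<epsilon>"
    "\<forall>y. (\<forall>j\<in>I. \<bar>y j\<bar> \<le> max 1 \<rho>0) \<and> (\<forall>j. j \<notin> I \<longrightarrow> y j = 0) \<longrightarrow> \<bar>g y - q y\<bar> \<le> \<epsilon>"
    by blast
  have Y': "\<forall>j\<in>I. (\<lambda>w. Y w j) \<in> borel_measurable M" "\<forall>w j. j \<notin> I \<longrightarrow> Y w j = 0"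
    using Y by blast+
  note * = trig_polys_L1_close[where Y = Y and \<rho> = "max 1 \<rho>0" and \<epsilon> = \<epsilon>,
      OF g B q I less_imp_le[OF pos(1)] pos(2) Y' \<rho>0[OF max.cobounded2]]
  have "c * (x / c) = x" if "0 < c" for c x :: real using that by simp
  from this[of "2 * B + 1" "e / 2"] have "(2 * B + 1) * \<delta> = e / 2"
    unfolding \<delta>_def using B0 by linarith
  then have "\<epsilon> + (2 * B + 1) * \<delta> \<le> e" using e unfolding \<epsilon>_def by simp
  with * show ?thesis by (intro that[OF q(1)]) auto
qed

text \<open>Levy's continuity theorem for finitely many coordinates, along a filter and with
  tightness as a hypothesis. Random vectors are functions vanishing off I, so that one countable
  index type serves for every number of blocks.\<close>

lemma trig_polys_convergence:
  fixes g :: "('i::countable \<Rightarrow> real) \<Rightarrow> real"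
  assumes I: "finite I" and P: "\<forall>\<^sub>F h in F. prob_space (P h)"
    and Ym: "\<forall>\<^sub>F h in F. \<forall>j\<in>I. (\<lambda>w. Y h w j) \<in> borel_measurable (P h)" and Y0: "\<And>h w j. j \<notin> I \<Longrightarrow> Y h w j = 0"
    and Q: "prob_space Q"
    and Zm: "\<And>j. j \<in> I \<Longrightarrow> (\<lambda>w. Z w j) \<in> borel_measurable Q" and Z0: "\<And>w j. j \<notin> I \<Longrightarrow> Z w j = 0"
    and tight: "\<And>e. 0 < e \<Longrightarrow> \<exists>\<rho>. \<forall>\<^sub>F h in F. measure (P h) {w \<in> space (P h). \<exists>j\<in>I. \<rho> < \<bar>Y h w j\<bar>} \<le> e"
    and char: "\<And>\<theta>. ((\<lambda>h. \<integral>w. cis (\<Sum>j\<in>I. \<theta> j * Y h w j) \<partial>P h) \<longlongrightarrow> (\<integral>w. cis (\<Sum>j\<in>I. \<theta> j * Z w j) \<partial>Q)) F"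
    and g: "continuous_on UNIV g" and B: "\<And>y. \<bar>g y\<bar> \<le> B"
  shows "((\<lambda>h. \<integral>w. g (Y h w) \<partial>P h) \<longlongrightarrow> (\<integral>w. g (Z w) \<partial>Q)) F"
proof -
  interpret Q: prob_space Q by fact
  have conv: "((\<lambda>h. \<integral>w. f (Y h w) \<partial>P h) \<longlongrightarrow> (\<integral>w. f (Z w) \<partial>Q)) F" if "f \<in> trig_polys I" for f
    using that
  proof induction
    case (exponential \<theta>)
    show ?case by (rule char)
  next
    case (scale f c)
    from tendsto_mult_left[OF scale.IH, of c] show ?case by simp
  next
    case (add f f')
    have "\<forall>\<^sub>F h in F. (\<integral>w. f (Y h w) \<partial>P h) + (\<integral>w. f' (Y h w) \<partial>P h) = (\<integral>w. f (Y h w) + f' (Y h w) \<partial>P h)"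
      using P Ym
    proof eventually_elim
      case (elim h)
      show ?case
        using prob_space.trig_polys_integrable[OF elim(1) add.hyps(1), of "Y h"]
          prob_space.trig_polys_integrable[OF elim(1) add.hyps(2), of "Y h"] elim(2)
        by (intro Bochner_Integration.integral_add[symmetric]) auto
    qed
    moreover have "(\<integral>w. f (Z w) \<partial>Q) + (\<integral>w. f' (Z w) \<partial>Q) = (\<integral>w. f (Z w) + f' (Z w) \<partial>Q)"
      using Q.trig_polys_integrable[OF add.hyps(1), of Z] Q.trig_polys_integrable[OF add.hyps(2), of Z] Zm
      by (intro Bochner_Integration.integral_add[symmetric]) auto
    ultimately show ?case using Lim_transform_eventually[OF tendsto_add[OF add.IH]] by simp
  qed
  have B0: "0 \<le> B" using B[of undefined] by linarith
  show ?thesis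
  proof (rule tendstoI)
    fix e :: real assume e: "0 < e"
    define \<epsilon> where "\<epsilon> = min 1 (e / 8)"
    define \<delta> where "\<delta> = e / 8 / (2 * B + 1)"
    have pos: "0 < \<epsilon>" "\<epsilon> \<le> 1" "0 < \<delta>" using e B0 by (auto simp: \<epsilon>_def \<delta>_def)
    have "c * (x / c) = x" if "0 < c" for c x :: real using that by simp
    from this[of "2 * B + 1" "e / 8"] have "(2 * B + 1) * \<delta> = e / 8"
      unfolding \<delta>_def using B0 by linarith
    then have le: "\<epsilon> + (2 * B + 1) * \<delta> \<le> e / 4" using e unfolding \<epsilon>_def by simp
    obtain \<rho>0 where \<rho>0: "\<And>\<rho>. \<rho> \<ge> \<rho>0 \<Longrightarrow> Q.prob {w \<in> space Q. \<exists>j\<in>I. \<rho> < \<bar>Z w j\<bar>} \<le> \<delta>"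
      using Q.finite_family_tight[of I Z, OF I Zm pos(3)] by blast
    obtain \<rho>1 where \<rho>1: "\<forall>\<^sub>F h in F. measure (P h) {w \<in> space (P h). \<exists>j\<in>I. \<rho>1 < \<bar>Y h w j\<bar>} \<le> \<delta>"
      using tight[OF pos(3)] by blast
    \<comment> \<open>One box, hence one q, has to serve for the limit and for the members of the
      family.\<close>
    define \<rho> where "\<rho> = max 1 (max \<rho>0 \<rho>1)"
    have \<rho>: "0 < \<rho>" "\<rho>0 \<le> \<rho>" "\<rho>1 \<le> \<rho>" by (auto simp: \<rho>_def)
    from trig_polys_approx[OF I g B \<rho>(1) pos(1)] obtain q where q: "(\<lambda>y. complex_of_real (q y)) \<in> trig_polys I"
       "\<And>y. \<bar>q y\<bar> \<le> B + \<epsilon>"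
      "\<forall>y. (\<forall>j\<in>I. \<bar>y j\<bar> \<le> \<rho>) \<and> (\<forall>j. j \<notin> I \<longrightarrow> y j = 0) \<longrightarrow> \<bar>g y - q y\<bar> \<le> \<epsilon>"
      by blast
    have close: "\<bar>(\<integral>w. g (V w) \<partial>N) - (\<integral>w. q (V w) \<partial>N)\<bar> \<le> e / 4"
      if N: "prob_space N" and V: "\<forall>j\<in>I. (\<lambda>w. V w j) \<in> borel_measurable N" "\<forall>w j. j \<notin> I \<longrightarrow> V w j = 0"
        and out: "measure N {w \<in> space N. \<exists>j\<in>I. \<rho> < \<bar>V w j\<bar>} \<le> \<delta>" for N and V :: "'z \<Rightarrow> 'i \<Rightarrow> real"
    proof -
      note * = prob_space.trig_polys_L1_close[where Y = V and \<rho> = \<rho> and \<epsilon> = \<epsilon>,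
        OF N g B q I less_imp_le[OF pos(1)] pos(2) V out]
      have "\<bar>(\<integral>w. g (V w) \<partial>N) - (\<integral>w. q (V w) \<partial>N)\<bar> = \<bar>\<integral>w. g (V w) - q (V w) \<partial>N\<bar>"
        using *(1,2) by (simp add: Bochner_Integration.integral_diff)
      also have "\<dots> \<le> (\<integral>w. \<bar>g (V w) - q (V w)\<bar> \<partial>N)" by (rule integral_abs_bound)
      finally show ?thesis using *(3) le by linarith
    qed
    have "((\<lambda>h. \<integral>w. complex_of_real (q (Y h w)) \<partial>P h) \<longlongrightarrow> (\<integral>w. complex_of_real (q (Z w)) \<partial>Q)) F"
      by (rule conv[OF q(1)])
    from tendsto_Re[OF this] have "((\<lambda>h. \<integral>w. q (Y h w) \<partial>P h) \<longlongrightarrow> (\<integral>w. q (Z w) \<partial>Q)) F" by simp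
    then have "\<forall>\<^sub>F h in F. dist (\<integral>w. q (Y h w) \<partial>P h) (\<integral>w. q (Z w) \<partial>Q) < e / 4"
      by (rule tendstoD) (use e in simp)
    then show "\<forall>\<^sub>F h in F. dist (\<integral>w. g (Y h w) \<partial>P h) (\<integral>w. g (Z w) \<partial>Q) < e"
      using P Ym \<rho>1
    proof eventually_elim
      case (elim h)
      interpret P: prob_space "P h" by (rule elim(2))
      have "P.prob {w \<in> space (P h). \<exists>j\<in>I. \<rho> < \<bar>Y h w j\<bar>} \<le> P.prob {w \<in> space (P h). \<exists>j\<in>I. \<rho>1 < \<bar>Y h w j\<bar>}"
      proof (rule P.finite_measure_mono)
        have "{w \<in> space (P h). \<exists>j\<in>I. \<rho>1 < \<bar>Y h w j\<bar>} = (\<Union>j\<in>I. {w \<in> space (P h). \<rho>1 < \<bar>Y h w j\<bar>})" by auto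
        also have "\<dots> \<in> P.events"
          using I elim(3) by (intro sets.finite_UN) (auto intro!: borel_measurable_less borel_measurable_abs)
        finally show "{w \<in> space (P h). \<exists>j\<in>I. \<rho>1 < \<bar>Y h w j\<bar>} \<in> P.events" .
      qed (use \<rho>(3) in force)
      then have c1: "\<bar>(\<integral>w. g (Y h w) \<partial>P h) - (\<integral>w. q (Y h w) \<partial>P h)\<bar> \<le> e / 4"
        using elim Y0 by (intro close) auto
      have c2: "\<bar>(\<integral>w. g (Z w) \<partial>Q) - (\<integral>w. q (Z w) \<partial>Q)\<bar> \<le> e / 4"
        using Zm Z0 \<rho>0[OF \<rho>(2)] Q by (intro close) auto
      show ?case using c1 c2 elim(1) e unfolding dist_real_def by linarith
    qed
  qed
qed

text \<open>W stands for a character of a later increment whose mean c is to split off from events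
  of the past R. The factorisation passes from exponentials to bounded continuous functions by
  \<open>trig_polys_dense\<close>, and from those to lower orthants by ramps.\<close>

lemma (in prob_space) char_factor_cylinder:
  fixes R :: "'a \<Rightarrow> 'i::countable \<Rightarrow> real" and W :: "'a \<Rightarrow> complex" and c :: real
  assumes I: "finite I" and R: "\<And>j. j \<in> I \<Longrightarrow> (\<lambda>w. R w j) \<in> borel_measurable M"
    and W: "W \<in> borel_measurable M" "\<And>w. norm (W w) \<le> 1"
    and char: "\<And>\<theta>. expectation (\<lambda>w. cis (\<Sum>j\<in>I. \<theta> j * R w j) * W w) = expectation (\<lambda>w. cis (\<Sum>j\<in>I. \<theta> j * R w j)) * c"
  shows "expectation (\<lambda>w. indicator {w\<in>space M. \<forall>j\<in>I. R w j \<le> a j} w * W w)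
    = prob {w\<in>space M. \<forall>j\<in>I. R w j \<le> a j} * c"
proof -
  define Y where "Y w = (\<lambda>j. if j \<in> I then R w j else 0)" for w
  have Ym: "\<And>j. j \<in> I \<Longrightarrow> (\<lambda>w. Y w j) \<in> borel_measurable M" and Y0: "\<And>w j. j \<notin> I \<Longrightarrow> Y w j = 0"
    using R by (auto simp: Y_def)
  have intW: "integrable M (\<lambda>w. f w * W w)" if "integrable M f" for f :: "'a \<Rightarrow> complex"
    using W by (intro Bochner_Integration.integrable_bound[OF that])
      (auto simp: norm_mult intro!: mult_left_le borel_measurable_times borel_measurable_integrable[OF that])
  have trig: "expectation (\<lambda>w. f (Y w) * W w) = expectation (\<lambda>w. f (Y w)) * c" if "f \<in> trig_polys I" for f
    using that
  proof induction
    case (exponential \<theta>)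
    then show ?case using char[of \<theta>] by (simp add: Y_def cong: sum.cong)
  next
    case (scale f b)
    then show ?case by (simp add: mult.assoc)
  next
    case (add f g)
    have i: "integrable M (\<lambda>w. f (Y w))" "integrable M (\<lambda>w. g (Y w))"
      by (rule trig_polys_integrable[of _ I Y]; use add.hyps Ym in blast)+
    show ?case using add.IH i intW[OF i(1)] intW[OF i(2)] by (simp add: distrib_right)
  qed
  have cont: "expectation (\<lambda>w. complex_of_real (g (Y w)) * W w) = expectation (\<lambda>w. g (Y w)) * c"
    if g: "continuous_on UNIV g" and B: "\<And>y. \<bar>g y\<bar> \<le> B" for g B
  proof -
    have "dist (expectation (\<lambda>w. complex_of_real (g (Y w)) * W w)) (expectation (\<lambda>w. g (Y w)) * c) \<le> 0 + e"
      if e: "0 < e" for e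
    proof -
      define e' where "e' = e / (1 + norm c)"
      have e': "0 < e'" "e' * (1 + norm c) = e"
        using e by (auto simp: e'_def add_pos_nonneg intro!: divide_pos_pos nonzero_eq_divide_eq[THEN iffD1])
      from trig_polys_dense[of I g B Y, OF I g B Ym Y0 e'(1)] obtain q where
        q: "(\<lambda>y. complex_of_real (q y)) \<in> trig_polys I"
        "integrable M (\<lambda>w. g (Y w))" "integrable M (\<lambda>w. q (Y w))"
        "expectation (\<lambda>w. \<bar>g (Y w) - q (Y w)\<bar>) \<le> e'" by blast
      have ic: "integrable M (\<lambda>w. complex_of_real (g (Y w)))" "integrable M (\<lambda>w. complex_of_real (q (Y w)))"
        using q by auto
      have "norm (expectation (\<lambda>w. complex_of_real (g (Y w)) * W w) - expectation (\<lambda>w. complex_of_real (q (Y w)) * W w))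
        = norm (expectation (\<lambda>w. complex_of_real (g (Y w)) * W w - complex_of_real (q (Y w)) * W w))"
        by (subst Bochner_Integration.integral_diff[OF intW[OF ic(1)] intW[OF ic(2)]]) simp
      also have "\<dots> \<le> expectation (\<lambda>w. norm (complex_of_real (g (Y w)) * W w - complex_of_real (q (Y w)) * W w))"
        by (rule integral_norm_bound)
      also have "\<dots> \<le> expectation (\<lambda>w. \<bar>g (Y w) - q (Y w)\<bar>)"
      proof (rule integral_mono)
        show "integrable M (\<lambda>w. norm (complex_of_real (g (Y w)) * W w - complex_of_real (q (Y w)) * W w))"
          by (intro integrable_norm Bochner_Integration.integrable_diff intW ic)
        fix w
        have "norm (complex_of_real (g (Y w)) * W w - complex_of_real (q (Y w)) * W w) = \<bar>g (Y w) - q (Y w)\<bar> * norm (W w)"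
          by (simp add: norm_mult flip: left_diff_distrib of_real_diff)
        also have "\<dots> \<le> \<bar>g (Y w) - q (Y w)\<bar>" using W(2) by (intro mult_left_le) auto
        finally show "norm (complex_of_real (g (Y w)) * W w - complex_of_real (q (Y w)) * W w) \<le> \<bar>g (Y w) - q (Y w)\<bar>" .
      qed (use q in auto)
      finally have 1: "dist (expectation (\<lambda>w. complex_of_real (g (Y w)) * W w)) (expectation (\<lambda>w. complex_of_real (q (Y w)) * W w)) \<le> e'"
        using q(4) by (simp add: dist_norm)
      have "\<bar>expectation (\<lambda>w. q (Y w)) - expectation (\<lambda>w. g (Y w))\<bar> = \<bar>expectation (\<lambda>w. g (Y w) - q (Y w))\<bar>"
        using q(2,3) by (simp add: Bochner_Integration.integral_diff)
      also have "\<dots> \<le> e'" using q(4) integral_abs_bound[of M "\<lambda>w. g (Y w) - q (Y w)"] by linarith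
      finally have "dist (expectation (\<lambda>w. q (Y w)) * c) (expectation (\<lambda>w. g (Y w)) * c) \<le> e' * norm c"
        by (simp add: dist_norm abs_mult mult_right_mono flip: left_diff_distrib of_real_diff)
      then have 2: "dist (complex_of_real (expectation (\<lambda>w. q (Y w)) * c)) (complex_of_real (expectation (\<lambda>w. g (Y w)) * c)) \<le> e' * norm c"
        by (simp only: dist_of_real)
      have 3: "expectation (\<lambda>w. complex_of_real (q (Y w)) * W w) = complex_of_real (expectation (\<lambda>w. q (Y w)) * c)"
        using trig[OF q(1)] by simp
      have "dist (expectation (\<lambda>w. complex_of_real (g (Y w)) * W w)) (complex_of_real (expectation (\<lambda>w. g (Y w)) * c)) \<le> e' + e' * norm c"
        using 1[unfolded 3] 2 by (rule order_trans[OF dist_triangle add_mono])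
      also have "\<dots> = e" using e'(2) by (simp add: algebra_simps)
      finally show ?thesis by simp
    qed
    then have "dist (expectation (\<lambda>w. complex_of_real (g (Y w)) * W w)) (expectation (\<lambda>w. g (Y w)) * c) \<le> 0"
      by (rule field_le_epsilon)
    then show ?thesis by simp
  qed
  \<comment> \<open>For positive n a ramp from 1 at 0 to 0 at 1/n; the products decrease to the
    indicator of the closed orthant.\<close>
  define \<phi> where "\<phi> n t = max 0 (min 1 (1 - real n * t))" for n and t :: real
  define g where "g n y = (\<Prod>j\<in>I. \<phi> n (y j - a j))" for n and y :: "'i \<Rightarrow> real"
  let ?A = "{w\<in>space M. \<forall>j\<in>I. R w j \<le> a j}"
  have \<phi>: "0 \<le> \<phi> n t" "\<phi> n t \<le> 1" for n t by (auto simp: \<phi>_def)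
  have gb: "\<bar>g n y\<bar> \<le> 1" for n y
    unfolding g_def abs_prod using \<phi> by (intro prod_le_1) auto
  have gc: "continuous_on UNIV (g n)" for n
    unfolding g_def \<phi>_def
    by (intro continuous_intros continuous_on_product_coordinates)
  have lim: "(\<lambda>n. g n (Y w)) \<longlonglongrightarrow> indicator ?A w" if "w \<in> space M" for w
  proof -
    have "(\<lambda>n. \<phi> n t) \<longlonglongrightarrow> (if t \<le> 0 then 1 else 0)" for t
    proof (cases "t \<le> 0")
      case True
      then have "\<phi> n t = 1" for n by (auto simp: \<phi>_def mult_nonneg_nonpos)
      with True show ?thesis by simp
    next
      case False
      then obtain n0 where n0: "1 / t < real n0" using reals_Archimedean2 by blast
      have "\<forall>\<^sub>F n in sequentially. \<phi> n t = 0"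
        using eventually_ge_at_top[of n0]
      proof eventually_elim
        case (elim n)
        then have "1 / t < real n" using n0 by simp
        then show ?case using False by (simp add: \<phi>_def field_simps)
      qed
      with False show ?thesis by (simp add: tendsto_eventually)
    qed
    then have "(\<lambda>n. g n (Y w)) \<longlonglongrightarrow> (\<Prod>j\<in>I. if Y w j - a j \<le> 0 then 1 else 0)"
      unfolding g_def by (intro tendsto_prod)
    also have "(\<Prod>j\<in>I. if Y w j - a j \<le> 0 then 1 else 0) = (indicator ?A w :: real)"
      using I that by (auto simp: indicator_def Y_def prod_zero_iff intro!: prod.neutral)
    finally show ?thesis .
  qed
  have "?A = {w\<in>space M. \<forall>j\<in>I. Y w j \<le> a j}" by (auto simp: Y_def)
  have A: "?A \<in> events"
    using I R by (intro sets.sets_Collect_finite_All borel_measurable_le) auto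
  have gm: "(\<lambda>w. g n (Y w)) \<in> borel_measurable M" for n
    by (rule borel_measurable_continuous_product[OF gc Ym Y0])
  have "(\<lambda>n. expectation (\<lambda>w. complex_of_real (g n (Y w)) * W w)) \<longlonglongrightarrow> expectation (\<lambda>w. complex_of_real (indicator ?A w) * W w)"
  proof (rule integral_dominated_convergence[where w = "\<lambda>_. 1"])
    show "AE x in M. (\<lambda>i. complex_of_real (g i (Y x)) * W x) \<longlonglongrightarrow> complex_of_real (indicator ?A x) * W x"
      using lim by (intro AE_I2 tendsto_mult tendsto_of_real tendsto_const) auto
    show "AE x in M. norm (complex_of_real (g i (Y x)) * W x) \<le> 1" for i
      using gb W(2) by (intro AE_I2) (simp add: norm_mult mult_le_one)
  qed (use A gm W in auto)
  moreover have "(\<lambda>n. complex_of_real (expectation (\<lambda>w. g n (Y w)) * c)) \<longlonglongrightarrow> complex_of_real (expectation (indicator ?A) * c)"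
  proof (intro tendsto_of_real tendsto_mult tendsto_const)
    show "(\<lambda>n. expectation (\<lambda>w. g n (Y w))) \<longlonglongrightarrow> expectation (indicator ?A)"
      by (rule integral_dominated_convergence[where w = "\<lambda>_. 1"]) (use A gm gb lim in auto)
  qed
  ultimately have "expectation (\<lambda>w. complex_of_real (indicator ?A w) * W w) = complex_of_real (expectation (indicator ?A) * c)"
    using cont[OF gc gb] by (simp add: LIMSEQ_unique)
  moreover have "complex_of_real (indicator ?A w) = indicator ?A w" for w by (simp add: indicator_def)
  ultimately show ?thesis using A by simp
qed

section \<open>Brownian motion and existence of weak solutions\<close>

definition gaussian_noise :: "(nat \<Rightarrow> real) measure" where
  "gaussian_noise = (\<Pi>\<^sub>M i\<in>UNIV. std_normal_distribution)"

lemma prob_space_std_normal: "prob_space std_normal_distribution"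
  by (rule prob_space_normal_density) simp

interpretation noise: prob_space gaussian_noise
  unfolding gaussian_noise_def by (intro prob_space_PiM prob_space_std_normal)

lemma measurable_gaussian_noise_component [measurable]: "(\<lambda>z. z e) \<in> borel_measurable gaussian_noise"
proof -
  have "(\<lambda>z. z e) \<in> gaussian_noise \<rightarrow>\<^sub>M std_normal_distribution"
    unfolding gaussian_noise_def by (rule measurable_component_singleton) simp
  then show ?thesis by (simp cong: measurable_cong_sets)
qed

lemma indep_vars_gaussian_noise:
  "noise.indep_vars (\<lambda>_. std_normal_distribution) (\<lambda>e z. z e) UNIV"
proof (subst noise.indep_vars_iff_distr_eq_PiM)
  show "(\<lambda>z. z i) \<in> gaussian_noise \<rightarrow>\<^sub>M std_normal_distribution" for i
    unfolding gaussian_noise_def by (rule measurable_component_singleton) simp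
  have "distr gaussian_noise (\<Pi>\<^sub>M i\<in>UNIV. std_normal_distribution) (\<lambda>x. \<lambda>i\<in>UNIV. x i) = gaussian_noise"
    by (simp add: gaussian_noise_def distr_id2 restrict_def)
  also have "\<dots> = (\<Pi>\<^sub>M i\<in>UNIV. distr gaussian_noise std_normal_distribution (\<lambda>z. z i))"
    unfolding gaussian_noise_def
    by (intro PiM_cong refl distr_PiM_component[symmetric] prob_space_std_normal) simp
  finally show "distr gaussian_noise (\<Pi>\<^sub>M i\<in>UNIV. std_normal_distribution) (\<lambda>x. \<lambda>i\<in>UNIV. x i)
     = (\<Pi>\<^sub>M i\<in>UNIV. distr gaussian_noise std_normal_distribution (\<lambda>z. z i))" .
qed simp

text \<open>Independence makes the characteristic function a product, and only the sum of squared
  coefficients survives. Joint laws of dyadic increments are therefore found by tracking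
  coefficients.\<close>

lemma char_gaussian_linear_form:
  assumes "finite E"
  shows "noise.expectation (\<lambda>z. cis (\<Sum>e\<in>E. c e * z e)) = complex_of_real (exp (- (\<Sum>e\<in>E. (c e)\<^sup>2) / 2))"
proof -
  have ind: "noise.indep_vars (\<lambda>_. borel) (\<lambda>e z. c e * z e) E"
    by (rule noise.indep_vars_subset[OF noise.indep_vars_compose2[OF indep_vars_gaussian_noise]])
      (auto intro!: borel_measurable_times)
  have single: "char (distr gaussian_noise borel (\<lambda>z. c e * z e)) 1 = complex_of_real (exp (- (c e)\<^sup>2 / 2))" for e
  proof -
    have "distr gaussian_noise std_normal_distribution (\<lambda>z. z e) = std_normal_distribution"
      unfolding gaussian_noise_def by (intro distr_PiM_component prob_space_std_normal) simp
    moreover have "(\<lambda>z. z e) \<in> gaussian_noise \<rightarrow>\<^sub>M std_normal_distribution"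
      unfolding gaussian_noise_def by (rule measurable_component_singleton) simp
    then have "(CLINT x|distr gaussian_noise std_normal_distribution (\<lambda>z. z e). iexp (c e * x)) = (CLINT z|gaussian_noise. iexp (c e * z e))"
      by (rule integral_distr) simp
    moreover have "char (distr gaussian_noise borel (\<lambda>z. c e * z e)) 1 = (CLINT z|gaussian_noise. iexp (c e * z e))"
      by (simp add: char_def integral_distr)
    ultimately have "char (distr gaussian_noise borel (\<lambda>z. c e * z e)) 1 = char std_normal_distribution (c e)"
      by (simp add: char_def)
    then show ?thesis by (simp add: char_std_normal_distribution)
  qed
  have "noise.expectation (\<lambda>z. cis (\<Sum>e\<in>E. c e * z e)) = char (distr gaussian_noise borel (\<lambda>z. \<Sum>e\<in>E. c e * z e)) 1"
    by (simp add: char_def integral_distr cis_conv_exp)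
  also have "\<dots> = (\<Prod>e\<in>E. char (distr gaussian_noise borel (\<lambda>z. c e * z e)) 1)"
    by (rule noise.char_distr_sum[OF ind])
  also have "\<dots> = complex_of_real (exp (- (\<Sum>e\<in>E. (c e)\<^sup>2) / 2))"
  proof -
    have "(\<Sum>e\<in>E. - (c e)\<^sup>2 / 2) = - (\<Sum>e\<in>E. (c e)\<^sup>2) / 2"
      by (simp add: sum_negf sum_divide_distrib)
    then show ?thesis
      unfolding single of_real_prod[symmetric] exp_sum[OF assms, symmetric] by (simp only:)
  qed
  finally show ?thesis .
qed

text \<open>Levy's midpoint construction: an increment over a dyadic interval of length \<open>S / 2^n\<close> is split into
  two independent halves by adding and subtracting a fresh Gaussian.\<close>

fun dyadic_incr :: "real \<Rightarrow> (nat \<Rightarrow> real) \<Rightarrow> nat \<Rightarrow> nat \<Rightarrow> real" where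
  "dyadic_incr S z 0 k = sqrt S * z (prod_encode (0, 0))"
| "dyadic_incr S z (Suc n) k = (dyadic_incr S z n (k div 2)
     + (if even k then 1 else -1) * (sqrt (S / 2 ^ n) * z (prod_encode (Suc n, k div 2)))) / 2"

lemma sum_lessThan_double: "(\<Sum>k<2 * (m::nat). f k) = (\<Sum>k<m. f (2 * k) + f (2 * k + 1) :: 'a::comm_monoid_add)"
  by (induction m) (auto simp: add.assoc)

text \<open>Following an arbitrary linear combination yields the joint law at once: by the
  parallelogram identity the squared coefficients add up to those of independent increments of
  variance S/2^n. The bound on the levels occurring in E ensures that the Gaussians of the next
  level are fresh.\<close>

lemma dyadic_incr_linear_form:
  assumes S: "0 < S"
  shows "\<exists>E c. finite E \<and> (\<forall>e\<in>E. fst (prod_decode e) \<le> n) \<and>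
    (\<forall>z. (\<Sum>k<2 ^ n. \<theta> k * dyadic_incr S z n k) = (\<Sum>e\<in>E. c e * z e)) \<and>
    (\<Sum>e\<in>E. (c e)\<^sup>2) = S / 2 ^ n * (\<Sum>k<2 ^ n. (\<theta> k)\<^sup>2)"
proof (induction n arbitrary: \<theta>)
  case 0
  show ?case
    by (rule exI[of _ "{prod_encode (0, 0)}"], rule exI[of _ "\<lambda>_. \<theta> 0 * sqrt S"])
      (use S in \<open>simp add: power_mult_distrib\<close>)
next
  case (Suc n)
  obtain E c where E: "finite E" "\<And>e. e \<in> E \<Longrightarrow> fst (prod_decode e) \<le> n"
    "\<And>z. (\<Sum>k<2 ^ n. (\<theta> (2 * k) + \<theta> (2 * k + 1)) / 2 * dyadic_incr S z n k) = (\<Sum>e\<in>E. c e * z e)"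
    "(\<Sum>e\<in>E. (c e)\<^sup>2) = S / 2 ^ n * (\<Sum>k<2 ^ n. ((\<theta> (2 * k) + \<theta> (2 * k + 1)) / 2)\<^sup>2)"
    using Suc[of "\<lambda>k. (\<theta> (2 * k) + \<theta> (2 * k + 1)) / 2"] by blast
  \<comment> \<open>Coefficient with which the fresh Gaussian enters the two halves with opposite
    signs; half the sum of the two frequencies goes to the parent increment.\<close>
  define d where "d k = sqrt (S / 2 ^ n) * ((\<theta> (2 * k) - \<theta> (2 * k + 1)) / 2)" for k
  define J where "J = (\<lambda>k. prod_encode (Suc n, k)) ` {..<2 ^ n}"
  define c' where "c' e = (if e \<in> E then c e else d (snd (prod_decode e)))" for e
  have disj: "E \<inter> J = {}" using E(2) by (force simp: J_def)
  have inj: "inj_on (\<lambda>k. prod_encode (Suc n, k)) {..<2 ^ n}" by (auto simp: inj_on_def)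
  have sumJ: "(\<Sum>e\<in>J. f (c' e) e) = (\<Sum>k<2 ^ n. f (d k) (prod_encode (Suc n, k)))" for f :: "real \<Rightarrow> nat \<Rightarrow> real"
  proof -
    have "(\<Sum>e\<in>J. f (c' e) e) = (\<Sum>e\<in>J. f (d (snd (prod_decode e))) e)"
      using disj by (intro sum.cong) (auto simp: c'_def)
    also have "\<dots> = (\<Sum>k<2 ^ n. f (d k) (prod_encode (Suc n, k)))"
      unfolding J_def by (subst sum.reindex[OF inj]) simp
    finally show ?thesis .
  qed
  have sumU: "(\<Sum>e\<in>E \<union> J. f (c' e) e) = (\<Sum>e\<in>E. f (c e) e) + (\<Sum>k<2 ^ n. f (d k) (prod_encode (Suc n, k)))"
    for f :: "real \<Rightarrow> nat \<Rightarrow> real"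
    using E(1) disj sumJ[of f] by (subst sum.union_disjoint) (auto simp: J_def c'_def)
  show ?case
  proof (rule exI[of _ "E \<union> J"], rule exI[of _ c'], intro conjI allI)
    show "finite (E \<union> J)" using E(1) by (simp add: J_def)
    show "\<forall>e\<in>E \<union> J. fst (prod_decode e) \<le> Suc n" using E(2) by (force simp: J_def)
    fix z
    have "(\<Sum>k<2 ^ Suc n. \<theta> k * dyadic_incr S z (Suc n) k)
      = (\<Sum>k<2 ^ n. \<theta> (2 * k) * dyadic_incr S z (Suc n) (2 * k) + \<theta> (2 * k + 1) * dyadic_incr S z (Suc n) (2 * k + 1))"
      unfolding power_Suc by (rule sum_lessThan_double)
    also have "\<dots> = (\<Sum>k<2 ^ n. (\<theta> (2 * k) + \<theta> (2 * k + 1)) / 2 * dyadic_incr S z n k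
        + d k * z (prod_encode (Suc n, k)))"
      by (intro sum.cong refl) (simp add: d_def field_simps)
    also have "\<dots> = (\<Sum>e\<in>E \<union> J. c' e * z e)"
      using sumU[of "\<lambda>c e. c * z e"] E(3) by (simp add: sum.distrib)
    finally show "(\<Sum>k<2 ^ Suc n. \<theta> k * dyadic_incr S z (Suc n) k) = (\<Sum>e\<in>E \<union> J. c' e * z e)" .
  next
    have "(\<Sum>e\<in>E \<union> J. (c' e)\<^sup>2) = (\<Sum>e\<in>E. (c e)\<^sup>2) + (\<Sum>k<2 ^ n. (d k)\<^sup>2)"
      using sumU[of "\<lambda>c e. c\<^sup>2"] by simp
    also have "\<dots> = (\<Sum>k<2 ^ n. S / 2 ^ n * ((\<theta> (2 * k) + \<theta> (2 * k + 1)) / 2)\<^sup>2 + S / 2 ^ n * ((\<theta> (2 * k) - \<theta> (2 * k + 1)) / 2)\<^sup>2)"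
    proof -
      have "(d k)\<^sup>2 = S / 2 ^ n * ((\<theta> (2 * k) - \<theta> (2 * k + 1)) / 2)\<^sup>2" for k
        unfolding d_def power_mult_distrib using S by simp
      then show ?thesis unfolding E(4) by (simp add: sum.distrib sum_distrib_left)
    qed
    also have "\<dots> = (\<Sum>k<2 ^ n. S / 2 ^ Suc n * ((\<theta> (2 * k))\<^sup>2 + (\<theta> (2 * k + 1))\<^sup>2))"
      by (intro sum.cong refl) (simp add: power2_eq_square field_simps)
    also have "\<dots> = S / 2 ^ Suc n * (\<Sum>k<2 ^ Suc n. (\<theta> k)\<^sup>2)"
      unfolding power_Suc sum_lessThan_double sum_distrib_left[symmetric] ..
    finally show "(\<Sum>e\<in>E \<union> J. (c' e)\<^sup>2) = S / 2 ^ Suc n * (\<Sum>k<2 ^ Suc n. (\<theta> k)\<^sup>2)" .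
  qed
qed

lemma char_dyadic_incr:
  assumes S: "0 < S"
  shows "noise.expectation (\<lambda>z. cis (\<Sum>k<2 ^ n. \<theta> k * dyadic_incr S z n k))
    = complex_of_real (exp (- (S / 2 ^ n * (\<Sum>k<2 ^ n. (\<theta> k)\<^sup>2)) / 2))"
proof -
  obtain E c where E: "finite E"
    "\<And>z. (\<Sum>k<2 ^ n. \<theta> k * dyadic_incr S z n k) = (\<Sum>e\<in>E. c e * z e)"
    "(\<Sum>e\<in>E. (c e)\<^sup>2) = S / 2 ^ n * (\<Sum>k<2 ^ n. (\<theta> k)\<^sup>2)"
    using dyadic_incr_linear_form[OF S, where n = n and \<theta> = \<theta>] by blast
  show ?thesis using char_gaussian_linear_form[OF E(1), of c] by (simp only: E(2,3))
qed

lemma measurable_dyadic_incr [measurable]: "(\<lambda>z. dyadic_incr S z n k) \<in> borel_measurable gaussian_noise"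
  by (induction n arbitrary: k) auto

lemma char_normal_scaled:
  assumes "0 \<le> \<sigma>"
  shows "char (distr std_normal_distribution borel (\<lambda>x. \<sigma> * x)) u = complex_of_real (exp (- (u\<^sup>2 * \<sigma>\<^sup>2) / 2))"
proof -
  have "char (distr std_normal_distribution borel (\<lambda>x. \<sigma> * x)) u = char std_normal_distribution (u * \<sigma>)"
    by (simp add: char_def integral_distr mult_ac)
  then show ?thesis by (simp add: char_std_normal_distribution power_mult_distrib)
qed

lemma real_distribution_normal_scaled: "real_distribution (distr std_normal_distribution borel (\<lambda>x. \<sigma> * x))"
  by (intro prob_space.real_distribution_distr prob_space_std_normal) simp

lemma distr_dyadic_incr:
  assumes S: "0 < S" and k: "k < 2 ^ n"
  shows "distr gaussian_noise borel (\<lambda>z. dyadic_incr S z n k)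
    = distr std_normal_distribution borel (\<lambda>x. sqrt (S / 2 ^ n) * x)"
proof (rule Levy_uniqueness)
  show "real_distribution (distr gaussian_noise borel (\<lambda>z. dyadic_incr S z n k))"
    by (rule noise.real_distribution_distr) simp
  show "char (distr gaussian_noise borel (\<lambda>z. dyadic_incr S z n k)) = char (distr std_normal_distribution borel (\<lambda>x. sqrt (S / 2 ^ n) * x))"
  proof
    fix u
    have 1: "(\<Sum>j<2 ^ n. (if j = k then u else 0) * dyadic_incr S z n j) = u * dyadic_incr S z n k" for z
      using k by (simp add: if_distrib[of "\<lambda>x. x * _"] cong: if_cong)
    have 2: "(\<Sum>j<2 ^ n. (if j = k then u else 0)\<^sup>2) = u\<^sup>2"
      using k by (simp add: if_distrib[of "\<lambda>x. x\<^sup>2"] cong: if_cong)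
    have "char (distr gaussian_noise borel (\<lambda>z. dyadic_incr S z n k)) u = noise.expectation (\<lambda>z. cis (u * dyadic_incr S z n k))"
      by (simp add: char_def integral_distr cis_conv_exp)
    also have "\<dots> = complex_of_real (exp (- (S / 2 ^ n * u\<^sup>2) / 2))"
      using char_dyadic_incr[OF S, where n = n and \<theta> = "\<lambda>j. if j = k then u else 0"] by (simp only: 1 2)
    also have "\<dots> = char (distr std_normal_distribution borel (\<lambda>x. sqrt (S / 2 ^ n) * x)) u"
      using S by (subst char_normal_scaled) (auto simp: mult_ac)
    finally show "char (distr gaussian_noise borel (\<lambda>z. dyadic_incr S z n k)) u = char (distr std_normal_distribution borel (\<lambda>x. sqrt (S / 2 ^ n) * x)) u" .
  qed
qed (rule real_distribution_normal_scaled)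

text \<open>Markov's inequality for fourth moments. With second moments the union bound over the 2^n
  increments of a level would not be summable for thresholds tending to 0.\<close>

lemma prob_dyadic_incr_large:
  assumes S: "0 < S" and k: "k < 2 ^ n" and r: "0 < r"
  shows "noise.prob {z \<in> space gaussian_noise. r < \<bar>dyadic_incr S z n k\<bar>} \<le> 3 * (S / 2 ^ n)\<^sup>2 / r ^ 4"
proof -
  let ?\<sigma> = "sqrt (S / 2 ^ n)"
  have "noise.prob {z \<in> space gaussian_noise. r < \<bar>dyadic_incr S z n k\<bar>}
    = measure (distr gaussian_noise borel (\<lambda>z. dyadic_incr S z n k)) {y. r < \<bar>y\<bar>}"
    by (subst measure_distr) (auto simp: vimage_def Int_def conj_commute)
  also have "\<dots> = measure std_normal_distribution {x. r < \<bar>?\<sigma> * x\<bar>}"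
    unfolding distr_dyadic_incr[OF S k] by (subst measure_distr) (auto simp: vimage_def)
  also have "\<dots> \<le> measure std_normal_distribution {x \<in> space std_normal_distribution. (r / ?\<sigma>) ^ 4 \<le> x ^ 4}"
  proof (rule finite_measure.finite_measure_mono)
    show "finite_measure std_normal_distribution"
      by (rule prob_space.finite_measure[OF prob_space_std_normal])
    show "{x. r < \<bar>?\<sigma> * x\<bar>} \<subseteq> {x \<in> space std_normal_distribution. (r / ?\<sigma>) ^ 4 \<le> x ^ 4}"
    proof safe
      fix x assume "r < \<bar>?\<sigma> * x\<bar>"
      then have "r / ?\<sigma> \<le> \<bar>x\<bar>" using S by (simp add: abs_mult field_simps)
      then have "(r / ?\<sigma>) ^ 4 \<le> \<bar>x\<bar> ^ 4" using r S by (intro power_mono) auto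
      then show "(r / ?\<sigma>) ^ 4 \<le> x ^ 4" by simp
    qed simp
  qed simp
  also have "\<dots> \<le> (LINT x|std_normal_distribution. x ^ 4) / (r / ?\<sigma>) ^ 4"
    using std_normal_distribution_even_moments(2)[of 2] r S
    by (intro integral_Markov_inequality_measure[where A = "{}"]) auto
  also have "(LINT x|std_normal_distribution. x ^ 4) = 3"
    using std_normal_distribution_even_moments(1)[of 2] by (simp add: fact_numeral)
  also have "3 / (r / ?\<sigma>) ^ 4 = 3 * (S / 2 ^ n)\<^sup>2 / r ^ 4"
  proof -
    have "?\<sigma> ^ 4 = (?\<sigma>\<^sup>2)\<^sup>2" by simp
    also have "\<dots> = (S / 2 ^ n)\<^sup>2" using S by simp
    finally have "?\<sigma> ^ 4 = (S / 2 ^ n)\<^sup>2" .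
    moreover have "(r / ?\<sigma>) ^ 4 = r ^ 4 / ?\<sigma> ^ 4" by (rule power_divide)
    ultimately show ?thesis by (simp only: divide_divide_eq_right)
  qed
  finally show ?thesis .
qed

text \<open>The 10 is 1/(1 - 9/10), from the tail of the geometric series.\<close>

lemma geometric_increments_converge:
  fixes a :: "nat \<Rightarrow> real"
  assumes "\<And>n. n0 \<le> n \<Longrightarrow> \<bar>a (Suc n) - a n\<bar> \<le> (9 / 10) ^ Suc n"
  shows "a \<longlonglongrightarrow> lim a" "\<And>n. n0 \<le> n \<Longrightarrow> \<bar>lim a - a n\<bar> \<le> 10 * (9 / 10) ^ n"
proof -
  have *: "\<bar>a m - a n\<bar> \<le> 10 * ((9 / 10) ^ n - (9 / 10) ^ m)" if "n0 \<le> n" "n \<le> m" for n m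
    using that(2)
  proof (induction m rule: dec_induct)
    case (step m)
    have "\<bar>a (Suc m) - a m\<bar> \<le> (9 / 10) ^ Suc m" using assms step that by simp
    moreover have "0 \<le> (9 / 10 :: real) ^ m" by simp
    moreover have "\<bar>x - w\<bar> \<le> 10 * (p - 9 / 10 * q)"
      if "\<bar>x - y\<bar> \<le> 9 / 10 * q" "0 \<le> q" "\<bar>y - w\<bar> \<le> 10 * (p - q)" for x y w p q :: real
      using that abs_triangle_ineq[of "x - y" "y - w"] by simp
    ultimately show ?case using step.IH unfolding power_Suc by blast
  qed simp
  have le: "\<bar>a m - a n\<bar> \<le> 10 * (9 / 10) ^ n" if "n0 \<le> n" "n \<le> m" for n m
  proof -
    have "0 \<le> (9 / 10 :: real) ^ m" by simp
    with *[OF that] show ?thesis unfolding right_diff_distrib by linarith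
  qed
  have "Cauchy a"
  proof (rule metric_CauchyI)
    fix e :: real assume e: "0 < e"
    have "(\<lambda>n. 10 * (9 / 10 :: real) ^ n) \<longlonglongrightarrow> 10 * 0" by (intro tendsto_intros LIMSEQ_realpow_zero) auto
    then have "\<forall>\<^sub>F n in sequentially. 10 * (9 / 10 :: real) ^ n < e / 2"
      by (rule order_tendstoD) (use e in auto)
    then have "\<forall>\<^sub>F n in sequentially. 10 * (9 / 10 :: real) ^ n < e / 2 \<and> n0 \<le> n"
      using eventually_ge_at_top by (rule eventually_conj)
    from eventually_happens'[OF sequentially_bot this] obtain n where n: "10 * (9 / 10 :: real) ^ n < e / 2" "n0 \<le> n" by blast
    show "\<exists>M. \<forall>m\<ge>M. \<forall>k\<ge>M. dist (a m) (a k) < e"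
    proof (intro exI[of _ n] allI impI)
      fix m k assume "n \<le> m" "n \<le> k"
      then show "dist (a m) (a k) < e" using le[OF n(2), of m] le[OF n(2), of k] n(1) by (simp add: dist_real_def)
    qed
  qed
  then show lim: "a \<longlonglongrightarrow> lim a" by (simp add: Cauchy_convergent_iff convergent_LIMSEQ_iff)
  show "\<bar>lim a - a n\<bar> \<le> 10 * (9 / 10) ^ n" if "n0 \<le> n" for n
  proof (rule LIMSEQ_le_const2)
    show "(\<lambda>m. \<bar>a m - a n\<bar>) \<longlonglongrightarrow> \<bar>lim a - a n\<bar>" by (intro tendsto_intros lim)
    show "\<exists>N. \<forall>m\<ge>N. \<bar>a m - a n\<bar> \<le> 10 * (9 / 10) ^ n" using le[OF that] by blast
  qed
qed

definition dyadic_index :: "real \<Rightarrow> nat \<Rightarrow> real \<Rightarrow> nat" where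
  "dyadic_index S n t = nat \<lfloor>2 ^ n * t / S\<rfloor>"

definition dyadic_walk :: "real \<Rightarrow> (nat \<Rightarrow> real) \<Rightarrow> nat \<Rightarrow> real \<Rightarrow> real" where
  "dyadic_walk S z n t = (\<Sum>k<dyadic_index S n t. dyadic_incr S z n k)"

text \<open>The ratio 9/10 lies below 1, for uniform convergence, and above 2^(-1/4), for a
  convergent Borel-Cantelli sum.\<close>

definition small_incr :: "real \<Rightarrow> (nat \<Rightarrow> real) \<Rightarrow> bool" where
  "small_incr S z \<longleftrightarrow> (\<exists>n0. \<forall>n\<ge>n0. \<forall>k<2 ^ n. \<bar>dyadic_incr S z n k\<bar> \<le> (9 / 10) ^ n)"

text \<open>Set to 0 on the exceptional null set, so that every path is continuous, as
  \<open>brownian_motion\<close> demands.\<close>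

definition brownian_path :: "real \<Rightarrow> (nat \<Rightarrow> real) \<Rightarrow> real \<Rightarrow> real" where
  "brownian_path S z t = (if small_incr S z then lim (\<lambda>n. dyadic_walk S z n t) else 0)"

lemma dyadic_index_bounds:
  assumes "0 < S" "0 \<le> t"
  shows "real (dyadic_index S n t) \<le> 2 ^ n * t / S" "2 ^ n * t / S < real (dyadic_index S n t) + 1"
proof -
  have "0 \<le> 2 ^ n * t / S" using assms by simp
  then have eq: "real (dyadic_index S n t) = of_int \<lfloor>2 ^ n * t / S\<rfloor>" by (simp add: dyadic_index_def)
  show "real (dyadic_index S n t) \<le> 2 ^ n * t / S" "2 ^ n * t / S < real (dyadic_index S n t) + 1"
    unfolding eq by linarith+
qed

lemma dyadic_index_less:
  assumes "0 \<le> t" "t < S"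
  shows "dyadic_index S n t < 2 ^ n"
proof -
  have "real (dyadic_index S n t) \<le> 2 ^ n * t / S" using dyadic_index_bounds(1)[of S t n] assms by auto
  also have "\<dots> < 2 ^ n" using assms by (simp add: pos_divide_less_eq)
  finally show ?thesis by (metis of_nat_less_iff of_nat_numeral of_nat_power)
qed

lemma dyadic_index_mono: "0 < S \<Longrightarrow> s \<le> t \<Longrightarrow> dyadic_index S n s \<le> dyadic_index S n t"
  unfolding dyadic_index_def by (intro nat_mono floor_mono divide_right_mono) auto

lemma dyadic_index_tendsto:
  assumes "0 < S" "0 \<le> t"
  shows "(\<lambda>n. S / 2 ^ n * real (dyadic_index S n t)) \<longlonglongrightarrow> t"
proof (rule tendsto_sandwich)
  have "(\<lambda>n. t - S * (1 / 2) ^ n) \<longlonglongrightarrow> t - S * 0"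
    by (intro tendsto_intros LIMSEQ_realpow_zero) auto
  then show "(\<lambda>n. t - S * (1 / 2) ^ n) \<longlonglongrightarrow> t" by simp
  show "\<forall>\<^sub>F n in sequentially. t - S * (1 / 2) ^ n \<le> S / 2 ^ n * real (dyadic_index S n t)"
  proof (intro always_eventually allI)
    fix n
    have "2 ^ n * t < (real (dyadic_index S n t) + 1) * S"
      using dyadic_index_bounds(2)[OF assms, of n] assms by (simp add: pos_divide_less_eq)
    then have "t < (real (dyadic_index S n t) + 1) * S / 2 ^ n" by (simp add: pos_less_divide_eq mult.commute)
    also have "\<dots> = S / 2 ^ n * real (dyadic_index S n t) + S * (1 / 2) ^ n"
      by (simp add: power_divide distrib_right add_divide_distrib)
    finally show "t - S * (1 / 2) ^ n \<le> S / 2 ^ n * real (dyadic_index S n t)" by simp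
  qed
  show "\<forall>\<^sub>F n in sequentially. S / 2 ^ n * real (dyadic_index S n t) \<le> t"
  proof (intro always_eventually allI)
    fix n
    have "real (dyadic_index S n t) * S \<le> 2 ^ n * t"
      using dyadic_index_bounds(1)[OF assms, of n] assms by (simp add: pos_le_divide_eq)
    then show "S / 2 ^ n * real (dyadic_index S n t) \<le> t" by (simp add: field_simps)
  qed
qed simp

lemma dyadic_index_Suc:
  assumes "0 < S" "0 \<le> t"
  shows "dyadic_index S (Suc n) t = 2 * dyadic_index S n t \<or> dyadic_index S (Suc n) t = 2 * dyadic_index S n t + 1"
proof -
  note b = dyadic_index_bounds[OF assms]
  have "2 ^ Suc n * t / S = 2 * (2 ^ n * t / S)" by simp
  with b[of n] b[of "Suc n"] have "real (dyadic_index S (Suc n) t) < real (2 * dyadic_index S n t + 2)"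
    "real (2 * dyadic_index S n t) < real (dyadic_index S (Suc n) t + 1)" by (simp_all only: of_nat_add of_nat_mult of_nat_numeral of_nat_1)
  then have "dyadic_index S (Suc n) t < 2 * dyadic_index S n t + 2" "2 * dyadic_index S n t < dyadic_index S (Suc n) t + 1"
    by (simp_all only: of_nat_less_iff)
  then show ?thesis by linarith
qed

lemma sum_dyadic_incr_Suc:
  "(\<Sum>k<2 * m. dyadic_incr S z (Suc n) k) = (\<Sum>k<m. dyadic_incr S z n k)"
  unfolding sum_lessThan_double by (intro sum.cong refl) (simp add: field_simps)

context
  fixes S :: real and z :: "nat \<Rightarrow> real" and n0 :: nat
  assumes S: "0 < S" and small: "\<And>n k. n0 \<le> n \<Longrightarrow> k < 2 ^ n \<Longrightarrow> \<bar>dyadic_incr S z n k\<bar> \<le> (9 / 10) ^ n"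
begin

text \<open>The two halves of a dyadic increment add up to it, so refining the grid changes the walk
  at t by at most one increment of the new level.\<close>

lemma dyadic_walk_Suc_close:
  assumes t: "0 \<le> t" "t < S" and n: "n0 \<le> n"
  shows "\<bar>dyadic_walk S z (Suc n) t - dyadic_walk S z n t\<bar> \<le> (9 / 10) ^ Suc n"
  using dyadic_index_Suc[OF S t(1), of n]
proof
  assume "dyadic_index S (Suc n) t = 2 * dyadic_index S n t"
  then show ?thesis unfolding dyadic_walk_def by (simp only: sum_dyadic_incr_Suc) simp
next
  assume eq: "dyadic_index S (Suc n) t = 2 * dyadic_index S n t + 1"
  have "dyadic_walk S z (Suc n) t - dyadic_walk S z n t = dyadic_incr S z (Suc n) (2 * dyadic_index S n t)"
    unfolding dyadic_walk_def eq using sum_dyadic_incr_Suc[of S z n "dyadic_index S n t"]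
    by (simp only: Suc_eq_plus1[symmetric] sum.lessThan_Suc)
  moreover have "2 * dyadic_index S n t < 2 ^ Suc n" using dyadic_index_less[OF t, of "Suc n"] eq by linarith
  ultimately show ?thesis using small[of "Suc n" "2 * dyadic_index S n t"] n by (simp only:)
qed

lemma small_incr_context: "small_incr S z"
  unfolding small_incr_def using small by blast

lemma
  assumes t: "0 \<le> t" "t < S"
  shows dyadic_walk_tendsto: "(\<lambda>n. dyadic_walk S z n t) \<longlonglongrightarrow> brownian_path S z t"
    and brownian_path_close: "n0 \<le> n \<Longrightarrow> \<bar>brownian_path S z t - dyadic_walk S z n t\<bar> \<le> 10 * (9 / 10) ^ n"
  using geometric_increments_converge[of n0 "\<lambda>n. dyadic_walk S z n t", OF dyadic_walk_Suc_close[OF t]] small_incr_context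
  by (auto simp: brownian_path_def)

text \<open>At level n the indices of s and t differ by at most one, and so do the walks by at most
  one increment; 21 is 10 + 1 + 10, with the distance between path and walk counted at both
  times.\<close>

lemma brownian_path_modulus:
  assumes st: "0 \<le> s" "s \<le> t" "t < S" and n: "n0 \<le> n" and close: "t - s \<le> S / 2 ^ n"
  shows "\<bar>brownian_path S z t - brownian_path S z s\<bar> \<le> 21 * (9 / 10) ^ n"
proof -
  have "2 ^ n * t / S \<le> 2 ^ n * s / S + 1"
  proof -
    have "2 ^ n * (t - s) \<le> S" using close by (simp add: field_simps)
    then have "2 ^ n * (t - s) / S \<le> 1" using S by simp
    then show ?thesis by (simp add: right_diff_distrib diff_divide_distrib)
  qed
  then have "real (dyadic_index S n t) < real (dyadic_index S n s + 2)"
    using dyadic_index_bounds[OF S, of t n] dyadic_index_bounds[OF S, of s n] st by simp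
  then have "dyadic_index S n t < dyadic_index S n s + 2" by (simp only: of_nat_less_iff)
  moreover have "dyadic_index S n s \<le> dyadic_index S n t" by (rule dyadic_index_mono[OF S st(2)])
  ultimately have "dyadic_index S n t = dyadic_index S n s \<or> dyadic_index S n t = Suc (dyadic_index S n s)" by linarith
  then have "\<bar>dyadic_walk S z n t - dyadic_walk S z n s\<bar> \<le> (9 / 10) ^ n"
  proof
    assume "dyadic_index S n t = Suc (dyadic_index S n s)"
    moreover have "dyadic_index S n s < 2 ^ n" by (rule dyadic_index_less) (use st in auto)
    ultimately show ?thesis using small[OF n, of "dyadic_index S n s"] by (simp add: dyadic_walk_def)
  qed (simp add: dyadic_walk_def)
  moreover have "\<bar>brownian_path S z t - dyadic_walk S z n t\<bar> \<le> 10 * (9 / 10) ^ n"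
    "\<bar>brownian_path S z s - dyadic_walk S z n s\<bar> \<le> 10 * (9 / 10) ^ n"
    by (rule brownian_path_close; use st n in simp)+
  ultimately show ?thesis by linarith
qed

end

lemma brownian_path_0: "0 < S \<Longrightarrow> brownian_path S z 0 = 0"
  by (simp add: brownian_path_def dyadic_walk_def dyadic_index_def)

lemma continuous_brownian_path:
  assumes T: "T < S" and S: "0 < S"
  shows "continuous_on {0..T} (brownian_path S z)"
proof (cases "small_incr S z")
  case True
  then obtain n0 where n0: "\<And>n k. n0 \<le> n \<Longrightarrow> k < 2 ^ n \<Longrightarrow> \<bar>dyadic_incr S z n k\<bar> \<le> (9 / 10) ^ n"
    unfolding small_incr_def by blast
  show ?thesis unfolding continuous_on_iff
  proof (intro ballI allI impI)
    fix s e :: real assume s: "s \<in> {0..T}" and e: "0 < e"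
    have "(\<lambda>n. 21 * (9 / 10 :: real) ^ n) \<longlonglongrightarrow> 21 * 0" by (intro tendsto_intros LIMSEQ_realpow_zero) auto
    then have "\<forall>\<^sub>F n in sequentially. 21 * (9 / 10 :: real) ^ n < e"
      by (rule order_tendstoD) (use e in auto)
    then have "\<forall>\<^sub>F n in sequentially. 21 * (9 / 10 :: real) ^ n < e \<and> n0 \<le> n"
      using eventually_ge_at_top by (rule eventually_conj)
    from eventually_happens'[OF sequentially_bot this] obtain n where n: "21 * (9 / 10 :: real) ^ n < e" "n0 \<le> n" by blast
    show "\<exists>d>0. \<forall>t\<in>{0..T}. dist t s < d \<longrightarrow> dist (brownian_path S z t) (brownian_path S z s) < e"
    proof (intro exI[of _ "S / 2 ^ n"] conjI ballI impI)
      fix t assume t: "t \<in> {0..T}" "dist t s < S / 2 ^ n"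
      show "dist (brownian_path S z t) (brownian_path S z s) < e"
      proof (cases "s \<le> t")
        case True
        then have "\<bar>brownian_path S z t - brownian_path S z s\<bar> \<le> 21 * (9 / 10) ^ n"
          using s t T by (intro brownian_path_modulus[OF S n0 _ _ _ n(2)]) (auto simp: dist_real_def)
        with n(1) show ?thesis by (simp add: dist_real_def)
      next
        case False
        then have "\<bar>brownian_path S z s - brownian_path S z t\<bar> \<le> 21 * (9 / 10) ^ n"
          using s t T by (intro brownian_path_modulus[OF S n0 _ _ _ n(2)]) (auto simp: dist_real_def)
        with n(1) show ?thesis by (simp add: dist_real_def)
      qed
    qed (use S in auto)
  qed
qed (simp add: brownian_path_def[abs_def])

lemma measurable_dyadic_walk [measurable]: "(\<lambda>z. dyadic_walk S z n t) \<in> borel_measurable gaussian_noise"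
  unfolding dyadic_walk_def by measurable

lemma measurable_small_incr [measurable]: "Measurable.pred gaussian_noise (small_incr S)"
proof -
  have "Measurable.pred gaussian_noise (\<lambda>z. \<exists>n0. \<forall>n\<in>{n0..}. \<forall>k\<in>{..<2 ^ n}. \<bar>dyadic_incr S z n k\<bar> \<le> (9 / 10) ^ n)"
    by measurable
  then show ?thesis by (simp add: small_incr_def[abs_def] Ball_def)
qed

lemma measurable_brownian_path [measurable]: "(\<lambda>z. brownian_path S z t) \<in> borel_measurable gaussian_noise"
  unfolding brownian_path_def by measurable

lemma AE_small_incr:
  assumes S: "0 < S"
  shows "AE z in gaussian_noise. small_incr S z"
proof -
  define A where "A n = {z \<in> space gaussian_noise. \<exists>k\<in>{..<2 ^ n}. (9 / 10) ^ n < \<bar>dyadic_incr S z n k\<bar>}" for n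
  have [measurable]: "A n \<in> noise.events" for n unfolding A_def by measurable
  \<comment> \<open>The ratio is 1/(2 (9/10)^4): 2^n increments, fourth moments of order 4^(-n), and
    the threshold (9/10)^n.\<close>
  have "noise.prob (A n) \<le> 3 * S\<^sup>2 * (5000 / 6561) ^ n" for n
  proof -
    have "A n = (\<Union>k\<in>{..<2 ^ n}. {z \<in> space gaussian_noise. (9 / 10) ^ n < \<bar>dyadic_incr S z n k\<bar>})"
      by (auto simp: A_def)
    also have "noise.prob \<dots> \<le> (\<Sum>k<2 ^ n. noise.prob {z \<in> space gaussian_noise. (9 / 10) ^ n < \<bar>dyadic_incr S z n k\<bar>})"
      by (rule noise.finite_measure_subadditive_finite) auto
    also have "\<dots> \<le> (\<Sum>k<(2::nat) ^ n. 3 * (S / 2 ^ n)\<^sup>2 / ((9 / 10) ^ n) ^ 4)"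
      by (intro sum_mono prob_dyadic_incr_large[OF S]) auto
    also have "\<dots> = 3 * S\<^sup>2 * (2 ^ n / ((2 ^ n)\<^sup>2 * ((9 / 10) ^ n) ^ 4))"
      by (simp add: power_divide)
    also have "(2 ^ n / ((2 ^ n)\<^sup>2 * ((9 / 10) ^ n) ^ 4)) = (2 / (2\<^sup>2 * (9 / 10) ^ 4) :: real) ^ n"
      unfolding power_divide power_mult_distrib by (simp only: power_mult[symmetric] mult.commute)
    also have "(2 / (2\<^sup>2 * (9 / 10) ^ 4) :: real) = 5000 / 6561" by (simp add: power_divide)
    finally show ?thesis .
  qed
  note bound = this
  have "summable (\<lambda>n. noise.prob (A n))"
  proof (rule summable_comparison_test'[where N = 0])
    show "summable (\<lambda>n. 3 * S\<^sup>2 * (5000 / 6561 :: real) ^ n)"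
      by (intro summable_mult summable_geometric) simp
    show "norm (noise.prob (A n)) \<le> 3 * S\<^sup>2 * (5000 / 6561) ^ n" for n
      using bound[of n] by simp
  qed
  then have "AE z in gaussian_noise. \<forall>\<^sub>F n in sequentially. z \<in> space gaussian_noise - A n"
    by (intro borel_cantelli_AE1) (auto simp: noise.emeasure_eq_measure)
  then show ?thesis
  proof eventually_elim
    case (elim z)
    then show ?case unfolding eventually_sequentially small_incr_def A_def by (force simp: not_less)
  qed
qed

lemma dyadic_walk_linear_combination:
  assumes "finite R" "\<And>r. r \<in> R \<Longrightarrow> dyadic_index S n r \<le> K"
  shows "(\<Sum>r\<in>R. \<theta> r * dyadic_walk S z n r)
    = (\<Sum>k<K. (\<Sum>r\<in>R. if k < dyadic_index S n r then \<theta> r else 0) * dyadic_incr S z n k)"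
proof -
  have "dyadic_walk S z n r = (\<Sum>k<K. (if k < dyadic_index S n r then 1 else 0) * dyadic_incr S z n k)" if "r \<in> R" for r
  proof -
    have "(\<Sum>k<K. (if k < dyadic_index S n r then 1 else 0) * dyadic_incr S z n k) = (\<Sum>k\<in>{..<dyadic_index S n r}. dyadic_incr S z n k)"
      using assms(2)[OF that] by (intro sum.mono_neutral_cong_right) auto
    then show ?thesis by (simp add: dyadic_walk_def)
  qed
  then have "(\<Sum>r\<in>R. \<theta> r * dyadic_walk S z n r) = (\<Sum>r\<in>R. \<Sum>k<K. \<theta> r * ((if k < dyadic_index S n r then 1 else 0) * dyadic_incr S z n k))"
    by (simp add: sum_distrib_left)
  also have "\<dots> = (\<Sum>k<K. \<Sum>r\<in>R. \<theta> r * ((if k < dyadic_index S n r then 1 else 0) * dyadic_incr S z n k))"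
    by (rule sum.swap)
  also have "\<dots> = (\<Sum>k<K. (\<Sum>r\<in>R. if k < dyadic_index S n r then \<theta> r else 0) * dyadic_incr S z n k)"
    unfolding sum_distrib_right by (intro sum.cong refl) auto
  finally show ?thesis .
qed

text \<open>The past is a linear form in the increments with index below that of s, the increment
  after s one in the following indices. The supports are disjoint, so the squared coefficients add
  and the Gaussian factor splits off.\<close>

lemma char_dyadic_walk:
  assumes S: "0 < S" and R: "finite R" "R \<subseteq> {0..s}" and st: "0 \<le> s" "s \<le> t" "t < S"
  shows "noise.expectation (\<lambda>z. cis (\<Sum>r\<in>R. \<theta> r * dyadic_walk S z n r) * cis (u * (dyadic_walk S z n t - dyadic_walk S z n s)))
    = noise.expectation (\<lambda>z. cis (\<Sum>r\<in>R. \<theta> r * dyadic_walk S z n r))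
      * exp (- (u\<^sup>2 * (S / 2 ^ n * real (dyadic_index S n t) - S / 2 ^ n * real (dyadic_index S n s))) / 2)"
proof -
  define ks kt where "ks = dyadic_index S n s" and "kt = dyadic_index S n t"
  have k: "ks \<le> kt" "kt < 2 ^ n"
    unfolding ks_def kt_def using dyadic_index_mono[OF S st(2)] dyadic_index_less[of t S] st by auto
  have Rk: "dyadic_index S n r \<le> ks" if "r \<in> R" for r
    unfolding ks_def using R that by (intro dyadic_index_mono[OF S]) auto
  have Rk': "dyadic_index S n r \<le> 2 ^ n" if "r \<in> R" for r using Rk[OF that] k by simp
  define \<phi> where "\<phi> k = (\<Sum>r\<in>R. if k < dyadic_index S n r then \<theta> r else 0)" for k
  define \<psi> where "\<psi> k = (if ks \<le> k \<and> k < kt then u else 0)" for k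
  have \<phi>0: "\<phi> k = 0" if "ks \<le> k" for k
    unfolding \<phi>_def using that Rk by (intro sum.neutral) fastforce
  have d: "dyadic_walk S z n t - dyadic_walk S z n s = (\<Sum>k\<in>{ks..<kt}. dyadic_incr S z n k)" for z
    unfolding dyadic_walk_def ks_def[symmetric] kt_def[symmetric] lessThan_atLeast0
    using sum.atLeastLessThan_concat[of 0 ks kt "dyadic_incr S z n"] k by simp
  have e: "u * (\<Sum>k\<in>{ks..<kt}. dyadic_incr S z n k) = (\<Sum>k<2 ^ n. \<psi> k * dyadic_incr S z n k)" for z
    unfolding sum_distrib_left using k by (intro sum.mono_neutral_cong_left) (auto simp: \<psi>_def)
  have f: "(\<Sum>r\<in>R. \<theta> r * dyadic_walk S z n r) = (\<Sum>k<2 ^ n. \<phi> k * dyadic_incr S z n k)" for z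
    unfolding \<phi>_def by (rule dyadic_walk_linear_combination[OF R(1) Rk'])
  have sq: "(\<Sum>k<2 ^ n. (\<phi> k + \<psi> k)\<^sup>2) = (\<Sum>k<2 ^ n. (\<phi> k)\<^sup>2) + (\<Sum>k<2 ^ n. (\<psi> k)\<^sup>2)"
    unfolding sum.distrib[symmetric] by (intro sum.cong refl) (auto simp: \<psi>_def \<phi>0)
  have sq\<psi>: "(\<Sum>k<2 ^ n. (\<psi> k)\<^sup>2) = u\<^sup>2 * (real kt - real ks)"
  proof -
    have "(\<Sum>k<2 ^ n. (\<psi> k)\<^sup>2) = (\<Sum>k\<in>{ks..<kt}. u\<^sup>2)"
      using k by (intro sum.mono_neutral_cong_right) (auto simp: \<psi>_def)
    then show ?thesis using k by (simp add: of_nat_diff mult.commute)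
  qed
  have "noise.expectation (\<lambda>z. cis (\<Sum>r\<in>R. \<theta> r * dyadic_walk S z n r) * cis (u * (dyadic_walk S z n t - dyadic_walk S z n s)))
    = noise.expectation (\<lambda>z. cis (\<Sum>k<2 ^ n. (\<phi> k + \<psi> k) * dyadic_incr S z n k))"
    unfolding d e f cis_mult by (simp add: distrib_right sum.distrib)
  also have "\<dots> = complex_of_real (exp (- (S / 2 ^ n * (\<Sum>k<2 ^ n. (\<phi> k)\<^sup>2)) / 2)) * exp (- (S / 2 ^ n * (u\<^sup>2 * (real kt - real ks))) / 2)"
    unfolding char_dyadic_incr[OF S] sq sq\<psi> of_real_mult[symmetric] exp_add[symmetric]
    by (simp add: distrib_left add_divide_distrib)
  also have "complex_of_real (exp (- (S / 2 ^ n * (\<Sum>k<2 ^ n. (\<phi> k)\<^sup>2)) / 2)) = noise.expectation (\<lambda>z. cis (\<Sum>r\<in>R. \<theta> r * dyadic_walk S z n r))"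
    unfolding f char_dyadic_incr[OF S] ..
  finally show ?thesis unfolding ks_def kt_def by (simp add: algebra_simps)
qed

lemma char_brownian_path:
  assumes S: "0 < S" and R: "finite R" "R \<subseteq> {0..s}" and st: "0 \<le> s" "s \<le> t" "t < S"
  shows "noise.expectation (\<lambda>z. cis (\<Sum>r\<in>R. \<theta> r * brownian_path S z r) * cis (u * (brownian_path S z t - brownian_path S z s)))
    = noise.expectation (\<lambda>z. cis (\<Sum>r\<in>R. \<theta> r * brownian_path S z r)) * exp (- (u\<^sup>2 * (t - s)) / 2)"
proof -
  have lim: "(\<lambda>n. dyadic_walk S z n r) \<longlonglongrightarrow> brownian_path S z r" if "small_incr S z" "0 \<le> r" "r < S" for z r
    using that dyadic_walk_tendsto[OF S] unfolding small_incr_def by blast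
  have [measurable]: "cis \<in> borel_measurable borel"
    by (intro borel_measurable_continuous_onI continuous_intros)
  have lim_cis: "(\<lambda>n. cis (f n)) \<longlonglongrightarrow> cis l" if "f \<longlonglongrightarrow> l" for f :: "nat \<Rightarrow> real" and l
    unfolding cis_conv_exp by (intro tendsto_intros that)
  have 1: "(\<lambda>n. noise.expectation (\<lambda>z. cis (\<Sum>r\<in>R. \<theta> r * dyadic_walk S z n r) * cis (u * (dyadic_walk S z n t - dyadic_walk S z n s))))
    \<longlonglongrightarrow> noise.expectation (\<lambda>z. cis (\<Sum>r\<in>R. \<theta> r * brownian_path S z r) * cis (u * (brownian_path S z t - brownian_path S z s)))"
  proof (rule integral_dominated_convergence[where w = "\<lambda>_. 1"])
    show "AE z in gaussian_noise. (\<lambda>n. cis (\<Sum>r\<in>R. \<theta> r * dyadic_walk S z n r) * cis (u * (dyadic_walk S z n t - dyadic_walk S z n s)))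
       \<longlonglongrightarrow> cis (\<Sum>r\<in>R. \<theta> r * brownian_path S z r) * cis (u * (brownian_path S z t - brownian_path S z s))"
      using AE_small_incr[OF S]
      by eventually_elim (use R st in \<open>auto intro!: tendsto_intros lim_cis lim simp: subset_iff\<close>)
  qed (auto simp: norm_mult)
  have 2: "(\<lambda>n. noise.expectation (\<lambda>z. cis (\<Sum>r\<in>R. \<theta> r * dyadic_walk S z n r)))
    \<longlonglongrightarrow> noise.expectation (\<lambda>z. cis (\<Sum>r\<in>R. \<theta> r * brownian_path S z r))"
  proof (rule integral_dominated_convergence[where w = "\<lambda>_. 1"])
    show "AE z in gaussian_noise. (\<lambda>n. cis (\<Sum>r\<in>R. \<theta> r * dyadic_walk S z n r)) \<longlonglongrightarrow> cis (\<Sum>r\<in>R. \<theta> r * brownian_path S z r)"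
      using AE_small_incr[OF S]
      by eventually_elim (use R st in \<open>auto intro!: tendsto_intros lim_cis lim simp: subset_iff\<close>)
  qed auto
  have 3: "(\<lambda>n. complex_of_real (exp (- (u\<^sup>2 * (S / 2 ^ n * real (dyadic_index S n t) - S / 2 ^ n * real (dyadic_index S n s))) / 2)))
    \<longlonglongrightarrow> exp (- (u\<^sup>2 * (t - s)) / 2)"
    using S st by (intro tendsto_intros dyadic_index_tendsto) auto
  show ?thesis
    using LIMSEQ_unique[OF 1[unfolded char_dyadic_walk[OF S R st]] tendsto_mult[OF 2 3]] .
qed

section \<open>Normal laws and independence of the past\<close>

text \<open>A push-forward instead of a density, so that variance 0 is included.\<close>

definition scaled_normal :: "real \<Rightarrow> real measure" where
  "scaled_normal v = distr std_normal_distribution borel (\<lambda>x. sqrt v * x)"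

lemma char_scaled_normal: "0 \<le> v \<Longrightarrow> char (scaled_normal v) u = complex_of_real (exp (- (u\<^sup>2 * v) / 2))"
  unfolding scaled_normal_def by (subst char_normal_scaled) auto

lemma scaled_normal_eq_density:
  assumes v: "0 < v"
  shows "scaled_normal v = density lborel (normal_density 0 (sqrt v))"
proof -
  interpret prob_space std_normal_distribution by (rule prob_space_std_normal)
  have "distributed std_normal_distribution lborel (\<lambda>x. x) std_normal_density"
    unfolding distributed_def by (auto simp: distr_id2)
  from normal_density_affine[OF this, of "sqrt v" 0] v
  have "distr std_normal_distribution lborel (\<lambda>x. sqrt v * x) = density lborel (normal_density 0 (sqrt v))"
    by (simp add: distributed_def)
  moreover have "distr std_normal_distribution lborel (\<lambda>x. sqrt v * x) = scaled_normal v"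
    unfolding scaled_normal_def by (rule distr_cong) auto
  ultimately show ?thesis by simp
qed

text \<open>Under the measure conditioned on A the variable Y has a Gaussian characteristic
  function, hence the Gaussian law by uniqueness; an event of probability 0 is trivial.\<close>

lemma (in prob_space) normal_law_on_event:
  assumes A[measurable]: "A \<in> events" and Y[measurable]: "Y \<in> borel_measurable M" and v: "0 \<le> v"
    and char: "\<And>u. expectation (\<lambda>w. indicator A w * cis (u * Y w)) = prob A * exp (- (u\<^sup>2 * v) / 2)"
    and C: "C \<in> sets borel"
  shows "prob (A \<inter> (Y -` C \<inter> space M)) = prob A * measure (scaled_normal v) C"
proof (cases "prob A = 0")
  case True
  have "prob (A \<inter> (Y -` C \<inter> space M)) \<le> prob A"
    by (rule finite_measure_mono) auto
  with True show ?thesis by (simp add: measure_le_0_iff)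
next
  case False
  then have pA: "0 < prob A" by (simp add: zero_less_measure_iff)
  define D where "D = density M (\<lambda>w. ennreal (indicator A w / prob A))"
  have emD: "emeasure D B = ennreal (prob (A \<inter> B) / prob A)" if [measurable]: "B \<in> events" for B
  proof -
    have "emeasure D B = (\<integral>\<^sup>+w. ennreal (1 / prob A) * indicator (A \<inter> B) w \<partial>M)"
      unfolding D_def by (subst emeasure_density) (auto intro!: nn_integral_cong simp: indicator_def)
    also have "\<dots> = ennreal (1 / prob A) * emeasure M (A \<inter> B)"
      by (rule nn_integral_cmult_indicator) simp
    also have "\<dots> = ennreal (prob (A \<inter> B) / prob A)"
      unfolding emeasure_eq_measure by (simp flip: ennreal_mult)
    finally show ?thesis .
  qed
  have "prob_space D"
  proof
    have "A \<inter> space M = A" using sets.sets_into_space[OF A] by blast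
    then show "emeasure D (space D) = 1"
      using emD[of "space M"] pA by (simp add: D_def)
  qed
  then interpret D: prob_space D .
  have [measurable]: "Y \<in> borel_measurable D" by (simp add: D_def)
  have [measurable]: "cis \<in> borel_measurable borel"
    by (intro borel_measurable_continuous_onI continuous_intros)
  have "distr D borel Y = scaled_normal v"
  proof (rule Levy_uniqueness)
    show "real_distribution (distr D borel Y)" by (rule D.real_distribution_distr) simp
    show "real_distribution (scaled_normal v)" unfolding scaled_normal_def by (rule real_distribution_normal_scaled)
    show "Characteristic_Functions.char (distr D borel Y) = Characteristic_Functions.char (scaled_normal v)"
    proof
      fix u
      have "Characteristic_Functions.char (distr D borel Y) u = D.expectation (\<lambda>w. cis (u * Y w))"
        by (simp add: char_def integral_distr cis_conv_exp)
      also have "\<dots> = expectation (\<lambda>w. (indicator A w / prob A) *\<^sub>R cis (u * Y w))"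
        unfolding D_def by (subst integral_density) auto
      also have "\<dots> = expectation (\<lambda>w. (1 / prob A) *\<^sub>R (indicator A w * cis (u * Y w)))"
        by (intro Bochner_Integration.integral_cong) (auto simp: indicator_def)
      also have "\<dots> = (1 / prob A) *\<^sub>R complex_of_real (prob A * exp (- (u\<^sup>2 * v) / 2))"
        by (simp only: integral_scaleR_right char)
      also have "\<dots> = complex_of_real (exp (- (u\<^sup>2 * v) / 2))"
        using pA by (simp add: scaleR_conv_of_real)
      finally show "Characteristic_Functions.char (distr D borel Y) u = Characteristic_Functions.char (scaled_normal v) u"
        using char_scaled_normal[OF v] by simp
    qed
  qed
  then have "measure (scaled_normal v) C = measure D (Y -` C \<inter> space D)"
    using C by (simp add: measure_distr flip: \<open>distr D borel Y = scaled_normal v\<close>)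
  also have "\<dots> = prob (A \<inter> (Y -` C \<inter> space M)) / prob A"
    using emD[of "Y -` C \<inter> space M"] C by (simp add: measure_def D_def measurable_sets[OF Y C])
  finally show ?thesis using pA by simp
qed

lemma brownian_path_increment_on_cylinder:
  assumes S: "0 < S" and R: "finite R" "R \<subseteq> {0..s}" and st: "0 \<le> s" "s \<le> t" "t < S" and C: "C \<in> sets borel"
  shows "noise.prob ({z \<in> space gaussian_noise. \<forall>r\<in>R. brownian_path S z r \<le> a r}
      \<inter> ((\<lambda>z. brownian_path S z t - brownian_path S z s) -` C \<inter> space gaussian_noise))
    = noise.prob {z \<in> space gaussian_noise. \<forall>r\<in>R. brownian_path S z r \<le> a r} * measure (scaled_normal (t - s)) C"
proof (rule noise.normal_law_on_event[OF _ _ _ _ C])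
  \<comment> \<open>\<open>char_factor_cylinder\<close> works over a countable index type, so the
    finitely many real times are numbered by naturals.\<close>
  obtain f where f: "bij_betw f {0..<card R} R" using ex_bij_betw_nat_finite[OF R(1)] by blast
  then have fR: "R = f ` {0..<card R}" and inj: "inj_on f {0..<card R}" by (auto simp: bij_betw_def)
  have sumR: "(\<Sum>r\<in>R. h r) = (\<Sum>k\<in>{0..<card R}. h (f k))" for h :: "real \<Rightarrow> real"
    using sum.reindex_bij_betw[OF f, of h] by simp
  have [measurable]: "cis \<in> borel_measurable borel"
    by (intro borel_measurable_continuous_onI continuous_intros)
  have ball: "(\<forall>r\<in>R. brownian_path S z r \<le> a r) \<longleftrightarrow> (\<forall>k\<in>{0..<card R}. brownian_path S z (f k) \<le> a (f k))" for z
    by (subst fR) simp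
  show "noise.expectation (\<lambda>w. indicator {z \<in> space gaussian_noise. \<forall>r\<in>R. brownian_path S z r \<le> a r} w *
      cis (u * (brownian_path S w t - brownian_path S w s)))
    = noise.prob {z \<in> space gaussian_noise. \<forall>r\<in>R. brownian_path S z r \<le> a r} * exp (- (u\<^sup>2 * (t - s)) / 2)" for u
    unfolding ball
  proof (rule noise.char_factor_cylinder[where R = "\<lambda>z k. brownian_path S z (f k)"])
    fix \<theta> :: "nat \<Rightarrow> real"
    define \<theta>' where "\<theta>' r = \<theta> (the_inv_into {0..<card R} f r)" for r
    have "(\<Sum>k\<in>{0..<card R}. \<theta> k * brownian_path S z (f k)) = (\<Sum>r\<in>R. \<theta>' r * brownian_path S z r)" for z
      unfolding sumR \<theta>'_def by (intro sum.cong refl) (simp add: the_inv_into_f_f[OF inj])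
    then show "noise.expectation (\<lambda>w. cis (\<Sum>k\<in>{0..<card R}. \<theta> k * brownian_path S w (f k)) * cis (u * (brownian_path S w t - brownian_path S w s)))
      = noise.expectation (\<lambda>w. cis (\<Sum>k\<in>{0..<card R}. \<theta> k * brownian_path S w (f k))) * exp (- (u\<^sup>2 * (t - s)) / 2)"
      using char_brownian_path[OF S R st, where \<theta> = \<theta>' and u = u] by (simp only:)
  qed auto
  show "{z \<in> space gaussian_noise. \<forall>r\<in>R. brownian_path S z r \<le> a r} \<in> noise.events"
    unfolding ball by measurable
qed (use st in auto)

section \<open>The vector-valued Brownian motion and its filtration\<close>

text \<open>The existence claim fixes the type \<open>real \<Rightarrow> real ^ 'n\<close> for the
  sample space. The k-th Gaussian of coordinate i is stored as component i at the argument k, and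
  the floor extends this to all real arguments.\<close>

definition vector_noise :: "(real \<Rightarrow> real ^ 'n::finite) measure" where
  "vector_noise = distr (\<Pi>\<^sub>M i\<in>(UNIV::'n set). gaussian_noise) (\<Pi>\<^sub>M r\<in>UNIV. borel) (\<lambda>w r. \<chi> i. w i (nat \<lfloor>r\<rfloor>))"

definition noise_coord :: "'n::finite \<Rightarrow> (real \<Rightarrow> real ^ 'n) \<Rightarrow> nat \<Rightarrow> real" where
  "noise_coord i w k = w (real k) $ i"

lemma borel_measurable_vecI:
  fixes f :: "'a \<Rightarrow> real ^ 'n::finite"
  assumes "\<And>i. (\<lambda>x. f x $ i) \<in> borel_measurable M"
  shows "f \<in> borel_measurable M"
  unfolding borel_measurable_euclidean_space[of f]
  using assms by (auto simp: Basis_vec_def inner_axis)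

lemma borel_measurable_vec_nth [measurable (raw)]:
  fixes f :: "'a \<Rightarrow> real ^ 'n::finite"
  shows "f \<in> borel_measurable M \<Longrightarrow> (\<lambda>x. f x $ i) \<in> borel_measurable M"
  by (rule measurable_compose[OF _ borel_measurable_continuous_onI[OF linear_continuous_on[OF bounded_linear_vec_nth]]])

lemma measurable_vector_noise_embedding:
  "(\<lambda>w (r::real). \<chi> i. w i (nat \<lfloor>r\<rfloor>)) \<in> (\<Pi>\<^sub>M i\<in>(UNIV::'n::finite set). gaussian_noise) \<rightarrow>\<^sub>M (\<Pi>\<^sub>M r\<in>UNIV. borel)"
proof (rule measurable_PiM_single')
  fix r :: real
  show "(\<lambda>w. \<chi> i. w i (nat \<lfloor>r\<rfloor>)) \<in> (\<Pi>\<^sub>M i\<in>(UNIV::'n set). gaussian_noise) \<rightarrow>\<^sub>M borel"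
  proof (rule borel_measurable_vecI)
    fix i :: 'n
    have "(\<lambda>w. w i) \<in> (\<Pi>\<^sub>M i\<in>(UNIV::'n set). gaussian_noise) \<rightarrow>\<^sub>M gaussian_noise"
      by (rule measurable_component_singleton) simp
    from measurable_compose[OF this measurable_gaussian_noise_component]
    show "(\<lambda>w. (\<chi> i. w i (nat \<lfloor>r\<rfloor>)) $ i) \<in> (\<Pi>\<^sub>M i\<in>(UNIV::'n set). gaussian_noise) \<rightarrow>\<^sub>M borel"
      by simp
  qed
qed auto

lemma prob_space_vector_noise: "prob_space (vector_noise :: (real \<Rightarrow> real ^ 'n::finite) measure)"
  unfolding vector_noise_def
  by (intro prob_space.prob_space_distr measurable_vector_noise_embedding prob_space_PiM noise.prob_space_axioms)

lemma measurable_noise_coord [measurable]: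
  fixes i :: "'n::finite"
  shows "noise_coord i \<in> vector_noise \<rightarrow>\<^sub>M gaussian_noise"
proof -
  have "noise_coord i \<in> (\<Pi>\<^sub>M r\<in>UNIV. borel) \<rightarrow>\<^sub>M (\<Pi>\<^sub>M k\<in>UNIV. std_normal_distribution)"
  proof (rule measurable_PiM_single')
    fix k :: nat
    have "(\<lambda>w::real \<Rightarrow> real ^ 'n. w (real k) $ i) \<in> (\<Pi>\<^sub>M r\<in>UNIV. borel) \<rightarrow>\<^sub>M borel"
      by (intro borel_measurable_vec_nth measurable_component_singleton) simp
    then show "(\<lambda>w. noise_coord i w k) \<in> (\<Pi>\<^sub>M r\<in>UNIV. borel) \<rightarrow>\<^sub>M std_normal_distribution"
      by (simp add: noise_coord_def cong: measurable_cong_sets)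
  qed (auto simp: space_PiM)
  then show ?thesis by (simp add: vector_noise_def gaussian_noise_def cong: measurable_cong_sets)
qed

lemma distr_noise_coord: "distr vector_noise gaussian_noise (noise_coord i) = gaussian_noise"
proof -
  have "distr vector_noise gaussian_noise (noise_coord i)
    = distr (\<Pi>\<^sub>M i\<in>UNIV. gaussian_noise) gaussian_noise (noise_coord i \<circ> (\<lambda>w r. \<chi> i. w i (nat \<lfloor>r\<rfloor>)))"
    unfolding vector_noise_def
    by (rule distr_distr[OF _ measurable_vector_noise_embedding])
      (use measurable_noise_coord[of i] in \<open>simp add: vector_noise_def cong: measurable_cong_sets\<close>)
  also have "noise_coord i \<circ> (\<lambda>w r. \<chi> i. w i (nat \<lfloor>r\<rfloor>)) = (\<lambda>w. w i)"
    by (simp add: fun_eq_iff noise_coord_def)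
  also have "distr (\<Pi>\<^sub>M i\<in>UNIV. gaussian_noise) gaussian_noise (\<lambda>w. w i) = gaussian_noise"
    by (rule distr_PiM_component) (auto intro: noise.prob_space_axioms)
  finally show ?thesis .
qed

lemma indep_vars_noise_coord:
  "prob_space.indep_vars (vector_noise :: (real \<Rightarrow> real ^ 'n::finite) measure) (\<lambda>_. gaussian_noise) noise_coord UNIV"
proof -
  interpret prob_space "vector_noise :: (real \<Rightarrow> real ^ 'n) measure" by (rule prob_space_vector_noise)
  let ?P = "\<Pi>\<^sub>M i\<in>(UNIV::'n set). gaussian_noise"
  show ?thesis
  proof (subst indep_vars_iff_distr_eq_PiM)
    have m: "(\<lambda>w. \<lambda>i\<in>UNIV. noise_coord i w) \<in> (vector_noise :: (real \<Rightarrow> real ^ 'n) measure) \<rightarrow>\<^sub>M ?P"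
      by (intro measurable_restrict measurable_noise_coord)
    have "distr (vector_noise :: (real \<Rightarrow> real ^ 'n) measure) ?P (\<lambda>w. \<lambda>i\<in>UNIV. noise_coord i w)
      = distr ?P ?P ((\<lambda>w. \<lambda>i\<in>UNIV. noise_coord i w) \<circ> (\<lambda>w r. \<chi> i. w i (nat \<lfloor>r\<rfloor>)))"
      using m unfolding vector_noise_def
      by (intro distr_distr[OF _ measurable_vector_noise_embedding]) (simp cong: measurable_cong_sets)
    also have "(\<lambda>w. \<lambda>i\<in>UNIV. noise_coord i w) \<circ> (\<lambda>w r. \<chi> i. w i (nat \<lfloor>r\<rfloor>)) = (\<lambda>w::'n \<Rightarrow> nat \<Rightarrow> real. w)"
      by (simp add: fun_eq_iff noise_coord_def)
    also have "distr ?P ?P (\<lambda>w. w) = ?P" by (simp add: distr_id2)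
    finally show "distr (vector_noise :: (real \<Rightarrow> real ^ 'n) measure) ?P (\<lambda>w. \<lambda>i\<in>UNIV. noise_coord i w)
      = (\<Pi>\<^sub>M i\<in>UNIV. distr vector_noise gaussian_noise (noise_coord i))"
      by (simp add: distr_noise_coord restrict_def)
  qed auto
qed

definition brownian_vector :: "real \<Rightarrow> real \<Rightarrow> (real \<Rightarrow> real ^ 'n::finite) \<Rightarrow> real ^ 'n" where
  "brownian_vector S t w = (\<chi> i. brownian_path S (noise_coord i w) t)"

text \<open>Lower orthants at finitely many times and coordinates: an intersection-stable generator
  on which independence can be tested.\<close>

definition brownian_cylinder ::
  "real \<Rightarrow> (real \<times> 'n) set \<Rightarrow> (real \<times> 'n \<Rightarrow> real) \<Rightarrow> (real \<Rightarrow> real ^ 'n::finite) set" where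
  "brownian_cylinder S I a = {w \<in> space vector_noise. \<forall>(r, i)\<in>I. brownian_vector S r w $ i \<le> a (r, i)}"

text \<open>Indexed by every real s, as \<open>filtration\<close> over the reals requires, while
  only times in [0, T] contribute generators.\<close>

definition brownian_filtration :: "real \<Rightarrow> real \<Rightarrow> real \<Rightarrow> (real \<Rightarrow> real ^ 'n::finite) measure" where
  "brownian_filtration S T s = sigma (space vector_noise)
     {brownian_cylinder S I a | I a. finite I \<and> I \<subseteq> ({0..T} \<inter> {..s}) \<times> UNIV}"

lemma measurable_brownian_vector_nth [measurable]:
  "(\<lambda>w. brownian_vector S t w $ i) \<in> borel_measurable vector_noise"
  unfolding brownian_vector_def by simp

lemma brownian_cylinder_sets [measurable]: "finite I \<Longrightarrow> brownian_cylinder S I a \<in> sets vector_noise"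
proof -
  assume I: "finite I"
  have "brownian_cylinder S I a = {w \<in> space vector_noise. \<forall>x\<in>I. brownian_vector S (fst x) w $ snd x \<le> a x}"
    by (auto simp: brownian_cylinder_def)
  then show ?thesis using I by (auto intro!: sets.sets_Collect_finite_All borel_measurable_le)
qed

text \<open>The event is an intersection of events of the independent coordinates. Only coordinate i
  carries the additional increment, and there the scalar statement applies.\<close>

lemma brownian_increment_on_cylinder:
  fixes i :: "'n::finite"
  assumes S: "0 < S" and I: "finite I" "I \<subseteq> {0..s} \<times> UNIV" and st: "0 \<le> s" "s \<le> t" "t < S" and C: "C \<in> sets borel"
  shows "measure vector_noise (brownian_cylinder S I a \<inter>
      ((\<lambda>w. brownian_vector S t w $ i - brownian_vector S s w $ i) -` C \<inter> space vector_noise))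
    = measure vector_noise (brownian_cylinder S I a) * measure (scaled_normal (t - s)) C"
proof -
  interpret prob_space "vector_noise :: (real \<Rightarrow> real ^ 'n) measure" by (rule prob_space_vector_noise)
  define R where "R j = {r. (r, j) \<in> I}" for j
  have R: "finite (R j)" "R j \<subseteq> {0..s}" for j
  proof -
    have "R j \<subseteq> fst ` I" by (force simp: R_def)
    then show "finite (R j)" using I(1) by (meson finite_imageI finite_subset)
    show "R j \<subseteq> {0..s}" using I(2) by (auto simp: R_def)
  qed
  define B where "B j = {z \<in> space gaussian_noise. \<forall>r\<in>R j. brownian_path S z r \<le> a (r, j)}" for j
  define Y where "Y = (\<lambda>z. brownian_path S z t - brownian_path S z s) -` C \<inter> space gaussian_noise"
  have B[measurable]: "B j \<in> noise.events" for j
    unfolding B_def using R(1) by (intro sets.sets_Collect_finite_All borel_measurable_le) auto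
  have Y[measurable]: "Y \<in> noise.events" unfolding Y_def using C by (intro measurable_sets) auto
  have in_space: "noise_coord j w \<in> space gaussian_noise" if "w \<in> space vector_noise" for j :: 'n and w
    using measurable_space[OF measurable_noise_coord that] .
  have coord: "prob (noise_coord j -` E \<inter> space vector_noise) = noise.prob E" if "E \<in> noise.events" for j :: 'n and E
    using measure_distr[OF measurable_noise_coord[of j] that] by (simp add: distr_noise_coord)
  have prod: "prob (\<Inter>j\<in>UNIV. noise_coord j -` E j \<inter> space vector_noise) = (\<Prod>j\<in>UNIV. noise.prob (E j))"
    if "\<And>j. E j \<in> noise.events" for E :: "'n \<Rightarrow> _"
    using indep_varsD_finite[OF indep_vars_noise_coord, of E] that coord by simp
  define B' where "B' j = (if j = i then B j \<inter> Y else B j)" for j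
  have B'[measurable]: "B' j \<in> noise.events" for j by (simp add: B'_def)
  have cyl: "brownian_cylinder S I a = (\<Inter>j\<in>UNIV. noise_coord j -` B j \<inter> space vector_noise)"
    by (auto simp: brownian_cylinder_def B_def R_def brownian_vector_def in_space)
  have cyl': "brownian_cylinder S I a \<inter> ((\<lambda>w. brownian_vector S t w $ i - brownian_vector S s w $ i) -` C \<inter> space vector_noise)
    = (\<Inter>j\<in>UNIV. noise_coord j -` B' j \<inter> space vector_noise)"
    unfolding cyl by (auto simp: B'_def Y_def brownian_vector_def in_space split: if_splits)
  have "noise.prob (B' j) = noise.prob (B j) * (if j = i then measure (scaled_normal (t - s)) C else 1)" for j
    unfolding B'_def B_def Y_def
    using brownian_path_increment_on_cylinder[OF S R st C, of j "\<lambda>r. a (r, j)"]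
    by (cases "j = i") simp_all
  then have "(\<Prod>j\<in>UNIV. noise.prob (B' j)) = (\<Prod>j\<in>UNIV. noise.prob (B j)) * measure (scaled_normal (t - s)) C"
    by (simp add: prod.distrib)
  then show ?thesis unfolding cyl' unfolding cyl by (simp only: prod[OF B] prod[OF B'])
qed

lemma space_brownian_filtration: "space (brownian_filtration S T s) = space vector_noise"
  by (simp add: brownian_filtration_def space_measure_of_conv)

lemma sets_brownian_filtration:
  "sets (brownian_filtration S T s) = sigma_sets (space vector_noise) {brownian_cylinder S I a | I a. finite I \<and> I \<subseteq> ({0..T} \<inter> {..s}) \<times> UNIV}"
  unfolding brownian_filtration_def by (rule sets_measure_of) (auto simp: brownian_cylinder_def)

lemma brownian_filtration_filtration: "filtration (space vector_noise) (brownian_filtration S T)"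
proof
  show "sets (brownian_filtration S T s) \<subseteq> sets (brownian_filtration S T t)" if "s \<le> t" for s t
    unfolding sets_brownian_filtration using that by (intro sigma_sets_mono') fastforce
qed (rule space_brownian_filtration)

lemma brownian_filtration_subalgebra: "subalgebra vector_noise (brownian_filtration S T s)"
  unfolding subalgebra_def
proof
  show "sets (brownian_filtration S T s) \<subseteq> sets vector_noise"
    unfolding sets_brownian_filtration by (rule sets.sigma_sets_subset) auto
qed (rule space_brownian_filtration)

lemma brownian_vector_adapted:
  assumes "t \<in> {0..T}"
  shows "brownian_vector S t \<in> borel_measurable (brownian_filtration S T t)"
proof (rule borel_measurable_vecI)
  fix i
  have "{w \<in> space vector_noise. brownian_vector S t w $ i \<le> c} \<in> sets (brownian_filtration S T t)" for c
  proof -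
    have "{w \<in> space vector_noise. brownian_vector S t w $ i \<le> c} = brownian_cylinder S {(t, i)} (\<lambda>_. c)"
      by (simp add: brownian_cylinder_def)
    also have "\<dots> \<in> sets (brownian_filtration S T t)"
      unfolding sets_brownian_filtration using assms by (intro sigma_sets.Basic) blast
    finally show ?thesis .
  qed
  then show "(\<lambda>w. brownian_vector S t w $ i) \<in> borel_measurable (brownian_filtration S T t)"
    unfolding borel_measurable_iff_le by (simp add: space_brownian_filtration)
qed

text \<open>At an index belonging to one of the two sets only, both arguments of the minimum are the
  bound from that set.\<close>

lemma brownian_cylinder_Int:
  "brownian_cylinder S I a \<inter> brownian_cylinder S J b
    = brownian_cylinder S (I \<union> J) (\<lambda>x. min (if x \<in> I then a x else b x) (if x \<in> J then b x else a x))"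
  by (auto simp: brownian_cylinder_def)

lemma brownian_motion_brownian_vector:
  fixes i :: "'n::finite"
  assumes T: "0 \<le> T" "T < S"
  shows "brownian_motion vector_noise (brownian_filtration S T) T (\<lambda>t w. brownian_vector S t w $ i)"
  unfolding brownian_motion_def
proof (intro conjI ballI)
  interpret prob_space "vector_noise :: (real \<Rightarrow> real ^ 'n) measure" by (rule prob_space_vector_noise)
  have S: "0 < S" using T by simp
  show "(\<lambda>w. brownian_vector S t w $ i) \<in> borel_measurable (brownian_filtration S T t)" if "t \<in> {0..T}" for t
    using brownian_vector_adapted[OF that] by (rule borel_measurable_vec_nth)
  show "AE w in vector_noise. brownian_vector S 0 w $ i = 0"
    by (simp add: brownian_vector_def brownian_path_0[OF S])
  show "continuous_on {0..T} (\<lambda>t. brownian_vector S t w $ i)" for w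
    using continuous_brownian_path[OF T(2) S] by (simp add: brownian_vector_def)
  fix s t assume s: "s \<in> {0..T}" and t: "t \<in> {s<..T}"
  define Y where "Y w = brownian_vector S t w $ i - brownian_vector S s w $ i" for w
  have Y[measurable]: "Y \<in> borel_measurable vector_noise" unfolding Y_def by measurable
  have cyl: "prob (brownian_cylinder S I a \<inter> (Y -` C \<inter> space vector_noise)) = prob (brownian_cylinder S I a) * measure (scaled_normal (t - s)) C"
    if "finite I" "I \<subseteq> ({0..T} \<inter> {..s}) \<times> UNIV" "C \<in> sets borel" for I a C
    unfolding Y_def using that s t T by (intro brownian_increment_on_cylinder[OF S]) auto
  \<comment> \<open>The cylinder over no times is the whole space, which turns \<open>cyl\<close>
    into the law of the increment.\<close>
  have empty: "brownian_cylinder S {} a = space (vector_noise :: (real \<Rightarrow> real ^ 'n) measure)" for a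
    by (simp add: brownian_cylinder_def)
  have law: "prob (Y -` C \<inter> space vector_noise) = measure (scaled_normal (t - s)) C" if C: "C \<in> sets borel" for C
    using cyl[OF _ _ C, of "{}" undefined] unfolding empty by (simp add: prob_space Int_absorb1)
  have "distr vector_noise borel Y = scaled_normal (t - s)"
  proof (rule measure_eqI)
    fix C assume "C \<in> sets (distr vector_noise borel Y)"
    then have C: "C \<in> sets borel" by simp
    interpret N: prob_space "scaled_normal (t - s)"
      unfolding scaled_normal_def by (intro prob_space.prob_space_distr prob_space_std_normal) simp
    show "emeasure (distr vector_noise borel Y) C = emeasure (scaled_normal (t - s)) C"
      using C law[OF C] by (simp add: emeasure_distr emeasure_eq_measure N.emeasure_eq_measure)
  qed (simp add: scaled_normal_def)
  also have "\<dots> = density lborel (normal_density 0 (sqrt (t - s)))"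
    by (rule scaled_normal_eq_density) (use t in simp)
  finally have "distr vector_noise lborel Y = density lborel (normal_density 0 (sqrt (t - s)))"
    by (metis distr_cong_AE distr_cong sets_lborel)
  then show "distributed vector_noise lborel (\<lambda>w. brownian_vector S t w $ i - brownian_vector S s w $ i) (normal_density 0 (sqrt (t - s)))"
    unfolding distributed_def Y_def[symmetric] by simp
  let ?G = "{brownian_cylinder S I a | I a. finite I \<and> I \<subseteq> ({0..T} \<inter> {..s}) \<times> UNIV} :: (real \<Rightarrow> real ^ 'n) set set"
  let ?H = "{Y -` C \<inter> space vector_noise | C. C \<in> sets borel} :: (real \<Rightarrow> real ^ 'n) set set"
  have "indep_set (sigma_sets (space vector_noise) ?G) (sigma_sets (space vector_noise) ?H)"
  proof (rule indep_set_sigma_sets)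
    show "indep_set ?G ?H"
    proof (rule indep_setI)
      fix A B assume "A \<in> ?G" "B \<in> ?H"
      then obtain I a C where A: "A = brownian_cylinder S I a" and I: "finite I" "I \<subseteq> ({0..T} \<inter> {..s}) \<times> UNIV"
        and B: "B = Y -` C \<inter> space vector_noise" and C: "C \<in> sets borel" by blast
      show "prob (A \<inter> B) = prob A * prob B"
        unfolding A B using cyl[OF I C] law[OF C] by simp
    qed auto
    show "Int_stable ?G"
    proof (rule Int_stableI)
      fix A B assume "A \<in> ?G" "B \<in> ?G"
      then obtain I a J b where "A = brownian_cylinder S I a" "finite I" "I \<subseteq> ({0..T} \<inter> {..s}) \<times> UNIV"
        "B = brownian_cylinder S J b" "finite J" "J \<subseteq> ({0..T} \<inter> {..s}) \<times> UNIV" by blast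
      then show "A \<inter> B \<in> ?G"
        by (auto simp: brownian_cylinder_Int intro!: exI[of _ "I \<union> J"])
    qed
    show "Int_stable ?H"
    proof (rule Int_stableI)
      fix A B assume "A \<in> ?H" "B \<in> ?H"
      then obtain C D where "A = Y -` C \<inter> space vector_noise" "C \<in> sets borel" "B = Y -` D \<inter> space vector_noise" "D \<in> sets borel" by blast
      then show "A \<inter> B \<in> ?H" by (auto intro!: exI[of _ "C \<inter> D"])
    qed
  qed
  moreover have "sigma_sets (space vector_noise) ?H = sets (vimage_algebra (space vector_noise) Y borel)"
    by (simp add: sets_vimage_algebra)
  ultimately show "indep_set (sets (brownian_filtration S T s))
      (sets (vimage_algebra (space vector_noise) (\<lambda>w. brownian_vector S t w $ i - brownian_vector S s w $ i) borel))"
    unfolding sets_brownian_filtration Y_def[symmetric] by simp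
qed

lemma indep_vars_brownian_vector:
  "prob_space.indep_vars (vector_noise :: (real \<Rightarrow> real ^ 'n::finite) measure) (\<lambda>_. \<Pi>\<^sub>M t\<in>{0..T}. borel)
     (\<lambda>i w. \<lambda>t\<in>{0..T}. brownian_vector S t w $ i) UNIV"
proof -
  interpret prob_space "vector_noise :: (real \<Rightarrow> real ^ 'n) measure" by (rule prob_space_vector_noise)
  have "indep_vars (\<lambda>_. \<Pi>\<^sub>M t\<in>{0..T}. borel) (\<lambda>i w. \<lambda>t\<in>{0..T}. brownian_path S (noise_coord i w) t) UNIV"
    by (rule indep_vars_compose2[OF indep_vars_noise_coord, where Y = "\<lambda>_ z. \<lambda>t\<in>{0..T}. brownian_path S z t"])
      (auto intro!: measurable_restrict)
  then show ?thesis by (simp add: brownian_vector_def)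
qed

context drift begin

lemma measurable_euler:
  assumes "\<And>l. l \<le> k \<Longrightarrow> (\<lambda>\<omega>. v \<omega> l) \<in> borel_measurable M"
  shows "(\<lambda>\<omega>. euler b d (v \<omega>) k) \<in> borel_measurable M"
  using assms
proof (induction k)
  case (Suc k)
  have "(\<lambda>\<omega>. euler b d (v \<omega>) k) \<in> borel_measurable M" using Suc by simp
  moreover have "(\<lambda>\<omega>. b (euler b d (v \<omega>) k)) \<in> borel_measurable M"
    using \<open>(\<lambda>\<omega>. euler b d (v \<omega>) k) \<in> borel_measurable M\<close>
    by (rule measurable_compose) (rule borel_measurable_continuous_onI[OF continuous_b])
  ultimately show ?case using Suc.prems by simp
qed simp

text \<open>The Euler path at t uses the driver only at grid times up to t; with M the
  \<open>\<sigma>\<close>-algebra of time t this is adaptedness.\<close>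

lemma measurable_solution:
  assumes cont: "\<And>\<omega>. \<omega> \<in> space M \<Longrightarrow> continuous_on {0..T} (w \<omega>)"
    and w: "\<And>s. s \<in> {0..t} \<Longrightarrow> (\<lambda>\<omega>. w \<omega> s) \<in> borel_measurable M" and t: "t \<in> {0..T}"
  shows "(\<lambda>\<omega>. solution (w \<omega>) t) \<in> borel_measurable M"
proof (rule borel_measurable_LIMSEQ_metric)
  fix q
  let ?d = "inverse (real (Suc q))"
  show "(\<lambda>\<omega>. euler_path (w \<omega>) q t) \<in> borel_measurable M"
    unfolding euler_path_def step_path_def
  proof (rule measurable_euler)
    fix l assume "l \<le> nat \<lfloor>t / ?d\<rfloor>"
    then have "real l * ?d \<le> real (nat \<lfloor>t / ?d\<rfloor>) * ?d" by (intro mult_right_mono) auto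
    also have "\<dots> \<le> t" by (rule nat_floor_divide_bounds) (use t in auto)
    finally show "(\<lambda>\<omega>. w \<omega> (real l * ?d)) \<in> borel_measurable M" by (intro w) auto
  qed
next
  fix \<omega> assume "\<omega> \<in> space M"
  then show "(\<lambda>q. euler_path (w \<omega>) q t) \<longlonglongrightarrow> solution (w \<omega>) t"
    using tendsto_uniform_limitI[OF solution_uniform_limit[OF cont] t] by blast
qed

end

text \<open>With additive noise the equation is solved separately for each path of the driver x0 +
  sigma B, so no stochastic integration is involved.\<close>

theorem weak_solution_exists:
  fixes x0 :: "real ^ 'n::finite"
  assumes T: "0 \<le> T" and b: "drift b C"
  shows "\<exists>(Q :: (real \<Rightarrow> real ^ 'n) measure) F \<beta> X. weak_solution Q F T \<beta> b \<sigma> x0 X"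
proof -
  interpret drift b C by fact
  \<comment> \<open>A horizon strictly beyond T, since the dyadic construction covers times in [0,
    S) only.\<close>
  define S where "S = T + 1"
  have TS: "0 \<le> T" "T < S" and S: "0 < S" using T by (auto simp: S_def)
  define w where "w \<omega> t = x0 + \<sigma> *\<^sub>R brownian_vector S t \<omega>" for \<omega> :: "real \<Rightarrow> real ^ 'n" and t
  have cont\<beta>: "continuous_on {0..T} (\<lambda>t. brownian_vector S t \<omega>)" for \<omega> :: "real \<Rightarrow> real ^ 'n"
    unfolding brownian_vector_def by (intro continuous_on_vec_lambda continuous_brownian_path TS S)
  then have cont: "continuous_on {0..T} (w \<omega>)" for \<omega>
    unfolding w_def by (intro continuous_intros)
  have \<beta>0: "brownian_vector S 0 \<omega> = 0" for \<omega> :: "real \<Rightarrow> real ^ 'n"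
    by (simp add: brownian_vector_def brownian_path_0[OF S] vec_eq_iff)
  have w0: "solution (w \<omega>) 0 = x0" for \<omega>
    using solution_eq(2)[OF cont, of 0 \<omega>] T by (simp add: w_def \<beta>0)
  have "weak_solution vector_noise (brownian_filtration S T) T (brownian_vector S) b \<sigma> x0 (\<lambda>t \<omega>. solution (w \<omega>) t)"
    unfolding weak_solution_def
  proof (intro conjI allI ballI AE_I2)
    fix t assume t: "t \<in> {0..T}"
    show "(\<lambda>\<omega>. solution (w \<omega>) t) \<in> borel_measurable (brownian_filtration S T t)"
    proof (rule measurable_solution[OF cont _ t])
      fix s assume s: "s \<in> {0..t}"
      have "brownian_vector S s \<in> borel_measurable (brownian_filtration S T s)"
        by (rule brownian_vector_adapted) (use s t in auto)
      moreover have "sets (brownian_filtration S T s) \<subseteq> sets (brownian_filtration S T t :: (real \<Rightarrow> real ^ 'n) measure)"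
        by (rule filtration.sets_F_mono[OF brownian_filtration_filtration]) (use s in simp)
      ultimately have "brownian_vector S s \<in> borel_measurable (brownian_filtration S T t :: (real \<Rightarrow> real ^ 'n) measure)"
        by (auto simp: measurable_def space_brownian_filtration)
      then show "(\<lambda>\<omega>. w \<omega> s) \<in> borel_measurable (brownian_filtration S T t)"
        unfolding w_def by (intro borel_measurable_add borel_measurable_scaleR borel_measurable_const)
    qed
  next
    fix \<omega> :: "real \<Rightarrow> real ^ 'n" and t assume t: "t \<in> {0..T}"
    show "(\<lambda>s. b (solution (w \<omega>) s)) integrable_on {0..t}"
      by (rule solution_eq(1)[OF cont t])
    show "solution (w \<omega>) t = solution (w \<omega>) 0 + integral {0..t} (\<lambda>s. b (solution (w \<omega>) s)) + \<sigma> *\<^sub>R (brownian_vector S t \<omega> - brownian_vector S 0 \<omega>)"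
      using solution_eq(2)[OF cont t, of \<omega>] by (simp add: w0 \<beta>0) (simp add: w_def)
  qed (auto simp: prob_space_vector_noise brownian_filtration_filtration brownian_filtration_subalgebra
      brownian_motion_brownian_vector[OF TS] indep_vars_brownian_vector continuous_on_solution[OF cont] w0)
  then show ?thesis by blast
qed

section \<open>Gaussian limits\<close>

context abm_chain begin

lemma increment_second_moment:
  assumes le: "n0 \<le> n1" and t: "real n1 * h \<le> t"
  shows "integrable M (\<lambda>w. (norm (W n1 w - W n0 w))\<^sup>2)"
    "expectation (\<lambda>w. (norm (W n1 w - W n0 w))\<^sup>2)
      \<le> exp t * (real (n1 - n0) * h * c2 + h * t * c3 * (((norm x0)\<^sup>2 + 1) * exp (c5 * t)))"
proof -
  define k where "k = n1 - n0"
  define Km where "Km = ((norm x0)\<^sup>2 + 1) * exp (c5 * t)"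
  have k: "n0 + k = n1" "k \<le> n1" using le by (auto simp: k_def)
  have sp: "space M \<in> sets (history M x n0)" using sets.top[of "history M x n0"] by simp
  note w = window_second_moment[OF sp, of k, unfolded k(1)]
  have int: "integrable M (\<lambda>w. indicator (space M) w * (norm (W n1 w - W n0 w))\<^sup>2)" using w by blast
  then show "integrable M (\<lambda>w. (norm (W n1 w - W n0 w))\<^sup>2)"
    by (simp cong: Bochner_Integration.integrable_cong)
  have e: "expectation (\<lambda>w. indicator (space M) w * f w) = expectation f" for f :: "'a \<Rightarrow> real"
    by (intro Bochner_Integration.integral_cong) auto
  have Km: "expectation (\<lambda>w. (norm (x (n0 + l) w))\<^sup>2) \<le> Km" if "l < k" for l
  proof -
    have "real (n0 + l) * h \<le> real n1 * h" using that k h by (intro mult_right_mono) auto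
    then show ?thesis using moment_bound[of "n0 + l" t] t by (simp add: Km_def)
  qed
  have Km0: "0 \<le> Km" unfolding Km_def by (intro mult_nonneg_nonneg add_nonneg_nonneg) auto
  have "expectation (\<lambda>w. (norm (W n1 w - W n0 w))\<^sup>2)
    \<le> (1 + h) ^ k * (real k * h * c2 * prob (space M) + h\<^sup>2 * c3 * (\<Sum>l<k. expectation (\<lambda>w. (norm (x (n0 + l) w))\<^sup>2)))"
    using conjunct2[OF w] unfolding e .
  also have "\<dots> \<le> exp t * (real k * h * c2 + h * t * c3 * Km)"
  proof (rule mult_mono)
    have "(1 + h) ^ k \<le> exp h ^ k" using h by (intro power_mono exp_ge_add_one_self) auto
    also have "\<dots> = exp (real k * h)" by (simp flip: exp_of_nat_mult)
    also have "\<dots> \<le> exp t"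
    proof -
      have "real k * h \<le> real n1 * h" using k h by (intro mult_right_mono) auto
      then have "real k * h \<le> t" using t by linarith
      then show ?thesis by simp
    qed
    finally show "(1 + h) ^ k \<le> exp t" .
    have "(\<Sum>l<k. expectation (\<lambda>w. (norm (x (n0 + l) w))\<^sup>2)) \<le> (\<Sum>l<k. Km)" using Km by (intro sum_mono) auto
    also have "\<dots> \<le> real n1 * Km" using k Km0 by (auto intro: mult_right_mono)
    finally have "h\<^sup>2 * c3 * (\<Sum>l<k. expectation (\<lambda>w. (norm (x (n0 + l) w))\<^sup>2)) \<le> h\<^sup>2 * c3 * (real n1 * Km)"
      using c3_nonneg by (intro mult_left_mono) auto
    also have "\<dots> = h * c3 * Km * (real n1 * h)" by (simp add: power2_eq_square)
    also have "\<dots> \<le> h * c3 * Km * t" using t h c3_nonneg Km0 by (intro mult_left_mono) auto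
    finally show "real k * h * c2 * prob (space M) + h\<^sup>2 * c3 * (\<Sum>l<k. expectation (\<lambda>w. (norm (x (n0 + l) w))\<^sup>2))
        \<le> real k * h * c2 + h * t * c3 * Km"
      by (simp add: prob_space mult_ac)
    show "0 \<le> real k * h * c2 * prob (space M) + h\<^sup>2 * c3 * (\<Sum>l<k. expectation (\<lambda>w. (norm (x (n0 + l) w))\<^sup>2))"
      by (intro add_nonneg_nonneg mult_nonneg_nonneg sum_nonneg c2_nonneg c3_nonneg) (use h in auto)
  qed simp
  finally show "expectation (\<lambda>w. (norm (W n1 w - W n0 w))\<^sup>2)
      \<le> exp t * (real (n1 - n0) * h * c2 + h * t * c3 * (((norm x0)\<^sup>2 + 1) * exp (c5 * t)))"
    by (simp add: k_def Km_def)
qed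

end

text \<open>For even n the absolute moment in the Taylor remainder is an ordinary moment, about
  which \<open>has_moment_rate\<close> gives information.\<close>

lemma char_moment_approx:
  assumes prob: "prob_space M" and X: "X \<in> borel_measurable M"
    and int: "\<And>k. k \<le> n \<Longrightarrow> integrable M (\<lambda>w. X w ^ k)" and even: "even n"
  shows "norm (char (distr M borel X) u - (\<Sum>k\<le>n. ((\<i> * u) ^ k / fact k) * (\<integral>w. X w ^ k \<partial>M)))
    \<le> (2 * \<bar>u\<bar> ^ n / fact n) * (\<integral>w. X w ^ n \<partial>M)"
proof -
  interpret prob_space M by fact
  interpret D: real_distribution "distr M borel X" by (rule real_distribution_distr[OF X])
  have i: "integrable (distr M borel X) (\<lambda>x. x ^ k)" if "k \<le> n" for k
    using int[OF that] X by (simp add: integrable_distr_eq)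
  have e: "(\<integral>x. x ^ k \<partial>distr M borel X) = (\<integral>w. X w ^ k \<partial>M)" for k
    using X by (simp add: integral_distr)
  have "\<bar>x\<bar> ^ n = x ^ n" for x :: real using even by (simp add: power_even_abs)
  then show ?thesis using D.char_approx1[where n = n and t = u, OF i] by (simp add: e)
qed

text \<open>The case distinction mirrors hypothesis (c). For m2 = 0 the second moment is itself o(h)
  and controls a Taylor remainder of second order. For m2 > 0 it is of order h, so the expansion
  goes to fourth order, where the third and fourth moments are o(h).\<close>

lemma char_noise_asymptotic:
  fixes \<Xi> :: "real \<Rightarrow> 'b measure" and \<xi> :: "real \<Rightarrow> 'b \<Rightarrow> real"
  assumes prob: "\<And>h. 0 < h \<Longrightarrow> prob_space (\<Xi> h)" and meas: "\<And>h. 0 < h \<Longrightarrow> \<xi> h \<in> borel_measurable (\<Xi> h)"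
    and m1: "has_moment_rate \<Xi> \<xi> 1 0" and m2: "has_moment_rate \<Xi> \<xi> 2 m2" and m20: "0 \<le> m2"
    and m34: "m2 > 0 \<Longrightarrow> has_moment_rate \<Xi> \<xi> 3 0 \<and> has_moment_rate \<Xi> \<xi> 4 0"
    and \<Theta>: "0 \<le> \<Theta>" and \<delta>: "0 < \<delta>"
  shows "\<forall>\<^sub>F h in at_right 0. \<forall>u. \<bar>u\<bar> \<le> \<Theta> \<longrightarrow>
     norm (char (distr (\<Xi> h) borel (\<xi> h)) u - complex_of_real (1 - u\<^sup>2 * m2 * h / 2)) \<le> h * \<delta>"
proof -
  define a where "a k h = (\<integral>w. \<xi> h w ^ k \<partial>\<Xi> h)" for k h
  have lim: "((\<lambda>h. a k h / h) \<longlongrightarrow> m) (at_right 0)" if "has_moment_rate \<Xi> \<xi> k m" for k m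
    using that by (simp add: has_moment_rate_def a_def)
  have int: "\<forall>\<^sub>F h in at_right 0. integrable (\<Xi> h) (\<lambda>w. \<xi> h w ^ k)" if "has_moment_rate \<Xi> \<xi> k m" for k m
    using that by (simp add: has_moment_rate_def)
  have pos: "\<forall>\<^sub>F h in at_right 0. (0::real) < h" by (rule eventually_at_right_less)
  have upow: "\<bar>u\<bar> ^ k \<le> \<Theta> ^ k" if "\<bar>u\<bar> \<le> \<Theta>" for u k using that by (intro power_mono) auto
  have a2eq: "a 2 h = (a 2 h - m2 * h) + m2 * h" for h by simp
  show ?thesis
  proof (cases "m2 = 0")
    case True
    have "((\<lambda>h. \<Theta> * \<bar>a 1 h / h\<bar> + 2 * (\<Theta>\<^sup>2 * \<bar>a 2 h / h\<bar>)) \<longlongrightarrow> \<Theta> * \<bar>0\<bar> + 2 * (\<Theta>\<^sup>2 * \<bar>m2\<bar>)) (at_right 0)"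
      by (intro tendsto_intros lim m1 m2)
    then have "\<forall>\<^sub>F h in at_right 0. \<Theta> * \<bar>a 1 h / h\<bar> + 2 * (\<Theta>\<^sup>2 * \<bar>a 2 h / h\<bar>) < \<delta>"
      using \<delta> True by (intro order_tendstoD) auto
    then show ?thesis using int[OF m1] int[OF m2] pos
    proof eventually_elim
      case (elim h)
      have i: "integrable (\<Xi> h) (\<lambda>w. \<xi> h w ^ k)" if "k \<le> 2" for k
      proof -
        interpret prob_space "\<Xi> h" by (rule prob[OF elim(4)])
        from that consider "k = 0" | "k = 1" | "k = 2" by linarith
        then show ?thesis using elim by cases auto
      qed
      show ?case
      proof (intro allI impI)
        fix u :: real assume u: "\<bar>u\<bar> \<le> \<Theta>"
        interpret prob_space "\<Xi> h" by (rule prob[OF elim(4)])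
        have a0: "a 0 h = 1" by (simp add: a_def prob_space)
        have a2p: "0 \<le> a 2 h" by (simp add: a_def)
        have "u\<^sup>2 \<le> \<Theta>\<^sup>2 * 2" using upow[OF u, of 2] zero_le_power2[of \<Theta>] unfolding power2_abs by linarith
        note au = a2p this
        have s: "(\<Sum>k\<le>2. ((\<i> * u) ^ k / fact k) * complex_of_real (a k h)) = 1 + \<i> * u * a 1 h - u\<^sup>2 / 2 * a 2 h"
          by (simp add: numeral_2_eq_2 a0 fact_numeral power2_eq_square) (simp add: complex_eq_iff)
        have "norm (char (distr (\<Xi> h) borel (\<xi> h)) u - (1 + \<i> * u * a 1 h - u\<^sup>2 / 2 * a 2 h)) \<le> \<bar>u\<bar> ^ 2 * a 2 h"
          using char_moment_approx[where n = 2 and u = u, OF prob[OF elim(4)] meas[OF elim(4)] i] unfolding a_def[symmetric] s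
          by simp
        moreover have "norm (\<i> * u * a 1 h - u\<^sup>2 / 2 * a 2 h) \<le> \<bar>u\<bar> * \<bar>a 1 h\<bar> + \<bar>u\<bar> ^ 2 / 2 * \<bar>a 2 h\<bar>"
          by (rule order_trans[OF norm_triangle_ineq4]) (simp add: norm_mult norm_divide norm_power)
        moreover have "char (distr (\<Xi> h) borel (\<xi> h)) u - 1 = (char (distr (\<Xi> h) borel (\<xi> h)) u - (1 + \<i> * u * a 1 h - u\<^sup>2 / 2 * a 2 h)) + (\<i> * u * a 1 h - u\<^sup>2 / 2 * a 2 h)"
          by simp
        ultimately have "norm (char (distr (\<Xi> h) borel (\<xi> h)) u - 1) \<le> \<bar>u\<bar> ^ 2 * a 2 h + (\<bar>u\<bar> * \<bar>a 1 h\<bar> + \<bar>u\<bar> ^ 2 / 2 * \<bar>a 2 h\<bar>)"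
          using norm_triangle_le add_mono by metis
        also have "\<dots> \<le> \<Theta>\<^sup>2 * \<bar>a 2 h\<bar> + (\<Theta> * \<bar>a 1 h\<bar> + \<Theta>\<^sup>2 * \<bar>a 2 h\<bar>)"
          using upow[OF u, of 2] u \<Theta> au by (intro add_mono mult_mono) auto
        also have "\<dots> = h * (\<Theta> * \<bar>a 1 h / h\<bar> + 2 * (\<Theta>\<^sup>2 * \<bar>a 2 h / h\<bar>))"
          using elim(4) by (simp add: abs_divide field_simps)
        also have "\<dots> \<le> h * \<delta>" using elim(1,4) by (intro mult_left_mono) auto
        finally show "norm (char (distr (\<Xi> h) borel (\<xi> h)) u - complex_of_real (1 - u\<^sup>2 * m2 * h / 2)) \<le> h * \<delta>"
          by (simp add: True)
      qed
    qed
  next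
    case False
    with m20 have "0 < m2" by simp
    then have m3: "has_moment_rate \<Xi> \<xi> 3 0" and m4: "has_moment_rate \<Xi> \<xi> 4 0" using m34 by auto
    have "((\<lambda>h. \<Theta> * \<bar>a 1 h / h\<bar> + \<Theta>\<^sup>2 * \<bar>a 2 h / h - m2\<bar> + \<Theta> ^ 3 * \<bar>a 3 h / h\<bar> + 2 * (\<Theta> ^ 4 * \<bar>a 4 h / h\<bar>))
        \<longlongrightarrow> \<Theta> * \<bar>0\<bar> + \<Theta>\<^sup>2 * \<bar>m2 - m2\<bar> + \<Theta> ^ 3 * \<bar>0\<bar> + 2 * (\<Theta> ^ 4 * \<bar>0\<bar>)) (at_right 0)"
      by (intro tendsto_intros lim m1 m2 m3 m4)
    then have "\<forall>\<^sub>F h in at_right 0. \<Theta> * \<bar>a 1 h / h\<bar> + \<Theta>\<^sup>2 * \<bar>a 2 h / h - m2\<bar> + \<Theta> ^ 3 * \<bar>a 3 h / h\<bar> + 2 * (\<Theta> ^ 4 * \<bar>a 4 h / h\<bar>) < \<delta>"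
      using \<delta> by (intro order_tendstoD) auto
    then show ?thesis using int[OF m1] int[OF m2] int[OF m3] int[OF m4] pos
    proof eventually_elim
      case (elim h)
      have i: "integrable (\<Xi> h) (\<lambda>w. \<xi> h w ^ k)" if "k \<le> 4" for k
      proof -
        interpret prob_space "\<Xi> h" by (rule prob[OF elim(6)])
        from that consider "k = 0" | "k = 1" | "k = 2" | "k = 3" | "k = 4" by linarith
        then show ?thesis using elim by cases auto
      qed
      show ?case
      proof (intro allI impI)
        fix u :: real assume u: "\<bar>u\<bar> \<le> \<Theta>"
        interpret prob_space "\<Xi> h" by (rule prob[OF elim(6)])
        have a0: "a 0 h = 1" by (simp add: a_def prob_space)
        define c where "c = char (distr (\<Xi> h) borel (\<xi> h)) u"
        \<comment> \<open>Everything that is o(h): the mean, the deviation of the second moment from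
          m2 h, and the third and fourth moments.\<close>
        define r where "r = \<i> * u * a 1 h - complex_of_real (u\<^sup>2 / 2 * (a 2 h - m2 * h)) - \<i> * (u ^ 3 / 6 * a 3 h) + complex_of_real (u ^ 4 / 24 * a 4 h)"
        have s: "(\<Sum>k\<le>4. ((\<i> * u) ^ k / fact k) * complex_of_real (a k h)) = complex_of_real (1 - u\<^sup>2 * m2 * h / 2) + r"
        proof -
          have "(\<Sum>k\<le>4. ((\<i> * u) ^ k / fact k) * complex_of_real (a k h))
            = (\<Sum>k\<in>{0, 1, 2, 3, 4}. ((\<i> * u) ^ k / fact k) * complex_of_real (a k h))"
            by (intro sum.cong) auto
          also have "\<dots> = complex_of_real (1 - u\<^sup>2 * m2 * h / 2) + r"
            by (simp add: r_def a0 fact_numeral power_mult_distrib power2_eq_square power3_eq_cube power4_eq_xxxx algebra_simps)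
          finally show ?thesis .
        qed
        have 1: "norm (c - (complex_of_real (1 - u\<^sup>2 * m2 * h / 2) + r)) \<le> \<bar>u\<bar> ^ 4 / 12 * a 4 h"
          using char_moment_approx[where n = 4 and u = u, OF prob[OF elim(6)] meas[OF elim(6)] i] unfolding a_def[symmetric] s c_def
          by (simp add: fact_numeral)
        have 2: "norm r \<le> \<bar>u\<bar> * \<bar>a 1 h\<bar> + \<bar>u\<bar> ^ 2 / 2 * \<bar>a 2 h - m2 * h\<bar> + \<bar>u\<bar> ^ 3 / 6 * \<bar>a 3 h\<bar> + \<bar>u\<bar> ^ 4 / 24 * \<bar>a 4 h\<bar>"
        proof -
          have "norm r \<le> norm (\<i> * u * a 1 h) + norm (complex_of_real (u\<^sup>2 / 2 * (a 2 h - m2 * h))) + norm (\<i> * (u ^ 3 / 6 * a 3 h)) + norm (complex_of_real (u ^ 4 / 24 * a 4 h))"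
            unfolding r_def by (intro norm_triangle_mono order_trans[OF norm_triangle_ineq4] add_mono order_refl)
          moreover have "norm (\<i> * u * a 1 h) = \<bar>u\<bar> * \<bar>a 1 h\<bar>" by (simp add: norm_mult)
          moreover have "norm (complex_of_real (u\<^sup>2 / 2 * (a 2 h - m2 * h))) = \<bar>u\<bar> ^ 2 / 2 * \<bar>a 2 h - m2 * h\<bar>"
            by (simp only: norm_of_real abs_mult) simp
          moreover have "norm (\<i> * (u ^ 3 / 6 * a 3 h)) = \<bar>u\<bar> ^ 3 / 6 * \<bar>a 3 h\<bar>"
            by (simp add: norm_mult norm_divide norm_power)
          moreover have "norm (complex_of_real (u ^ 4 / 24 * a 4 h)) = \<bar>u\<bar> ^ 4 / 24 * \<bar>a 4 h\<bar>"
            by (simp add: norm_mult norm_divide norm_power)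
          ultimately show ?thesis by linarith
        qed
        have "c - complex_of_real (1 - u\<^sup>2 * m2 * h / 2) = (c - (complex_of_real (1 - u\<^sup>2 * m2 * h / 2) + r)) + r" by simp
        then have "norm (c - complex_of_real (1 - u\<^sup>2 * m2 * h / 2)) \<le> norm (c - (complex_of_real (1 - u\<^sup>2 * m2 * h / 2) + r)) + norm r"
          by (metis norm_triangle_ineq)
        also have "\<dots> \<le> \<bar>u\<bar> ^ 4 / 12 * a 4 h + (\<bar>u\<bar> * \<bar>a 1 h\<bar> + \<bar>u\<bar> ^ 2 / 2 * \<bar>a 2 h - m2 * h\<bar> + \<bar>u\<bar> ^ 3 / 6 * \<bar>a 3 h\<bar> + \<bar>u\<bar> ^ 4 / 24 * \<bar>a 4 h\<bar>)"
          using 1 2 by (rule add_mono)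
        also have "\<dots> \<le> \<Theta> ^ 4 * \<bar>a 4 h\<bar> + (\<Theta> * \<bar>a 1 h\<bar> + \<Theta>\<^sup>2 * \<bar>a 2 h - m2 * h\<bar> + \<Theta> ^ 3 * \<bar>a 3 h\<bar> + \<Theta> ^ 4 * \<bar>a 4 h\<bar>)"
        proof (intro add_mono)
          have p: "0 \<le> \<bar>u\<bar> ^ k" for k by simp
          have "\<bar>u\<bar> ^ 4 / 12 \<le> \<Theta> ^ 4" using upow[OF u, of 4] p[of 4] by linarith
          moreover have "0 \<le> a 4 h" by (simp add: a_def)
          ultimately show "\<bar>u\<bar> ^ 4 / 12 * a 4 h \<le> \<Theta> ^ 4 * \<bar>a 4 h\<bar>"
            using \<Theta> by (intro mult_mono) auto
          show "\<bar>u\<bar> * \<bar>a 1 h\<bar> \<le> \<Theta> * \<bar>a 1 h\<bar>" using u by (intro mult_right_mono) auto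
          show "\<bar>u\<bar> ^ 2 / 2 * \<bar>a 2 h - m2 * h\<bar> \<le> \<Theta>\<^sup>2 * \<bar>a 2 h - m2 * h\<bar>"
            using upow[OF u, of 2] p[of 2] by (intro mult_right_mono, linarith) simp
          show "\<bar>u\<bar> ^ 3 / 6 * \<bar>a 3 h\<bar> \<le> \<Theta> ^ 3 * \<bar>a 3 h\<bar>"
            using upow[OF u, of 3] p[of 3] by (intro mult_right_mono, linarith) simp
          show "\<bar>u\<bar> ^ 4 / 24 * \<bar>a 4 h\<bar> \<le> \<Theta> ^ 4 * \<bar>a 4 h\<bar>"
            using upow[OF u, of 4] p[of 4] by (intro mult_right_mono, linarith) simp
        qed
        also have "\<dots> = h * (\<Theta> * \<bar>a 1 h / h\<bar> + \<Theta>\<^sup>2 * \<bar>a 2 h / h - m2\<bar> + \<Theta> ^ 3 * \<bar>a 3 h / h\<bar> + 2 * (\<Theta> ^ 4 * \<bar>a 4 h / h\<bar>))"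
        proof -
          have "a 2 h / h - m2 = (a 2 h - m2 * h) / h" using elim(6) by (simp add: diff_divide_distrib)
          then have "h * \<bar>a 2 h / h - m2\<bar> = \<bar>a 2 h - m2 * h\<bar>" using elim(6) by (simp add: abs_divide)
          moreover have "h * \<bar>a k h / h\<bar> = \<bar>a k h\<bar>" for k using elim(6) by (simp add: abs_divide)
          ultimately show ?thesis by (simp only: distrib_left mult.left_commute[of h])
        qed
        also have "\<dots> \<le> h * \<delta>" using elim(1,6) by (intro mult_left_mono) auto
        finally show "norm (char (distr (\<Xi> h) borel (\<xi> h)) u - complex_of_real (1 - u\<^sup>2 * m2 * h / 2)) \<le> h * \<delta>"
          by (simp only: c_def)
      qed
    qed
  qed
qed

section \<open>The driving Brownian motion of an arbitrary weak solution\<close>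

text \<open>\<open>brownian_motion\<close> states independence of one increment from the preceding
  \<open>\<sigma>\<close>-algebra; the product formula results from splitting off the last increment
  inductively.\<close>

lemma brownian_motion_char:
  assumes Q: "prob_space Q" and sub: "\<And>t. subalgebra Q (F t)" and fil: "filtration (space Q) F"
    and B: "brownian_motion Q F T B" and d: "0 < d" and K: "real K * d \<le> T"
  shows "(\<integral>w. cis (\<Sum>k<K. c k * (B (real (Suc k) * d) w - B (real k * d) w)) \<partial>Q)
    = complex_of_real (exp (- (d * (\<Sum>k<K. (c k)\<^sup>2)) / 2))"
  using K
proof (induction K)
  case 0
  interpret prob_space Q by fact
  show ?case by (simp add: prob_space)
next
  case (Suc K)
  interpret prob_space Q by fact
  define s t where "s = real K * d" and "t = real (Suc K) * d"
  have st: "s \<in> {0..T}" "t \<in> {s<..T}" "t - s = d"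
    using Suc.prems d by (auto simp: s_def t_def algebra_simps)
  define D where "D w = B t w - B s w" for w
  have cism[measurable]: "cis \<in> borel_measurable borel"
    by (intro borel_measurable_continuous_onI continuous_intros)
  have BF: "B r \<in> borel_measurable (F s)" if "r \<in> {0..s}" for r
  proof -
    have "B r \<in> borel_measurable (F r)" using B that st by (auto simp: brownian_motion_def)
    moreover have "sets (F r) \<subseteq> sets (F s)" by (rule filtration.sets_F_mono[OF fil]) (use that in simp)
    ultimately show ?thesis using filtration.space_F[OF fil] by (auto simp: measurable_def)
  qed
  have BQ: "B r \<in> borel_measurable Q" if "r \<in> {0..T}" for r
    using B that by (auto simp: brownian_motion_def intro: measurable_from_subalg[OF sub])
  have dist: "distributed Q lborel D (normal_density 0 (sqrt d))"
    and ind: "indep_set (sets (F s)) (sets (vimage_algebra (space Q) D borel))"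
    using B st unfolding brownian_motion_def D_def[abs_def] by (metis, metis)
  have Dm[measurable]: "D \<in> borel_measurable Q" using distributed_measurable[OF dist] by simp
  define Z where "Z w = cis (\<Sum>k<K. c k * (B (real (Suc k) * d) w - B (real k * d) w))" for w
  have ZF: "Z \<in> borel_measurable (F s)"
    unfolding Z_def
  proof (intro measurable_compose[OF _ cism] borel_measurable_sum borel_measurable_times borel_measurable_const borel_measurable_diff)
    fix k assume "k \<in> {..<K}"
    then have "real (Suc k) * d \<le> s" "real k * d \<le> s" unfolding s_def using d by (auto intro!: mult_right_mono)
    then show "B (real (Suc k) * d) \<in> borel_measurable (F s)" "B (real k * d) \<in> borel_measurable (F s)"
      using d by (auto intro!: BF)
  qed
  then have ZQ[measurable]: "Z \<in> borel_measurable Q" by (rule measurable_from_subalg[OF sub])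
  \<comment> \<open>Z is measurable for \<open>F s\<close> and the character of D for the
    \<open>\<sigma>\<close>-algebra of D, so independence of the \<open>\<sigma>\<close>-algebras
    passes to these two variables.\<close>
  have indv: "indep_var borel Z borel (\<lambda>w. cis (c K * D w))"
  proof -
    let ?D = "\<lambda>w. cis (c K * D w)" and ?V = "vimage_algebra (space Q) D borel"
    have sF: "space (F s) = space Q" using filtration.space_F[OF fil] by simp
    have "{Z -` A \<inter> space Q | A. A \<in> sets borel} \<subseteq> sets (F s)"
      using measurable_sets[OF ZF] sF by auto
    then have 1: "sigma_sets (space Q) {Z -` A \<inter> space Q | A. A \<in> sets borel} \<subseteq> sets (F s)"
      using sets.sigma_sets_subset[of _ "F s"] sF by simp
    have "D \<in> borel_measurable ?V" by (rule measurable_vimage_algebra1) simp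
    then have "?D \<in> borel_measurable ?V" by measurable
    then have "{?D -` A \<inter> space Q | A. A \<in> sets borel} \<subseteq> sets ?V"
      using measurable_sets[of ?D ?V borel] by auto
    then have 2: "sigma_sets (space Q) {?D -` A \<inter> space Q | A. A \<in> sets borel} \<subseteq> sets ?V"
      using sets.sigma_sets_subset[of _ ?V] by simp
    from ind have "indep_set (sigma_sets (space Q) {Z -` A \<inter> space Q | A. A \<in> sets borel})
       (sigma_sets (space Q) {?D -` A \<inter> space Q | A. A \<in> sets borel})"
      unfolding indep_sets2_eq using 1 2 by blast
    moreover have "?D \<in> borel_measurable Q" by measurable
    ultimately show ?thesis unfolding indep_var_eq using ZQ by blast
  qed
  have charD: "expectation (\<lambda>w. cis (c K * D w)) = complex_of_real (exp (- (d * (c K)\<^sup>2) / 2))"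
  proof -
    have "expectation (\<lambda>w. cis (c K * D w)) = (\<integral>x. cis (c K * x) \<partial>distr Q lborel D)"
      by (subst integral_distr) auto
    also have "distr Q lborel D = scaled_normal d"
      using dist scaled_normal_eq_density[OF d] by (simp add: distributed_def)
    also have "(\<integral>x. cis (c K * x) \<partial>scaled_normal d) = char (scaled_normal d) (c K)"
      by (simp add: char_def cis_conv_exp)
    also have "\<dots> = complex_of_real (exp (- ((c K)\<^sup>2 * d) / 2))" by (rule char_scaled_normal) (use d in simp)
    finally show ?thesis by (simp add: mult.commute)
  qed
  have "expectation (\<lambda>w. cis (\<Sum>k<Suc K. c k * (B (real (Suc k) * d) w - B (real k * d) w))) = expectation (\<lambda>w. Z w * cis (c K * D w))"
    unfolding Z_def cis_mult D_def s_def t_def by (simp add: algebra_simps)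
  also have "\<dots> = expectation Z * expectation (\<lambda>w. cis (c K * D w))"
    proof (rule indep_var_lebesgue_integral[OF indv])
    show "integrable Q Z" by (intro integrable_const_bound[of _ 1] ZQ) (simp add: Z_def)
    show "integrable Q (\<lambda>w. cis (c K * D w))" by (intro integrable_const_bound[of _ 1]) auto
  qed
  also have "expectation Z = complex_of_real (exp (- (d * (\<Sum>k<K. (c k)\<^sup>2)) / 2))"
    unfolding Z_def by (rule Suc.IH) (use st s_def in auto)
  finally show ?case unfolding charD of_real_mult[symmetric] exp_add[symmetric]
    by (simp add: algebra_simps add_divide_distrib)
qed

text \<open>Coordinates are independent as whole paths, and \<open>f i\<close> reads path i at grid
  times only; the expectation of the product is therefore the product of the one-dimensional
  formulas.\<close>

lemma weak_solution_char:
  fixes \<beta> :: "real \<Rightarrow> 'c \<Rightarrow> real ^ 'n::finite"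
  assumes ws: "weak_solution Q F T \<beta> b \<sigma> x0 X" and d: "0 < d" and K: "real K * d \<le> T"
  shows "(\<integral>\<omega>. cis (\<Sum>(k, i)\<in>{..<K} \<times> UNIV. \<theta> (k, i) * (\<sigma> * (\<beta> (real (Suc k) * d) \<omega> $ i - \<beta> (real k * d) \<omega> $ i))) \<partial>Q)
    = complex_of_real (exp (- (\<sigma>\<^sup>2 / 2 * d * (\<Sum>(k, i)\<in>{..<K} \<times> UNIV. (\<theta> (k, i))\<^sup>2))))"
proof -
  interpret prob_space Q using ws by (simp add: weak_solution_def)
  define f where "f i w = cis (\<Sum>k<K. (\<theta> (k, i) * \<sigma>) * (w (real (Suc k) * d) - w (real k * d)))" for i and w :: "real \<Rightarrow> real"
  have times: "real (Suc k) * d \<in> {0..T}" "real k * d \<in> {0..T}" if "k < K" for k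
  proof -
    have "real (Suc k) * d \<le> real K * d" "real k * d \<le> real K * d"
      using that d by (intro mult_right_mono, auto)+
    then have "real (Suc k) * d \<le> T" "real k * d \<le> T" using K by linarith+
    moreover have "0 \<le> real (Suc k) * d" "0 \<le> real k * d" using d by auto
    ultimately show "real (Suc k) * d \<in> {0..T}" "real k * d \<in> {0..T}" by (simp_all del: of_nat_Suc)
  qed
  have cism[measurable]: "cis \<in> borel_measurable borel"
    by (intro borel_measurable_continuous_onI continuous_intros)
  have fm: "f i \<in> borel_measurable (\<Pi>\<^sub>M t\<in>{0..T}. borel)" for i
    unfolding f_def using times
    by (intro measurable_compose[OF _ cism] borel_measurable_sum borel_measurable_times borel_measurable_diff borel_measurable_const measurable_component_singleton) auto
  have "indep_vars (\<lambda>_. \<Pi>\<^sub>M t\<in>{0..T}. borel) (\<lambda>i \<omega>. \<lambda>t\<in>{0..T}. \<beta> t \<omega> $ i) UNIV"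
    using ws by (simp add: weak_solution_def)
  then have "indep_vars (\<lambda>_. borel) (\<lambda>i \<omega>. f i (\<lambda>t\<in>{0..T}. \<beta> t \<omega> $ i)) UNIV"
    by (rule indep_vars_compose2) (rule fm)
  moreover have fr: "f i (\<lambda>t\<in>{0..T}. \<beta> t \<omega> $ i) = f i (\<lambda>t. \<beta> t \<omega> $ i)" for i \<omega>
    unfolding f_def using times by (intro arg_cong[where f = cis] sum.cong refl) auto
  ultimately have ind: "indep_vars (\<lambda>_. borel) (\<lambda>i \<omega>. f i (\<lambda>t. \<beta> t \<omega> $ i)) UNIV" by simp
  have int: "integrable Q (\<lambda>\<omega>. f i (\<lambda>t. \<beta> t \<omega> $ i))" for i
    using ind by (intro integrable_const_bound[of _ 1]) (auto simp: f_def indep_vars_def)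
  have each: "expectation (\<lambda>\<omega>. f i (\<lambda>t. \<beta> t \<omega> $ i)) = complex_of_real (exp (- (d * (\<Sum>k<K. (\<theta> (k, i) * \<sigma>)\<^sup>2)) / 2))" for i
    unfolding f_def
    by (rule brownian_motion_char[where F = F and T = T]) (use ws d K in \<open>auto simp: weak_solution_def prob_space_axioms\<close>)
  have cis_sum: "cis (\<Sum>i\<in>I. g i) = (\<Prod>i\<in>I. cis (g i))" if "finite I" for I :: "'n set" and g
    using that by (induction I rule: finite_induct) (auto simp: cis_mult[symmetric])
  have "(\<Sum>(k, i)\<in>{..<K} \<times> UNIV. \<theta> (k, i) * (\<sigma> * (\<beta> (real (Suc k) * d) \<omega> $ i - \<beta> (real k * d) \<omega> $ i)))
    = (\<Sum>i\<in>UNIV. \<Sum>k<K. (\<theta> (k, i) * \<sigma>) * (\<beta> (real (Suc k) * d) \<omega> $ i - \<beta> (real k * d) \<omega> $ i))" for \<omega>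
    unfolding sum.cartesian_product[symmetric] by (subst sum.swap) (simp add: mult.assoc)
  then have "expectation (\<lambda>\<omega>. cis (\<Sum>(k, i)\<in>{..<K} \<times> UNIV. \<theta> (k, i) * (\<sigma> * (\<beta> (real (Suc k) * d) \<omega> $ i - \<beta> (real k * d) \<omega> $ i))))
    = expectation (\<lambda>\<omega>. \<Prod>i\<in>UNIV. f i (\<lambda>t. \<beta> t \<omega> $ i))"
    by (simp add: cis_sum f_def)
  also have "\<dots> = (\<Prod>i\<in>UNIV. expectation (\<lambda>\<omega>. f i (\<lambda>t. \<beta> t \<omega> $ i)))"
    by (rule indep_vars_lebesgue_integral[OF _ ind int]) simp
  also have "\<dots> = complex_of_real (\<Prod>i\<in>UNIV. exp (- (d * (\<Sum>k<K. (\<theta> (k, i) * \<sigma>)\<^sup>2)) / 2))"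
    by (simp add: each)
  also have "(\<Prod>i\<in>UNIV. exp (- (d * (\<Sum>k<K. (\<theta> (k, i) * \<sigma>)\<^sup>2)) / 2)) = exp (\<Sum>i\<in>UNIV. - (d * (\<Sum>k<K. (\<theta> (k, i) * \<sigma>)\<^sup>2)) / 2)"
    by (rule exp_sum[symmetric]) simp
  also have "(\<Sum>i\<in>UNIV. - (d * (\<Sum>k<K. (\<theta> (k, i) * \<sigma>)\<^sup>2)) / 2) = - (\<sigma>\<^sup>2 / 2 * d * (\<Sum>(k, i)\<in>{..<K} \<times> UNIV. (\<theta> (k, i))\<^sup>2))"
    unfolding sum.cartesian_product[symmetric]
    by (subst sum.swap) (simp add: sum_distrib_left sum_negf power_mult_distrib mult_ac sum_divide_distrib)
  finally show ?thesis .
qed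

section \<open>The family of chains\<close>

text \<open>For monotone n at most one block contains l, so the sum has at most one possibly nonzero
  term and even a nonlinear F, such as the squared norm, commutes with it.\<close>

lemma map_block_sum:
  fixes \<theta> :: "nat \<Rightarrow> 'v::comm_monoid_add" and F :: "'v \<Rightarrow> 'w::comm_monoid_add"
  assumes n: "mono n" and F0: "F 0 = 0"
  shows "F (\<Sum>k<K. if n k \<le> l \<and> l < n (Suc k) then \<theta> k else 0)
    = (\<Sum>k<K. if n k \<le> l \<and> l < n (Suc k) then F (\<theta> k) else 0)"
proof (induction K)
  case (Suc K)
  show ?case
  proof (cases "n K \<le> l")
    case True
    have no: "\<not> l < n (Suc k)" if "k < K" for k
      using monoD[OF n, of "Suc k" K] that True by simp
    have "(\<Sum>k<K. if n k \<le> l \<and> l < n (Suc k) then \<theta> k else 0) = 0"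
      "(\<Sum>k<K. if n k \<le> l \<and> l < n (Suc k) then F (\<theta> k) else 0) = 0"
      using no by (auto intro!: sum.neutral)
    then show ?thesis using F0 by simp
  qed (use Suc.IH in simp)
qed (simp add: F0)

lemma sum_over_blocks:
  fixes f :: "nat \<Rightarrow> nat \<Rightarrow> 'v::comm_monoid_add"
  assumes n: "mono n" and n0: "n 0 = 0"
  shows "(\<Sum>l<n K. \<Sum>k<K. if n k \<le> l \<and> l < n (Suc k) then f k l else 0) = (\<Sum>k<K. \<Sum>l\<in>{n k..<n (Suc k)}. f k l)"
proof -
  have "(\<Sum>l<n K. if n k \<le> l \<and> l < n (Suc k) then f k l else 0) = (\<Sum>l\<in>{n k..<n (Suc k)}. f k l)" if "k < K" for k
  proof -
    have "n (Suc k) \<le> n K" using n that by (auto intro: monoD)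
    then have "{..<n K} \<inter> {l. n k \<le> l \<and> l < n (Suc k)} = {n k..<n (Suc k)}" by auto
    then show ?thesis by (simp add: sum.If_cases)
  qed
  then show ?thesis by (subst sum.swap) simp
qed

text \<open>Index of the last chain step at or before the time k d; consecutive values delimit the
  blocks.\<close>

definition grid :: "real \<Rightarrow> real \<Rightarrow> nat \<Rightarrow> nat" where
  "grid h d k = nat \<lfloor>real k * d / h\<rfloor>"

lemma grid_0 [simp]: "grid h d 0 = 0" by (simp add: grid_def)

lemma grid_bounds:
  assumes "0 < h" "0 \<le> d"
  shows "real (grid h d k) * h \<le> real k * d" "real k * d < real (grid h d k) * h + h"
proof -
  have "0 \<le> real k * d / h" using assms by simp
  then have "real (grid h d k) \<le> real k * d / h" "real k * d / h < real (grid h d k) + 1"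
    unfolding grid_def by linarith+
  then show "real (grid h d k) * h \<le> real k * d" "real k * d < real (grid h d k) * h + h"
    using assms by (auto simp: field_simps)
qed

lemma mono_grid: "0 < h \<Longrightarrow> 0 \<le> d \<Longrightarrow> mono (grid h d)"
  unfolding grid_def by (intro monoI nat_mono floor_mono divide_right_mono mult_right_mono) auto

lemma grid_step:
  assumes "0 < h" "0 \<le> d"
  shows "grid h d k \<le> grid h d (Suc k)" "real (grid h d (Suc k) - grid h d k) * h \<le> d + h"
proof -
  show le: "grid h d k \<le> grid h d (Suc k)" by (rule monoD[OF mono_grid[OF assms]]) simp
  then show "real (grid h d (Suc k) - grid h d k) * h \<le> d + h"
    using grid_bounds[OF assms, of k] grid_bounds[OF assms, of "Suc k"] by (simp add: of_nat_diff algebra_simps)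
qed

lemma tendsto_grid:
  assumes d: "0 \<le> d"
  shows "((\<lambda>h. real (grid h d k) * h) \<longlongrightarrow> real k * d) (at_right 0)"
proof (rule tendsto_sandwich)
  show "\<forall>\<^sub>F h in at_right 0. real k * d - h \<le> real (grid h d k) * h"
    "\<forall>\<^sub>F h in at_right 0. real (grid h d k) * h \<le> real k * d"
    using eventually_at_right_less[of "0::real"] by (eventually_elim, use grid_bounds[OF _ d, of _ k] in fastforce)+
  show "((\<lambda>h. real k * d - h) \<longlongrightarrow> real k * d) (at_right 0)" by (auto intro!: tendsto_eq_intros)
qed simp

locale abm_family =
  fixes m2 :: real and x0 :: "real ^ 'n::finite" and p :: "'n \<Rightarrow> 'n \<Rightarrow> real ^ 'n \<Rightarrow> real"
    and \<Xi> :: "real \<Rightarrow> 'b measure" and \<xi> :: "real \<Rightarrow> 'b \<Rightarrow> real"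
    and M :: "real \<Rightarrow> 'a measure" and x :: "real \<Rightarrow> nat \<Rightarrow> 'a \<Rightarrow> real ^ 'n"
  assumes p01: "\<And>i j y. p i j y \<in> {0..1}"
    and p_lipschitz: "\<And>i j. \<exists>L. L-lipschitz_on UNIV (p i j)"
    and noise_prob: "\<And>h. 0 < h \<Longrightarrow> prob_space (\<Xi> h)"
    and noise_measurable: "\<And>h. 0 < h \<Longrightarrow> \<xi> h \<in> borel_measurable (\<Xi> h)"
    and m1: "has_moment_rate \<Xi> \<xi> 1 0"
    and m2: "has_moment_rate \<Xi> \<xi> 2 m2"
    and m34: "m2 > 0 \<Longrightarrow> has_moment_rate \<Xi> \<xi> 3 0 \<and> has_moment_rate \<Xi> \<xi> 4 0"
    and markov: "\<And>h. 0 < h \<Longrightarrow>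
      markov_chain (M h) (abm_kernel (real CARD('n) * h) p (distr (\<Xi> h) borel (\<xi> h))) x0 (x h)"
begin

lemma m2_nonneg: "0 \<le> m2"
proof (rule tendsto_lowerbound)
  show "((\<lambda>h. (\<integral>w. \<xi> h w ^ 2 \<partial>\<Xi> h) / h) \<longlongrightarrow> m2) (at_right 0)" using m2 by (simp add: has_moment_rate_def)
  show "\<forall>\<^sub>F h in at_right 0. 0 \<le> (\<integral>w. \<xi> h w ^ 2 \<partial>\<Xi> h) / h"
    using eventually_at_right_less[of "0::real"] by eventually_elim simp
qed simp

lemma prob_space_M: "0 < h \<Longrightarrow> prob_space (M h)" and x_measurable: "0 < h \<Longrightarrow> x h n \<in> borel_measurable (M h)"
  and x_initial: "0 < h \<Longrightarrow> AE w in M h. x h 0 w = x0"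
  using markov by (auto simp: markov_chain_def)

lemma p_measurable: "p i j \<in> borel_measurable borel"
proof -
  obtain L where "L-lipschitz_on UNIV (p i j)" using p_lipschitz by blast
  then show ?thesis by (intro borel_measurable_continuous_onI lipschitz_on_continuous_on)
qed

text \<open>The limits m1 = 0 and m2 leave room, for small h, for the bound h on the mean and (m2 +
  1) h on the second moment.\<close>

lemma eventually_chain:
  "\<forall>\<^sub>F h in at_right 0. abm_chain (real CARD('n)) h p (distr (\<Xi> h) borel (\<xi> h)) (M h) x0 (x h) (m2 + 1)"
proof -
  have "\<forall>\<^sub>F h in at_right 0. \<bar>(\<integral>w. \<xi> h w ^ 1 \<partial>\<Xi> h) / h\<bar> < 1"
  proof (rule order_tendstoD)
    show "((\<lambda>h. \<bar>(\<integral>w. \<xi> h w ^ 1 \<partial>\<Xi> h) / h\<bar>) \<longlongrightarrow> \<bar>0\<bar>) (at_right 0)"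
      by (rule tendsto_rabs) (use m1 in \<open>simp add: has_moment_rate_def\<close>)
  qed simp
  moreover have "\<forall>\<^sub>F h in at_right 0. (\<integral>w. \<xi> h w ^ 2 \<partial>\<Xi> h) / h < m2 + 1"
  proof (rule order_tendstoD)
    show "((\<lambda>h. (\<integral>w. \<xi> h w ^ 2 \<partial>\<Xi> h) / h) \<longlongrightarrow> m2) (at_right 0)" using m2 by (simp add: has_moment_rate_def)
  qed simp
  moreover have "\<forall>\<^sub>F h in at_right 0. integrable (\<Xi> h) (\<lambda>w. \<xi> h w ^ 2)" using m2 by (simp add: has_moment_rate_def)
  moreover have "\<forall>\<^sub>F h in at_right 0. (h::real) < 1" by (rule eventually_mono[OF eventually_at_right_real[of 0 1]]) auto
  moreover have "\<forall>\<^sub>F h in at_right 0. (0::real) < h" by (rule eventually_at_right_less)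
  ultimately show ?thesis
  proof eventually_elim
    case (elim h)
    note h = elim(5) and meas[measurable] = noise_measurable[OF elim(5)]
    interpret \<Xi>: prob_space "\<Xi> h" by (rule noise_prob[OF h])
    have s: "abm_kernel_setup p (distr (\<Xi> h) borel (\<xi> h))"
      by (intro abm_kernel_setup.intro p01 p_measurable \<Xi>.prob_space_distr meas sets_distr)
    show ?case
    proof (intro abm_chain.intro abm_markov.intro abm_markov_axioms.intro abm_chain_axioms.intro s markov h p_lipschitz refl)
      show "h \<le> 1" using elim by simp
      show "integrable (distr (\<Xi> h) borel (\<xi> h)) (\<lambda>z. z\<^sup>2)"
        using elim(3) by (simp add: integrable_distr_eq)
      show "\<bar>\<integral>z. z \<partial>distr (\<Xi> h) borel (\<xi> h)\<bar> \<le> h"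
        using elim(1) h by (simp add: integral_distr abs_divide)
      show "(\<integral>z. z\<^sup>2 \<partial>distr (\<Xi> h) borel (\<xi> h)) \<le> (m2 + 1) * h"
        using elim(2) h by (simp add: integral_distr pos_divide_less_eq)
    qed
  qed
qed

text \<open>The process \<open>W\<close> outside the locale \<open>abm_chain\<close>, whose
  assumptions are available for small h only.\<close>

definition V :: "real \<Rightarrow> nat \<Rightarrow> 'a \<Rightarrow> real ^ 'n" where
  "V h n w = x h n w - h *\<^sub>R (\<Sum>l<n. abm_drift p (x h l w))"

lemma V_0: "V h 0 = x h 0"
  by (simp add: V_def fun_eq_iff)

lemma x_eq_euler: "x h n w = euler (abm_drift p) h (\<lambda>k. V h k w) n"
proof (induction n)
  case (Suc n)
  have "V h (Suc n) w - V h n w = x h (Suc n) w - x h n w - h *\<^sub>R abm_drift p (x h n w)"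
    by (simp add: V_def scaleR_add_right)
  then show ?case using Suc by (simp add: algebra_simps)
qed (simp add: V_0)

lemma chain_W_eq:
  assumes "abm_chain (real CARD('n)) h p \<nu> (M h) x0 (x h) \<kappa>"
  shows "abm_chain.W h p (x h) = V h"
  by (intro ext) (simp add: abm_chain.W_def[OF assms] V_def)

lemma V_measurable:
  assumes h: "0 < h"
  shows "V h n \<in> borel_measurable (M h)"
proof -
  interpret drift "abm_drift p" "2 * real CARD('n)" by (rule drift_abm_drift[OF p01 p_lipschitz])
  have "abm_drift p \<in> borel_measurable borel" by (intro borel_measurable_continuous_onI continuous_b)
  from measurable_compose[OF x_measurable[OF h] this] x_measurable[OF h] show ?thesis
    unfolding V_def by (intro borel_measurable_diff borel_measurable_scaleR borel_measurable_sum borel_measurable_const) auto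
qed

text \<open>Second-moment and maximal estimates with one constant for the whole family; the trailing
  h takes up the error terms that vanish with the step.\<close>

definition regular_windows :: "real \<Rightarrow> real \<Rightarrow> real \<Rightarrow> bool" where
  "regular_windows C t h \<longleftrightarrow> (\<forall>n0 n1. n0 \<le> n1 \<longrightarrow> real n1 * h \<le> t \<longrightarrow>
       integrable (M h) (\<lambda>w. (norm (V h n1 w - V h n0 w))\<^sup>2) \<and>
       (\<integral>w. (norm (V h n1 w - V h n0 w))\<^sup>2 \<partial>M h) \<le> C * (real (n1 - n0) * h + h) \<and>
       (\<forall>\<epsilon>>0. measure (M h) {w \<in> space (M h). \<exists>n\<in>{n0..n1}. 2 * \<epsilon> \<le> norm (V h n w - V h n0 w)}
          \<le> measure (M h) {w \<in> space (M h). \<epsilon> \<le> norm (V h n1 w - V h n0 w)}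
            + C / \<epsilon>\<^sup>2 * (real (n1 - n0) * h
                * measure (M h) {w \<in> space (M h). \<exists>n\<in>{n0..n1}. 2 * \<epsilon> \<le> norm (V h n w - V h n0 w)} + h)))"

lemma regular_windowsD:
  assumes "regular_windows C t h" "n0 \<le> n1" "real n1 * h \<le> t"
  shows "integrable (M h) (\<lambda>w. (norm (V h n1 w - V h n0 w))\<^sup>2)"
    "(\<integral>w. (norm (V h n1 w - V h n0 w))\<^sup>2 \<partial>M h) \<le> C * (real (n1 - n0) * h + h)"
    "0 < \<epsilon> \<Longrightarrow> measure (M h) {w \<in> space (M h). \<exists>n\<in>{n0..n1}. 2 * \<epsilon> \<le> norm (V h n w - V h n0 w)}
          \<le> measure (M h) {w \<in> space (M h). \<epsilon> \<le> norm (V h n1 w - V h n0 w)}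
            + C / \<epsilon>\<^sup>2 * (real (n1 - n0) * h
                * measure (M h) {w \<in> space (M h). \<exists>n\<in>{n0..n1}. 2 * \<epsilon> \<le> norm (V h n w - V h n0 w)} + h)"
  using assms unfolding regular_windows_def by blast+

text \<open>The constants c2, c3 and c5 depend on the number of agents and on m2 + 1, not on h, so
  one C serves for all small steps.\<close>

lemma windows:
  assumes t: "0 \<le> t"
  obtains C where "0 \<le> C"
    "\<forall>\<^sub>F h in at_right 0. regular_windows C t h"
proof -
  define c2 where "c2 = abm_chain.c2 (real CARD('n)) (m2 + 1)"
  define c3 where "c3 = abm_chain.c3 (real CARD('n))"
  define Km where "Km = ((norm x0)\<^sup>2 + 1) * exp (abm_chain.c5 (real CARD('n)) (m2 + 1) * t)"
  define C where "C = exp t * (\<bar>c2\<bar> + t * \<bar>c3\<bar> * Km)"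
  have Km0: "0 \<le> Km" unfolding Km_def by (intro mult_nonneg_nonneg add_nonneg_nonneg) auto
  have K0: "0 \<le> t * \<bar>c3\<bar> * Km" using Km0 t by simp
  have "0 \<le> \<bar>c2\<bar> + t * \<bar>c3\<bar> * Km" using K0 by simp
  then have C0: "0 \<le> C" unfolding C_def by (rule mult_nonneg_nonneg[OF exp_ge_zero])
  have le: "exp t * (y * c2 + h * t * c3 * Km) \<le> C * (y + h)" if "0 \<le> y" "0 \<le> h" for y h :: real
  proof -
    have "y * c2 + h * t * c3 * Km \<le> y * \<bar>c2\<bar> + h * (t * \<bar>c3\<bar> * Km)"
      using that t Km0 by (intro add_mono mult_left_mono) (auto simp: mult.assoc intro!: mult_left_mono mult_right_mono)
    also have "\<dots> \<le> (\<bar>c2\<bar> + t * \<bar>c3\<bar> * Km) * (y + h)"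
      using that K0 mult_nonneg_nonneg[OF that(1) K0] mult_nonneg_nonneg[OF that(2) abs_ge_zero[of c2]]
      by (simp add: algebra_simps)
    finally have "exp t * (y * c2 + h * t * c3 * Km) \<le> exp t * ((\<bar>c2\<bar> + t * \<bar>c3\<bar> * Km) * (y + h))" by simp
    then show ?thesis by (simp add: C_def mult.assoc)
  qed
  show ?thesis
  proof (rule that[OF C0])
    show "\<forall>\<^sub>F h in at_right 0. regular_windows C t h"
      using eventually_chain
    proof eventually_elim
      case (elim h)
      note VW = chain_W_eq[OF elim] and h = abm_chain.h(1)[OF elim]
      note sm = abm_chain.increment_second_moment[OF elim, unfolded VW, folded c2_def c3_def]
      note wm = abm_chain.window_maximal[OF elim, unfolded VW, folded c2_def c3_def]
      show ?case
        unfolding regular_windows_def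
      proof (intro allI impI conjI)
        fix n0 n1 assume n: "n0 \<le> n1" "real n1 * h \<le> t"
        show "integrable (M h) (\<lambda>w. (norm (V h n1 w - V h n0 w))\<^sup>2)" by (rule sm(1)[OF n])
        have "(\<integral>w. (norm (V h n1 w - V h n0 w))\<^sup>2 \<partial>M h) \<le> exp t * (real (n1 - n0) * h * c2 + h * t * c3 * Km)"
          by (rule sm(2)[OF n, folded Km_def])
        also have "\<dots> \<le> C * (real (n1 - n0) * h + h)" using h by (intro le) auto
        finally show "(\<integral>w. (norm (V h n1 w - V h n0 w))\<^sup>2 \<partial>M h) \<le> C * (real (n1 - n0) * h + h)" .
        fix \<epsilon> :: real assume e: "0 < \<epsilon>"
        define r where "r = measure (M h) {w \<in> space (M h). \<exists>n\<in>{n0..n1}. 2 * \<epsilon> \<le> norm (V h n w - V h n0 w)}"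
        have r: "0 \<le> r" by (simp add: r_def)
        have "r \<le> measure (M h) {w \<in> space (M h). \<epsilon> \<le> norm (V h n1 w - V h n0 w)}
            + exp t / \<epsilon>\<^sup>2 * (real (n1 - n0) * h * c2 * r + h * t * c3 * Km)"
          unfolding r_def by (rule wm[OF e n, folded Km_def])
        also have "exp t / \<epsilon>\<^sup>2 * (real (n1 - n0) * h * c2 * r + h * t * c3 * Km)
           = inverse (\<epsilon>\<^sup>2) * (exp t * ((real (n1 - n0) * h * r) * c2 + h * t * c3 * Km))"
          by (simp add: divide_inverse mult_ac)
        also have "\<dots> \<le> inverse (\<epsilon>\<^sup>2) * (C * (real (n1 - n0) * h * r + h))"
          using h r by (intro mult_left_mono le) auto
        finally show "r \<le> measure (M h) {w \<in> space (M h). \<epsilon> \<le> norm (V h n1 w - V h n0 w)}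
            + C / \<epsilon>\<^sup>2 * (real (n1 - n0) * h * r + h)"
          by (simp add: divide_inverse mult_ac)
      qed
    qed
  qed
qed

lemma char_schedule:
  assumes \<Theta>: "0 \<le> \<Theta>" and t: "0 \<le> t" and \<delta>: "0 < \<delta>"
  shows "\<forall>\<^sub>F h in at_right 0. \<forall>\<theta> n. (\<forall>l. norm (\<theta> l) \<le> \<Theta>) \<longrightarrow> real n * h \<le> t \<longrightarrow>
     norm ((\<integral>w. cis (\<Sum>l<n. \<theta> l \<bullet> (V h (Suc l) w - V h l w)) \<partial>M h)
       - complex_of_real (exp (- (m2 / (2 * real CARD('n)) * h * (\<Sum>l<n. (norm (\<theta> l))\<^sup>2))))) \<le> \<delta>"
proof -
  define N where "N = real CARD('n)"
  define Km where "Km = ((norm x0)\<^sup>2 + 1) * exp (abm_chain.c5 N (m2 + 1) * t)"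
  \<comment> \<open>Chosen so that the accumulated error \<open>\<delta>' * (t * Km)\<close> stays
    below \<open>\<delta>\<close>; the added 1 avoids a zero denominator.\<close>
  define \<delta>' where "\<delta>' = \<delta> / (2 * (t * Km + 1))"
  define K' where "K' = 8 * \<Theta>\<^sup>2 * N\<^sup>2 + (\<delta>' + \<Theta>\<^sup>2 * m2 / 2) * \<Theta> * 2 * N + (m2 * \<Theta>\<^sup>2)\<^sup>2 / 2"
  have Km0: "0 \<le> Km" unfolding Km_def by (intro mult_nonneg_nonneg add_nonneg_nonneg) auto
  have tK: "0 \<le> t * Km" using t Km0 by simp
  have d': "0 < \<delta>'" unfolding \<delta>'_def using \<delta> tK by (intro divide_pos_pos) auto
  have K'0: "0 \<le> K'" unfolding K'_def N_def using \<Theta> d' m2_nonneg by (intro add_nonneg_nonneg mult_nonneg_nonneg) auto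
  have "((\<lambda>h. (\<delta>' + h * K') * (t * Km)) \<longlongrightarrow> (\<delta>' + 0 * K') * (t * Km)) (at_right 0)"
    by (intro tendsto_intros)
  moreover have "(\<delta>' + 0 * K') * (t * Km) < \<delta>"
  proof -
    have "\<delta>' * (t * Km) = \<delta> * ((t * Km) / (2 * (t * Km + 1)))" by (simp add: \<delta>'_def)
    also have "\<dots> < \<delta> * 1" 
    proof (intro mult_strict_left_mono \<delta>)
      have "z / (2 * (z + 1)) < 1" if "0 \<le> z" for z :: real using that by (simp add: divide_simps)
      then show "t * Km / (2 * (t * Km + 1)) < 1" using tK by blast
    qed
    finally show ?thesis by simp
  qed
  ultimately have "\<forall>\<^sub>F h in at_right 0. (\<delta>' + h * K') * (t * Km) < \<delta>" by (rule order_tendstoD)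
  moreover have "\<forall>\<^sub>F h in at_right 0. \<forall>u. \<bar>u\<bar> \<le> \<Theta> \<longrightarrow>
     norm (char (distr (\<Xi> h) borel (\<xi> h)) u - complex_of_real (1 - u\<^sup>2 * m2 * h / 2)) \<le> h * \<delta>'"
    by (rule char_noise_asymptotic[OF noise_prob noise_measurable m1 m2 m2_nonneg m34 \<Theta> d'])
  ultimately show ?thesis using eventually_chain
  proof eventually_elim
    case (elim h)
    note VW = chain_W_eq[OF elim(3)] and h = abm_chain.h(1)[OF elim(3)]
    show ?case
    proof (intro allI impI)
      fix \<theta> :: "nat \<Rightarrow> real ^ 'n" and n assume a: "\<forall>l. norm (\<theta> l) \<le> \<Theta>" "real n * h \<le> t"
      have "norm ((\<integral>w. cis (\<Sum>l<n. \<theta> l \<bullet> (V h (Suc l) w - V h l w)) \<partial>M h)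
       - complex_of_real (exp (- (m2 / (2 * real CARD('n)) * h * (\<Sum>l<n. (norm (\<theta> l))\<^sup>2)))))
        \<le> real n * h * (\<delta>' + h * K') * Km"
        using abm_chain.char_of_increments[OF elim(3), of \<theta> \<Theta> m2 \<delta>' n t, unfolded VW] a elim(2) m2_nonneg d'
        by (simp add: K'_def Km_def N_def)
      also have "\<dots> \<le> t * (\<delta>' + h * K') * Km"
        using a(2) d' K'0 Km0 h by (intro mult_right_mono) auto
      also have "\<dots> \<le> \<delta>" using elim(1) by (simp add: mult_ac)
      finally show "norm ((\<integral>w. cis (\<Sum>l<n. \<theta> l \<bullet> (V h (Suc l) w - V h l w)) \<partial>M h)
       - complex_of_real (exp (- (m2 / (2 * real CARD('n)) * h * (\<Sum>l<n. (norm (\<theta> l))\<^sup>2))))) \<le> \<delta>" .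
    qed
  qed
qed

end

section \<open>Tails of the block increments\<close>

text \<open>Half-angle formula: 1 - cos y = 2 sin(y/2)^2, and sin u >= 5u/6 for 0 <= u <= 1/2, which
  leaves room for the factor 1/4.\<close>

lemma one_minus_cos_ge:
  fixes y :: real
  assumes "\<bar>y\<bar> \<le> 1"
  shows "y\<^sup>2 / 4 \<le> 1 - cos y"
proof -
  define u where "u = \<bar>y\<bar> / 2"
  have u: "0 \<le> u" "u \<le> 1 / 2" using assms by (auto simp: u_def)
  have "(\<Sum>m<Suc (Suc (Suc 0)). sin_coeff m * u ^ m) = u" by (simp add: sin_coeff_def)
  note Maclaurin_sin_bound[of u "Suc (Suc (Suc 0))", unfolded this]
  also have "inverse (fact (Suc (Suc (Suc 0)))) * \<bar>u\<bar> ^ Suc (Suc (Suc 0)) = u * u\<^sup>2 / 6"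
    using u(1) by (simp add: power2_eq_square)
  finally have "\<bar>sin u - u\<bar> \<le> u * u\<^sup>2 / 6" .
  moreover have "u * u\<^sup>2 \<le> u * 1" using u by (intro mult_left_mono power_le_one) auto
  ultimately have "5 / 6 * u \<le> sin u" by linarith
  then have "(5 / 6 * u)\<^sup>2 \<le> (sin u)\<^sup>2" using u by (intro power_mono) auto
  then have "2 * (25 / 36 * u\<^sup>2) \<le> 2 * (sin u)\<^sup>2" by (simp add: power_mult_distrib power_divide)
  moreover have "cos y = 1 - 2 * (sin u)\<^sup>2"
    using cos_double_sin[of u] by (simp add: u_def)
  moreover have "u\<^sup>2 = y\<^sup>2 / 4" by (simp add: u_def power_divide)
  ultimately show ?thesis using zero_le_power2[of u] by linarith
qed

text \<open>The product of 1 - x + x^2/2 and 1 + x + x^2/2 is 1 + x^4/4, so the lower Taylor bound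
  for exp x becomes an upper bound for exp(-x).\<close>

lemma exp_uminus_le_quadratic:
  fixes x :: real
  assumes "0 \<le> x"
  shows "exp (- x) \<le> 1 - x + x\<^sup>2 / 2"
proof -
  have p: "0 \<le> 1 - x + x\<^sup>2 / 2"
  proof -
    have "2 * (1 - x + x\<^sup>2 / 2) = (1 - x)\<^sup>2 + 1" by (simp add: power2_eq_square algebra_simps)
    then have "0 \<le> 2 * (1 - x + x\<^sup>2 / 2)" by (simp only:) (intro add_nonneg_nonneg zero_le_power2 zero_le_one)
    moreover have "0 \<le> 2 * y \<Longrightarrow> 0 \<le> y" for y :: real by simp
    ultimately show ?thesis by blast
  qed
  have "1 \<le> (1 - x + x\<^sup>2 / 2) * (1 + x + x\<^sup>2 / 2)"
  proof -
    have "(1 - x + x\<^sup>2 / 2) * (1 + x + x\<^sup>2 / 2) = 1 + (x\<^sup>2)\<^sup>2 / 4" by (simp add: power2_eq_square algebra_simps)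
    then show ?thesis by simp
  qed
  also have "\<dots> \<le> (1 - x + x\<^sup>2 / 2) * exp x"
    using exp_lower_Taylor_quadratic[OF assms] p by (intro mult_left_mono) auto
  finally have "exp (- x) * 1 \<le> exp (- x) * ((1 - x + x\<^sup>2 / 2) * exp x)" by (intro mult_left_mono) auto
  also have "\<dots> = 1 - x + x\<^sup>2 / 2" using exp_add[of "- x" x] by (simp add: mult_ac)
  finally show ?thesis by simp
qed

context prob_space begin

text \<open>Where |d w| > 1 the term d^2 w^2 already exceeds 1; elsewhere 1 - cos(d w) >= (d
  \<open>\<epsilon>\<close>)^2/4, and squaring explains the factor 16/(d
  \<open>\<epsilon>\<close>)^4. Expanding the square leaves cosines at the frequencies d and 2d,
  whose expectations converge as h tends to 0.\<close>

lemma tail_by_cos: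
  fixes w :: "'a \<Rightarrow> real"
  assumes w[measurable]: "w \<in> borel_measurable M" and int: "integrable M (\<lambda>\<omega>. (w \<omega>)\<^sup>2)"
    and d: "0 < d" and \<epsilon>: "0 < \<epsilon>"
  shows "prob {\<omega> \<in> space M. \<epsilon> \<le> \<bar>w \<omega>\<bar>} \<le> d\<^sup>2 * expectation (\<lambda>\<omega>. (w \<omega>)\<^sup>2)
     + 16 / (d ^ 4 * \<epsilon> ^ 4) * (3 / 2 - 2 * expectation (\<lambda>\<omega>. cos (d * w \<omega>)) + 1 / 2 * expectation (\<lambda>\<omega>. cos (2 * d * w \<omega>)))"
proof -
  define k where "k = 16 / (d ^ 4 * \<epsilon> ^ 4)"
  have k0: "0 \<le> k" using d \<epsilon> by (simp add: k_def)
  define f where "f \<omega> = d\<^sup>2 * (w \<omega>)\<^sup>2 + k * (3 / 2 - 2 * cos (d * w \<omega>) + 1 / 2 * cos (2 * d * w \<omega>))" for \<omega>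
  have ci: "integrable M (\<lambda>\<omega>. cos (a * w \<omega>))" for a
    by (intro integrable_const_bound[of _ 1]) (auto simp: abs_cos_le_one)
  have fint: "integrable M f" unfolding f_def
    by (intro Bochner_Integration.integrable_add integrable_mult_right Bochner_Integration.integrable_diff int ci integrable_const)
  have sq: "(3 / 2 - 2 * cos (d * y) + 1 / 2 * cos (2 * d * y)) = (1 - cos (d * y))\<^sup>2" for y
    using cos_double_cos[of "d * y"] by (simp add: power2_eq_square algebra_simps)
  have "prob {\<omega> \<in> space M. \<epsilon> \<le> \<bar>w \<omega>\<bar>} = expectation (indicator {\<omega> \<in> space M. \<epsilon> \<le> \<bar>w \<omega>\<bar>})" by simp
  also have "\<dots> \<le> expectation f"
  proof (intro integral_mono fint)
    fix \<omega> assume "\<omega> \<in> space M"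
    have f: "f \<omega> = (d * w \<omega>)\<^sup>2 + k * (1 - cos (d * w \<omega>))\<^sup>2" by (simp only: f_def sq power_mult_distrib)
    have f0: "0 \<le> f \<omega>" unfolding f using k0 by simp
    have "1 \<le> f \<omega>" if e: "\<epsilon> \<le> \<bar>w \<omega>\<bar>"
    proof (cases "\<bar>d * w \<omega>\<bar> \<le> 1")
      case True
      have "(d * \<epsilon>)\<^sup>2 \<le> (d * \<bar>w \<omega>\<bar>)\<^sup>2" using d \<epsilon> e by (intro power_mono mult_left_mono) auto
      then have "(d * \<epsilon>)\<^sup>2 / 4 \<le> 1 - cos (d * w \<omega>)" using one_minus_cos_ge[OF True] by (simp add: power_mult_distrib)
      then have "((d * \<epsilon>)\<^sup>2 / 4)\<^sup>2 \<le> (1 - cos (d * w \<omega>))\<^sup>2" by (intro power_mono) auto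
      then have "k * ((d * \<epsilon>)\<^sup>2 / 4)\<^sup>2 \<le> k * (1 - cos (d * w \<omega>))\<^sup>2" using k0 by (rule mult_left_mono)
      moreover have "k * ((d * \<epsilon>)\<^sup>2 / 4)\<^sup>2 = 1"
        using d \<epsilon> by (simp add: k_def power_divide power_mult_distrib flip: power_mult)
      ultimately show ?thesis unfolding f using zero_le_power2[of "d * w \<omega>"] by linarith
    next
      case False
      then have "1 \<le> \<bar>d * w \<omega>\<bar>\<^sup>2" by (intro one_le_power) auto
      moreover have "0 \<le> k * (1 - cos (d * w \<omega>))\<^sup>2" using k0 by simp
      ultimately show ?thesis unfolding f by simp
    qed
    then show "indicator {\<omega> \<in> space M. \<epsilon> \<le> \<bar>w \<omega>\<bar>} \<omega> \<le> f \<omega>" using f0 by (auto simp: indicator_def)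
  qed (auto intro!: integrable_real_indicator simp: emeasure_eq_measure)
  also have "\<dots> = d\<^sup>2 * expectation (\<lambda>\<omega>. (w \<omega>)\<^sup>2)
     + k * (3 / 2 - 2 * expectation (\<lambda>\<omega>. cos (d * w \<omega>)) + 1 / 2 * expectation (\<lambda>\<omega>. cos (2 * d * w \<omega>)))"
    unfolding f_def using int ci[of d] ci[of "2 * d"] by (simp add: prob_space)
  finally show ?thesis by (simp add: k_def)
qed

lemma square_tail:
  fixes w :: "'a \<Rightarrow> 'v::{second_countable_topology, real_normed_vector}"
  assumes w: "w \<in> borel_measurable M" and int: "integrable M (\<lambda>\<omega>. (norm (w \<omega>))\<^sup>2)" and \<epsilon>: "0 < \<epsilon>"
  shows "prob {\<omega> \<in> space M. \<epsilon> \<le> norm (w \<omega>)} \<le> expectation (\<lambda>\<omega>. (norm (w \<omega>))\<^sup>2) / \<epsilon>\<^sup>2"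
proof -
  have "{\<omega> \<in> space M. \<epsilon> \<le> norm (w \<omega>)} = {\<omega> \<in> space M. \<epsilon>\<^sup>2 \<le> (norm (w \<omega>))\<^sup>2}"
    using \<epsilon> by (auto intro: power_mono dest: power2_le_imp_le)
  then show ?thesis using integral_Markov_inequality_measure[OF int sets.empty_sets, of "\<epsilon>\<^sup>2"] \<epsilon> by simp
qed

end

context abm_family begin

text \<open>Frequencies that are constant on blocks let the sum over single steps telescope to block
  increments, while the sum of their squares, weighted by h, produces the block lengths, which tend
  to d.\<close>

lemma block_char:
  fixes \<theta> :: "nat \<Rightarrow> real ^ 'n"
  assumes d: "0 < d"
  shows "((\<lambda>h. \<integral>\<omega>. cis (\<Sum>k<K. \<theta> k \<bullet> (V h (grid h d (Suc k)) \<omega> - V h (grid h d k) \<omega>)) \<partial>M h)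
    \<longlongrightarrow> complex_of_real (exp (- (m2 / (2 * real CARD('n)) * (d * (\<Sum>k<K. (norm (\<theta> k))\<^sup>2)))))) (at_right 0)"
proof -
  define s where "s h l = (\<Sum>k<K. if grid h d k \<le> l \<and> l < grid h d (Suc k) then \<theta> k else 0)" for h l
  define \<Theta> where "\<Theta> = (\<Sum>k<K. norm (\<theta> k))"
  define E where "E h = (\<integral>\<omega>. cis (\<Sum>k<K. \<theta> k \<bullet> (V h (grid h d (Suc k)) \<omega> - V h (grid h d k) \<omega>)) \<partial>M h)" for h
  define L where "L h = complex_of_real (exp (- (m2 / (2 * real CARD('n)) *
      (\<Sum>k<K. (real (grid h d (Suc k)) * h - real (grid h d k) * h) * (norm (\<theta> k))\<^sup>2))))" for h
  have \<Theta>: "norm (s h l) \<le> \<Theta>" for h l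
    unfolding s_def \<Theta>_def by (rule order_trans[OF norm_sum]) (auto intro!: sum_mono)
  have \<Theta>0: "0 \<le> \<Theta>" by (auto simp: \<Theta>_def intro: sum_nonneg)
  have "((\<lambda>h. E h - L h) \<longlongrightarrow> 0) (at_right 0)"
  proof (rule tendstoI)
    fix e :: real assume e: "0 < e"
    have "\<forall>\<^sub>F h in at_right 0. (0::real) < h" by (rule eventually_at_right_less)
    moreover have "\<forall>\<^sub>F h in at_right 0. \<forall>\<theta> n. (\<forall>l. norm (\<theta> l) \<le> \<Theta>) \<longrightarrow> real n * h \<le> real K * d \<longrightarrow>
     norm ((\<integral>\<omega>. cis (\<Sum>l<n. \<theta> l \<bullet> (V h (Suc l) \<omega> - V h l \<omega>)) \<partial>M h)
       - complex_of_real (exp (- (m2 / (2 * real CARD('n)) * h * (\<Sum>l<n. (norm (\<theta> l))\<^sup>2))))) \<le> e / 2"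
      by (rule char_schedule) (use e d \<Theta>0 in auto)
    ultimately show "\<forall>\<^sub>F h in at_right 0. dist (E h - L h) 0 < e"
    proof eventually_elim
      case (elim h)
      note h = elim(1)
      have mono: "mono (grid h d)" using h d by (intro mono_grid) auto
      have step: "grid h d k \<le> grid h d (Suc k)" for k using mono by (auto intro: monoD)
      have 1: "(\<Sum>l<grid h d K. s h l \<bullet> (V h (Suc l) \<omega> - V h l \<omega>))
        = (\<Sum>k<K. \<theta> k \<bullet> (V h (grid h d (Suc k)) \<omega> - V h (grid h d k) \<omega>))" for \<omega>
      proof -
        have "(\<Sum>l<grid h d K. s h l \<bullet> (V h (Suc l) \<omega> - V h l \<omega>))
          = (\<Sum>l<grid h d K. \<Sum>k<K. if grid h d k \<le> l \<and> l < grid h d (Suc k) then \<theta> k \<bullet> (V h (Suc l) \<omega> - V h l \<omega>) else 0)"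
          unfolding s_def by (subst map_block_sum[OF mono, where F = "\<lambda>v. v \<bullet> z" for z]) auto
        also have "\<dots> = (\<Sum>k<K. \<Sum>l\<in>{grid h d k..<grid h d (Suc k)}. \<theta> k \<bullet> (V h (Suc l) \<omega> - V h l \<omega>))"
          by (rule sum_over_blocks[OF mono]) simp
        also have "\<dots> = (\<Sum>k<K. \<theta> k \<bullet> (V h (grid h d (Suc k)) \<omega> - V h (grid h d k) \<omega>))"
          unfolding inner_sum_right[symmetric] using sum_Suc_diff'[OF step, of "\<lambda>l. V h l \<omega>"] by simp
        finally show ?thesis .
      qed
      have 2: "(\<Sum>l<grid h d K. (norm (s h l))\<^sup>2) = (\<Sum>k<K. real (grid h d (Suc k) - grid h d k) * (norm (\<theta> k))\<^sup>2)"
      proof -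
        have "(\<Sum>l<grid h d K. (norm (s h l))\<^sup>2)
          = (\<Sum>l<grid h d K. \<Sum>k<K. if grid h d k \<le> l \<and> l < grid h d (Suc k) then (norm (\<theta> k))\<^sup>2 else 0)"
          unfolding s_def by (subst map_block_sum[OF mono, where F = "\<lambda>v. (norm v)\<^sup>2"]) auto
        also have "\<dots> = (\<Sum>k<K. \<Sum>l\<in>{grid h d k..<grid h d (Suc k)}. (norm (\<theta> k))\<^sup>2)"
          by (rule sum_over_blocks[OF mono]) simp
        finally show ?thesis by simp
      qed
      have 3: "h * (\<Sum>l<grid h d K. (norm (s h l))\<^sup>2)
          = (\<Sum>k<K. (real (grid h d (Suc k)) * h - real (grid h d k) * h) * (norm (\<theta> k))\<^sup>2)"
        unfolding 2 sum_distrib_left using step by (intro sum.cong refl) (simp add: of_nat_diff algebra_simps)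
      have "real (grid h d K) * h \<le> real K * d" using grid_bounds(1)[of h d K] h d by simp
      with elim(2) \<Theta> have "norm ((\<integral>\<omega>. cis (\<Sum>l<grid h d K. s h l \<bullet> (V h (Suc l) \<omega> - V h l \<omega>)) \<partial>M h)
         - complex_of_real (exp (- (m2 / (2 * real CARD('n)) * h * (\<Sum>l<grid h d K. (norm (s h l))\<^sup>2))))) \<le> e / 2"
        by blast
      then have "norm (E h - L h) \<le> e / 2"
        unfolding 1 E_def[symmetric] L_def 3[symmetric] by (simp only: mult.assoc)
      then show ?case using e by simp
    qed
  qed
  moreover have "(L \<longlongrightarrow> complex_of_real (exp (- (m2 / (2 * real CARD('n)) * (\<Sum>k<K. (real (Suc k) * d - real k * d) * (norm (\<theta> k))\<^sup>2))))) (at_right 0)"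
    unfolding L_def by (intro tendsto_intros tendsto_grid) (use d in auto)
  ultimately have "((\<lambda>h. (E h - L h) + L h) \<longlongrightarrow> 0 + complex_of_real (exp (- (m2 / (2 * real CARD('n)) * (\<Sum>k<K. (real (Suc k) * d - real k * d) * (norm (\<theta> k))\<^sup>2))))) (at_right 0)"
    by (rule tendsto_add)
  then show ?thesis by (simp add: E_def sum_distrib_left algebra_simps)
qed

lemma block_cos:
  assumes d: "0 < d"
  shows "((\<lambda>h. \<integral>\<omega>. cos (c * (V h (grid h d (Suc k)) \<omega> - V h (grid h d k) \<omega>) $ i) \<partial>M h)
    \<longlongrightarrow> exp (- (m2 / (2 * real CARD('n)) * (d * c\<^sup>2)))) (at_right 0)"
proof -
  define \<theta> :: "nat \<Rightarrow> real ^ 'n" where "\<theta> j = (if j = k then c *\<^sub>R axis i 1 else 0)" for j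
  have z: "(\<Sum>j<Suc k. f j) = f k" if "\<And>j. j < k \<Longrightarrow> f j = 0" for f :: "nat \<Rightarrow> real"
    using that by simp
  have 1: "(\<Sum>j<Suc k. \<theta> j \<bullet> (V h (grid h d (Suc j)) \<omega> - V h (grid h d j) \<omega>))
    = c * (V h (grid h d (Suc k)) \<omega> - V h (grid h d k) \<omega>) $ i" for h \<omega>
    by (subst z) (auto simp: \<theta>_def inner_axis')
  have 2: "(\<Sum>j<Suc k. (norm (\<theta> j))\<^sup>2) = c\<^sup>2"
    by (subst z) (auto simp: \<theta>_def)
  have "((\<lambda>h. Re (\<integral>\<omega>. cis (c * (V h (grid h d (Suc k)) \<omega> - V h (grid h d k) \<omega>) $ i) \<partial>M h))
    \<longlongrightarrow> Re (complex_of_real (exp (- (m2 / (2 * real CARD('n)) * (d * c\<^sup>2)))))) (at_right 0)"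
    using tendsto_Re[OF block_char[OF d, of \<theta> "Suc k"]] unfolding 1 2 .
  moreover have "\<forall>\<^sub>F h in at_right 0. Re (\<integral>\<omega>. cis (c * (V h (grid h d (Suc k)) \<omega> - V h (grid h d k) \<omega>) $ i) \<partial>M h)
      = (\<integral>\<omega>. cos (c * (V h (grid h d (Suc k)) \<omega> - V h (grid h d k) \<omega>) $ i) \<partial>M h)"
    using eventually_at_right_less[of "0::real"]
  proof eventually_elim
    case (elim h)
    interpret prob_space "M h" by (rule prob_space_M[OF elim])
    have [measurable]: "V h n \<in> borel_measurable (M h)" for n by (rule V_measurable[OF elim])
    have cm: "cis \<in> borel_measurable borel"
      by (intro borel_measurable_continuous_onI continuous_intros)
    have "(\<lambda>\<omega>. c * (V h (grid h d (Suc k)) \<omega> - V h (grid h d k) \<omega>) $ i) \<in> borel_measurable (M h)"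
      by (intro borel_measurable_times borel_measurable_const borel_measurable_vec_nth) measurable
    from measurable_compose[OF this cm]
    have "integrable (M h) (\<lambda>\<omega>. cis (c * (V h (grid h d (Suc k)) \<omega> - V h (grid h d k) \<omega>) $ i))"
      by (intro integrable_const_bound[of _ 1]) auto
    from integral_Re[OF this] show ?case by simp
  qed
  ultimately show ?thesis by (simp add: filterlim_cong)
qed

end

context abm_family begin

text \<open>The frequency in \<open>tail_by_cos\<close> is taken equal to the block length d. As h
  tends to 0 the increment becomes Gaussian with variance m2 d/N, so the exponent is q = c d^3; the
  terms linear in q cancel, the rest is at most 4 q^2 = O(d^6), and the factor d^(-4) leaves
  O(d^2).\<close>

lemma block_tail:
  assumes \<epsilon>: "0 < \<epsilon>" and t: "0 \<le> t"
  obtains C where "0 \<le> C"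
    "\<And>d k. 0 < d \<Longrightarrow> d \<le> 1 \<Longrightarrow> real (Suc k) * d \<le> t \<Longrightarrow> \<forall>\<^sub>F h in at_right 0.
       measure (M h) {\<omega> \<in> space (M h). \<epsilon> \<le> norm (V h (grid h d (Suc k)) \<omega> - V h (grid h d k) \<omega>)} \<le> C * d\<^sup>2"
proof -
  obtain C0 where C0: "0 \<le> C0" and win: "\<forall>\<^sub>F h in at_right 0. regular_windows C0 t h"
    by (rule windows[OF t])
  define \<epsilon>' where "\<epsilon>' = \<epsilon> / real CARD('n)"
  have \<epsilon>': "0 < \<epsilon>'" using \<epsilon> by (simp add: \<epsilon>'_def)
  define c where "c = m2 / (2 * real CARD('n))"
  have c: "0 \<le> c" using m2_nonneg by (simp add: c_def)
  define C1 where "C1 = 3 * C0 + 16 / \<epsilon>' ^ 4 * (4 * c\<^sup>2 + 1)"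
  have "0 \<le> C1" unfolding C1_def using C0 \<epsilon>' by (intro add_nonneg_nonneg mult_nonneg_nonneg) auto
  then have C1: "0 \<le> real CARD('n) * C1" by simp
  show ?thesis
  proof (rule that[OF C1])
    fix d :: real and k assume d: "0 < d" "d \<le> 1" and kd: "real (Suc k) * d \<le> t"
    define q where "q = c * d ^ 3"
    have q: "0 \<le> q" using c d by (simp add: q_def)
    define G where "G i h = 3 / 2 - 2 * (\<integral>\<omega>. cos (d * (V h (grid h d (Suc k)) \<omega> - V h (grid h d k) \<omega>) $ i) \<partial>M h)
      + 1 / 2 * (\<integral>\<omega>. cos (2 * d * (V h (grid h d (Suc k)) \<omega> - V h (grid h d k) \<omega>) $ i) \<partial>M h)" for i h
    have "(G i \<longlongrightarrow> 3 / 2 - 2 * exp (- (c * (d * d\<^sup>2))) + 1 / 2 * exp (- (c * (d * (2 * d)\<^sup>2)))) (at_right 0)" for i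
      unfolding G_def c_def by (intro tendsto_intros block_cos d)
    then have G: "(G i \<longlongrightarrow> 3 / 2 - 2 * exp (- q) + 1 / 2 * exp (- (4 * q))) (at_right 0)" for i
      by (simp add: q_def power2_eq_square power3_eq_cube mult_ac)
    have "3 / 2 - 2 * exp (- q) + 1 / 2 * exp (- (4 * q)) \<le> 4 * q\<^sup>2"
      using exp_ge_add_one_self[of "- q"] exp_uminus_le_quadratic[of "4 * q"] q by (simp add: power2_eq_square)
    \<comment> \<open>The additional d^6 gives the strict inequality with which a bound on the limit
      passes to all small h, also when q = 0.\<close>
    also have "4 * q\<^sup>2 < 4 * q\<^sup>2 + d ^ 6" using d by simp
    also have "4 * q\<^sup>2 + d ^ 6 = (4 * c\<^sup>2 + 1) * d ^ 6"
      by (simp add: q_def power_mult_distrib distrib_right flip: power_mult)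
    finally have "\<forall>\<^sub>F h in at_right 0. G i h < (4 * c\<^sup>2 + 1) * d ^ 6" for i
      by (rule order_tendstoD(2)[OF G])
    then have "\<forall>\<^sub>F h in at_right 0. \<forall>i. G i h < (4 * c\<^sup>2 + 1) * d ^ 6"
      by (intro eventually_all_finite) auto
    moreover have "\<forall>\<^sub>F h in at_right 0. h < (1::real)" by (rule eventually_mono[OF eventually_at_right_real[of 0 1]]) auto
    moreover note eventually_at_right_less[of "0::real"] win
    ultimately show "\<forall>\<^sub>F h in at_right 0.
       measure (M h) {\<omega> \<in> space (M h). \<epsilon> \<le> norm (V h (grid h d (Suc k)) \<omega> - V h (grid h d k) \<omega>)} \<le> real CARD('n) * C1 * d\<^sup>2"
    proof eventually_elim
      case (elim h)
      interpret prob_space "M h" by (rule prob_space_M[OF elim(3)])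
      have [measurable]: "V h n \<in> borel_measurable (M h)" for n by (rule V_measurable[OF elim(3)])
      define w where "w \<omega> = V h (grid h d (Suc k)) \<omega> - V h (grid h d k) \<omega>" for \<omega>
      have wm[measurable]: "w \<in> borel_measurable (M h)" unfolding w_def by measurable
      have wim[measurable]: "(\<lambda>\<omega>. w \<omega> $ i) \<in> borel_measurable (M h)" for i
        by (rule borel_measurable_vec_nth[OF wm])
      note step = grid_step[OF elim(3), of d k]
      have "real (grid h d (Suc k)) * h \<le> t" using grid_bounds(1)[OF elim(3), of d "Suc k"] d kd by simp
      note win = regular_windowsD[OF elim(4) step(1) this] 
      have wint: "integrable (M h) (\<lambda>\<omega>. (norm (w \<omega>))\<^sup>2)"
        unfolding w_def by (rule win(1)) (use d in simp)
      have "expectation (\<lambda>\<omega>. (norm (w \<omega>))\<^sup>2) \<le> C0 * (real (grid h d (Suc k) - grid h d k) * h + h)"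
        unfolding w_def by (rule win(2)) (use d in simp)
      also have "C0 * (real (grid h d (Suc k) - grid h d k) * h + h) \<le> C0 * 3"
        using step(2) d elim(2) C0 by (intro mult_left_mono) auto
      finally have w2: "expectation (\<lambda>\<omega>. (norm (w \<omega>))\<^sup>2) \<le> 3 * C0" by simp
      have le: "(w \<omega> $ i)\<^sup>2 \<le> (norm (w \<omega>))\<^sup>2" for \<omega> i
        using component_le_norm_cart[of "w \<omega>" i] by (metis abs_ge_zero power2_abs power_mono)
      have wiint: "integrable (M h) (\<lambda>\<omega>. (w \<omega> $ i)\<^sup>2)" for i
        by (rule Bochner_Integration.integrable_bound[OF wint]) (use le in auto)
      have each: "prob {\<omega> \<in> space (M h). \<epsilon>' \<le> \<bar>w \<omega> $ i\<bar>} \<le> C1 * d\<^sup>2" for i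
      proof -
        have "prob {\<omega> \<in> space (M h). \<epsilon>' \<le> \<bar>w \<omega> $ i\<bar>} \<le> d\<^sup>2 * expectation (\<lambda>\<omega>. (w \<omega> $ i)\<^sup>2) + 16 / (d ^ 4 * \<epsilon>' ^ 4) * G i h"
          using tail_by_cos[OF wim wiint d(1) \<epsilon>', of i] by (simp add: G_def w_def)
        also have "\<dots> \<le> d\<^sup>2 * (3 * C0) + 16 / (d ^ 4 * \<epsilon>' ^ 4) * ((4 * c\<^sup>2 + 1) * d ^ 6)"
        proof (intro add_mono mult_left_mono)
          show "expectation (\<lambda>\<omega>. (w \<omega> $ i)\<^sup>2) \<le> 3 * C0"
            by (rule order_trans[OF integral_mono[OF wiint wint le] w2])
          show "G i h \<le> (4 * c\<^sup>2 + 1) * d ^ 6" using elim(1) by (auto intro: less_imp_le)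
        qed (use d \<epsilon>' in auto)
        also have "16 / (d ^ 4 * \<epsilon>' ^ 4) * ((4 * c\<^sup>2 + 1) * d ^ 6) = 16 / \<epsilon>' ^ 4 * (4 * c\<^sup>2 + 1) * d\<^sup>2"
        proof -
          have "d ^ 6 = d ^ 4 * d\<^sup>2" by (simp flip: power_add)
          then show ?thesis using d \<epsilon>' unfolding \<open>d ^ 6 = d ^ 4 * d\<^sup>2\<close> by (simp add: field_simps)
        qed
        finally show ?thesis by (simp add: C1_def algebra_simps)
      qed
      have "{\<omega> \<in> space (M h). \<epsilon> \<le> norm (w \<omega>)} \<subseteq> (\<Union>i. {\<omega> \<in> space (M h). \<epsilon>' \<le> \<bar>w \<omega> $ i\<bar>})"
      proof
        fix \<omega> assume \<omega>: "\<omega> \<in> {\<omega> \<in> space (M h). \<epsilon> \<le> norm (w \<omega>)}"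
        have "\<exists>i. \<epsilon>' \<le> \<bar>w \<omega> $ i\<bar>"
        proof (rule ccontr)
          assume "\<nexists>i. \<epsilon>' \<le> \<bar>w \<omega> $ i\<bar>"
          then have "(\<Sum>i\<in>UNIV. \<bar>w \<omega> $ i\<bar>) < (\<Sum>i\<in>(UNIV :: 'n set). \<epsilon>')" by (intro sum_strict_mono) (auto simp: not_le)
          also have "\<dots> = \<epsilon>" by (simp add: \<epsilon>'_def)
          finally show False using norm_le_l1_cart[of "w \<omega>"] \<omega> by simp
        qed
        then show "\<omega> \<in> (\<Union>i. {\<omega> \<in> space (M h). \<epsilon>' \<le> \<bar>w \<omega> $ i\<bar>})" using \<omega> by auto
      qed
      then have "prob {\<omega> \<in> space (M h). \<epsilon> \<le> norm (w \<omega>)} \<le> prob (\<Union>i. {\<omega> \<in> space (M h). \<epsilon>' \<le> \<bar>w \<omega> $ i\<bar>})"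
        by (intro finite_measure_mono) auto
      also have "\<dots> \<le> (\<Sum>i\<in>(UNIV :: 'n set). prob {\<omega> \<in> space (M h). \<epsilon>' \<le> \<bar>w \<omega> $ i\<bar>})"
        by (intro finite_measure_subadditive_finite) auto
      also have "\<dots> \<le> (\<Sum>i\<in>(UNIV :: 'n set). C1 * d\<^sup>2)" by (intro sum_mono each)
      finally show ?case by (simp add: w_def)
    qed
  qed
qed

text \<open>A single window over [0, T]: the probability on the right of the maximal inequality is
  bounded by 1, and Chebyshev's inequality makes the rest small for large
  \<open>\<epsilon>\<close>.\<close>

lemma sup_tight:
  assumes T: "0 \<le> T" and e: "0 < e"
  obtains A where "0 < A"
    "\<forall>\<^sub>F h in at_right 0. measure (M h) {\<omega> \<in> space (M h). \<exists>n. real n * h \<le> T \<and> A \<le> norm (V h n \<omega> - V h 0 \<omega>)} \<le> e"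
proof -
  obtain C where C: "0 \<le> C" and win: "\<forall>\<^sub>F h in at_right 0. regular_windows C T h"
    by (rule windows[OF T])
  \<comment> \<open>At least 1, so that its square is no smaller, and large enough for each of the
    two terms of the maximal inequality to be at most e/2.\<close>
  define \<epsilon> where "\<epsilon> = 2 * C * (T + 1) / e + 1"
  have E0: "0 \<le> 2 * C * (T + 1) / e" using C T e by simp
  then have \<epsilon>: "1 \<le> \<epsilon>" by (simp add: \<epsilon>_def)
  have small: "2 * (C / \<epsilon>\<^sup>2 * (T + 1)) \<le> e"
  proof -
    have "2 * C * (T + 1) / e \<le> \<epsilon>\<^sup>2"
      using self_le_power[OF \<epsilon>, of 2] by (simp add: \<epsilon>_def)
    then have "2 * C * (T + 1) \<le> e * \<epsilon>\<^sup>2" using e by (simp add: pos_divide_le_eq mult.commute)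
    then have "2 * C * (T + 1) / \<epsilon>\<^sup>2 \<le> e" using \<epsilon> by (subst pos_divide_le_eq) auto
    then show ?thesis by simp
  qed
  show ?thesis
  proof (rule that[of "2 * \<epsilon>"])
    show "0 < 2 * \<epsilon>" using \<epsilon> by simp
    have "\<forall>\<^sub>F h in at_right 0. h < (1::real)" by (rule eventually_mono[OF eventually_at_right_real[of 0 1]]) auto
    then show "\<forall>\<^sub>F h in at_right 0. measure (M h) {\<omega> \<in> space (M h). \<exists>n. real n * h \<le> T \<and> 2 * \<epsilon> \<le> norm (V h n \<omega> - V h 0 \<omega>)} \<le> e"
      using win eventually_at_right_less[of "0::real"]
    proof eventually_elim
      case (elim h)
      note h = elim(3)
      interpret prob_space "M h" by (rule prob_space_M[OF h])
      have [measurable]: "V h n \<in> borel_measurable (M h)" for n by (rule V_measurable[OF h])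
      define n1 where "n1 = nat \<lfloor>T / h\<rfloor>"
      note n1 = nat_floor_divide_bounds[OF h T, folded n1_def]
      have iff: "real n * h \<le> T \<longleftrightarrow> n \<in> {0..n1}" for n
      proof
        assume "real n * h \<le> T"
        then have "real n * h < (real n1 + 1) * h" using n1 by linarith
        then show "n \<in> {0..n1}" using h by (simp add: mult_less_cancel_right)
      next
        assume "n \<in> {0..n1}"
        then have "real n * h \<le> real n1 * h" using h by (intro mult_right_mono) auto
        then show "real n * h \<le> T" using n1 by linarith
      qed
      define r where "r = prob {\<omega> \<in> space (M h). \<exists>n\<in>{0..n1}. 2 * \<epsilon> \<le> norm (V h n \<omega> - V h 0 \<omega>)}"
      have r: "0 \<le> r" "r \<le> 1" by (auto simp: r_def)
      have w: "integrable (M h) (\<lambda>\<omega>. (norm (V h n1 \<omega> - V h 0 \<omega>))\<^sup>2)"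
        "expectation (\<lambda>\<omega>. (norm (V h n1 \<omega> - V h 0 \<omega>))\<^sup>2) \<le> C * (real n1 * h + h)"
        "r \<le> prob {\<omega> \<in> space (M h). \<epsilon> \<le> norm (V h n1 \<omega> - V h 0 \<omega>)} + C / \<epsilon>\<^sup>2 * (real n1 * h * r + h)"
        using regular_windowsD[OF elim(2) zero_le[of n1] n1(1)] \<epsilon> unfolding r_def by auto
      note w(3)
      also have "prob {\<omega> \<in> space (M h). \<epsilon> \<le> norm (V h n1 \<omega> - V h 0 \<omega>)} \<le> expectation (\<lambda>\<omega>. (norm (V h n1 \<omega> - V h 0 \<omega>))\<^sup>2) / \<epsilon>\<^sup>2"
        by (rule square_tail[OF _ w(1)]) (measurable, use \<epsilon> in simp)
      also have "\<dots> \<le> C * (real n1 * h + h) / \<epsilon>\<^sup>2" using w(2) by (intro divide_right_mono) auto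
      also have "\<dots> \<le> C / \<epsilon>\<^sup>2 * (T + 1)"
        using C n1 elim(1) by (auto simp: times_divide_eq_left intro!: divide_right_mono mult_left_mono)
      also have "C / \<epsilon>\<^sup>2 * (real n1 * h * r + h) \<le> C / \<epsilon>\<^sup>2 * (T + 1)"
      proof -
        have "real n1 * h * r \<le> real n1 * h * 1" using r h by (intro mult_left_mono) auto
        then have "real n1 * h * r + h \<le> T + 1" using n1 elim(1) by linarith
        then show ?thesis using C by (intro mult_left_mono) auto
      qed
      finally have "r \<le> e" using small by simp
      then show ?case unfolding r_def iff Bex_def by simp
    qed
  qed
qed

text \<open>Within a block the probability reappears on the right of the maximal inequality with a
  factor of at most 1/2 and is absorbed. About T/d blocks, each contributing O(d^2) and O(h), then
  sum to O(d) as h vanishes.\<close>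

lemma oscillation:
  assumes T: "0 \<le> T" and \<epsilon>: "0 < \<epsilon>" and e: "0 < e"
  obtains d0 where "0 < d0"
    "\<And>d. 0 < d \<Longrightarrow> d < d0 \<Longrightarrow> \<forall>\<^sub>F h in at_right 0. measure (M h) {\<omega> \<in> space (M h).
       \<exists>k\<le>nat \<lfloor>T / d\<rfloor>. \<exists>n\<in>{grid h d k..grid h d (Suc k)}. 2 * \<epsilon> \<le> norm (V h n \<omega> - V h (grid h d k) \<omega>)} \<le> e"
proof -
  have T1: "0 \<le> T + 1" using T by simp
  obtain C where C: "0 \<le> C" and win: "\<forall>\<^sub>F h in at_right 0. regular_windows C (T + 1) h"
    by (rule windows[OF T1])
  obtain C1 where C1: "0 \<le> C1" and tail: "\<And>d k. 0 < d \<Longrightarrow> d \<le> 1 \<Longrightarrow> real (Suc k) * d \<le> T + 1 \<Longrightarrow> \<forall>\<^sub>F h in at_right 0.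
       measure (M h) {\<omega> \<in> space (M h). \<epsilon> \<le> norm (V h (grid h d (Suc k)) \<omega> - V h (grid h d k) \<omega>)} \<le> C1 * d\<^sup>2"
    using block_tail[OF \<epsilon> T1] by blast
  define c where "c = C / \<epsilon>\<^sup>2"
  have c: "0 \<le> c" using C by (simp add: c_def)
  \<comment> \<open>The second bound makes the absorbed factor at most 1/2, the third the sum of the
    O(d^2) terms at most e/2; the first keeps d within the range of
    \<open>block_tail\<close>.\<close>
  define d0 where "d0 = min 1 (min (1 / (4 * (c + 1))) (e / (4 * (C1 + 1) * (T + 1))))"
  have d0: "0 < d0" unfolding d0_def using c C1 T e by auto
  show ?thesis
  proof (rule that[OF d0])
    fix d assume d: "0 < d" "d < d0"
    have d1: "d \<le> 1" using d by (simp add: d0_def)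
    have dc: "c * (2 * d) \<le> 1 / 2"
    proof -
      have "d * (4 * (c + 1)) < 1" using d c by (simp add: d0_def pos_less_divide_eq)
      then show ?thesis using d by (simp add: algebra_simps)
    qed
    have de: "2 * C1 * d * (T + 1) \<le> e / 2"
    proof -
      have "0 < 4 * (C1 + 1) * (T + 1)" using C1 T by auto
      then have "d * (4 * (C1 + 1) * (T + 1)) < e" using d by (simp add: d0_def pos_less_divide_eq)
      moreover have "0 \<le> d * (4 * (T + 1))" using d T by simp
      ultimately show ?thesis by (simp add: algebra_simps)
    qed
    define K where "K = nat \<lfloor>T / d\<rfloor>"
    have K: "real K * d \<le> T" using nat_floor_divide_bounds[OF d(1) T] by (simp add: K_def)
    have kd: "real (Suc k) * d \<le> T + 1" if "k \<le> K" for k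
    proof -
      have "real k * d \<le> real K * d" using that d by (intro mult_right_mono) auto
      then show ?thesis using K d1 by (simp add: algebra_simps)
    qed
    have "\<forall>\<^sub>F h in at_right 0. \<forall>k\<in>{..K}.
       measure (M h) {\<omega> \<in> space (M h). \<epsilon> \<le> norm (V h (grid h d (Suc k)) \<omega> - V h (grid h d k) \<omega>)} \<le> C1 * d\<^sup>2"
      by (intro eventually_ball_finite ballI tail d d1 kd) auto
    moreover have "\<forall>\<^sub>F h in at_right 0. h < d" by (rule eventually_mono[OF eventually_at_right_real[OF d(1)]]) auto
    moreover have "\<forall>\<^sub>F h in at_right 0. real (Suc K) * (2 * (c * h)) < e / 2"
    proof (rule order_tendstoD)
      show "((\<lambda>h. real (Suc K) * (2 * (c * h))) \<longlongrightarrow> real (Suc K) * (2 * (c * 0))) (at_right 0)"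
        by (intro tendsto_intros)
    qed (use e in simp)
    moreover note win eventually_at_right_less[of "0::real"]
    ultimately show "\<forall>\<^sub>F h in at_right 0. measure (M h) {\<omega> \<in> space (M h).
       \<exists>k\<le>nat \<lfloor>T / d\<rfloor>. \<exists>n\<in>{grid h d k..grid h d (Suc k)}. 2 * \<epsilon> \<le> norm (V h n \<omega> - V h (grid h d k) \<omega>)} \<le> e"
    proof eventually_elim
      case (elim h)
      note h = elim(5)
      interpret prob_space "M h" by (rule prob_space_M[OF h])
      have [measurable]: "V h n \<in> borel_measurable (M h)" for n by (rule V_measurable[OF h])
      define B where "B k = {\<omega> \<in> space (M h). \<exists>n\<in>{grid h d k..grid h d (Suc k)}. 2 * \<epsilon> \<le> norm (V h n \<omega> - V h (grid h d k) \<omega>)}" for k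
      have B[measurable]: "B k \<in> sets (M h)" for k unfolding B_def by measurable
      have each: "prob (B k) \<le> 2 * (C1 * d\<^sup>2 + c * h)" if k: "k \<le> K" for k
      proof -
        note step = grid_step[OF h, of d k]
        have "real (grid h d (Suc k)) * h \<le> T + 1" using grid_bounds(1)[OF h, of d "Suc k"] d kd[OF k] by simp
        then have "prob (B k) \<le> prob {\<omega> \<in> space (M h). \<epsilon> \<le> norm (V h (grid h d (Suc k)) \<omega> - V h (grid h d k) \<omega>)}
            + c * (real (grid h d (Suc k) - grid h d k) * h * prob (B k) + h)"
          using regular_windowsD(3)[OF elim(4) step(1) _ \<epsilon>] d unfolding B_def c_def by simp
        also have "\<dots> \<le> C1 * d\<^sup>2 + c * (2 * d * prob (B k) + h)"
        proof (intro add_mono mult_left_mono c mult_right_mono order_refl measure_nonneg)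
          show "prob {\<omega> \<in> space (M h). \<epsilon> \<le> norm (V h (grid h d (Suc k)) \<omega> - V h (grid h d k) \<omega>)} \<le> C1 * d\<^sup>2"
            using elim(1) k by simp
          show "real (grid h d (Suc k) - grid h d k) * h \<le> 2 * d" using step(2) d elim(2) by simp
        qed
        also have "\<dots> = C1 * d\<^sup>2 + c * h + (c * (2 * d)) * prob (B k)" by (simp add: algebra_simps)
        also have "(c * (2 * d)) * prob (B k) \<le> 1 / 2 * prob (B k)" by (intro mult_right_mono dc) simp
        finally show ?thesis by simp
      qed
      have "{\<omega> \<in> space (M h). \<exists>k\<le>nat \<lfloor>T / d\<rfloor>. \<exists>n\<in>{grid h d k..grid h d (Suc k)}. 2 * \<epsilon> \<le> norm (V h n \<omega> - V h (grid h d k) \<omega>)}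
          = (\<Union>k\<in>{..K}. B k)"
        by (auto simp: B_def K_def)
      moreover have "prob (\<Union>k\<in>{..K}. B k) \<le> e"
      proof -
        have "prob (\<Union>k\<in>{..K}. B k) \<le> (\<Sum>k\<in>{..K}. prob (B k))"
          by (intro finite_measure_subadditive_finite) (use B in auto)
        also have "\<dots> \<le> (\<Sum>k\<in>{..K}. 2 * (C1 * d\<^sup>2 + c * h))" by (intro sum_mono each) simp
        also have "\<dots> = 2 * C1 * d * (real (Suc K) * d) + real (Suc K) * (2 * (c * h))"
          by (simp add: power2_eq_square algebra_simps)
        also have "\<dots> \<le> e / 2 + e / 2"
        proof (rule add_mono)
          have "2 * C1 * d * (real (Suc K) * d) \<le> 2 * C1 * d * (T + 1)"
            using kd[OF order_refl] C1 d by (intro mult_left_mono) auto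
          with de show "2 * C1 * d * (real (Suc K) * d) \<le> e / 2" by (rule order_trans[rotated])
        qed (use elim(3) in simp)
        finally show ?thesis by simp
      qed
      ultimately show ?case by simp
    qed
  qed
qed

end

section \<open>Convergence of trajectories\<close>

lemma euler_cong:
  assumes "\<And>j. j \<le> k \<Longrightarrow> v j = v' j"
  shows "euler b d v k = euler b d v' k"
  using assms by (induction k) auto

text \<open>Real numbers indexed by block and coordinate match the countable index type of
  \<open>trig_polys_convergence\<close>.\<close>

definition increments_path :: "real ^ 'n::finite \<Rightarrow> (nat \<times> 'n \<Rightarrow> real) \<Rightarrow> nat \<Rightarrow> real ^ 'n" where
  "increments_path x0 y k = x0 + (\<Sum>j<k. \<chi> i. y (j, i))"

lemma increments_path_telescope:
  fixes u :: "nat \<Rightarrow> real ^ 'n::finite"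
  assumes y: "\<And>j i. j < K \<Longrightarrow> y (j, i) = (u (Suc j) - u j) $ i" and k: "k \<le> K"
  shows "increments_path x0 y k = x0 + (u k - u 0)"
proof -
  have "(\<Sum>j<k. \<chi> i. y (j, i)) = (\<Sum>j<k. u (Suc j) - u j)"
    using y k by (intro sum.cong refl) (simp add: vec_eq_iff)
  then show ?thesis by (simp add: increments_path_def sum_lessThan_telescope)
qed

text \<open>On [0, T] a function of finitely many real increments; chain and Brownian motion are
  both fed into it, which reduces path convergence to finite dimensions.\<close>

definition coarse_path ::
  "(real ^ 'n \<Rightarrow> real ^ 'n) \<Rightarrow> real ^ 'n::finite \<Rightarrow> real \<Rightarrow> real \<Rightarrow> (nat \<times> 'n \<Rightarrow> real) \<Rightarrow> real \<Rightarrow> real ^ 'n" where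
  "coarse_path b x0 T d y = (\<lambda>t\<in>{0..T}. step_path d (euler b d (increments_path x0 y)) t)"

lemma coarse_path_cadlag: "0 < d \<Longrightarrow> coarse_path b x0 T d y \<in> cadlag T"
  unfolding coarse_path_def by (rule step_path_cadlag)

text \<open>Finitely many Euler values determine the path, each continuous in y, and their uniform
  distance dominates the Skorokhod distance. A Lipschitz functional of the coarse path thus becomes
  an admissible test function in \<open>increments_converge\<close>.\<close>

lemma continuous_coarse_path:
  fixes b :: "real ^ 'n::finite \<Rightarrow> real ^ 'n"
  assumes b: "continuous_on UNIV b" and d: "0 < d" and k: "0 \<le> k"
    and g: "\<And>p p'. p \<in> cadlag T \<Longrightarrow> p' \<in> cadlag T \<Longrightarrow> \<bar>g p - g p'\<bar> \<le> k * skorokhod_dist T p p'"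
  shows "continuous_on UNIV (\<lambda>y. g (coarse_path b x0 T d y))"
proof -
  have inc: "continuous_on UNIV (\<lambda>y. increments_path x0 y n)" for n
  proof -
    have "continuous_on UNIV (\<lambda>y :: nat \<times> 'n \<Rightarrow> real. \<chi> i. y (j, i))" for j
      by (intro continuous_on_vec_lambda continuous_on_product_coordinates)
    then show ?thesis unfolding increments_path_def
      by (intro continuous_on_add continuous_on_const continuous_on_sum)
  qed
  have eul: "continuous_on UNIV (\<lambda>y. euler b d (increments_path x0 y) n)" for n
  proof (induction n)
    case (Suc n)
    have "continuous_on UNIV (\<lambda>y. b (euler b d (increments_path x0 y) n))"
      by (rule continuous_on_compose2[OF b Suc]) simp
    with Suc inc show ?case by (auto intro!: continuous_intros)
  qed (use inc in simp)
  have "((\<lambda>y. g (coarse_path b x0 T d y)) \<longlongrightarrow> g (coarse_path b x0 T d y0)) (at y0)" for y0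
  proof (rule tendstoI)
    fix e :: real assume e: "0 < e"
    \<comment> \<open>k + 1 stands in for k, which may be 0.\<close>
    define \<delta> where "\<delta> = e / (2 * (k + 1))"
    have \<delta>: "0 < \<delta>" using e k by (simp add: \<delta>_def)
    have k\<delta>: "k * \<delta> < e"
    proof -
      have "k * \<delta> \<le> (k + 1) * \<delta>" using \<delta> by (intro mult_right_mono) auto
      also have "\<dots> = e / 2" using k unfolding \<delta>_def by (auto simp: field_simps)
      finally show ?thesis using e by simp
    qed
    have "\<forall>\<^sub>F y in at y0. \<forall>n\<in>{..nat \<lfloor>T / d\<rfloor>}. dist (euler b d (increments_path x0 y) n) (euler b d (increments_path x0 y0) n) < \<delta>"
    proof (intro eventually_ball_finite ballI tendstoD \<delta>)
      fix n
      show "((\<lambda>y. euler b d (increments_path x0 y) n) \<longlongrightarrow> euler b d (increments_path x0 y0) n) (at y0)"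
        using eul[of n] by (simp add: continuous_on_def)
    qed simp
    then show "\<forall>\<^sub>F y in at y0. dist (g (coarse_path b x0 T d y)) (g (coarse_path b x0 T d y0)) < e"
    proof eventually_elim
      case (elim y)
      have "dist (coarse_path b x0 T d y t) (coarse_path b x0 T d y0 t) \<le> \<delta>" if t: "t \<in> {0..T}" for t
      proof -
        have "nat \<lfloor>t / d\<rfloor> \<le> nat \<lfloor>T / d\<rfloor>" using t d by (intro nat_mono floor_mono divide_right_mono) auto
        with elim t show ?thesis by (auto simp: coarse_path_def step_path_def intro: less_imp_le)
      qed
      then have "skorokhod_dist T (coarse_path b x0 T d y) (coarse_path b x0 T d y0) \<le> \<delta>"
        by (intro skorokhod_dist_le_uniform coarse_path_cadlag d \<delta>)
      then have "k * skorokhod_dist T (coarse_path b x0 T d y) (coarse_path b x0 T d y0) \<le> k * \<delta>"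
        using k by (rule mult_left_mono)
      with g[OF coarse_path_cadlag[OF d] coarse_path_cadlag[OF d], of b x0 y b x0 y0] k\<delta>
      show ?case by (simp add: dist_real_def)
    qed
  qed
  then show ?thesis by (simp add: continuous_on_def)
qed

lemma measurable_coarse_path:
  fixes b :: "real ^ 'n::finite \<Rightarrow> real ^ 'n"
  assumes b: "drift b C" and d: "0 < d" and Y: "\<And>j. (\<lambda>w. Y w j) \<in> borel_measurable M"
  shows "(\<lambda>w. coarse_path b x0 T d (Y w)) \<in> M \<rightarrow>\<^sub>M borel_sets_of (skorokhod_topology T)"
  unfolding coarse_path_def
proof (rule measurable_step_path[OF d])
  interpret drift b C by fact
  fix k
  show "(\<lambda>w. euler b d (increments_path x0 (Y w)) k) \<in> borel_measurable M"
  proof (rule measurable_euler)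
    fix l
    have "(\<lambda>w. \<chi> i. Y w (j, i)) \<in> borel_measurable M" for j by (intro borel_measurable_vecI) (simp add: Y)
    then show "(\<lambda>w. increments_path x0 (Y w) l) \<in> borel_measurable M"
      unfolding increments_path_def by (intro borel_measurable_add borel_measurable_sum borel_measurable_const) auto
  qed
qed

text \<open>Zero beyond the K blocks, as the convention for random vectors in
  \<open>trig_polys_convergence\<close> requires; \<open>chain_increments\<close> follows the same
  convention.\<close>

definition noise_increments ::
  "real \<Rightarrow> (real \<Rightarrow> 'c \<Rightarrow> real ^ 'n) \<Rightarrow> real \<Rightarrow> nat \<Rightarrow> 'c \<Rightarrow> nat \<times> 'n::finite \<Rightarrow> real" where
  "noise_increments \<sigma> \<beta> d K w =
     (\<lambda>(k, i). if k < K then \<sigma> * (\<beta> (real (Suc k) * d) w $ i - \<beta> (real k * d) w $ i) else 0)"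

lemma grid_times:
  fixes d :: real
  assumes "0 < d" "real K * d \<le> T" "k \<le> K"
  shows "real k * d \<in> {0..T}"
proof -
  have "real k * d \<le> real K * d" using assms by (intro mult_right_mono) auto
  then have "real k * d \<le> T" using assms(2) by (rule order_trans)
  then show ?thesis using assms(1) by simp
qed

lemma weak_solution_noise_measurable:
  assumes "weak_solution Q F T \<beta> b \<sigma> x0 X" "t \<in> {0..T}"
  shows "(\<lambda>w. \<beta> t w $ i) \<in> borel_measurable Q"
proof -
  have "(\<lambda>w. \<beta> t w $ i) \<in> borel_measurable (F t)" "subalgebra Q (F t)"
    using assms unfolding weak_solution_def brownian_motion_def by blast+
  then show ?thesis by (rule measurable_from_subalg[rotated])
qed

lemma measurable_noise_increments:
  fixes \<beta> :: "real \<Rightarrow> 'c \<Rightarrow> real ^ 'n::finite"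
  assumes ws: "weak_solution Q F T \<beta> b \<sigma> x0 X" and d: "0 < d" and K: "real K * d \<le> T"
  shows "(\<lambda>w. noise_increments \<sigma> \<beta> d K w j) \<in> borel_measurable Q"
proof (cases "fst j < K")
  case True
  have "(\<lambda>w. \<beta> (real (Suc (fst j)) * d) w $ snd j) \<in> borel_measurable Q"
    "(\<lambda>w. \<beta> (real (fst j) * d) w $ snd j) \<in> borel_measurable Q"
    using True by (auto intro!: weak_solution_noise_measurable[OF ws] grid_times[OF d K] simp del: of_nat_Suc atLeastAtMost_iff)
  then show ?thesis using True unfolding noise_increments_def case_prod_unfold
    by (simp del: of_nat_Suc)
qed (simp add: noise_increments_def case_prod_unfold)

context abm_family begin

definition chain_increments :: "real \<Rightarrow> real \<Rightarrow> nat \<Rightarrow> 'a \<Rightarrow> nat \<times> 'n \<Rightarrow> real" where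
  "chain_increments h d K w =
     (\<lambda>(k, i). if k < K then (V h (grid h d (Suc k)) w - V h (grid h d k) w) $ i else 0)"

lemma measurable_chain_increments: "0 < h \<Longrightarrow> (\<lambda>w. chain_increments h d K w j) \<in> borel_measurable (M h)"
  unfolding chain_increments_def case_prod_unfold
  by (cases "fst j < K") (auto intro!: borel_measurable_vec_nth borel_measurable_diff V_measurable simp del: vector_minus_component)

text \<open>\<open>block_char\<close> and \<open>weak_solution_char\<close> produce the same
  exponent because the squared diffusion coefficient is m2/N; tightness of the increments comes from
  \<open>sup_tight\<close>.\<close>

lemma increments_converge:
  fixes Q :: "'c measure" and \<beta> :: "real \<Rightarrow> 'c \<Rightarrow> real ^ 'n"
  assumes ws: "weak_solution Q F T \<beta> b' (sqrt (m2 / real CARD('n))) x0' X" and T: "0 \<le> T"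
    and d: "0 < d" and K: "real K * d \<le> T" and g: "continuous_on UNIV g" and B: "\<And>y. \<bar>g y\<bar> \<le> (B :: real)"
  shows "((\<lambda>h. \<integral>w. g (chain_increments h d K w) \<partial>M h)
    \<longlongrightarrow> (\<integral>w. g (noise_increments (sqrt (m2 / real CARD('n))) \<beta> d K w) \<partial>Q)) (at_right 0)"
proof (rule trig_polys_convergence[where I = "{..<K} \<times> UNIV" and B = B and g = g
      and Y = "\<lambda>h. chain_increments h d K" and Z = "noise_increments (sqrt (m2 / real CARD('n))) \<beta> d K"])
  have pos: "\<forall>\<^sub>F h in at_right 0. (0::real) < h" by (rule eventually_at_right_less)
  show "\<forall>\<^sub>F h in at_right 0. prob_space (M h)" using pos by eventually_elim (rule prob_space_M)
  show "\<forall>\<^sub>F h in at_right 0. \<forall>j\<in>{..<K} \<times> UNIV. (\<lambda>w. chain_increments h d K w j) \<in> borel_measurable (M h)"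
    using pos by eventually_elim (auto intro: measurable_chain_increments)
  show "chain_increments h d K w j = 0" if "j \<notin> {..<K} \<times> UNIV" for h w j
    using that by (cases j) (simp add: chain_increments_def)
  show "noise_increments (sqrt (m2 / real CARD('n))) \<beta> d K w j = 0" if "j \<notin> {..<K} \<times> UNIV" for w j
    using that by (cases j) (simp add: noise_increments_def)
  show "prob_space Q" using ws by (simp add: weak_solution_def)
  show "(\<lambda>w. noise_increments (sqrt (m2 / real CARD('n))) \<beta> d K w j) \<in> borel_measurable Q" for j
    by (rule measurable_noise_increments[OF ws d K])
  show "((\<lambda>h. \<integral>w. cis (\<Sum>j\<in>{..<K} \<times> UNIV. \<theta> j * chain_increments h d K w j) \<partial>M h)
    \<longlongrightarrow> (\<integral>w. cis (\<Sum>j\<in>{..<K} \<times> UNIV. \<theta> j * noise_increments (sqrt (m2 / real CARD('n))) \<beta> d K w j) \<partial>Q)) (at_right 0)"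
    for \<theta> :: "nat \<times> 'n \<Rightarrow> real"
  proof -
    define v :: "nat \<Rightarrow> real ^ 'n" where "v k = (\<chi> i. \<theta> (k, i))" for k
    have 1: "(\<Sum>j\<in>{..<K} \<times> UNIV. \<theta> j * chain_increments h d K w j)
      = (\<Sum>k<K. v k \<bullet> (V h (grid h d (Suc k)) w - V h (grid h d k) w))" for h w
      unfolding chain_increments_def inner_vec_def v_def
      by (simp add: sum.cartesian_product[symmetric] sum.cartesian_product')
    have 2: "(\<Sum>j\<in>{..<K} \<times> UNIV. \<theta> j * noise_increments (sqrt (m2 / real CARD('n))) \<beta> d K w j)
      = (\<Sum>(k, i)\<in>{..<K} \<times> UNIV. \<theta> (k, i) * (sqrt (m2 / real CARD('n)) * (\<beta> (real (Suc k) * d) w $ i - \<beta> (real k * d) w $ i)))" for w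
      by (intro sum.cong refl) (auto simp: noise_increments_def simp del: of_nat_Suc)
    have 3: "(\<Sum>(k, i)\<in>{..<K} \<times> UNIV. (\<theta> (k, i))\<^sup>2) = (\<Sum>k<K. (norm (v k))\<^sup>2)"
      unfolding power2_norm_eq_inner inner_vec_def v_def
      by (simp add: sum.cartesian_product case_prod_unfold power2_eq_square)
    have "(sqrt (m2 / real CARD('n)))\<^sup>2 / 2 = m2 / (2 * real CARD('n))" using m2_nonneg by simp
    then show ?thesis
      unfolding 1 2 weak_solution_char[OF ws d K] 3 using block_char[OF d, of v K] by (simp only: mult.assoc)
  qed
  fix e :: real assume e: "0 < e"
  obtain A where A: "0 < A" and sup: "\<forall>\<^sub>F h in at_right 0. measure (M h) {w \<in> space (M h). \<exists>n. real n * h \<le> T \<and> A \<le> norm (V h n w - V h 0 w)} \<le> e"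
    by (rule sup_tight[OF T e])
  show "\<exists>\<rho>. \<forall>\<^sub>F h in at_right 0. measure (M h) {w \<in> space (M h). \<exists>j\<in>{..<K} \<times> UNIV. \<rho> < \<bar>chain_increments h d K w j\<bar>} \<le> e"
  \<comment> \<open>An increment larger than 2A puts one of its two end points at distance at least
    A from the starting value.\<close>
  proof (intro exI[of _ "2 * A"])
    show "\<forall>\<^sub>F h in at_right 0. measure (M h) {w \<in> space (M h). \<exists>j\<in>{..<K} \<times> UNIV. 2 * A < \<bar>chain_increments h d K w j\<bar>} \<le> e"
      using sup pos
    proof eventually_elim
      case (elim h)
      interpret prob_space "M h" by (rule prob_space_M[OF elim(2)])
      have [measurable]: "V h n \<in> borel_measurable (M h)" for n by (rule V_measurable[OF elim(2)])
      have "{w \<in> space (M h). \<exists>j\<in>{..<K} \<times> UNIV. 2 * A < \<bar>chain_increments h d K w j\<bar>}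
        \<subseteq> {w \<in> space (M h). \<exists>n. real n * h \<le> T \<and> A \<le> norm (V h n w - V h 0 w)}"
      proof
        fix w assume w: "w \<in> {w \<in> space (M h). \<exists>j\<in>{..<K} \<times> UNIV. 2 * A < \<bar>chain_increments h d K w j\<bar>}"
        then obtain k i where k: "k \<in> {..<K}" and j: "2 * A < \<bar>chain_increments h d K w (k, i)\<bar>" by auto
        have le: "real (grid h d l) * h \<le> T" if "l \<le> K" for l
          using grid_bounds(1)[OF elim(2), of d l] d grid_times[OF d K that] by simp
        let ?a = "V h (grid h d (Suc k)) w - V h 0 w" and ?b = "V h (grid h d k) w - V h 0 w"
        have "2 * A < \<bar>(?a - ?b) $ i\<bar>" using j k by (simp add: chain_increments_def)
        also have "\<dots> \<le> norm (?a - ?b)" by (rule component_le_norm_cart)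
        also have "\<dots> \<le> norm ?a + norm ?b" by (rule norm_triangle_ineq4)
        finally have "A \<le> norm ?a \<or> A \<le> norm ?b" by linarith
        then show "w \<in> {w \<in> space (M h). \<exists>n. real n * h \<le> T \<and> A \<le> norm (V h n w - V h 0 w)}"
          using le[of k] le[of "Suc k"] k w by auto
      qed
      then have "prob {w \<in> space (M h). \<exists>j\<in>{..<K} \<times> UNIV. 2 * A < \<bar>chain_increments h d K w j\<bar>}
         \<le> prob {w \<in> space (M h). \<exists>n. real n * h \<le> T \<and> A \<le> norm (V h n w - V h 0 w)}"
        by (intro finite_measure_mono) measurable
      then show ?case using elim(1) by simp
    qed
  qed
qed (use g B in auto)

end

lemma (in prob_space) expectation_close:
  fixes f g :: "'a \<Rightarrow> real"
  assumes [measurable]: "f \<in> borel_measurable M" "g \<in> borel_measurable M" "G \<in> events"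
    and B: "\<And>\<omega>. \<bar>f \<omega>\<bar> \<le> B" "\<And>\<omega>. \<bar>g \<omega>\<bar> \<le> B"
    and \<eta>: "0 \<le> \<eta>" "\<And>\<omega>. \<omega> \<in> space M \<Longrightarrow> \<omega> \<notin> G \<Longrightarrow> \<bar>f \<omega> - g \<omega>\<bar> \<le> \<eta>"
  shows "\<bar>expectation f - expectation g\<bar> \<le> \<eta> + 2 * B * prob G"
proof -
  have f: "integrable M f" and g: "integrable M g"
    using B by (auto intro!: integrable_const_bound[of _ B])
  have i: "integrable M (\<lambda>\<omega>. \<eta> + 2 * B * indicator G \<omega>)"
    by (auto intro!: integrable_real_indicator simp: emeasure_eq_measure)
  have "\<bar>expectation f - expectation g\<bar> = \<bar>expectation (\<lambda>\<omega>. f \<omega> - g \<omega>)\<bar>" using f g by simp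
  also have "\<dots> \<le> expectation (\<lambda>\<omega>. \<bar>f \<omega> - g \<omega>\<bar>)" by (rule integral_abs_bound)
  also have "\<dots> \<le> expectation (\<lambda>\<omega>. \<eta> + 2 * B * indicator G \<omega>)"
  proof (rule integral_mono[OF _ i])
    fix \<omega> assume "\<omega> \<in> space M"
    moreover have "\<bar>f \<omega> - g \<omega>\<bar> \<le> 2 * B" using B[of \<omega>] by linarith
    ultimately show "\<bar>f \<omega> - g \<omega>\<bar> \<le> \<eta> + 2 * B * indicator G \<omega>" using \<eta> by (cases "\<omega> \<in> G") auto
  qed (use f g in auto)
  also have "\<dots> = \<eta> + 2 * B * prob G" by (simp add: prob_space emeasure_eq_measure)
  finally show ?thesis .
qed

lemma measurable_lipschitz_functional:
  fixes Y :: "'a \<Rightarrow> real \<Rightarrow> 'v::metric_space"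
  assumes k: "0 \<le> k"
    and g: "\<And>p p'. p \<in> cadlag T \<Longrightarrow> p' \<in> cadlag T \<Longrightarrow> \<bar>g p - g p'\<bar> \<le> k * skorokhod_dist T p p'"
    and Y: "Y \<in> N \<rightarrow>\<^sub>M borel_sets_of (skorokhod_topology T)"
  shows "(\<lambda>\<omega>. g (Y \<omega>)) \<in> borel_measurable N"
  by (rule measurable_continuous_map_comp[OF Y])
    (unfold skorokhod_topology_def, rule Metric_space.lipschitz_continuous_map[OF Metric_space_skorokhod k g])

definition noise_path ::
  "(real ^ 'n \<Rightarrow> real ^ 'n) \<Rightarrow> real ^ 'n \<Rightarrow> real \<Rightarrow> real \<Rightarrow> (real \<Rightarrow> 'c \<Rightarrow> real ^ 'n) \<Rightarrow> real \<Rightarrow> 'c \<Rightarrow> real \<Rightarrow> real ^ 'n::finite"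
  where "noise_path b x0 T \<sigma> \<beta> d \<omega> = coarse_path b x0 T d (noise_increments \<sigma> \<beta> d (nat \<lfloor>T / d\<rfloor>) \<omega>)"

text \<open>The noise being additive, almost every path of X solves the deterministic equation
  driven by w, whose solution is unique. Every weak solution is therefore the same functional of its
  own Brownian motion.\<close>

lemma weak_solution_eq_solution:
  fixes \<beta> :: "real \<Rightarrow> 'c \<Rightarrow> real ^ 'n::finite"
  assumes ws: "weak_solution Q F T \<beta> b \<sigma> x0 X" and b: "drift b C"
  defines "w \<equiv> \<lambda>\<omega> t. x0 + \<sigma> *\<^sub>R (\<beta> t \<omega> - \<beta> 0 \<omega>)"
  shows "\<omega> \<in> space Q \<Longrightarrow> continuous_on {0..T} (w \<omega>)"
    and "AE \<omega> in Q. \<forall>t\<in>{0..T}. X t \<omega> = drift.solution b (w \<omega>) t"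
proof -
  interpret drift b C by fact
  show cont: "continuous_on {0..T} (w \<omega>)" if \<omega>: "\<omega> \<in> space Q" for \<omega>
  proof -
    have "continuous_on {0..T} (\<lambda>t. \<chi> i. \<beta> t \<omega> $ i)"
      using ws \<omega> by (intro continuous_on_vec_lambda) (auto simp: weak_solution_def brownian_motion_def)
    then show ?thesis unfolding w_def by (auto intro!: continuous_intros)
  qed
  have "AE \<omega> in Q. X 0 \<omega> = x0 \<and> (\<forall>t\<in>{0..T}. (\<lambda>s. b (X s \<omega>)) integrable_on {0..t} \<and>
          X t \<omega> = X 0 \<omega> + integral {0..t} (\<lambda>s. b (X s \<omega>)) + \<sigma> *\<^sub>R (\<beta> t \<omega> - \<beta> 0 \<omega>))"
    using ws by (simp add: weak_solution_def)
  then show "AE \<omega> in Q. \<forall>t\<in>{0..T}. X t \<omega> = solution (w \<omega>) t"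
    using AE_space
  proof eventually_elim
    case (elim \<omega>)
    have "continuous_on {0..T} (\<lambda>t. X t \<omega>)" using ws elim by (simp add: weak_solution_def)
    then have "bounded ((\<lambda>t. X t \<omega>) ` {0..T})"
      by (intro compact_imp_bounded compact_continuous_image) auto
    moreover have "norm (X t \<omega> - w \<omega> t - integral {0..t} (\<lambda>s. b (X s \<omega>))) \<le> 0" if "t \<in> {0..T}" for t
    proof -
      have "X t \<omega> = X 0 \<omega> + integral {0..t} (\<lambda>s. b (X s \<omega>)) + \<sigma> *\<^sub>R (\<beta> t \<omega> - \<beta> 0 \<omega>)" using elim that by blast
      then show ?thesis using elim unfolding w_def by (simp add: algebra_simps)
    qed
    ultimately have "approx_solution b T (w \<omega>) 0 (\<lambda>t. X t \<omega>)"
      using elim unfolding approx_solution_def by blast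
    then show ?case using solution_unique[OF cont[OF elim(2)]] by blast
  qed
qed

text \<open>Fed with the increments of \<open>\<beta>\<close>, the coarse path is on [0, T] the
  Euler path of the driver w, and Euler paths converge uniformly to the solution.\<close>

lemma noise_path_limit:
  fixes \<beta> :: "real \<Rightarrow> 'c \<Rightarrow> real ^ 'n::finite"
  assumes ws: "weak_solution Q F T \<beta> b \<sigma> x0 X" and b: "drift b C" and T: "0 \<le> T" and k: "0 \<le> k"
    and g: "\<And>p p'. p \<in> cadlag T \<Longrightarrow> p' \<in> cadlag T \<Longrightarrow> \<bar>g p - g p'\<bar> \<le> k * skorokhod_dist T p p'"
    and B: "\<And>p. p \<in> cadlag T \<Longrightarrow> \<bar>g p\<bar> \<le> B"
  shows "(\<lambda>q. \<integral>\<omega>. g (noise_path b x0 T \<sigma> \<beta> (inverse (real (Suc q))) \<omega>) \<partial>Q)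
    \<longlonglongrightarrow> (\<integral>\<omega>. g (\<lambda>t\<in>{0..T}. X t \<omega>) \<partial>Q)"
proof (rule integral_dominated_convergence[where w = "\<lambda>_. B"])
  interpret drift b C by fact
  interpret Q: prob_space Q using ws by (simp add: weak_solution_def)
  show "integrable Q (\<lambda>_. B)" by simp
  define d where "d q = inverse (real (Suc q))" for q
  have d: "0 < d q" for q by (simp add: d_def)
  define K where "K q = nat \<lfloor>T / d q\<rfloor>" for q
  have K: "real (K q) * d q \<le> T" for q using nat_floor_divide_bounds(1)[OF d T] by (simp add: K_def)
  have cadX: "(\<lambda>t\<in>{0..T}. X t \<omega>) \<in> cadlag T" if "\<omega> \<in> space Q" for \<omega>
    using ws that by (intro continuous_path_cadlag) (simp add: weak_solution_def)
  have XQ: "X t \<in> borel_measurable Q" if "t \<in> {0..T}" for t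
  proof -
    have "X t \<in> borel_measurable (F t)" "subalgebra Q (F t)" using ws that by (auto simp: weak_solution_def)
    then show ?thesis by (rule measurable_from_subalg[rotated])
  qed
  show "(\<lambda>\<omega>. g (\<lambda>t\<in>{0..T}. X t \<omega>)) \<in> borel_measurable Q"
    by (rule measurable_lipschitz_functional[OF k g measurable_continuous_path[OF XQ T]])
      (use ws in \<open>auto simp: weak_solution_def\<close>)
  show "(\<lambda>\<omega>. g (noise_path b x0 T \<sigma> \<beta> (inverse (real (Suc q))) \<omega>)) \<in> borel_measurable Q" for q
    unfolding d_def[symmetric] noise_path_def K_def[symmetric]
    by (rule measurable_lipschitz_functional[OF k g measurable_coarse_path[OF b d measurable_noise_increments[OF ws d K]]])
  show "AE \<omega> in Q. norm (g (noise_path b x0 T \<sigma> \<beta> (inverse (real (Suc q))) \<omega>)) \<le> B" for q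
    by (simp add: noise_path_def B coarse_path_cadlag)
  define w where "w \<omega> t = x0 + \<sigma> *\<^sub>R (\<beta> t \<omega> - \<beta> 0 \<omega>)" for \<omega> t
  note sol = weak_solution_eq_solution[OF ws b, folded w_def]
  show "AE \<omega> in Q. (\<lambda>q. g (noise_path b x0 T \<sigma> \<beta> (inverse (real (Suc q))) \<omega>))
    \<longlonglongrightarrow> g (\<lambda>t\<in>{0..T}. X t \<omega>)"
    using sol(2) AE_space
  proof eventually_elim
    case (elim \<omega>)
    have cw: "continuous_on {0..T} (w \<omega>)" using sol(1)[OF elim(2)] by (simp add: w_def[abs_def])
    have path: "coarse_path b x0 T (d q) (noise_increments \<sigma> \<beta> (d q) (K q) \<omega>) t = euler_path (w \<omega>) q t" if t: "t \<in> {0..T}" for q t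
    proof -
      have le: "nat \<lfloor>t / d q\<rfloor> \<le> K q" unfolding K_def using t d[of q] by (intro nat_mono floor_mono divide_right_mono) auto
      have "increments_path x0 (noise_increments \<sigma> \<beta> (d q) (K q) \<omega>) j = w \<omega> (real j * d q)" if "j \<le> K q" for j
        by (subst increments_path_telescope[where u = "\<lambda>j. \<sigma> *\<^sub>R \<beta> (real j * d q) \<omega>" and K = "K q"])
          (use that in \<open>auto simp: noise_increments_def w_def algebra_simps\<close>)
      then have "euler b (d q) (increments_path x0 (noise_increments \<sigma> \<beta> (d q) (K q) \<omega>)) (nat \<lfloor>t / d q\<rfloor>)
        = euler b (d q) (\<lambda>j. w \<omega> (real j * d q)) (nat \<lfloor>t / d q\<rfloor>)"
        using le by (intro euler_cong) auto
      then show ?thesis using t by (simp add: coarse_path_def step_path_def euler_path_def d_def)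
    qed
    show ?case
    proof (rule tendstoI)
      fix e :: real assume e: "0 < e"
      define \<delta> where "\<delta> = e / (2 * (k + 1))"
      have \<delta>: "0 < \<delta>" "k * \<delta> < e"
        using e k add_nonneg_pos[of "e * k" "e * 2"] by (auto simp: \<delta>_def field_simps)
      have "\<forall>\<^sub>F q in sequentially. \<forall>t\<in>{0..T}. dist (euler_path (w \<omega>) q t) (solution (w \<omega>) t) < \<delta>"
        using solution_uniform_limit[OF cw] \<delta>(1) by (rule uniform_limitD)
      then show "\<forall>\<^sub>F q in sequentially. dist (g (noise_path b x0 T \<sigma> \<beta> (inverse (real (Suc q))) \<omega>))
         (g (\<lambda>t\<in>{0..T}. X t \<omega>)) < e"
        unfolding d_def[symmetric] noise_path_def K_def[symmetric]
      proof eventually_elim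
        case (elim q)
        let ?p = "coarse_path b x0 T (d q) (noise_increments \<sigma> \<beta> (d q) (K q) \<omega>)" and ?X = "\<lambda>t\<in>{0..T}. X t \<omega>"
        have "skorokhod_dist T ?p ?X \<le> \<delta>"
        proof (intro skorokhod_dist_le_uniform coarse_path_cadlag d \<delta>(1) cadX \<open>\<omega> \<in> space Q\<close>)
          fix t assume t: "t \<in> {0..T}"
          then have "X t \<omega> = solution (w \<omega>) t" using \<open>\<forall>t\<in>{0..T}. X t \<omega> = solution (w \<omega>) t\<close> by blast
          with elim t show "dist (?p t) (?X t) \<le> \<delta>" by (simp add: path less_imp_le)
        qed
        then have "k * skorokhod_dist T ?p ?X \<le> k * \<delta>" using k by (rule mult_left_mono)
        with g[OF coarse_path_cadlag[OF d] cadX[OF \<open>\<omega> \<in> space Q\<close>]] \<delta>(2) show ?case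
          by (simp add: dist_real_def) (meson order_le_less_trans order_trans)
      qed
    qed
  qed
qed

context abm_family begin

text \<open>Chain and coarse path are approximate solutions for one and the same driver, the step
  path of \<open>V\<close>: the former with defect h G, the latter with the oscillation 2
  \<open>\<epsilon>\<close> plus d G. Outside an event of small probability
  \<open>approx_solution_close\<close> then bounds their uniform distance.\<close>

lemma chain_coarse_close:
  assumes T: "0 \<le> T" and k: "0 \<le> k"
    and g: "\<And>p p'. p \<in> cadlag T \<Longrightarrow> p' \<in> cadlag T \<Longrightarrow> \<bar>g p - g p'\<bar> \<le> k * skorokhod_dist T p p'"
    and B: "\<And>p. p \<in> cadlag T \<Longrightarrow> \<bar>g p\<bar> \<le> B" and e: "0 < e"
  obtains d0 where "0 < d0" "\<And>d. 0 < d \<Longrightarrow> d < d0 \<Longrightarrow> \<forall>\<^sub>F h in at_right 0.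
     \<bar>(\<integral>\<omega>. g (trajectory T h (x h) \<omega>) \<partial>M h)
       - (\<integral>\<omega>. g (coarse_path (abm_drift p) x0 T d (chain_increments h d (nat \<lfloor>T / d\<rfloor>) \<omega>)) \<partial>M h)\<bar> \<le> e"
proof -
  define C where "C = 2 * real CARD('n)"
  let ?b = "abm_drift p"
  interpret drift ?b C unfolding C_def by (rule drift_abm_drift[OF p01 p_lipschitz])
  have "\<bar>g (coarse_path ?b x0 T 1 (\<lambda>_. 0))\<bar> \<le> B" by (intro B coarse_path_cadlag) simp
  then have B0: "0 \<le> B" by linarith
  \<comment> \<open>Two bad events of probability at most e1 each, on which the functionals differ
    by at most 2B, cost 4 B e1.\<close>
  define e1 where "e1 = e / (8 * (B + 1))"
  have e1: "0 < e1" "4 * B * e1 \<le> e / 2" using e B0 by (auto simp: e1_def field_simps)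
  obtain A0 where A0: "0 < A0" and sup: "\<forall>\<^sub>F h in at_right 0. measure (M h) {\<omega> \<in> space (M h). \<exists>n. real n * h \<le> T \<and> A0 \<le> norm (V h n \<omega> - V h 0 \<omega>)} \<le> e1"
    by (rule sup_tight[OF T e1(1)])
  define A where "A = norm x0 + A0"
  define G where "G = C * (A * exp (C * T))"
  have G: "0 \<le> G" unfolding G_def A_def using A0 C_nonneg by (intro mult_nonneg_nonneg add_nonneg_nonneg) auto
  define L where "L = exp (2 * lip (radius T A) * T)"
  have L: "0 < L" by (simp add: L_def)
  \<comment> \<open>The admissible total defect: the resulting distance 2 s L changes the functional
    by at most e/2.\<close>
  define s where "s = min 1 (e / (4 * (k + 1) * L))"
  have s: "0 < s" "s \<le> 1" using e k L by (auto simp: s_def)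
  have sk: "k * (2 * s * L) \<le> e / 2"
  proof -
    have "s \<le> e / (4 * (k + 1) * L)" by (simp add: s_def)
    moreover have "0 < 4 * (k + 1) * L" using k L by simp
    ultimately have "s * (4 * (k + 1) * L) \<le> e" by (simp add: pos_le_divide_eq)
    moreover have "0 \<le> s * (4 * L)" using s L by simp
    ultimately show ?thesis by (simp add: algebra_simps)
  qed
  \<comment> \<open>Divides s so that h G, 2 \<open>\<epsilon>\<close> and d G are each at most
    s/4.\<close>
  define \<epsilon> where "\<epsilon> = s / 8"
  have \<epsilon>: "0 < \<epsilon>" using s by (simp add: \<epsilon>_def)
  obtain d1 where d1: "0 < d1" and osc: "\<And>d. 0 < d \<Longrightarrow> d < d1 \<Longrightarrow> \<forall>\<^sub>F h in at_right 0. measure (M h) {\<omega> \<in> space (M h).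
       \<exists>k\<le>nat \<lfloor>T / d\<rfloor>. \<exists>n\<in>{grid h d k..grid h d (Suc k)}. 2 * \<epsilon> \<le> norm (V h n \<omega> - V h (grid h d k) \<omega>)} \<le> e1"
    using oscillation[OF T \<epsilon> e1(1)] by blast
  define d0 where "d0 = min d1 (s / (4 * (G + 1)))"
  have d0: "0 < d0" using d1 s G by (simp add: d0_def)
  show ?thesis
  proof (rule that[OF d0])
    fix d assume d: "0 < d" "d < d0"
    have dG: "d * G \<le> s / 4"
    proof -
      have "d * (4 * (G + 1)) < s" using d G by (simp add: d0_def pos_less_divide_eq)
      then show ?thesis using d by (simp add: algebra_simps)
    qed
    define K where "K = nat \<lfloor>T / d\<rfloor>"
    have "\<forall>\<^sub>F h in at_right 0. h < d" by (rule eventually_mono[OF eventually_at_right_real[OF d(1)]]) auto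
    moreover have "\<forall>\<^sub>F h in at_right 0. measure (M h) {\<omega> \<in> space (M h).
       \<exists>k\<le>K. \<exists>n\<in>{grid h d k..grid h d (Suc k)}. 2 * \<epsilon> \<le> norm (V h n \<omega> - V h (grid h d k) \<omega>)} \<le> e1"
      unfolding K_def by (rule osc) (use d in \<open>auto simp: d0_def\<close>)
    moreover note sup eventually_at_right_less[of "0::real"]
    ultimately show "\<forall>\<^sub>F h in at_right 0.
     \<bar>(\<integral>\<omega>. g (trajectory T h (x h) \<omega>) \<partial>M h)
       - (\<integral>\<omega>. g (coarse_path ?b x0 T d (chain_increments h d (nat \<lfloor>T / d\<rfloor>) \<omega>)) \<partial>M h)\<bar> \<le> e"
      unfolding K_def[symmetric]
    proof eventually_elim
      case (elim h)
      note h = elim(4)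
      interpret prob_space "M h" by (rule prob_space_M[OF h])
      have [measurable]: "V h n \<in> borel_measurable (M h)" for n by (rule V_measurable[OF h])
      have [measurable]: "x h n \<in> borel_measurable (M h)" for n by (rule x_measurable[OF h])
      have traj: "trajectory T h (x h) \<omega> = (\<lambda>t\<in>{0..T}. step_path h (\<lambda>n. x h n \<omega>) t)" for \<omega>
        by (simp add: trajectory_def step_path_def)
      have cad: "trajectory T h (x h) \<omega> \<in> cadlag T" for \<omega> unfolding traj by (rule step_path_cadlag[OF h])
      define S where "S = {\<omega> \<in> space (M h). \<exists>n. real n * h \<le> T \<and> A0 \<le> norm (V h n \<omega> - V h 0 \<omega>)}"
      define O' where "O' = {\<omega> \<in> space (M h). \<exists>k\<le>K. \<exists>n\<in>{grid h d k..grid h d (Suc k)}. 2 * \<epsilon> \<le> norm (V h n \<omega> - V h (grid h d k) \<omega>)}"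
      \<comment> \<open>A null set: the chain starts in x0 only almost surely, whereas the coarse
        path starts there always.\<close>
      define I where "I = {\<omega> \<in> space (M h). x h 0 \<omega> \<noteq> x0}"
      have SOI: "S \<in> events" "O' \<in> events" "I \<in> events" unfolding S_def O'_def I_def by measurable
      have "prob I = 0"
        using x_initial[OF h] SOI(3) by (subst prob_eq_0) (auto simp: I_def elim!: eventually_mono)
      moreover have "prob (S \<union> O' \<union> I) \<le> prob S + prob O' + prob I"
        using measure_Un_le[of "S \<union> O'" "M h" I] measure_Un_le[of S "M h" O'] SOI by auto
      ultimately have bad: "prob (S \<union> O' \<union> I) \<le> 2 * e1" using elim(2,3) by (simp add: S_def O'_def)
      let ?y = "\<lambda>\<omega>. coarse_path ?b x0 T d (chain_increments h d K \<omega>)"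
      have good: "\<bar>g (trajectory T h (x h) \<omega>) - g (?y \<omega>)\<bar> \<le> e / 2"
        if \<omega>: "\<omega> \<in> space (M h)" "\<omega> \<notin> S \<union> O' \<union> I" for \<omega>
      proof -
        define v where "v n = V h n \<omega>" for n
        define v' where "v' k = v (grid h d k)" for k
        define w where "w = step_path h v"
        have v0: "v 0 = x0" using \<omega> by (simp add: I_def v_def V_0)
        have vA: "norm (v n) \<le> A" if "real n * h \<le> T" for n
        proof -
          have "norm (v n - v 0) < A0" using \<omega> that by (auto simp: S_def v_def not_le dest!: spec[of _ n])
          then show ?thesis using norm_triangle_sub[of "v n" "v 0"] by (simp add: A_def v0)
        qed
        have v'A: "norm (v' k) \<le> A" if "real k * d \<le> T" for k
          unfolding v'_def by (rule vA, rule order_trans[OF grid_bounds(1)[OF h]]) (use d that in auto)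
        have wA: "norm (w t) \<le> A" if "t \<in> {0..T}" for t
          unfolding w_def step_path_def
          by (rule vA, rule order_trans[OF nat_floor_divide_bounds(1)[OF h]]) (use that in auto)
        have K: "nat \<lfloor>t / d\<rfloor> \<le> K" if "t \<in> {0..T}" for t
          unfolding K_def using that d by (intro nat_mono floor_mono divide_right_mono) auto
        have wv': "norm (w t - step_path d v' t) \<le> 2 * \<epsilon>" if t: "t \<in> {0..T}" for t
        proof -
          define j where "j = nat \<lfloor>t / d\<rfloor>"
          have t0: "0 \<le> t" using t by simp
          note j = nat_floor_divide_bounds[OF d(1) t0, folded j_def]
          have "nat \<lfloor>t / h\<rfloor> \<in> {grid h d j..grid h d (Suc j)}"
            unfolding grid_def using j h by (auto intro!: nat_mono floor_mono divide_right_mono simp: add.commute)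
          moreover have "j \<le> K" using K[OF t] by (simp add: j_def)
          ultimately have "norm (v (nat \<lfloor>t / h\<rfloor>) - v (grid h d j)) < 2 * \<epsilon>"
            using \<omega> by (auto simp: O'_def v_def not_le dest!: spec[of _ j])
          then show ?thesis by (simp add: w_def v'_def step_path_def j_def)
        qed
        have a1: "approx_solution ?b T w (h * G) (step_path h (euler ?b h v))"
          using euler_approx_solution[where T = T and w = w and \<rho> = 0, OF h vA] by (simp add: w_def G_def)
        have a2: "approx_solution ?b T w (2 * \<epsilon> + d * G) (step_path d (euler ?b d v'))"
          using euler_approx_solution[where T = T and w = w, OF d(1) v'A wv'] by (simp add: G_def)
        have hG: "h * G \<le> s / 4"
          by (rule order_trans[OF mult_right_mono[OF less_imp_le[OF elim(1)] G] dG])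
        have small: "h * G \<le> 1" "2 * \<epsilon> + d * G \<le> 1" "h * G + (2 * \<epsilon> + d * G) \<le> s"
          using hG dG s by (auto simp: \<epsilon>_def)
        have "dist (trajectory T h (x h) \<omega> t) (?y \<omega> t) \<le> 2 * s * L" if t: "t \<in> {0..T}" for t
        proof -
          have "increments_path x0 (chain_increments h d K \<omega>) j = v' j" if "j \<le> K" for j
            by (subst increments_path_telescope[where u = v' and K = K])
              (use that v0 in \<open>auto simp: chain_increments_def v'_def v_def\<close>)
          then have "euler ?b d (increments_path x0 (chain_increments h d K \<omega>)) (nat \<lfloor>t / d\<rfloor>) = euler ?b d v' (nat \<lfloor>t / d\<rfloor>)"
            using K[OF t] by (intro euler_cong) auto
          then have y: "?y \<omega> t = step_path d (euler ?b d v') t" using t by (simp add: coarse_path_def step_path_def)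
          have z: "trajectory T h (x h) \<omega> t = step_path h (euler ?b h v) t"
            using t by (simp add: traj step_path_def x_eq_euler v_def[abs_def])
          have "norm (step_path h (euler ?b h v) t - step_path d (euler ?b d v') t) \<le> 2 * (h * G + (2 * \<epsilon> + d * G)) * L"
            unfolding L_def by (rule approx_solution_close[OF a1 small(1) a2 small(2) t wA])
          also have "\<dots> \<le> 2 * s * L" using small(3) L by (intro mult_right_mono mult_left_mono) auto
          finally show ?thesis by (simp add: y z dist_norm)
        qed
        then have "skorokhod_dist T (trajectory T h (x h) \<omega>) (?y \<omega>) \<le> 2 * s * L"
          using s L by (intro skorokhod_dist_le_uniform cad coarse_path_cadlag d) auto
        then have "k * skorokhod_dist T (trajectory T h (x h) \<omega>) (?y \<omega>) \<le> k * (2 * s * L)" using k by (rule mult_left_mono)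
        with g[OF cad coarse_path_cadlag[OF d(1)]] sk show ?thesis by (meson order_trans)
      qed
      have "\<bar>expectation (\<lambda>\<omega>. g (trajectory T h (x h) \<omega>)) - expectation (\<lambda>\<omega>. g (?y \<omega>))\<bar> \<le> e / 2 + 2 * B * prob (S \<union> O' \<union> I)"
      proof (rule expectation_close)
        show "(\<lambda>\<omega>. g (trajectory T h (x h) \<omega>)) \<in> borel_measurable (M h)"
          unfolding traj by (rule measurable_lipschitz_functional[OF k g measurable_step_path[OF h]]) simp_all
        show "(\<lambda>\<omega>. g (?y \<omega>)) \<in> borel_measurable (M h)"
          by (rule measurable_lipschitz_functional[OF k g measurable_coarse_path[OF drift_axioms d(1) measurable_chain_increments[OF h]]])
      qed (use SOI e good in \<open>auto intro!: B cad coarse_path_cadlag d\<close>)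
      also have "\<dots> \<le> e / 2 + 2 * B * (2 * e1)" using bad B0 by (intro add_left_mono mult_left_mono) auto
      finally show ?case using e1(2) by simp
    qed
  qed
qed

lemma trajectory_converges:
  fixes Q :: "'c measure" and \<beta> :: "real \<Rightarrow> 'c \<Rightarrow> real ^ 'n"
  assumes T: "0 \<le> T" and ws: "weak_solution Q F T \<beta> (abm_drift p) (sqrt (m2 / real CARD('n))) x0 X"
  shows "converges_in_distribution (skorokhod_topology T) M (\<lambda>h. trajectory T h (x h)) Q (\<lambda>\<omega>. \<lambda>t\<in>{0..T}. X t \<omega>)"
proof -
  let ?b = "abm_drift p" and ?\<sigma> = "sqrt (m2 / real CARD('n))"
  have b: "drift ?b (2 * real CARD('n))" by (rule drift_abm_drift[OF p01 p_lipschitz])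
  have Q: "prob_space Q" using ws by (simp add: weak_solution_def)
  have Y: "(\<lambda>\<omega>. trajectory T h (x h) \<omega>) \<in> M h \<rightarrow>\<^sub>M borel_sets_of (skorokhod_topology T)" if "0 < h" for h
  proof -
    have "trajectory T h (x h) \<omega> = (\<lambda>t\<in>{0..T}. step_path h (\<lambda>n. x h n \<omega>) t)" for \<omega>
      by (simp add: trajectory_def step_path_def)
    then show ?thesis using measurable_step_path[OF that x_measurable[OF that]] by simp
  qed
  have XQ: "X t \<in> borel_measurable Q" if "t \<in> {0..T}" for t
  proof -
    have "X t \<in> borel_measurable (F t)" "subalgebra Q (F t)" using ws that by (auto simp: weak_solution_def)
    then show ?thesis by (rule measurable_from_subalg[rotated])
  qed
  have Z: "(\<lambda>\<omega>. \<lambda>t\<in>{0..T}. X t \<omega>) \<in> Q \<rightarrow>\<^sub>M borel_sets_of (skorokhod_topology T)"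
    by (rule measurable_continuous_path[OF XQ T]) (use ws in \<open>auto simp: weak_solution_def\<close>)
  have "((\<lambda>h. \<integral>\<omega>. f (trajectory T h (x h) \<omega>) \<partial>M h) \<longlongrightarrow> (\<integral>\<omega>. f (\<lambda>t\<in>{0..T}. X t \<omega>) \<partial>Q)) (at_right 0)"
    if f: "continuous_map (skorokhod_topology T) euclideanreal f" "bounded (f ` topspace (skorokhod_topology T))" for f
  proof (rule Metric_space.lipschitz_tests_suffice[OF Metric_space_skorokhod _ prob_space_M _ Q _
        f[unfolded skorokhod_topology_def]])
    fix g :: "(real \<Rightarrow> real ^ 'n) \<Rightarrow> real" and k B
    assume k: "0 \<le> k" and g: "\<And>p p'. p \<in> cadlag T \<Longrightarrow> p' \<in> cadlag T \<Longrightarrow> \<bar>g p - g p'\<bar> \<le> k * skorokhod_dist T p p'"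
      and B: "\<And>p. p \<in> cadlag T \<Longrightarrow> \<bar>g p\<bar> \<le> B"
    show "((\<lambda>h. \<integral>\<omega>. g (trajectory T h (x h) \<omega>) \<partial>M h) \<longlongrightarrow> (\<integral>\<omega>. g (\<lambda>t\<in>{0..T}. X t \<omega>) \<partial>Q)) (at_right 0)"
    proof (rule tendstoI)
      fix e :: real assume e: "0 < e"
      then have e4: "0 < e / 4" by simp
      obtain d0 where d0: "0 < d0" and close: "\<And>d. 0 < d \<Longrightarrow> d < d0 \<Longrightarrow> \<forall>\<^sub>F h in at_right 0.
         \<bar>(\<integral>\<omega>. g (trajectory T h (x h) \<omega>) \<partial>M h)
           - (\<integral>\<omega>. g (coarse_path ?b x0 T d (chain_increments h d (nat \<lfloor>T / d\<rfloor>) \<omega>)) \<partial>M h)\<bar> \<le> e / 4"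
        using chain_coarse_close[OF T k g B e4] by blast
      have "\<forall>\<^sub>F q in sequentially. inverse (real (Suc q)) < d0"
        by (rule order_tendstoD(2)[OF LIMSEQ_inverse_real_of_nat d0])
      moreover have "\<forall>\<^sub>F q in sequentially. dist (\<integral>\<omega>. g (noise_path ?b x0 T ?\<sigma> \<beta> (inverse (real (Suc q))) \<omega>) \<partial>Q)
         (\<integral>\<omega>. g (\<lambda>t\<in>{0..T}. X t \<omega>) \<partial>Q) < e / 4"
        by (rule tendstoD[OF noise_path_limit[OF ws b T k g B] e4])
      ultimately have "\<forall>\<^sub>F q in sequentially. inverse (real (Suc q)) < d0 \<and> dist (\<integral>\<omega>. g (noise_path ?b x0 T ?\<sigma> \<beta> (inverse (real (Suc q))) \<omega>) \<partial>Q)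
         (\<integral>\<omega>. g (\<lambda>t\<in>{0..T}. X t \<omega>) \<partial>Q) < e / 4"
        by (rule eventually_conj)
      \<comment> \<open>One d must serve for both replacements, that of the chain and that of the
        limit; it stays fixed while h tends to 0.\<close>
      from eventually_happens'[OF sequentially_bot this] obtain q where q: "inverse (real (Suc q)) < d0"
        "dist (\<integral>\<omega>. g (noise_path ?b x0 T ?\<sigma> \<beta> (inverse (real (Suc q))) \<omega>) \<partial>Q)
         (\<integral>\<omega>. g (\<lambda>t\<in>{0..T}. X t \<omega>) \<partial>Q) < e / 4" by blast
      define d where "d = inverse (real (Suc q))"
      have d: "0 < d" by (simp add: d_def)
      define K where "K = nat \<lfloor>T / d\<rfloor>"
      have K: "real K * d \<le> T" using nat_floor_divide_bounds(1)[OF d T] by (simp add: K_def)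
      note q = q[folded d_def, unfolded noise_path_def, folded K_def]
      interpret drift ?b "2 * real CARD('n)" by (rule b)
      have "\<forall>\<^sub>F h in at_right 0. dist (\<integral>\<omega>. g (coarse_path ?b x0 T d (chain_increments h d K \<omega>)) \<partial>M h)
          (\<integral>\<omega>. g (coarse_path ?b x0 T d (noise_increments ?\<sigma> \<beta> d K \<omega>)) \<partial>Q) < e / 4"
        by (rule tendstoD[OF increments_converge[OF ws T d K, where g = "\<lambda>y. g (coarse_path ?b x0 T d y)"] e4])
          (auto intro!: continuous_coarse_path continuous_b d k g B coarse_path_cadlag)
      then show "\<forall>\<^sub>F h in at_right 0. dist (\<integral>\<omega>. g (trajectory T h (x h) \<omega>) \<partial>M h) (\<integral>\<omega>. g (\<lambda>t\<in>{0..T}. X t \<omega>) \<partial>Q) < e"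
        using close[OF d q(1)]
      proof eventually_elim
        case (elim h)
        then show ?case using q(2) e unfolding K_def[symmetric] dist_real_def by linarith
      qed
    qed
  qed (use Y Z in \<open>simp_all add: skorokhod_topology_def\<close>)
  then show ?thesis using Y Z unfolding converges_in_distribution_def by blast
qed

end

section \<open>The deterministic case and the final assembly\<close>

text \<open>For the constant driver x0 the integral equation is the integrated form of the ODE, so
  the deterministic solution map already contains the solution.\<close>

lemma ode_solution_exists:
  fixes b :: "real ^ 'n::finite \<Rightarrow> real ^ 'n"
  assumes b: "drift b C" and T: "0 \<le> T"
  shows "ode_solution T b x0 (drift.solution b (\<lambda>_. x0))"
proof -
  interpret drift b C by fact
  let ?y = "solution (\<lambda>_. x0)"
  have w: "continuous_on {0..T} (\<lambda>_. x0)" by simp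
  note eq = solution_eq[OF w]
  have "continuous_on {0..T} (\<lambda>s. b (?y s))"
    by (rule continuous_on_compose2[OF continuous_b continuous_on_solution[OF w]]) simp
  then have "((\<lambda>t. x0 + integral {0..t} (\<lambda>s. b (?y s))) has_vector_derivative b (?y t)) (at t within {0..T})"
    if "t \<in> {0..T}" for t
    using has_vector_derivative_add[OF has_vector_derivative_const integral_has_vector_derivative[OF _ that], of _ x0] by simp
  then have "(?y has_vector_derivative b (?y t)) (at t within {0..T})" if "t \<in> {0..T}" for t
    by (rule has_vector_derivative_transform[rotated 2, OF _ that]) (use that eq(2) in auto)
  moreover have "?y 0 = x0" using eq(2)[of 0] T by simp
  ultimately show ?thesis by (simp add: ode_solution_def)
qed

lemma ode_solution_unique:
  fixes b :: "real ^ 'n::finite \<Rightarrow> real ^ 'n"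
  assumes b: "drift b C" and y: "ode_solution T b x0 y" and t: "t \<in> {0..T}"
  shows "y t = drift.solution b (\<lambda>_. x0) t"
proof (rule drift.solution_unique[OF b _ _ t])
  have y': "(y has_vector_derivative b (y t)) (at t within {0..T})" if "t \<in> {0..T}" for t
    using y that by (simp add: ode_solution_def)
  have y0: "y 0 = x0" using y by (simp add: ode_solution_def)
  have "continuous_on {0..T} y"
    unfolding continuous_on_eq_continuous_within using y' has_vector_derivative_continuous by blast
  then have "bounded (y ` {0..T})" by (intro compact_imp_bounded compact_continuous_image) auto
  moreover have "((\<lambda>s. b (y s)) has_integral y t - y 0) {0..t}" if "t \<in> {0..T}" for t
    by (rule fundamental_theorem_of_calculus) (use that in \<open>auto intro: has_vector_derivative_within_subset[OF y']\<close>)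
  ultimately show "approx_solution b T (\<lambda>_. x0) 0 y"
    unfolding approx_solution_def using y0 by (auto simp: has_integral_iff)
qed simp

text \<open>A type cannot be quantified existentially, so existence is claimed on one concrete type
  of sample spaces, and convergence for weak solutions over an arbitrary one. Limits being unique,
  the latter includes that all weak solutions have the same law. In the deterministic case the limit
  lives on a one-point space.\<close>

theorem mainTheorem6:
  fixes T m2 :: real and x0 :: "real ^ 'n::finite"
    and p :: "'n \<Rightarrow> 'n \<Rightarrow> real ^ 'n \<Rightarrow> real"
    and \<Xi> :: "real \<Rightarrow> 'b measure" and \<xi> :: "real \<Rightarrow> 'b \<Rightarrow> real"
    and M :: "real \<Rightarrow> 'a measure" and x :: "real \<Rightarrow> nat \<Rightarrow> 'a \<Rightarrow> real ^ 'n"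
  assumes "0 \<le> T"
    and "\<And>i j y. p i j y \<in> {0..1}"
    and "\<And>i j. \<exists>L. L-lipschitz_on UNIV (p i j)"
    and "\<And>h. 0 < h \<Longrightarrow> prob_space (\<Xi> h)"
    and "\<And>h. 0 < h \<Longrightarrow> \<xi> h \<in> borel_measurable (\<Xi> h)"
    and "has_moment_rate \<Xi> \<xi> 1 0"
    and "has_moment_rate \<Xi> \<xi> 2 m2"
    and "m2 > 0 \<Longrightarrow> has_moment_rate \<Xi> \<xi> 3 0 \<and> has_moment_rate \<Xi> \<xi> 4 0"
    and "\<And>h. 0 < h \<Longrightarrow>
      markov_chain (M h) (abm_kernel (real CARD('n) * h) p (distr (\<Xi> h) borel (\<xi> h))) x0 (x h)"
  shows
    "(\<exists>(Q :: (real \<Rightarrow> real ^ 'n) measure) F \<beta> X.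
        weak_solution Q F T \<beta> (abm_drift p) (sqrt (m2 / real CARD('n))) x0 X) \<and>
     (\<forall>(Q :: 'c measure) F \<beta> X.
        weak_solution Q F T \<beta> (abm_drift p) (sqrt (m2 / real CARD('n))) x0 X \<longrightarrow>
        converges_in_distribution (skorokhod_topology T) M (\<lambda>h. trajectory T h (x h))
          Q (\<lambda>w. \<lambda>t\<in>{0..T}. X t w)) \<and>
     (m2 = 0 \<longrightarrow>
        (\<exists>y. ode_solution T (abm_drift p) x0 y) \<and>
        (\<forall>y. ode_solution T (abm_drift p) x0 y \<longrightarrow>
          converges_in_distribution (skorokhod_topology T) M (\<lambda>h. trajectory T h (x h))
            (return (count_space UNIV) ()) (\<lambda>_. \<lambda>t\<in>{0..T}. y t)))"
proof -
  interpret abm_family m2 x0 p \<Xi> \<xi> M x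
    by (rule abm_family.intro) (fact assms)+
  let ?b = "abm_drift p"
  note T = \<open>0 \<le> T\<close>
  have b: "drift ?b (2 * real CARD('n))" by (rule drift_abm_drift[OF p01 p_lipschitz])
  obtain Q :: "(real \<Rightarrow> real ^ 'n) measure" and F \<beta> X
    where ws: "weak_solution Q F T \<beta> ?b (sqrt (m2 / real CARD('n))) x0 X"
    using weak_solution_exists[OF T b] by blast
  have ode: "converges_in_distribution (skorokhod_topology T) M (\<lambda>h. trajectory T h (x h))
      (return (count_space UNIV) ()) (\<lambda>_. \<lambda>t\<in>{0..T}. y t)"
    if m2: "m2 = 0" and y: "ode_solution T ?b x0 y" for y
  proof -
    \<comment> \<open>With diffusion coefficient 0 the driver is constant, so the weak solution at
      hand is almost surely the ODE solution, and its limit theorem carries over.\<close>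
    have "AE w in Q. \<forall>t\<in>{0..T}. X t w = drift.solution ?b (\<lambda>_. x0) t"
      using weak_solution_eq_solution(2)[OF ws b] m2 by simp
    then have XY: "AE w in Q. (\<lambda>t\<in>{0..T}. X t w) = (\<lambda>t\<in>{0..T}. y t)"
      by eventually_elim (simp add: ode_solution_unique[OF b y] cong: restrict_cong)
    interpret Q: prob_space Q using ws by (simp add: weak_solution_def)
    have eq: "(\<integral>w. f (\<lambda>t\<in>{0..T}. X t w) \<partial>Q) = (\<integral>_. f (\<lambda>t\<in>{0..T}. y t) \<partial>return (count_space UNIV) ())"
      if "(\<lambda>w. f (\<lambda>t\<in>{0..T}. X t w)) \<in> borel_measurable Q" for f :: "(real \<Rightarrow> real ^ 'n) \<Rightarrow> real"
    proof -
      have "(\<integral>w. f (\<lambda>t\<in>{0..T}. X t w) \<partial>Q) = (\<integral>w. f (\<lambda>t\<in>{0..T}. y t) \<partial>Q)"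
        by (rule integral_cong_AE) (use XY that in \<open>auto elim!: eventually_mono\<close>)
      moreover have "prob_space (return (count_space UNIV) ())" by (rule prob_space_return) simp
      ultimately show ?thesis using prob_space.prob_space by (fastforce simp: Q.prob_space)
    qed
    have "continuous_on {0..T} y"
      unfolding continuous_on_eq_continuous_within
      using y has_vector_derivative_continuous unfolding ode_solution_def by blast
    then have "(\<lambda>t\<in>{0..T}. y t) \<in> space (borel_sets_of (skorokhod_topology T))"
      unfolding borel_sets_of_def by (simp add: space_measure_of_conv topspace_skorokhod continuous_path_cadlag)
    then have "(\<lambda>_. \<lambda>t\<in>{0..T}. y t) \<in> return (count_space UNIV) () \<rightarrow>\<^sub>M borel_sets_of (skorokhod_topology T)"
      by simp
    moreover note conv = trajectory_converges[OF T ws, unfolded converges_in_distribution_def]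
    moreover have "(\<lambda>w. f (\<lambda>t\<in>{0..T}. X t w)) \<in> borel_measurable Q"
      if "continuous_map (skorokhod_topology T) euclideanreal f" for f
      using conv by (intro measurable_continuous_map_comp[OF _ that]) blast
    ultimately show ?thesis
      unfolding converges_in_distribution_def using eq by auto
  qed
  show ?thesis
    using ws trajectory_converges[OF T] ode ode_solution_exists[OF b T] by blast
qed

end
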